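(* Let $M\subset X\times H(f)$ be a minimal set of the skew-product semiflow $\Pi_t$ generated by $u_t=u_{xx}+f(t,u,u_x)$ on $S^1=\mathbb{R}/L\mathbb{Z}$. Then there exists $N\in\mathbb{N}$ such that $$z\big(\varphi(t,\cdot;u_1,g)-\varphi(t,\cdot;\sigma_a u_2,g)\big)=N$$ for any $t\in\mathbb{R}$, any $g\in H(f)$, any $(u_1,g),(u_2,g)\in M\cap p^{-1}(g)$, and any $a\in S^1$ with $u_1\neq\sigma_a u_2$.
   Context: Standing assumption on $f$: $f=f(t,u,p)\in C^1(\mathbb{R}\times\mathbb{R}\times\mathbb{R},\mathbb{R})$, and $f$ and all its first-order partial derivatives are uniformly almost periodic in $t$. Here a function $F\in C(\mathbb{R}\times D,\mathbb{R})$, $D\subset\mathbb{R}^m$, is admissible if for every compact $K\subset D$ it is bounded and uniformly continuous on $\mathbb{R}\times K$; it is uniformly almost periodic in $t$ if it is admissible and $F(\cdot,d)$ is almost periodic for each fixed $d\in D$. The hull $H(f)$ is the closure of $\{f(\cdot+\tau,\cdot,\cdot):\tau\in\mathbb{R}\}$ in the compact-open topology; it is a compact metric space, on which $(g\cdot t)(s,u,p)=g(s+t,u,p)$ defines a minimal flow. Semiflow: $L>0$, $S^1=\mathbb{R}/L\mathbb{Z}$, and $X$ is a fractional power space associated with the operator $u\mapsto -u_{xx}:H^2(S^1)\to L^2(S^1)$ such that $X$ is compactly embedded into $C^1(S^1)$. For $(u,g)\in X\times H(f)$, $\varphi(t,\cdot;u,g)$ denotes the (local) solution in $X$ of $u_t=u_{xx}+g(t,u,u_x)$,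 $t>0$, $x\in S^1$, with $\varphi(0,\cdot;u,g)=u$. The (local) skew-product semiflow is $\Pi_t(u,g)=(\varphi(t,\cdot;u,g),g\cdot t)$, $t\ge0$. $p:X\times H(f)\to H(f)$ is the natural projection. A minimal set of $\Pi_t$ is a nonempty compact positively invariant set containing no other nonempty compact positively invariant set. On a minimal set $M$ the semiflow extends to a flow (each point has a unique backward orbit in $M$), and $\varphi(t,\cdot;u,g)$ for $t<0$, $(u,g)\in M$, is understood through this flow. Shifts: $(\sigma_a u)(\cdot)=u(\cdot+a)$ for $a\in S^1$. By uniqueness, $\sigma_a\varphi(t,\cdot;u,g)=\varphi(t,\cdot;\sigma_a u,g)$, and for $t<0$ this equality is used to interpret the right-hand side when $(u,g)\in M$. Zero number: for a $C^1$ function $u:S^1\to\mathbb{R}$, $z(u)=\mathrm{card}\{x\in S^1: u(x)=0\}$. Here $\mathbb{N}$ includes $0$. *)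

theory Defs
  imports "HOL-Analysis.Analysis"
begin

section \<open>Almost periodicity and hulls\<close>

definition almost_periodic :: "(real \<Rightarrow> real) \<Rightarrow> bool" where
  "almost_periodic h \<longleftrightarrow> continuous_on UNIV h \<and>
     (\<forall>\<epsilon>>0. \<exists>l>0. \<forall>b. \<exists>\<tau>\<in>{b..b + l}. \<forall>t. \<bar>h (t + \<tau>) - h t\<bar> < \<epsilon>)"

definition admissible :: "'d::euclidean_space set \<Rightarrow> (real \<times> 'd \<Rightarrow> real) \<Rightarrow> bool" where
  "admissible D F \<longleftrightarrow> continuous_on (UNIV \<times> D) F \<and>
     (\<forall>K. compact K \<longrightarrow> K \<subseteq> D \<longrightarrow>
        bounded (F ` (UNIV \<times> K)) \<and> uniformly_continuous_on (UNIV \<times> K) F)"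

definition uniformly_almost_periodic ::
    "'d::euclidean_space set \<Rightarrow> (real \<times> 'd \<Rightarrow> real) \<Rightarrow> bool" where
  "uniformly_almost_periodic D F \<longleftrightarrow>
     admissible D F \<and> (\<forall>d\<in>D. almost_periodic (\<lambda>t. F (t, d)))"

definition partial :: "'d::euclidean_space \<Rightarrow> ('d \<Rightarrow> real) \<Rightarrow> 'd \<Rightarrow> real" where
  "partial b F z = deriv (\<lambda>s. F (z + s *\<^sub>R b)) 0"

definition C1_function :: "('d::euclidean_space \<Rightarrow> real) \<Rightarrow> bool" where
  "C1_function F \<longleftrightarrow> continuous_on UNIV F \<and>
     (\<forall>b\<in>Basis. (\<forall>z. (\<lambda>s. F (z + s *\<^sub>R b)) field_differentiable at 0) \<and>
        continuous_on UNIV (partial b F))"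

text \<open>The arguments of a nonlinearity are ordered as \<open>(t, u, p)\<close>, with \<open>p\<close> standing for \<open>u\<^sub>x\<close>.\<close>

type_synonym nonlinearity = "real \<times> real \<times> real \<Rightarrow> real"

definition translate :: "real \<Rightarrow> nonlinearity \<Rightarrow> nonlinearity" where
  "translate \<tau> g = (\<lambda>(s, u, p). g (s + \<tau>, u, p))"

text \<open>Its underlying set is the set of all continuous functions (take \<open>K = {}\<close>).\<close>

definition compact_open_topology ::
    "('x::topological_space \<Rightarrow> 'y::topological_space) topology" where
  "compact_open_topology = topology_generated_by
     {{g. continuous_on UNIV g \<and> g ` K \<subseteq> U} | K U. compact K \<and> open U}"

definition translation_hull :: "nonlinearity \<Rightarrow> nonlinearity set" where
  "translation_hull f = compact_open_topology closure_of (range (\<lambda>\<tau>. translate \<tau> f))"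

section \<open>The phase space\<close>

text \<open>Functions on the circle \<open>\<real>/L\<int>\<close> are represented by \<open>L\<close>-periodic functions on \<open>\<real>\<close>.\<close>

definition L_periodic :: "real \<Rightarrow> (real \<Rightarrow> 'b) \<Rightarrow> bool" where
  "L_periodic L u \<longleftrightarrow> (\<forall>x. u (x + L) = u x)"

definition shift :: "real \<Rightarrow> (real \<Rightarrow> real) \<Rightarrow> real \<Rightarrow> real" where
  "shift a u = (\<lambda>x. u (x + a))"

definition L2_circle :: "real \<Rightarrow> (real \<Rightarrow> real) set" where
  "L2_circle L = {u. L_periodic L u \<and> u \<in> borel_measurable borel \<and>
     set_integrable lborel {0..L} (\<lambda>x. (u x)\<^sup>2)}"

definition C1_circle :: "real \<Rightarrow> (real \<Rightarrow> real) set" where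
  "C1_circle L = {u. L_periodic L u \<and> u C1_differentiable_on UNIV}"

definition fourier_coeff :: "real \<Rightarrow> (real \<Rightarrow> real) \<Rightarrow> int \<Rightarrow> complex" where
  "fourier_coeff L u k =
     (1 / complex_of_real L) *
       (LBINT x:{0..L}. complex_of_real (u x) * cis (- (2 * pi * real_of_int k * x / L)))"

text \<open>The operator \<open>A u = - u\<^sub>x\<^sub>x\<close> from \<open>H\<^sup>2(S\<^sup>1)\<close> to \<open>L\<^sup>2(S\<^sup>1)\<close> is self-adjoint, with
  orthogonal eigenfunctions \<open>exp (2 \<pi> i k x / L)\<close> and the following eigenvalues.\<close>

definition eigenvalue :: "real \<Rightarrow> int \<Rightarrow> real" where
  "eigenvalue L k = (2 * pi * real_of_int k / L)\<^sup>2"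

text \<open>Since 0 is an eigenvalue of \<open>A\<close>, fractional powers are those of the positive operator
  \<open>A + I\<close>, given by the spectral theorem: \<open>(A + I)\<^sup>\<alpha>\<close> multiplies the \<open>k\<close>-th Fourier coefficient by
  \<open>(1 + eigenvalue L k) powr \<alpha>\<close>. The norm below is the \<open>L\<^sup>2\<close> norm (with respect to the normalised
  measure \<open>dx / L\<close>) of \<open>(A + I)\<^sup>\<alpha> u\<close>, and the domain consists of those \<open>u\<close> in \<open>L\<^sup>2\<close> for which it
  is finite. Elements of the domain are functions here, not yet classes modulo null sets.\<close>

definition frac_domain :: "real \<Rightarrow> real \<Rightarrow> (real \<Rightarrow> real) set" where
  "frac_domain L \<alpha> = {u \<in> L2_circle L.
     (\<lambda>k. ((1 + eigenvalue L k) powr \<alpha> * cmod (fourier_coeff L u k))\<^sup>2) summable_on UNIV}"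

definition frac_norm :: "real \<Rightarrow> real \<Rightarrow> (real \<Rightarrow> real) \<Rightarrow> real" where
  "frac_norm L \<alpha> u =
     sqrt (\<Sum>\<^sub>\<infinity>k. ((1 + eigenvalue L k) powr \<alpha> * cmod (fourier_coeff L u k))\<^sup>2)"

text \<open>Every class has a \<open>C\<^sup>1\<close> representative, and norm-bounded sequences (of such
  representatives) have subsequences converging in the \<open>C\<^sup>1\<close> norm.\<close>

definition compactly_embedded_C1 :: "real \<Rightarrow> real \<Rightarrow> bool" where
  "compactly_embedded_C1 L \<alpha> \<longleftrightarrow>
     (\<forall>u\<in>frac_domain L \<alpha>. \<exists>v\<in>C1_circle L. AE x in lborel. u x = v x) \<and>
     (\<forall>w :: nat \<Rightarrow> real \<Rightarrow> real.
        (\<forall>n. w n \<in> frac_domain L \<alpha> \<inter> C1_circle L) \<longrightarrow>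
        bounded (range (\<lambda>n. frac_norm L \<alpha> (w n))) \<longrightarrow>
        (\<exists>r v. strict_mono (r :: nat \<Rightarrow> nat) \<and> v \<in> C1_circle L \<and>
           uniform_limit UNIV (\<lambda>n. w (r n)) v sequentially \<and>
           uniform_limit UNIV (\<lambda>n. deriv (w (r n))) (deriv v) sequentially))"

text \<open>Under \<open>compactly_embedded_C1 L \<alpha>\<close>, each class has exactly one \<open>C\<^sup>1\<close> representative, so the
  fractional power space is identified with the following set of genuine functions.\<close>

definition phase_space :: "real \<Rightarrow> real \<Rightarrow> (real \<Rightarrow> real) set" where
  "phase_space L \<alpha> = frac_domain L \<alpha> \<inter> C1_circle L"

definition phase_topology :: "real \<Rightarrow> real \<Rightarrow> (real \<Rightarrow> real) topology" where
  "phase_topology L \<alpha> =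
     Metric_space.mtopology (phase_space L \<alpha>) (\<lambda>u v. frac_norm L \<alpha> (\<lambda>x. u x - v x))"

section \<open>The skew-product semiflow\<close>

text \<open>\<open>\<phi>\<close> is a solution of \<open>u\<^sub>t = u\<^sub>x\<^sub>x + g(t, u, u\<^sub>x)\<close> in the phase space on the time interval
  \<open>[0, T)\<close>: continuous with values in the phase space, and classical for positive times.\<close>

definition is_solution ::
    "real \<Rightarrow> real \<Rightarrow> nonlinearity \<Rightarrow> real \<Rightarrow> (real \<Rightarrow> real \<Rightarrow> real) \<Rightarrow> bool" where
  "is_solution L \<alpha> g T \<phi> \<longleftrightarrow>
     continuous_map (top_of_set {0..<T}) (phase_topology L \<alpha>) \<phi> \<and>
     (\<exists>\<phi>t \<phi>xx. continuous_on ({0<..<T} \<times> UNIV) \<phi>t \<and> continuous_on ({0<..<T} \<times> UNIV) \<phi>xx \<and>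
        (\<forall>t\<in>{0<..<T}. \<forall>x.
           ((\<lambda>s. \<phi> s x) has_real_derivative \<phi>t (t, x)) (at t) \<and>
           (deriv (\<phi> t) has_real_derivative \<phi>xx (t, x)) (at x) \<and>
           \<phi>t (t, x) = \<phi>xx (t, x) + g (t, \<phi> t x, deriv (\<phi> t) x)))"

definition reaches ::
    "real \<Rightarrow> real \<Rightarrow> real \<Rightarrow> (real \<Rightarrow> real) \<Rightarrow> nonlinearity \<Rightarrow> (real \<Rightarrow> real) \<Rightarrow> bool" where
  "reaches L \<alpha> t u g v \<longleftrightarrow> (\<exists>T>t. \<exists>\<phi>. is_solution L \<alpha> g T \<phi> \<and> \<phi> 0 = u \<and> \<phi> t = v)"

text \<open>The solution from \<open>(u, g)\<close> exists up to and including time \<open>t \<ge> 0\<close>.\<close>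

definition phi_defined ::
    "real \<Rightarrow> real \<Rightarrow> real \<Rightarrow> (real \<Rightarrow> real) \<Rightarrow> nonlinearity \<Rightarrow> bool" where
  "phi_defined L \<alpha> t u g \<longleftrightarrow> (\<exists>v. reaches L \<alpha> t u g v)"

definition phi ::
    "real \<Rightarrow> real \<Rightarrow> real \<Rightarrow> (real \<Rightarrow> real) \<Rightarrow> nonlinearity \<Rightarrow> real \<Rightarrow> real" where
  "phi L \<alpha> t u g = (THE v. reaches L \<alpha> t u g v)"

definition skew_product ::
    "real \<Rightarrow> real \<Rightarrow> real \<Rightarrow> (real \<Rightarrow> real) \<times> nonlinearity \<Rightarrow> (real \<Rightarrow> real) \<times> nonlinearity" where
  "skew_product L \<alpha> t = (\<lambda>(u, g). (phi L \<alpha> t u g, translate t g))"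

definition positively_invariant ::
    "real \<Rightarrow> real \<Rightarrow> ((real \<Rightarrow> real) \<times> nonlinearity) set \<Rightarrow> bool" where
  "positively_invariant L \<alpha> M \<longleftrightarrow>
     (\<forall>(u, g)\<in>M. \<forall>t\<ge>0. phi_defined L \<alpha> t u g \<and> skew_product L \<alpha> t (u, g) \<in> M)"

definition extended_phase_topology ::
    "real \<Rightarrow> real \<Rightarrow> nonlinearity \<Rightarrow> ((real \<Rightarrow> real) \<times> nonlinearity) topology" where
  "extended_phase_topology L \<alpha> f =
     prod_topology (phase_topology L \<alpha>) (subtopology compact_open_topology (translation_hull f))"

definition compact_positively_invariant ::
    "real \<Rightarrow> real \<Rightarrow> nonlinearity \<Rightarrow> ((real \<Rightarrow> real) \<times> nonlinearity) set \<Rightarrow> bool" where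
  "compact_positively_invariant L \<alpha> f M \<longleftrightarrow>
     M \<noteq> {} \<and> compactin (extended_phase_topology L \<alpha> f) M \<and> positively_invariant L \<alpha> M"

definition minimal_set ::
    "real \<Rightarrow> real \<Rightarrow> nonlinearity \<Rightarrow> ((real \<Rightarrow> real) \<times> nonlinearity) set \<Rightarrow> bool" where
  "minimal_set L \<alpha> f M \<longleftrightarrow> compact_positively_invariant L \<alpha> f M \<and>
     (\<forall>M'. M' \<subseteq> M \<longrightarrow> compact_positively_invariant L \<alpha> f M' \<longrightarrow> M' = M)"

text \<open>The flow on a minimal set \<open>M\<close>: for negative times, follow the unique backward orbit
  in \<open>M\<close>.\<close>

definition phi_flow ::
    "real \<Rightarrow> real \<Rightarrow> ((real \<Rightarrow> real) \<times> nonlinearity) set \<Rightarrow>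
      real \<Rightarrow> (real \<Rightarrow> real) \<Rightarrow> nonlinearity \<Rightarrow> real \<Rightarrow> real" where
  "phi_flow L \<alpha> M t u g =
     (if t \<ge> 0 then phi L \<alpha> t u g
      else THE v. (v, translate t g) \<in> M \<and>
             skew_product L \<alpha> (- t) (v, translate t g) = (u, g))"

text \<open>The value of \<open>\<phi>(t, \<cdot>; \<sigma>\<^sub>a u, g)\<close> for \<open>(u, g)\<close> in \<open>M\<close>. As \<open>(\<sigma>\<^sub>a u, g)\<close> need not belong to
  \<open>M\<close>, for negative times it is understood as \<open>\<sigma>\<^sub>a \<phi>(t, \<cdot>; u, g)\<close>.\<close>

definition phi_shifted ::
    "real \<Rightarrow> real \<Rightarrow> ((real \<Rightarrow> real) \<times> nonlinearity) set \<Rightarrow>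
      real \<Rightarrow> real \<Rightarrow> (real \<Rightarrow> real) \<Rightarrow> nonlinearity \<Rightarrow> real \<Rightarrow> real" where
  "phi_shifted L \<alpha> M t a u g =
     (if t \<ge> 0 then phi L \<alpha> t (shift a u) g else shift a (phi_flow L \<alpha> M t u g))"

section \<open>Zero number\<close>

text \<open>The set \<open>{0..<L}\<close> is a fundamental domain of the circle. The value is extended, because
  \<open>card\<close> is 0 on infinite sets.\<close>

definition zero_number :: "real \<Rightarrow> (real \<Rightarrow> real) \<Rightarrow> enat" where
  "zero_number L u =
     (if finite {x \<in> {0..<L}. u x = 0} then enat (card {x \<in> {0..<L}. u x = 0}) else \<infinity>)"

end

(* The difference w of two solutions, one of them shifted in x, satisfies a periodic parabolic
   inequality |w_t - w_xx| <= C (|w| + |w_x|). A frequency function for the Gaussian-weighted L^2 norm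
   gives backward uniqueness, and its monotonicity forces w, rescaled parabolically at a zero, to
   approach a heat polynomial. Hence zeros are isolated, and the number of zeros is finite, does not
   increase with time and drops at every multiple zero. Along a sequence of times going to plus or minus
   infinity a pair of orbits in M converges to a limit pair, whose zero number is constant in time
   because the zero number of the original pair is eventually constant; so its zeros are simple. Applied
   to an orbit and its own shift, this gives one number N for all nontrivial shifts. For two orbits in
   the same fibre, aligning the maxima shows that some limit pair consists of shifts of one function,
   both in forward and in backward time. The zero number therefore equals N near both ends, hence at all
   times, except for a discrete set of shifts, which perturbation at a simple time removes. *)
theory Submission
  imports "HOL-Probability.Probability" "HOL-Complex_Analysis.Great_Picard" Defs
begin

section \<open>Gaussian integrals\<close>

text \<open>Only Lipschitz bounds on the nonlinearity are transferred to the hull, so the linear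
  equation for w has merely bounded coefficients; hence an inequality is carried throughout and no
  change of variable removes the first-order term. In the variables s = - ln (T - t), y = (x - x0) /
  sqrt (T - t) the heat operator becomes the Ornstein-Uhlenbeck operator v_yy - (y / 2) v_y,
  symmetric for the weight exp (- y^2 / 4), and the error gains a factor exp (- s / 2). This error
  is integrable in s, so a corrected Rayleigh quotient decreases; its limit must be an eigenvalue k
  / 2, whose eigenfunction is a heat polynomial at time -1. That describes w only before T. A
  barrier and a gradient estimate carry the description across T, because for monotonicity of the
  zero number at most one zero may survive near each old one. The exceptional shifts at the end form
  a coset of the group of common periods of the elements of M; this group is the whole line or
  discrete.\<close>

definition gauss :: "real measure" where
  "gauss = density lborel (%y. ennreal (exp (- y\<^sup>2 / 4)))"

text \<open>Integrability against \<open>gauss\<close> is decided by exponents alone: they add under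
  products, a polynomial factor costs an arbitrarily small amount, and the sum has to stay below
  1/4. The fractions 1/64, 1/32, 1/16, 1/8 below are this bookkeeping.\<close>

definition exp_growth :: "real => (real => real) => bool" where
  "exp_growth c f \<longleftrightarrow> f \<in> borel_measurable borel & (\<exists>K\<ge>0. \<forall>y. \<bar>f y\<bar> <= K * exp (c * y\<^sup>2))"

lemma exp_growthI:
  assumes "f \<in> borel_measurable borel" "!!y. \<bar>f y\<bar> <= K * exp (c * y\<^sup>2)"
  shows "exp_growth c f"
proof -
  have "\<bar>f y\<bar> <= \<bar>K\<bar> * exp (c * y\<^sup>2)" for y
    by (rule order_trans[OF assms(2)]) (simp add: mult_right_mono)
  then show ?thesis
    unfolding exp_growth_def using assms(1) abs_ge_zero by blast
qed

lemma sets_gauss [simp, measurable_cong]: "sets gauss = sets borel"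
  and space_gauss [simp]: "space gauss = UNIV"
  by (simp_all add: gauss_def)

lemma borel_measurable_gauss [simp]: "borel_measurable gauss = borel_measurable borel"
  by (rule measurable_cong_sets) auto

lemma integrable_gauss_iff:
  fixes f :: "real => 'b::{banach, second_countable_topology}"
  assumes "f \<in> borel_measurable borel"
  shows "integrable gauss f \<longleftrightarrow> integrable lborel (%y. exp (- y\<^sup>2 / 4) *\<^sub>R f y)"
  unfolding gauss_def using assms by (subst integrable_density) auto

lemma integral_gauss:
  fixes f :: "real => 'b::{banach, second_countable_topology}"
  assumes "f \<in> borel_measurable borel"
  shows "integral\<^sup>L gauss f = (\<integral>y. exp (- y\<^sup>2 / 4) *\<^sub>R f y \<partial>lborel)"
  unfolding gauss_def using assms by (subst integral_density) auto

lemma integrable_gauss_exp: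
  assumes "c < 1 / 4"
  shows "integrable gauss (%y. exp (c * y\<^sup>2))"
proof -
  \<comment> \<open>The integrand is a multiple of the centred normal density whose variance
    satisfies 1 / (2 * \<sigma>^2) = 1/4 - c.\<close>
  define \<sigma> where "\<sigma> = sqrt (1 / (2 * (1 / 4 - c)))"
  have \<sigma>: "\<sigma> > 0" "\<sigma>\<^sup>2 = 1 / (2 * (1 / 4 - c))"
    using assms by (auto simp: \<sigma>_def)
  have e: "- (y - 0)\<^sup>2 / (2 * \<sigma>\<^sup>2) = - y\<^sup>2 / 4 + c * y\<^sup>2" for y
    unfolding \<sigma>(2) using assms by (simp add: field_simps)
  have "integrable lborel (%y. sqrt (2 * pi * \<sigma>\<^sup>2) * normal_density 0 \<sigma> y)"
    using integrable_normal_density[OF \<sigma>(1)] by (intro integrable_mult_right) auto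
  moreover have "sqrt (2 * pi * \<sigma>\<^sup>2) * normal_density 0 \<sigma> y = exp (- y\<^sup>2 / 4) *\<^sub>R exp (c * y\<^sup>2)" for y
    unfolding normal_density_def e exp_add using \<sigma>(1) by simp
  ultimately show ?thesis
    by (simp add: integrable_gauss_iff)
qed

lemma exp_growth_measurable: "exp_growth c f ==> f \<in> borel_measurable borel"
  by (simp add: exp_growth_def)

lemma integrable_gauss_growth:
  assumes "exp_growth c f" "c < 1 / 4"
  shows "integrable gauss f"
proof -
  obtain K where "!!y. \<bar>f y\<bar> <= K * exp (c * y\<^sup>2)" "K >= 0"
    using assms(1) by (auto simp: exp_growth_def)
  then show ?thesis
    using exp_growth_measurable[OF assms(1)]
    by (intro Bochner_Integration.integrable_bound
        [OF integrable_mult_right[of K, OF integrable_gauss_exp[OF assms(2)]]])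
      auto
qed

lemma exp_growth_mult:
  assumes "exp_growth a f" "exp_growth b h"
  shows "exp_growth (a + b) (%y. f y * h y)"
proof -
  obtain K L where K: "!!y. \<bar>f y\<bar> <= K * exp (a * y\<^sup>2)" "K >= 0"
    and L: "!!y. \<bar>h y\<bar> <= L * exp (b * y\<^sup>2)" "L >= 0"
    using assms by (auto simp: exp_growth_def)
  show ?thesis
  proof (rule exp_growthI)
    show "\<bar>f y * h y\<bar> <= (K * L) * exp ((a + b) * y\<^sup>2)" for y
      using mult_mono[OF K(1)[of y] L(1)[of y]] K(2) L(2)
      by (simp add: abs_mult exp_add distrib_right mult_ac)
  qed (use assms in \<open>auto simp: exp_growth_def\<close>)
qed

lemma exp_growth_mono: "exp_growth a f ==> a <= b ==> exp_growth b f"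
proof -
  assume "exp_growth a f" and ab: "a <= b"
  then obtain K where K: "!!y. \<bar>f y\<bar> <= K * exp (a * y\<^sup>2)" "K >= 0" and "f \<in> borel_measurable borel"
    by (auto simp: exp_growth_def)
  moreover have "K * exp (a * y\<^sup>2) <= K * exp (b * y\<^sup>2)" for y
    using ab K(2) by (intro mult_left_mono) (auto intro: mult_right_mono)
  ultimately show ?thesis
    by (intro exp_growthI[where K = K]) (auto intro: order_trans)
qed

lemma exp_growth_add:
  assumes "exp_growth c f" "exp_growth c h"
  shows "exp_growth c (%y. f y + h y)"
proof -
  obtain K L where K: "!!y. \<bar>f y\<bar> <= K * exp (c * y\<^sup>2)"
    and L: "!!y. \<bar>h y\<bar> <= L * exp (c * y\<^sup>2)"
    using assms by (auto simp: exp_growth_def)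
  show ?thesis
  proof (rule exp_growthI)
    show "\<bar>f y + h y\<bar> <= (K + L) * exp (c * y\<^sup>2)" for y
      using K[of y] L[of y] by (simp add: distrib_right)
  qed (use assms in \<open>auto simp: exp_growth_def\<close>)
qed

lemma exp_growth_const: "c >= 0 ==> exp_growth c (%y. k)"
proof (rule exp_growthI[where K = "\<bar>k\<bar>"])
  fix y :: real assume "c >= 0"
  then have "1 <= exp (c * y\<^sup>2)" by simp
  then show "\<bar>k\<bar> <= \<bar>k\<bar> * exp (c * y\<^sup>2)" using mult_left_mono[of 1 _ "\<bar>k\<bar>"] by fastforce
qed simp

lemma exp_growth_cmult: "exp_growth c f ==> exp_growth c (%y. k * f y)"
  using exp_growth_mult[OF exp_growth_const[of 0 k], of c f] by simp

lemma exp_growth_diff: "exp_growth c f ==> exp_growth c h ==> exp_growth c (%y. f y - h y)"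
  using exp_growth_add[of c f, OF _ exp_growth_cmult[of c h "-1"]] by simp

lemma exp_growth_ident: "c > 0 ==> exp_growth c (%y. y)"
proof (rule exp_growthI[where K = "1 + 1 / c"])
  fix y :: real assume c: "c > 0"
  have "\<bar>y\<bar> <= 1 + y\<^sup>2"
  proof (cases "\<bar>y\<bar> <= 1")
    case False
    then have "\<bar>y\<bar> * 1 <= \<bar>y\<bar> * \<bar>y\<bar>" by (intro mult_left_mono) auto
    then show ?thesis by (simp add: power2_eq_square)
  qed (simp add: add_increasing2)
  also have "\<dots> <= (1 + 1 / c) * (1 + c * y\<^sup>2)"
    using c by (simp add: field_simps)
  also have "\<dots> <= (1 + 1 / c) * exp (c * y\<^sup>2)"
    using c by (intro mult_left_mono) (auto simp: exp_ge_add_one_self)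
  finally show "\<bar>y\<bar> <= (1 + 1 / c) * exp (c * y\<^sup>2)" .
qed simp

lemma exp_growth_power: "c > 0 ==> exp_growth c (%y. y ^ n)"
proof (induction n arbitrary: c)
  case (Suc n)
  show ?case
    using exp_growth_mult[OF exp_growth_ident[of "c / 2"] Suc.IH[of "c / 2"]] Suc.prems by simp
qed (simp add: exp_growth_const)

lemma exp_growth_decay:
  assumes "exp_growth c f" "c < b"
  shows "((%y. f y * exp (- b * y\<^sup>2)) \<longlongrightarrow> 0) at_top"
    and "((%y. f y * exp (- b * y\<^sup>2)) \<longlongrightarrow> 0) at_bot"
proof -
  obtain K where K: "!!y. \<bar>f y\<bar> <= K * exp (c * y\<^sup>2)" "K >= 0"
    using assms by (auto simp: exp_growth_def)
  have *: "\<bar>f y * exp (- b * y\<^sup>2)\<bar> <= K * exp (- (b - c) * y\<^sup>2)" for y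
    using mult_right_mono[OF K(1)[of y], of "exp (- b * y\<^sup>2)"]
    by (simp add: abs_mult mult.assoc flip: exp_add) (simp add: algebra_simps)
  have t: "filterlim (%y::real. - (b - c) * y\<^sup>2) at_bot at_top"
    using assms(2) by real_asymp
  have b: "filterlim (%y::real. - (b - c) * y\<^sup>2) at_bot at_bot"
    using assms(2) by real_asymp
  have 1: "((%y. K * exp (- (b - c) * y\<^sup>2)) \<longlongrightarrow> 0) at_top"
    using tendsto_mult[OF tendsto_const[of K] filterlim_compose[OF exp_at_bot t]] by simp
  have 2: "((%y. K * exp (- (b - c) * y\<^sup>2)) \<longlongrightarrow> 0) at_bot"
    using tendsto_mult[OF tendsto_const[of K] filterlim_compose[OF exp_at_bot b]] by simp
  show "((%y. f y * exp (- b * y\<^sup>2)) \<longlongrightarrow> 0) at_top"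
    by (rule Lim_null_comparison[OF _ 1]) (use * in auto)
  show "((%y. f y * exp (- b * y\<^sup>2)) \<longlongrightarrow> 0) at_bot"
    by (rule Lim_null_comparison[OF _ 2]) (use * in auto)
qed

text \<open>Times the weight, the integrand is the derivative of F y * exp (- y^2 / 4), whose limits
  at both infinities vanish because c < 1/4.\<close>

lemma gauss_by_parts:
  assumes F: "!!y. (F has_real_derivative F' y) (at y)" and F': "continuous_on UNIV F'"
    and "exp_growth c F" "exp_growth c F'" and c: "c < 1 / 4"
  shows "(\<integral>y. F' y - y / 2 * F y \<partial>gauss) = 0"
proof -
  have cF: "continuous_on UNIV F"
    using F by (intro continuous_at_imp_continuous_on) (auto intro: DERIV_isCont)
  \<comment> \<open>The factor y in the integrand needs slightly more exponent than c; half of the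
    distance to 1/4 is reserved for it.\<close>
  define d where "d = (1 / 4 - c) / 2"
  have d: "d > 0" "c + d < 1 / 4" using c by (auto simp: d_def field_simps)
  have "exp_growth (c + d) (%y. F' y - 1 / 2 * (F y * y))"
    using exp_growth_mult[OF assms(3) exp_growth_ident[OF d(1)]] exp_growth_mono[OF assms(4), of "c + d"] d(1)
    by (intro exp_growth_diff exp_growth_cmult) auto
  then have "exp_growth (c + d) (%y. F' y - y / 2 * F y)"
    by (simp add: mult_ac)
  from integrable_gauss_growth[OF this d(2)] have i: "integrable lborel (%y. exp (- y\<^sup>2 / 4) *\<^sub>R (F' y - y / 2 * F y))"
    using exp_growth_measurable assms(3,4) by (subst (asm) integrable_gauss_iff) auto
  have "(LBINT y=-\<infinity>..\<infinity>. exp (- y\<^sup>2 / 4) *\<^sub>R (F' y - y / 2 * F y)) = 0 - 0"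
  proof (rule interval_integral_FTC_integrable)
    show "((%y. F y * exp (- y\<^sup>2 / 4)) has_vector_derivative exp (- y\<^sup>2 / 4) *\<^sub>R (F' y - y / 2 * F y)) (at y)" for y
      unfolding has_real_derivative_iff_has_vector_derivative[symmetric]
      by (rule derivative_eq_intros F refl | simp)+ (simp add: algebra_simps power2_eq_square)
    show "isCont (%y. exp (- y\<^sup>2 / 4) *\<^sub>R (F' y - y / 2 * F y)) y" for y
      using F' cF by (intro continuous_intros) (auto simp: continuous_on_eq_continuous_at)
    show "set_integrable lborel (einterval (-\<infinity>) \<infinity>) (%y. exp (- y\<^sup>2 / 4) *\<^sub>R (F' y - y / 2 * F y))"
      using i by (simp add: set_integrable_def)
    show "(((%y. F y * exp (- y\<^sup>2 / 4)) \<circ> real_of_ereal) \<longlongrightarrow> 0) (at_right (-\<infinity>))"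
      using exp_growth_decay(2)[OF assms(3) c] by (simp add: ereal_tendsto_simps)
    show "(((%y. F y * exp (- y\<^sup>2 / 4)) \<circ> real_of_ereal) \<longlongrightarrow> 0) (at_left \<infinity>)"
      using exp_growth_decay(1)[OF assms(3) c] by (simp add: ereal_tendsto_simps)
  qed simp
  then have "(\<integral>y. exp (- y\<^sup>2 / 4) *\<^sub>R (F' y - y / 2 * F y) \<partial>lborel) = 0"
    by (simp add: interval_lebesgue_integral_def set_lebesgue_integral_def)
  then show ?thesis
    using exp_growth_measurable assms(3,4) by (subst integral_gauss) auto
qed

lemma gauss_tendsto:
  fixes f :: "nat => real => real"
  assumes "!!y. (%n. f n y) \<longlonglongrightarrow> h y" "!!n. f n \<in> borel_measurable borel"
    and "!!n y. \<bar>f n y\<bar> <= K * exp (c * y\<^sup>2)" and c: "c < 1 / 4"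
  shows "(%n. \<integral>y. f n y \<partial>gauss) \<longlonglongrightarrow> (\<integral>y. h y \<partial>gauss)"
proof -
  have "h \<in> borel_measurable borel"
    using assms(1,2) by (rule borel_measurable_LIMSEQ_real)
  then show ?thesis
    using assms integrable_mult_right[of K, OF integrable_gauss_exp[OF c]]
    by (intro integral_dominated_convergence[where w = "%y. K * exp (c * y\<^sup>2)"]) auto
qed

text \<open>The difference quotient is represented by an arbitrary integrand \<open>q h\<close>, not
  by the quotient of an integrand: for the Dirichlet energy it is first integrated by parts, so that
  only difference quotients of v occur and vy need not be differentiable in s.\<close>

lemma gauss_integral_deriv_quotient:
  assumes "a < s" "s < b"
    and q: "!!h. h ~= 0 ==> s + h \<in> {a<..<b} ==> (I (s + h) - I s) / h = (\<integral>y. q h y \<partial>gauss)"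
    and qm: "!!h. h ~= 0 ==> s + h \<in> {a<..<b} ==> q h \<in> borel_measurable borel"
    and lim: "!!y. ((%h. q h y) \<longlongrightarrow> q0 y) (at 0)"
    and bd: "!!h y. h ~= 0 ==> s + h \<in> {a<..<b} ==> \<bar>q h y\<bar> <= K * exp (c * y\<^sup>2)" and c: "c < 1 / 4"
  shows "(I has_real_derivative (\<integral>y. q0 y \<partial>gauss)) (at s)"
proof -
  define r where "r = min (s - a) (b - s)"
  have r: "r > 0" using assms(1,2) by (simp add: r_def)
  have "((%h. (I (s + h) - I s) / h) \<longlongrightarrow> (\<integral>y. q0 y \<partial>gauss)) (at 0 within {-r<..<r})"
    unfolding tendsto_at_iff_sequentially
  proof (intro allI impI)
    fix X :: "nat => real" assume X: "\<forall>i. X i \<in> {-r<..<r} - {0}" "X \<longlonglongrightarrow> 0"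
    then have in0: "X i ~= 0" "s + X i \<in> {a<..<b}" for i
      by (auto simp: r_def) (smt (verit, best) DiffD1 greaterThanLessThan_iff min_less_iff_conj)+
    have "(%n. \<integral>y. q (X n) y \<partial>gauss) \<longlonglongrightarrow> (\<integral>y. q0 y \<partial>gauss)"
    proof (rule gauss_tendsto[where K = K, OF _ _ _ c])
      show "(%n. q (X n) y) \<longlonglongrightarrow> q0 y" for y
        using lim[of y] X in0 unfolding tendsto_at_iff_sequentially by (auto simp: o_def)
    qed (use qm bd in0 in auto)
    then show "((%h. (I (s + h) - I s) / h) \<circ> X) \<longlonglongrightarrow> (\<integral>y. q0 y \<partial>gauss)"
      using q in0 by (simp add: o_def)
  qed
  then have "((%h. (I (s + h) - I s) / h) \<longlongrightarrow> (\<integral>y. q0 y \<partial>gauss)) (at 0)"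
    using r at_within_open[of 0 "{-r<..<r}"] by auto
  then show ?thesis by (simp add: DERIV_def)
qed

lemma gauss_integral_deriv:
  assumes s: "s \<in> {a<..<b}"
    and m: "!!s. s \<in> {a<..<b} ==> exp_growth c (F s)"
    and d: "!!s y. s \<in> {a<..<b} ==> ((%s. F s y) has_real_derivative F' s y) (at s)"
    and bd: "!!s y. s \<in> {a<..<b} ==> \<bar>F' s y\<bar> <= K * exp (c * y\<^sup>2)" and c: "c < 1 / 4"
  shows "((%s. \<integral>y. F s y \<partial>gauss) has_real_derivative (\<integral>y. F' s y \<partial>gauss)) (at s)"
proof (rule gauss_integral_deriv_quotient[where q = "%h y. (F (s + h) y - F s y) / h" and K = K])
  fix h assume h: "h ~= 0" "s + h \<in> {a<..<b}"
  have i: "integrable gauss (F (s + h))" "integrable gauss (F s)"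
    using m[OF h(2)] m[OF s] c by (auto intro: integrable_gauss_growth)
  then show "((\<integral>y. F (s + h) y \<partial>gauss) - (\<integral>y. F s y \<partial>gauss)) / h = (\<integral>y. (F (s + h) y - F s y) / h \<partial>gauss)"
    by simp
  show "(%y. (F (s + h) y - F s y) / h) \<in> borel_measurable borel"
    using m[OF h(2)] m[OF s] exp_growth_measurable by auto
  fix y
  have seg: "closed_segment s (s + h) \<subseteq> {a<..<b}"
    using s h(2) by (auto simp: closed_segment_eq_real_ivl)
  have "norm (F s y - F (s + h) y) <= (K * exp (c * y\<^sup>2)) * norm (s - (s + h))"
  proof (rule field_differentiable_bound[OF convex_closed_segment])
    show "((%s. F s y) has_field_derivative F' z y) (at z within closed_segment s (s + h))"
      if "z \<in> closed_segment s (s + h)" for z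
      by (rule has_field_derivative_at_within[OF d[OF subsetD[OF seg that]]])
    show "norm (F' z y) <= K * exp (c * y\<^sup>2)" if "z \<in> closed_segment s (s + h)" for z
      using bd[OF subsetD[OF seg that]] by simp
  qed simp_all
  then show "\<bar>(F (s + h) y - F s y) / h\<bar> <= K * exp (c * y\<^sup>2)"
    using h(1) by (simp add: abs_minus_commute divide_le_eq)
qed (use s d[OF s] c in \<open>auto simp: DERIV_def\<close>)

lemma gauss_integral_eq_0_iff:
  fixes f :: "real => real"
  assumes "continuous_on UNIV f" "!!y. f y >= 0" "integrable gauss f"
  shows "(\<integral>y. f y \<partial>gauss) = 0 \<longleftrightarrow> (\<forall>y. f y = 0)"
proof
  assume "(\<integral>y. f y \<partial>gauss) = 0"
  then have "AE y in gauss. f y = 0"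
    using assms(2,3) integral_nonneg_eq_0_iff_AE[of gauss f] by auto
  then have "AE y in lborel. f y = 0"
    unfolding gauss_def by (subst (asm) AE_density) auto
  then have "{y. f y ~= 0} \<in> null_sets lborel"
    using borel_measurable_continuous_onI[OF assms(1)] by (subst (asm) AE_iff_null) auto
  then have "negligible {y. f y ~= 0}"
    by (simp add: negligible_iff_null_sets null_sets_completionI)
  moreover have "open {y. f y ~= 0}"
    by (intro open_Collect_neq assms continuous_on_const)
  ultimately show "\<forall>y. f y = 0"
    using open_not_negligible by blast
qed simp

section \<open>The frequency function\<close>

text \<open>In the application \<open>v s y\<close> is w at time T - exp (- s) and position x0 + exp
  (- s / 2) * y. The residual is the defect in v_s = v_yy - (y / 2) v_y; its factor exp (- s / 2) is
  the power of the length scale left over by the first-order term.\<close>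

locale ou_flow =
  fixes v vy vyy vs :: "real => real => real" and a b c K :: real
  assumes deriv_y: "s \<in> {a<..<b} ==> (v s has_real_derivative vy s y) (at y)"
    and deriv_yy: "s \<in> {a<..<b} ==> (vy s has_real_derivative vyy s y) (at y)"
    and deriv_s: "s \<in> {a<..<b} ==> ((%s. v s y) has_real_derivative vs s y) (at s)"
    and cont_yy: "s \<in> {a<..<b} ==> continuous_on UNIV (vyy s)"
    and cont_vs: "s \<in> {a<..<b} ==> continuous_on UNIV (vs s)"
    and cont_s_vy: "s \<in> {a<..<b} ==> isCont (%s. vy s y) s"
    and cont_s_vyy: "s \<in> {a<..<b} ==> isCont (%s. vyy s y) s"
    and bound_v: "s \<in> {a<..<b} ==> \<bar>v s y\<bar> <= K * exp (y\<^sup>2 / 64)"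
    and bound_vy: "s \<in> {a<..<b} ==> \<bar>vy s y\<bar> <= K * exp (y\<^sup>2 / 64)"
    and bound_vyy: "s \<in> {a<..<b} ==> \<bar>vyy s y\<bar> <= K * exp (y\<^sup>2 / 64)"
    and bound_vs: "s \<in> {a<..<b} ==> \<bar>vs s y\<bar> <= K * exp (y\<^sup>2 / 64)"
    and c_nonneg: "c >= 0"
    and residual: "s \<in> {a<..<b} ==>
      \<bar>vs s y - (vyy s y - y / 2 * vy s y)\<bar> <= c * exp (- s / 2) * (\<bar>v s y\<bar> + \<bar>vy s y\<bar>)"
begin

definition Lv :: "real => real => real" where "Lv s y = vyy s y - y / 2 * vy s y"
definition N :: "real => real" where "N s = (\<integral>y. (v s y)\<^sup>2 \<partial>gauss)"
definition D :: "real => real" where "D s = (\<integral>y. (vy s y)\<^sup>2 \<partial>gauss)"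
text \<open>The Rayleigh quotient of minus \<open>Lv\<close>, known as the parabolic
  frequency.\<close>

definition Q :: "real => real" where "Q s = D s / N s"
text \<open>The squared distance of \<open>v s\<close> from solving the eigenvalue equation with
  eigenvalue - \<open>Q s\<close>; it drives the decay of the frequency.\<close>

definition Z :: "real => real" where "Z s = (\<integral>y. (Lv s y + Q s * v s y)\<^sup>2 \<partial>gauss)"
text \<open>The exponential factor has logarithmic derivative -2 c^2 exp (- s), which cancels the
  largest growth of 1 + \<open>Q\<close> that the residual can cause.\<close>

definition P :: "real => real" where "P s = (1 + Q s) * exp (2 * c\<^sup>2 * exp (- s))"

context fixes s :: real assumes s: "s \<in> {a<..<b}"
begin

lemma cont_v: "continuous_on UNIV (v s)" and cont_vy: "continuous_on UNIV (vy s)"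
  using deriv_y[OF s] deriv_yy[OF s]
  by (auto intro!: continuous_at_imp_continuous_on DERIV_isCont)

lemma growth_v: "exp_growth (1/64) (v s)" and growth_vy: "exp_growth (1/64) (vy s)"
  and growth_vyy: "exp_growth (1/64) (vyy s)" and growth_vs: "exp_growth (1/64) (vs s)"
  using bound_v[OF s] bound_vy[OF s] bound_vyy[OF s] bound_vs[OF s]
    borel_measurable_continuous_onI cont_v cont_vy cont_yy[OF s] cont_vs[OF s]
  by (auto intro!: exp_growthI[where K = K])

lemma growth_Lv: "exp_growth (1/32) (Lv s)"
proof -
  have "exp_growth (1/32) (%y. vyy s y - 1 / 2 * (y * vy s y))"
    using exp_growth_mult[OF exp_growth_ident growth_vy, of "1/64"] exp_growth_mono[OF growth_vyy, of "1/32"]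
    by (intro exp_growth_diff exp_growth_cmult) auto
  then show ?thesis by (simp add: Lv_def[abs_def])
qed

text \<open>The drift - y / 2 is the logarithmic derivative of the weight, so the operator is in
  divergence form with respect to \<open>gauss\<close>.\<close>

lemma by_parts:
  assumes u: "!!y. (u has_real_derivative u' y) (at y)" "continuous_on UNIV u'"
    and g: "exp_growth (1/32) u" "exp_growth (1/32) u'"
  shows "(\<integral>y. u y * Lv s y \<partial>gauss) = - (\<integral>y. u' y * vy s y \<partial>gauss)"
proof -
  have cu: "continuous_on UNIV u"
    using u(1) by (auto intro!: continuous_at_imp_continuous_on DERIV_isCont)
  have e: "1/32 + 1/64 <= (1/16::real)" "1/32 + 1/32 <= (1/16::real)" by auto
  have gs: "exp_growth (1/16) (%y. u y * vy s y)" "exp_growth (1/16) (%y. u' y * vy s y)"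
    "exp_growth (1/16) (%y. u y * vyy s y)" "exp_growth (1/16) (%y. u y * Lv s y)"
    using exp_growth_mono[OF exp_growth_mult[OF g(1) growth_vy] e(1)]
      exp_growth_mono[OF exp_growth_mult[OF g(2) growth_vy] e(1)]
      exp_growth_mono[OF exp_growth_mult[OF g(1) growth_vyy] e(1)]
      exp_growth_mono[OF exp_growth_mult[OF g(1) growth_Lv] e(2)] by auto
  have "(\<integral>y. (u' y * vy s y + u y * vyy s y) - y / 2 * (u y * vy s y) \<partial>gauss) = 0"
  proof (rule gauss_by_parts)
    show "((%y. u y * vy s y) has_real_derivative u' y * vy s y + u y * vyy s y) (at y)" for y
      using DERIV_mult[OF u(1)[of y] deriv_yy[OF s, of y]] by (simp add: mult.commute add.commute)
    show "continuous_on UNIV (%y. u' y * vy s y + u y * vyy s y)"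
      using cu u(2) cont_vy cont_yy[OF s] by (intro continuous_intros) auto
    show "exp_growth (1/16) (%y. u' y * vy s y + u y * vyy s y)"
      using gs by (intro exp_growth_add)
  qed (use gs in auto)
  then have "(\<integral>y. u' y * vy s y + u y * Lv s y \<partial>gauss) = 0"
    by (simp add: Lv_def algebra_simps)
  then show ?thesis
    using gs(2,4)[THEN integrable_gauss_growth] by (subst (asm) Bochner_Integration.integral_add) auto
qed

lemma int_products [simp]:
  "integrable gauss (%y. (v s y)\<^sup>2)" "integrable gauss (%y. (vy s y)\<^sup>2)"
  "integrable gauss (%y. v s y * vs s y)" "integrable gauss (%y. Lv s y * vs s y)"
  "integrable gauss (%y. v s y * Lv s y)" "integrable gauss (%y. (Lv s y)\<^sup>2)"
  "integrable gauss (%y. (Lv s y + k * v s y)\<^sup>2)" "integrable gauss (%y. (vs s y - Lv s y)\<^sup>2)"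
  "integrable gauss (%y. v s y * (vs s y - Lv s y))"
proof -
  have e: "1/64 + 1/64 < (1/4::real)" "1/32 + 1/32 < (1/4::real)" "1/64+1/32 < (1/4::real)" "1/32+1/64 < (1/4::real)" by auto
  have z: "exp_growth (1/32) (%y. Lv s y + k * v s y)" "exp_growth (1/32) (%y. vs s y - Lv s y)"
    using growth_Lv exp_growth_mono[OF growth_v, of "1/32"] exp_growth_mono[OF growth_vs, of "1/32"]
    by (auto intro!: exp_growth_add exp_growth_diff exp_growth_cmult)
  show "integrable gauss (%y. (v s y)\<^sup>2)" "integrable gauss (%y. (vy s y)\<^sup>2)"
    "integrable gauss (%y. v s y * vs s y)" "integrable gauss (%y. Lv s y * vs s y)"
    "integrable gauss (%y. v s y * Lv s y)" "integrable gauss (%y. (Lv s y)\<^sup>2)"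
    "integrable gauss (%y. (Lv s y + k * v s y)\<^sup>2)" "integrable gauss (%y. (vs s y - Lv s y)\<^sup>2)"
    "integrable gauss (%y. v s y * (vs s y - Lv s y))"
    unfolding power2_eq_square
    using integrable_gauss_growth[OF exp_growth_mult[OF growth_v growth_v] e(1)]
      integrable_gauss_growth[OF exp_growth_mult[OF growth_vy growth_vy] e(1)]
      integrable_gauss_growth[OF exp_growth_mult[OF growth_v growth_vs] e(1)]
      integrable_gauss_growth[OF exp_growth_mult[OF growth_Lv growth_vs] e(4)]
      integrable_gauss_growth[OF exp_growth_mult[OF growth_v growth_Lv] e(3)]
      integrable_gauss_growth[OF exp_growth_mult[OF growth_Lv growth_Lv] e(2)]
      integrable_gauss_growth[OF exp_growth_mult[OF z(1) z(1)] e(2)]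
      integrable_gauss_growth[OF exp_growth_mult[OF z(2) z(2)] e(2)]
      integrable_gauss_growth[OF exp_growth_mult[OF growth_v z(2)] e(3)]
    by blast+
qed

lemma int_v_Lv: "(\<integral>y. v s y * Lv s y \<partial>gauss) = - D s"
  using by_parts[OF deriv_y[OF s] cont_vy] growth_v growth_vy exp_growth_mono[of "1/64" _ "1/32"]
  by (simp add: D_def power2_eq_square)

lemma N_nonneg: "N s >= 0" and D_nonneg: "D s >= 0" and Z_nonneg: "Z s >= 0"
  by (simp_all add: N_def D_def Z_def)

lemma Q_nonneg: "Q s >= 0"
  using N_nonneg D_nonneg by (simp add: Q_def)

lemma N_pos_iff: "N s > 0 \<longleftrightarrow> (\<exists>y. v s y ~= 0)"
  using gauss_integral_eq_0_iff[of "%y. (v s y)\<^sup>2"] N_nonneg cont_v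
  by (auto simp: N_def continuous_on_power less_le)

lemma N_deriv: "(N has_real_derivative (\<integral>y. 2 * (v s y * vs s y) \<partial>gauss)) (at s)"
  unfolding N_def
proof (rule gauss_integral_deriv[OF s, where K = "2 * K\<^sup>2" and c = "1/32"])
  fix s y assume s: "s \<in> {a<..<b}"
  show "exp_growth (1 / 32) (%y. (v s y)\<^sup>2)"
    using exp_growth_mult[OF ou_flow.growth_v[OF ou_flow_axioms s] ou_flow.growth_v[OF ou_flow_axioms s]]
    by (simp add: power2_eq_square)
  show "((%s. (v s y)\<^sup>2) has_real_derivative 2 * (v s y * vs s y)) (at s)"
    using deriv_s[OF s, of y] by (auto intro!: derivative_eq_intros)
  have "K >= 0" using order_trans[OF abs_ge_zero bound_v[OF s, of y]] by (simp add: zero_le_mult_iff)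
  then have "\<bar>v s y\<bar> * \<bar>vs s y\<bar> <= (K * exp (y\<^sup>2 / 64)) * (K * exp (y\<^sup>2 / 64))"
    using bound_v[OF s, of y] bound_vs[OF s, of y] by (intro mult_mono) auto
  also have "\<dots> = K\<^sup>2 * exp (1/32 * y\<^sup>2)"
    by (simp add: power2_eq_square mult_ac flip: exp_add) 
  finally show "\<bar>2 * (v s y * vs s y)\<bar> <= 2 * K\<^sup>2 * exp (1/32 * y\<^sup>2)"
    by (simp add: abs_mult)
qed simp

lemma residual_sq: "(\<integral>y. (vs s y - Lv s y)\<^sup>2 \<partial>gauss) <= 2 * c\<^sup>2 * exp (- s) * (N s + D s)"
proof -
  have "(vs s y - Lv s y)\<^sup>2 <= 2 * c\<^sup>2 * exp (- s) * ((v s y)\<^sup>2 + (vy s y)\<^sup>2)" for y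
  proof -
    have "(vs s y - Lv s y)\<^sup>2 <= (c * exp (- s / 2) * (\<bar>v s y\<bar> + \<bar>vy s y\<bar>))\<^sup>2"
      using residual[OF s, of y] c_nonneg unfolding Lv_def by (subst abs_le_square_iff[symmetric]) auto
    also have "\<dots> = c\<^sup>2 * exp (- s) * (\<bar>v s y\<bar> + \<bar>vy s y\<bar>)\<^sup>2"
      by (simp add: power_mult_distrib flip: exp_double)
    also have "\<dots> <= c\<^sup>2 * exp (- s) * (2 * ((v s y)\<^sup>2 + (vy s y)\<^sup>2))"
      using sum_squares_bound[of "\<bar>v s y\<bar>" "\<bar>vy s y\<bar>"]
      by (intro mult_left_mono) (auto simp: power2_sum)
    finally show ?thesis by (simp add: algebra_simps)
  qed
  then have "(\<integral>y. (vs s y - Lv s y)\<^sup>2 \<partial>gauss) <= (\<integral>y. 2 * c\<^sup>2 * exp (- s) * ((v s y)\<^sup>2 + (vy s y)\<^sup>2) \<partial>gauss)"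
    by (intro integral_mono) auto
  then show ?thesis by (simp add: N_def D_def)
qed

lemma int_v_residual: "\<bar>\<integral>y. v s y * (vs s y - Lv s y) \<partial>gauss\<bar> <= c * exp (- s / 2) * (2 * N s + D s)"
proof -
  have "\<bar>v s y * (vs s y - Lv s y)\<bar> <= c * exp (- s / 2) * (2 * (v s y)\<^sup>2 + (vy s y)\<^sup>2)" for y
  proof -
    have "\<bar>v s y * (vs s y - Lv s y)\<bar> <= \<bar>v s y\<bar> * (c * exp (- s / 2) * (\<bar>v s y\<bar> + \<bar>vy s y\<bar>))"
      using residual[OF s, of y] unfolding abs_mult Lv_def by (intro mult_left_mono) auto
    also have "\<dots> = c * exp (- s / 2) * (\<bar>v s y\<bar>\<^sup>2 + \<bar>v s y\<bar> * \<bar>vy s y\<bar>)"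
      by (simp add: power2_eq_square algebra_simps)
    also have "\<dots> <= c * exp (- s / 2) * (2 * (v s y)\<^sup>2 + (vy s y)\<^sup>2)"
    proof (intro mult_left_mono)
      have "0 <= \<bar>v s y\<bar> * \<bar>vy s y\<bar>" by simp
      then show "\<bar>v s y\<bar>\<^sup>2 + \<bar>v s y\<bar> * \<bar>vy s y\<bar> <= 2 * (v s y)\<^sup>2 + (vy s y)\<^sup>2"
        using sum_squares_bound[of "\<bar>v s y\<bar>" "\<bar>vy s y\<bar>"] unfolding power2_abs mult.assoc by linarith
    qed (use c_nonneg in auto)
    finally show ?thesis .
  qed
  then have "(\<integral>y. \<bar>v s y * (vs s y - Lv s y)\<bar> \<partial>gauss) <= (\<integral>y. c * exp (- s / 2) * (2 * (v s y)\<^sup>2 + (vy s y)\<^sup>2) \<partial>gauss)"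
    by (intro integral_mono) auto
  also have "\<dots> = c * exp (- s / 2) * (2 * N s + D s)"
    by (simp add: N_def D_def)
  finally show ?thesis
    using integral_abs_bound[of gauss "%y. v s y * (vs s y - Lv s y)"] by linarith
qed

end

text \<open>No s-derivative of vy is available. The difference of two energies factors into (vy (s +
  h) - vy s) times (vy (s + h) + vy s); integrating by parts turns it into a difference quotient of
  v against \<open>Lv (s + h)\<close> plus \<open>Lv s\<close>, which is the integrand
  \<open>?q\<close>.\<close>

lemma D_deriv:
  assumes s: "s \<in> {a<..<b}"
  shows "(D has_real_derivative (\<integral>y. - 2 * (Lv s y * vs s y) \<partial>gauss)) (at s)"
proof -
  let ?q = "%h y. - ((v (s + h) y - v s y) / h * (Lv (s + h) y + Lv s y))"
  have K: "K >= 0" using order_trans[OF abs_ge_zero bound_v[OF s, of 0]] by simp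
  obtain K1 :: real where K1: "!!y. \<bar>y\<bar> <= K1 * exp (1/64 * y\<^sup>2)" "K1 >= 0"
    using exp_growth_ident[of "1/64"] unfolding exp_growth_def by (auto simp: mult.commute)
  have boundL: "\<bar>Lv s y\<bar> <= (K + K1 * K) * exp (y\<^sup>2 / 32)" if "s \<in> {a<..<b}" for s y
  proof -
    have "\<bar>y / 2 * vy s y\<bar> <= (K1 * exp (1/64 * y\<^sup>2)) * (K * exp (y\<^sup>2 / 64))"
      unfolding abs_mult
    proof (rule mult_mono)
      show "\<bar>y / 2\<bar> <= K1 * exp (1/64 * y\<^sup>2)" using K1(1)[of y] by linarith
    qed (use K1(2) bound_vy[OF that, of y] in auto)
    also have "\<dots> = (K1 * K) * exp (y\<^sup>2 / 32)" by (simp add: mult_ac flip: exp_add)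
    finally have 1: "\<bar>y / 2 * vy s y\<bar> <= (K1 * K) * exp (y\<^sup>2 / 32)" .
    have "\<bar>vyy s y\<bar> <= K * exp (y\<^sup>2 / 32)"
      using bound_vyy[OF that, of y] mult_left_mono[OF _ K, of "exp (y\<^sup>2 / 64)" "exp (y\<^sup>2 / 32)"] by auto
    with 1 show ?thesis unfolding Lv_def by (simp add: distrib_right abs_le_iff)
  qed
  show ?thesis
  proof (rule gauss_integral_deriv_quotient[where q = ?q and K = "K * (2 * (K + K1 * K))" and c = "1/16"])
    show "a < s" "s < b" using s by auto
    fix h assume h: "h ~= 0" "s + h \<in> {a<..<b}"
    let ?u = "%y. v (s + h) y - v s y" and ?u' = "%y. vy (s + h) y - vy s y"
    have u: "(?u has_real_derivative ?u' y) (at y)" for y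
      using deriv_y[OF s] deriv_y[OF h(2)] by (intro DERIV_diff)
    have cu: "continuous_on UNIV ?u'" using cont_vy s h(2) by (intro continuous_intros) auto
    have gu: "exp_growth (1/32) ?u" "exp_growth (1/32) ?u'"
      using growth_v[OF s] growth_v[OF h(2)] growth_vy[OF s] growth_vy[OF h(2)]
      by (auto intro!: exp_growth_diff intro: exp_growth_mono)
    have e: "1/32 + 1/32 < (1/4::real)" by simp
    have i: "integrable gauss (%y. ?u y * Lv s y)" "integrable gauss (%y. ?u y * Lv (s + h) y)"
      using integrable_gauss_growth[OF exp_growth_mult[OF gu(1) growth_Lv[OF s]] e]
        integrable_gauss_growth[OF exp_growth_mult[OF gu(1) growth_Lv[OF h(2)]] e] by auto
    have gy: "exp_growth (1/32) (vy s)" "exp_growth (1/32) (vy (s + h))"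
      using growth_vy[OF s] growth_vy[OF h(2)] exp_growth_mono by force+
    have j: "integrable gauss (%y. ?u' y * vy s y)" "integrable gauss (%y. ?u' y * vy (s + h) y)"
      using integrable_gauss_growth[OF exp_growth_mult[OF gu(2) gy(1)] e]
        integrable_gauss_growth[OF exp_growth_mult[OF gu(2) gy(2)] e] by auto
    have "D (s + h) - D s = (\<integral>y. ?u' y * vy s y + ?u' y * vy (s + h) y \<partial>gauss)"
      unfolding D_def using int_products(2)[OF s] int_products(2)[OF h(2)]
      by (subst Bochner_Integration.integral_diff[symmetric]) (auto simp: power2_eq_square algebra_simps)
    also have "\<dots> = - (\<integral>y. ?u y * Lv s y \<partial>gauss) - (\<integral>y. ?u y * Lv (s + h) y \<partial>gauss)"
      using by_parts[OF s u cu gu] by_parts[OF h(2) u cu gu] j by (simp only: Bochner_Integration.integral_add)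
    also have "\<dots> = (\<integral>y. - (?u y * Lv s y + ?u y * Lv (s + h) y) \<partial>gauss)"
      using i by simp
    finally have "(D (s + h) - D s) / h = (\<integral>y. - (?u y * Lv s y + ?u y * Lv (s + h) y) / h \<partial>gauss)"
      by simp
    moreover have "(%y. - (?u y * Lv s y + ?u y * Lv (s + h) y) / h) = ?q h"
      using h(1) by (auto simp: fun_eq_iff field_simps)
    ultimately show "(D (s + h) - D s) / h = integral\<^sup>L gauss (?q h)"
      by (rule subst[rotated])
    show "?q h \<in> borel_measurable borel"
      using exp_growth_measurable[OF gu(1)] exp_growth_measurable[OF growth_Lv[OF s]]
        exp_growth_measurable[OF growth_Lv[OF h(2)]] by measurable
    fix y
    have seg: "closed_segment s (s + h) \<subseteq> {a<..<b}"
      using s h(2) by (auto simp: closed_segment_eq_real_ivl)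
    have "norm (v s y - v (s + h) y) <= (K * exp (y\<^sup>2 / 64)) * norm (s - (s + h))"
    proof (rule field_differentiable_bound[OF convex_closed_segment])
      show "((%s. v s y) has_field_derivative vs z y) (at z within closed_segment s (s + h))"
        if "z \<in> closed_segment s (s + h)" for z
        by (rule has_field_derivative_at_within[OF deriv_s[OF subsetD[OF seg that]]])
      show "norm (vs z y) <= K * exp (y\<^sup>2 / 64)" if "z \<in> closed_segment s (s + h)" for z
        using bound_vs[OF subsetD[OF seg that]] by simp
    qed simp_all
    then have 1: "\<bar>(v (s + h) y - v s y) / h\<bar> <= K * exp (y\<^sup>2 / 64)"
      using h(1) by (simp add: abs_minus_commute divide_le_eq)
    have 2: "\<bar>Lv (s + h) y + Lv s y\<bar> <= 2 * (K + K1 * K) * exp (y\<^sup>2 / 32)"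
      using boundL[OF s, of y] boundL[OF h(2), of y] by linarith
    have "\<bar>?q h y\<bar> <= (K * exp (y\<^sup>2 / 64)) * (2 * (K + K1 * K) * exp (y\<^sup>2 / 32))"
      unfolding abs_minus_cancel abs_mult[of "_ / h"] using 1 2 K by (intro mult_mono) auto
    also have "\<dots> = K * (2 * (K + K1 * K)) * exp (y\<^sup>2 / 64 + y\<^sup>2 / 32)"
      unfolding exp_add by simp
    also have "\<dots> <= K * (2 * (K + K1 * K)) * exp (1/16 * y\<^sup>2)"
      using K K1 by (intro mult_left_mono) auto
    finally show "\<bar>?q h y\<bar> <= K * (2 * (K + K1 * K)) * exp (1/16 * y\<^sup>2)" .
  next
    fix y
    have "isCont (%s. Lv s y) s"
      unfolding Lv_def using cont_s_vy[OF s] cont_s_vyy[OF s] by (intro continuous_intros)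
    then have "((%h. Lv (s + h) y) \<longlongrightarrow> Lv s y) (at 0)"
      by (simp add: isCont_def LIM_offset_zero_iff)
    then have "((%h. ?q h y) \<longlongrightarrow> - (vs s y * (Lv s y + Lv s y))) (at 0)"
      using deriv_s[OF s, of y] unfolding DERIV_def by (intro tendsto_intros)
    then show "((%h. ?q h y) \<longlongrightarrow> - 2 * (Lv s y * vs s y)) (at 0)"
      by (simp add: algebra_simps)
  qed simp
qed

text \<open>Write z = Lv + Q v and r = vs - Lv. Since z is orthogonal to v, N times the derivative
  of Q is -2 <z, z + r>, which is at most - |z|^2 + |r|^2. The first term is - Z; the second is
  bounded by \<open>residual_sq\<close> and cancelled by the exponential factor of
  \<open>P\<close>.\<close>

lemma P_deriv:
  assumes s: "s \<in> {a<..<b}" and N: "N s > 0"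
  shows "\<exists>P'. (P has_real_derivative P') (at s) & P' <= - Z s / N s"
proof -
  define A where "A = (\<integral>y. v s y * vs s y \<partial>gauss)"
  define B where "B = (\<integral>y. Lv s y * vs s y \<partial>gauss)"
  define R where "R = (\<integral>y. (vs s y - Lv s y)\<^sup>2 \<partial>gauss)"
  define Q' where "Q' = (- 2 * B * N s - D s * (2 * A)) / (N s * N s)"
  have Q': "(Q has_real_derivative Q') (at s)"
    using DERIV_divide[OF D_deriv[OF s] N_deriv[OF s]] N
    by (simp add: Q_def[abs_def] A_def B_def Q'_def)
  note ints = int_products[OF s]
  have QN: "D s = Q s * N s" using N by (simp add: Q_def)
  have z0: "(\<integral>y. (Lv s y + Q s * v s y) * v s y \<partial>gauss) = 0"
  proof -
    have "(\<integral>y. (Lv s y + Q s * v s y) * v s y \<partial>gauss) = (\<integral>y. v s y * Lv s y + Q s * (v s y)\<^sup>2 \<partial>gauss)"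
      by (simp add: power2_eq_square algebra_simps)
    also have "\<dots> = - D s + Q s * N s" using ints by (simp add: int_v_Lv[OF s] N_def)
    finally show ?thesis using QN by simp
  qed
  have iz: "integrable gauss (%y. (Lv s y + Q s * v s y) * v s y)"
  proof -
    have "integrable gauss (%y. v s y * Lv s y + Q s * (v s y)\<^sup>2)" using ints by simp
    then show ?thesis by (simp add: power2_eq_square algebra_simps)
  qed
  have "- 2 * (B + Q s * A) = (\<integral>y. - 2 * (Lv s y * vs s y + Q s * (v s y * vs s y)) \<partial>gauss)"
    using ints by (simp add: A_def B_def)
  also have "\<dots> <= (\<integral>y. - (Lv s y + Q s * v s y)\<^sup>2 + (vs s y - Lv s y)\<^sup>2
      + 2 * Q s * ((Lv s y + Q s * v s y) * v s y) \<partial>gauss)"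
  proof (rule integral_mono)
    fix y
    let ?z = "Lv s y + Q s * v s y" and ?r = "vs s y - Lv s y"
    have "0 <= (?z + ?r)\<^sup>2" by simp
    then show "- 2 * (Lv s y * vs s y + Q s * (v s y * vs s y)) <=
        - ?z\<^sup>2 + ?r\<^sup>2 + 2 * Q s * (?z * v s y)"
      by (simp add: power2_eq_square algebra_simps)
  qed (use ints iz in auto)
  also have "\<dots> = - Z s + R"
    using ints iz z0 by (simp add: Z_def R_def)
  finally have 1: "- 2 * (B + Q s * A) <= - Z s + R" .
  have "Q' = - 2 * (B + Q s * A) / N s"
    using N unfolding Q'_def QN by (simp add: field_simps)
  also have "\<dots> <= (- Z s + R) / N s" using 1 N by (intro divide_right_mono) auto
  also have "\<dots> <= (- Z s + 2 * c\<^sup>2 * exp (- s) * (N s + D s)) / N s"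
    using residual_sq[OF s] N unfolding R_def by (intro divide_right_mono) auto
  also have "\<dots> = - Z s / N s + 2 * c\<^sup>2 * exp (- s) * (1 + Q s)"
    using N unfolding QN by (simp add: field_simps)
  finally have Q'_le: "Q' <= - Z s / N s + 2 * c\<^sup>2 * exp (- s) * (1 + Q s)" .
  let ?e = "exp (2 * c\<^sup>2 * exp (- s))"
  have P': "(P has_real_derivative (Q' - 2 * c\<^sup>2 * exp (- s) * (1 + Q s)) * ?e) (at s)"
    unfolding P_def[abs_def]
    by (rule derivative_eq_intros Q' refl | simp)+ (simp add: algebra_simps)
  have "(Q' - 2 * c\<^sup>2 * exp (- s) * (1 + Q s)) * ?e <= (- Z s / N s) * ?e"
    using Q'_le by (intro mult_right_mono) auto
  also have "\<dots> <= (- Z s / N s) * 1"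
    using Z_nonneg[OF s] N by (intro mult_left_mono_neg) (auto simp: divide_nonpos_pos)
  finally show ?thesis using P' by auto
qed

lemma P_antimono:
  assumes "a < s1" "s1 <= s2" "s2 < b" and N: "!!s. s1 <= s ==> s <= s2 ==> N s > 0"
  shows "P s2 <= P s1"
proof (rule DERIV_nonpos_imp_nonincreasing[OF assms(2)])
  fix x assume x: "s1 <= x" "x <= s2"
  then have i: "x \<in> {a<..<b}" using assms by auto
  have "- Z x / N x <= 0" using Z_nonneg[OF i] N_nonneg[OF i] by (simp add: divide_nonpos_nonneg)
  then show "\<exists>y. (P has_real_derivative y) (at x) & y <= 0"
    using P_deriv[OF i N[OF x]] by (meson order_trans)
qed

lemma Q_le_P: "s \<in> {a<..<b} ==> 1 + Q s <= P s"
  unfolding P_def using Q_nonneg[of s] by (simp add: mult_le_cancel_left1)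

text \<open>While N is positive, \<open>P\<close> decreases and bounds the frequency, so N' >= - k N
  with a fixed k. Up to its first zero m, N s * exp (k * s) is therefore nondecreasing and cannot
  tend to 0.\<close>

lemma N_stays_positive:
  assumes "a < s1" "s1 <= s2" "s2 < b" "N s1 > 0"
  shows "N s2 > 0"
proof (rule ccontr)
  assume n: "\<not> N s2 > 0"
  have cN: "continuous_on {s1..s2} N"
    using DERIV_isCont[OF N_deriv] assms(1,3) by (intro continuous_at_imp_continuous_on) auto
  define E where "E = {s \<in> {s1..s2}. N s = 0}"
  have "s2 \<in> E" using n N_nonneg[of s2] assms by (auto simp: E_def)
  have "compact E"
    unfolding E_def using continuous_closed_preimage_constant[OF cN]
    by (intro compact_eq_bounded_closed[THEN iffD2] conjI) (auto intro: bounded_subset[OF bounded_closed_interval])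
  with \<open>s2 \<in> E\<close> obtain m where m: "m \<in> E" "!!s. s \<in> E ==> m <= s"
    using compact_attains_inf[of E] by auto
  have mpos: "s1 < m" "m <= s2" "N m = 0" using m(1) assms(4) by (auto simp: E_def less_le)
  have pos: "N s > 0" if "s1 <= s" "s < m" for s
    using m(2)[of s] that N_nonneg[of s] mpos assms by (force simp: E_def less_le)
  define k where "k = 2 * P s1 + c * exp (- s1 / 2) * 2 * (2 + P s1)"
  have grow: "N s1 * exp (k * s1) <= N s * exp (k * s)" if s: "s1 <= s" "s < m" for s
  proof (rule DERIV_nonneg_imp_nondecreasing[OF s(1)])
    fix x assume x: "s1 <= x" "x <= s"
    then have i: "x \<in> {a<..<b}" using assms mpos s by auto
    have Px: "P x <= P s1" using x s assms mpos pos by (intro P_antimono) auto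
    have Nx: "N x > 0" using pos x s by auto
    have "D x = Q x * N x" using Nx by (simp add: Q_def)
    also have "\<dots> <= P s1 * N x" using Q_le_P[OF i] Px Nx by (intro mult_right_mono) auto
    finally have Dx: "D x <= P s1 * N x" .
    have "(\<integral>y. 2 * (v x y * vs x y) \<partial>gauss) = 2 * (\<integral>y. v x y * Lv x y + v x y * (vs x y - Lv x y) \<partial>gauss)"
      by (simp add: algebra_simps)
    also have "\<dots> = 2 * (- D x + (\<integral>y. v x y * (vs x y - Lv x y) \<partial>gauss))"
      using int_products[OF i] by (subst Bochner_Integration.integral_add) (auto simp: int_v_Lv[OF i])
    also have "\<dots> >= 2 * (- D x - c * exp (- x / 2) * (2 * N x + D x))"
      using int_v_residual[OF i] by (intro mult_left_mono) auto
    finally have 1: "(\<integral>y. 2 * (v x y * vs x y) \<partial>gauss) >= - 2 * D x - c * exp (- x / 2) * 2 * (2 * N x + D x)"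
      by (simp add: algebra_simps)
    have "c * exp (- x / 2) * 2 * (2 * N x + D x) <= c * exp (- s1 / 2) * 2 * (2 * N x + P s1 * N x)"
      using x c_nonneg Dx Nx D_nonneg[OF i] by (intro mult_mono mult_right_mono mult_left_mono) auto
    with 1 Dx have "(\<integral>y. 2 * (v x y * vs x y) \<partial>gauss) >= - k * N x"
      unfolding k_def by (simp add: algebra_simps)
    then have "0 <= ((\<integral>y. 2 * (v x y * vs x y) \<partial>gauss) + k * N x) * exp (k * x)" by simp
    moreover have "((%s. N s * exp (k * s)) has_real_derivative
        ((\<integral>y. 2 * (v x y * vs x y) \<partial>gauss) + k * N x) * exp (k * x)) (at x)"
      by (rule derivative_eq_intros N_deriv[OF i] refl | simp)+ (simp add: algebra_simps)
    ultimately show "\<exists>y. ((%s. N s * exp (k * s)) has_real_derivative y) (at x) & 0 <= y"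
      by blast
  qed
  have "isCont (%s. N s * exp (k * s)) m"
    using N_deriv[of m] mpos assms by (intro continuous_intros DERIV_isCont) auto
  then have "((%s. N s * exp (k * s)) \<longlongrightarrow> N m * exp (k * m)) (at_left m)"
    by (simp add: isCont_def filterlim_at_split)
  moreover have "\<forall>\<^sub>F s in at_left m. N s1 * exp (k * s1) <= N s * exp (k * s)"
    using eventually_at_left_real[OF mpos(1)] by eventually_elim (use grow in auto)
  ultimately have "N s1 * exp (k * s1) <= N m * exp (k * m)"
    by (rule tendsto_lowerbound) simp
  then show False using mpos(3) assms(4) by (simp add: mult_le_0_iff)
qed

end

text \<open>The heat polynomial of degree \<open>n\<close>: the solution of the heat equation which equals \<open>x ^ n\<close>
  at time 0. At time \<open>-1\<close> it is a multiple of a Hermite polynomial.\<close>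

fun heat_poly :: "nat => real => real => real" where
  "heat_poly 0 t x = 1"
| "heat_poly (Suc 0) t x = x"
| "heat_poly (Suc (Suc n)) t x = x * heat_poly (Suc n) t x + 2 * t * (real n + 1) * heat_poly n t x"

text \<open>The truncated n - 1 does no harm for n = 0, since the factor \<open>real n\<close>
  vanishes; this removes the case split of the recursion.\<close>

lemma heat_poly_Suc: "heat_poly (Suc n) t x = x * heat_poly n t x + 2 * t * real n * heat_poly (n - 1) t x"
  by (cases n) (auto simp: algebra_simps)

lemma heat_poly_deriv_x:
  "(heat_poly n t has_real_derivative real n * heat_poly (n - 1) t x) (at x)"
proof (induction n t x rule: heat_poly.induct)
  case (3 n t x)
  have "((%x. x * heat_poly (Suc n) t x + 2 * t * (real n + 1) * heat_poly n t x) has_real_derivative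
      (heat_poly (Suc n) t x + x * ((real n + 1) * heat_poly n t x) + 2 * t * (real n + 1) * (real n * heat_poly (n - 1) t x))) (at x)"
    using 3 by (auto intro!: derivative_eq_intros)
  moreover have "heat_poly (Suc n) t x + x * ((real n + 1) * heat_poly n t x) + 2 * t * (real n + 1) * (real n * heat_poly (n - 1) t x)
     = real (Suc (Suc n)) * heat_poly (Suc n) t x"
    by (simp add: heat_poly_Suc algebra_simps)
  moreover have "heat_poly (Suc (Suc n)) t = (%x. x * heat_poly (Suc n) t x + 2 * t * (real n + 1) * heat_poly n t x)"
    by (rule ext) simp
  ultimately show ?case by (simp only: diff_Suc_1)
next
  case (1 t x)
  have "heat_poly 0 t = (%x. 1)" by (rule ext) simp
  then show ?case by simp
next
  case (2 t x)
  have "heat_poly (Suc 0) t = (%x. x)" by (rule ext) simp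
  then show ?case by simp
qed

text \<open>By \<open>heat_poly_deriv_x\<close> used twice, the value is also the second
  x-derivative: this is the heat equation.\<close>

lemma heat_poly_deriv_t:
  "((%t. heat_poly n t x) has_real_derivative real n * real (n - 1) * heat_poly (n - 2) t x) (at t)"
proof (induction n t x rule: heat_poly.induct)
  case (3 n t x)
  have "((%t. x * heat_poly (Suc n) t x + 2 * t * (real n + 1) * heat_poly n t x) has_real_derivative
      (x * (real (Suc n) * real n * heat_poly (n - 1) t x)
       + (2 * (real n + 1) * heat_poly n t x + 2 * t * (real n + 1) * (real n * real (n - 1) * heat_poly (n - 2) t x)))) (at t)"
    using 3 by (auto intro!: derivative_eq_intros simp: algebra_simps)
  moreover have "x * (real (Suc n) * real n * heat_poly (n - 1) t x)
       + (2 * (real n + 1) * heat_poly n t x + 2 * t * (real n + 1) * (real n * real (n - 1) * heat_poly (n - 2) t x))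
     = real (Suc (Suc n)) * real (Suc n) * heat_poly n t x"
    by (cases n) (auto simp: heat_poly_Suc algebra_simps)
  ultimately show ?case by simp
qed auto

lemma heat_poly_scale: "heat_poly n (r\<^sup>2 * t) (r * x) = r ^ n * heat_poly n t x"
  by (induction n t x rule: heat_poly.induct) (auto simp: algebra_simps power2_eq_square)

lemma heat_poly_0 [simp]: "heat_poly n 0 x = x ^ n"
proof (induction n rule: less_induct)
  case (less n)
  show ?case
  proof (cases n)
    case (Suc m)
    then show ?thesis using less[of m] by (simp add: heat_poly_Suc)
  qed simp
qed

lemma heat_poly_minus: "heat_poly n t (- x) = (- 1) ^ n * heat_poly n t x"
  using heat_poly_scale[of n "-1" t x] by simp

text \<open>For nonnegative time all coefficients of the recurrence are nonnegative, so the leading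
  term is a lower bound.\<close>

lemma heat_poly_nonneg:
  assumes "t >= 0" "x >= 0" shows "heat_poly n t x >= x ^ n"
proof (induction n rule: less_induct)
  case (less n)
  have pos: "heat_poly m t x >= 0" if "m < n" for m
    using less[OF that] assms(2) by (meson order_trans zero_le_power)
  show ?case
  proof (cases n)
    case (Suc m)
    have "x ^ Suc m <= x * heat_poly m t x"
      using less[of m] Suc assms(2) by (simp add: mult_left_mono)
    moreover have "0 <= 2 * t * real m * heat_poly (m - 1) t x"
      using pos[of "m - 1"] Suc assms(1) by (intro mult_nonneg_nonneg) auto
    ultimately show ?thesis unfolding Suc heat_poly_Suc by linarith
  qed simp
qed

text \<open>This decides what happens after the blow-up time: an even profile has no zeros, and an
  odd one has a derivative of even degree, hence is strictly monotone. Either way at most one zero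
  remains.\<close>

lemma heat_poly_even_pos:
  assumes "t > 0" "even n" shows "heat_poly n t x > 0"
proof -
  have *: "heat_poly n t x > 0" if "even n" "x >= 0" for n x
    using that
  proof (induction n rule: less_induct)
    case (less n)
    show ?case
    proof (cases "n = 0")
      case False
      then obtain k where "n = 2 * k" "k ~= 0" using less.prems by auto
      then obtain m where m: "n = Suc (Suc m)" by (cases k) auto
      have "heat_poly m t x > 0" using less m by simp
      moreover have "x * heat_poly (Suc m) t x >= 0"
        using heat_poly_nonneg[of t x "Suc m"] zero_le_power[of x "Suc m"] assms(1) less.prems
        by (intro mult_nonneg_nonneg) linarith+
      ultimately show ?thesis using assms(1) unfolding m heat_poly.simps by (intro add_nonneg_pos) auto
    qed simp
  qed
  show ?thesis
  proof (cases "x >= 0")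
    case False
    then show ?thesis using *[OF assms(2), of "-x"] assms(2) heat_poly_minus[of n t x] by simp
  qed (use * assms in auto)
qed

text \<open>The reason is self-similarity: differentiating \<open>heat_poly_scale\<close> in r at r
  = 1, t = -1 and using the heat equation gives this identity. The proof reads it off the
  recurrence.\<close>

lemma heat_poly_eigen:
  "real n * real (n - 1) * heat_poly (n - 2) (-1) y - y / 2 * (real n * heat_poly (n - 1) (-1) y)
   = - (real n / 2) * heat_poly n (-1) y"
proof -
  consider "n = 0" | "n = Suc 0" | k where "n = Suc (Suc k)"
    by (metis not0_implies_Suc)
  then show ?thesis
  proof cases
    case (3 k)
    define A B where "A = heat_poly k (-1) y" and "B = heat_poly (Suc k) (-1) y"
    have H: "heat_poly n (-1) y = y * B - 2 * (real k + 1) * A" "heat_poly (n - 1) (-1) y = B"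
      "heat_poly (n - 2) (-1) y = A" "real n = real k + 2" "real (n - 1) = real k + 1"
      unfolding 3 A_def B_def by (simp_all add: algebra_simps)
    show ?thesis unfolding H by (simp add: field_simps)
  qed auto
qed

lemma heat_poly_bound:
  assumes "c > 0"
  shows "\<exists>K\<ge>0. \<forall>t x. \<bar>t\<bar> <= 1 --> \<bar>heat_poly n t x\<bar> <= K * exp (c * x\<^sup>2)"
  using assms
proof (induction n arbitrary: c rule: less_induct)
  case (less n)
  obtain K1 where K1: "K1 >= 0" "!!y. \<bar>y\<bar> <= K1 * exp (c / 2 * y\<^sup>2)"
    using exp_growth_ident[of "c/2"] less.prems unfolding exp_growth_def by auto
  consider "n = 0" | "n = 1" | m where "n = Suc (Suc m)"
    by (metis One_nat_def not0_implies_Suc)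
  then show ?case
  proof cases
    case 1
    then show ?thesis using less.prems by (intro exI[of _ 1]) auto
  next
    case 2
    then show ?thesis using exp_growth_ident[OF less.prems] unfolding exp_growth_def by auto
  next
    case (3 m)
    obtain K2 where K2: "K2 >= 0" "!!t x. \<bar>t\<bar> <= 1 ==> \<bar>heat_poly (Suc m) t x\<bar> <= K2 * exp (c / 2 * x\<^sup>2)"
      using less.IH[of "Suc m" "c / 2"] 3 less.prems by auto
    obtain K3 where K3: "K3 >= 0" "!!t x. \<bar>t\<bar> <= 1 ==> \<bar>heat_poly m t x\<bar> <= K3 * exp (c * x\<^sup>2)"
      using less.IH[of m c] 3 less.prems by auto
    show ?thesis
    proof (intro exI[of _ "K1 * K2 + 2 * (real m + 1) * K3"] conjI allI impI)
      fix t x :: real assume t: "\<bar>t\<bar> <= 1"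
      have "\<bar>x * heat_poly (Suc m) t x\<bar> <= (K1 * exp (c / 2 * x\<^sup>2)) * (K2 * exp (c / 2 * x\<^sup>2))"
        unfolding abs_mult using K1 K2(2)[OF t, of x] by (intro mult_mono) auto
      also have "\<dots> = K1 * K2 * exp (c * x\<^sup>2)" by (simp add: mult_ac flip: exp_add)
      finally have 1: "\<bar>x * heat_poly (Suc m) t x\<bar> <= K1 * K2 * exp (c * x\<^sup>2)" .
      have "\<bar>2 * t * (real m + 1) * heat_poly m t x\<bar> = (2 * (real m + 1)) * (\<bar>t\<bar> * \<bar>heat_poly m t x\<bar>)"
        by (simp add: abs_mult)
      also have "\<dots> <= (2 * (real m + 1)) * (1 * (K3 * exp (c * x\<^sup>2)))"
        using K3(2)[OF t, of x] t by (intro mult_left_mono mult_mono) auto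
      finally show "\<bar>heat_poly n t x\<bar> <= (K1 * K2 + 2 * (real m + 1) * K3) * exp (c * x\<^sup>2)"
        using 1 unfolding 3 heat_poly.simps by (simp add: distrib_right)
    qed (use K1 K2 K3 in auto)
  qed
qed

lemma heat_poly_continuous [continuous_intros]:
  assumes "continuous_on S f" "continuous_on S g"
  shows "continuous_on S (%x. heat_poly n (f x) (g x))"
proof (induction n rule: less_induct)
  case (less n)
  consider "n = 0" | "n = Suc 0" | m where "n = Suc (Suc m)"
    by (metis not0_implies_Suc)
  then show ?case
    using assms less by cases (auto intro!: continuous_intros)
qed

lemma heat_poly_growth:
  assumes "c > 0" shows "exp_growth c (heat_poly n (-1))"
proof -
  obtain K where "!!x. \<bar>heat_poly n (-1) x\<bar> <= K * exp (c * x\<^sup>2)"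
    using heat_poly_bound[OF assms, of n] by (metis abs_1 abs_minus_cancel order_refl)
  then show ?thesis
    using heat_poly_continuous[OF continuous_on_const continuous_on_id, of UNIV n "-1"]
    by (intro exp_growthI borel_measurable_continuous_onI)
qed

text \<open>Powers of the variable times heat polynomials stay in the span of the heat polynomials, by
  the three-term recurrence.\<close>

lemma gauss_moments_0:
  assumes f: "exp_growth (1/8) f"
    and 0: "!!j. (\<integral>y. f y * heat_poly j (-1) y \<partial>gauss) = 0"
  shows "(\<integral>y. f y * y ^ m \<partial>gauss) = 0"
proof -
  have i: "integrable gauss (%y. f y * (y ^ m * heat_poly j (-1) y))" for m j
    using exp_growth_mult[OF f exp_growth_mult[OF exp_growth_power[of "1/32" m] heat_poly_growth[of "1/32" j]]]
    by (rule integrable_gauss_growth) auto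
  have "(\<integral>y. f y * (y ^ m * heat_poly j (-1) y) \<partial>gauss) = 0" for j
  proof (induction m arbitrary: j)
    case (Suc m)
    have e: "y * heat_poly j (-1) y = heat_poly (Suc j) (-1) y + 2 * real j * heat_poly (j - 1) (-1) y" for y
      by (simp add: heat_poly_Suc)
    have "f y * (y ^ Suc m * heat_poly j (-1) y)
        = f y * (y ^ m * heat_poly (Suc j) (-1) y) + 2 * real j * (f y * (y ^ m * heat_poly (j - 1) (-1) y))" for y
    proof -
      have "f y * (y ^ Suc m * heat_poly j (-1) y) = f y * y ^ m * (y * heat_poly j (-1) y)"
        by simp
      then show ?thesis unfolding e by (simp add: algebra_simps)
    qed
    then show ?case using Suc i by simp
  qed (use 0 in simp)
  from this[of 0] show ?thesis by simp
qed

text \<open>Vanishing moments annihilate the Taylor polynomials of the Fourier transform of f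
  against the weight; Gaussian decay dominates the partial sums of the exponential series, so the
  transform itself vanishes. Uniqueness of characteristic functions then gives f = 0.\<close>

lemma gauss_poly_complete:
  assumes f: "exp_growth (1/8) f" and c: "continuous_on UNIV f"
    and 0: "!!m. (\<integral>y. f y * y ^ m \<partial>gauss) = 0"
  shows "f y = 0"
proof -
  have fm [measurable]: "f \<in> borel_measurable borel" using f by (rule exp_growth_measurable)
  have int: "integrable gauss f" using f by (rule integrable_gauss_growth) simp
  obtain K where K: "K >= 0" "!!y. \<bar>f y\<bar> <= K * exp (1/8 * y\<^sup>2)"
    using f unfolding exp_growth_def by auto
  have char0: "(\<integral>y. of_real (f y) * exp (\<i> * of_real (\<xi> * y)) \<partial>gauss) = (0::complex)" for \<xi> :: real
  proof -
    let ?S = "%n y. of_real (f y) * (\<Sum>k<n. (\<i> * of_real (\<xi> * y)) ^ k /\<^sub>R fact k)"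
    \<comment> \<open>Young's inequality trades exp |\<xi> * y| for a Gaussian with exponent 1/64;
      together with the 1/8 of f this makes 9/64, still below 1/4.\<close>
    have bound_w: "exp (\<bar>\<xi> * y\<bar>) <= exp (16 * \<xi>\<^sup>2) * exp (1/64 * y\<^sup>2)" for y
    proof -
      have "0 <= (4 * \<bar>\<xi>\<bar> - \<bar>y\<bar> / 8)\<^sup>2" by simp
      then have "\<bar>\<xi>\<bar> * \<bar>y\<bar> <= 16 * \<xi>\<^sup>2 + 1/64 * y\<^sup>2"
        by (simp add: power2_diff power_mult_distrib power_divide)
      then show ?thesis by (simp add: abs_mult flip: exp_add)
    qed
    have "(%n. integral\<^sup>L gauss (?S n)) \<longlonglongrightarrow> (\<integral>y. of_real (f y) * exp (\<i> * of_real (\<xi> * y)) \<partial>gauss)"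
    proof (rule integral_dominated_convergence[where w = "%y. K * exp (16 * \<xi>\<^sup>2) * exp (9/64 * y\<^sup>2)"])
      show "AE y in gauss. (%n. ?S n y) \<longlonglongrightarrow> of_real (f y) * exp (\<i> * of_real (\<xi> * y))"
        by (intro always_eventually allI tendsto_mult tendsto_const exp_converges[unfolded sums_def])
      show "integrable gauss (%y. K * exp (16 * \<xi>\<^sup>2) * exp (9/64 * y\<^sup>2))"
        by (intro integrable_mult_right integrable_gauss_exp) auto
      show "AE y in gauss. norm (?S n y) <= K * exp (16 * \<xi>\<^sup>2) * exp (9/64 * y\<^sup>2)" for n
      proof (intro always_eventually allI)
        fix y
        have "norm (\<Sum>k<n. (\<i> * of_real (\<xi> * y)) ^ k /\<^sub>R fact k :: complex) <= (\<Sum>k<n. \<bar>\<xi> * y\<bar> ^ k /\<^sub>R fact k)"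
          by (rule order_trans[OF norm_sum]) (simp add: norm_mult norm_power abs_mult divide_inverse)
        also have "\<dots> <= (\<Sum>k. \<bar>\<xi> * y\<bar> ^ k /\<^sub>R fact k)"
          using summable_exp_generic[of "\<bar>\<xi> * y\<bar>"] by (intro sum_le_suminf) auto
        also have "\<dots> = exp \<bar>\<xi> * y\<bar>" by (simp add: exp_def)
        finally have "norm (?S n y) <= \<bar>f y\<bar> * exp \<bar>\<xi> * y\<bar>"
          by (simp add: norm_mult mult_left_mono)
        also have "\<dots> <= (K * exp (1/8 * y\<^sup>2)) * (exp (16 * \<xi>\<^sup>2) * exp (1/64 * y\<^sup>2))"
          using K bound_w[of y] by (intro mult_mono) auto
        also have "\<dots> = K * exp (16 * \<xi>\<^sup>2) * (exp (1/8 * y\<^sup>2) * exp (1/64 * y\<^sup>2))" by (simp add: mult_ac)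
        also have "exp (1/8 * y\<^sup>2) * exp (1/64 * y\<^sup>2) = exp (9/64 * y\<^sup>2)" by (simp flip: exp_add)
        finally show "norm (?S n y) <= K * exp (16 * \<xi>\<^sup>2) * exp (9/64 * y\<^sup>2)" .
      qed
    qed simp_all
    moreover have "integral\<^sup>L gauss (?S n) = 0" for n
    proof -
      have i: "integrable gauss (%y. f y * y ^ k)" for k
        using exp_growth_mult[OF f exp_growth_power[of "1/32" k]] by (rule integrable_gauss_growth) auto
      have "?S n y = (\<Sum>k<n. ((\<i> * of_real \<xi>) ^ k /\<^sub>R fact k) * of_real (f y * y ^ k))" for y
        by (simp add: sum_distrib_left power_mult_distrib mult_ac scaleR_conv_of_real)
      then have "integral\<^sup>L gauss (?S n) = (\<Sum>k<n. ((\<i> * of_real \<xi>) ^ k /\<^sub>R fact k) * (\<integral>y. of_real (f y * y ^ k) \<partial>gauss))"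
        using i by (simp only: integral_mult_right_zero Bochner_Integration.integral_sum integrable_mult_right integrable_of_real)
      also have "\<dots> = 0" using 0 i by (simp only: integral_complex_of_real) simp
      finally show ?thesis .
    qed
    ultimately show ?thesis by (simp add: LIMSEQ_const_iff)
  qed
  \<comment> \<open>Levy's uniqueness theorem concerns probability measures, so f is split into its
    positive and negative part. The zeroth moment gives both the same mass m, the common
    normalisation.\<close>
  define fp where "fp y = max (f y) 0" for y
  define fn where "fn y = max (- f y) 0" for y
  have [measurable]: "fp \<in> borel_measurable borel" "fn \<in> borel_measurable borel"
    by (auto simp: fp_def[abs_def] fn_def[abs_def])
  have intp: "integrable gauss fp" "integrable gauss fn"
    using int by (auto simp: fp_def[abs_def] fn_def[abs_def])
  have dec: "f y = fp y - fn y" "fp y >= 0" "fn y >= 0" "fp y = 0 \<or> fn y = 0" for y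
    by (auto simp: fp_def fn_def)
  define m where "m = (\<integral>y. fp y \<partial>gauss)"
  have m': "m = (\<integral>y. fn y \<partial>gauss)"
    using 0[of 0] intp unfolding m_def by (simp add: dec(1))
  show ?thesis
  proof (cases "m = 0")
    case True
    have cont: "continuous_on UNIV fp" "continuous_on UNIV fn"
      unfolding fp_def[abs_def] fn_def[abs_def] using c by (auto intro!: continuous_intros)
    have "fp y = 0" "fn y = 0"
      using gauss_integral_eq_0_iff[OF cont(1) dec(2) intp(1)] gauss_integral_eq_0_iff[OF cont(2) dec(3) intp(2)]
        True m_def m' by auto
    then show ?thesis using dec by simp
  next
    case False
    then have m: "m > 0" using dec(2) by (simp add: m_def less_le)
    define Mp where "Mp = density gauss (%y. ennreal (fp y / m))"
    define Mn where "Mn = density gauss (%y. ennreal (fn y / m))"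
    have dist: "real_distribution (density gauss (%y. ennreal (h y / m)))"
      if [measurable]: "h \<in> borel_measurable borel" and "integrable gauss h" "!!y. h y >= 0" "(\<integral>y. h y \<partial>gauss) = m" for h
    proof -
      have "emeasure (density gauss (%y. ennreal (h y / m))) UNIV = (\<integral>\<^sup>+y. ennreal (h y / m) \<partial>gauss)"
        by (subst emeasure_density) auto
      also have "\<dots> = ennreal (\<integral>y. h y / m \<partial>gauss)"
        using that m by (intro nn_integral_eq_integral) auto
      also have "\<dots> = 1" using that m by simp
      finally have "prob_space (density gauss (%y. ennreal (h y / m)))"
        by (intro prob_spaceI) simp
      then show ?thesis by (simp add: real_distribution_def real_distribution_axioms_def)
    qed
    have charh: "char (density gauss (%y. ennreal (h y / m))) \<xi> = (\<integral>y. of_real (h y) * exp (\<i> * of_real (\<xi> * y)) \<partial>gauss) / m"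
      if [measurable]: "h \<in> borel_measurable borel" and "!!y. h y >= 0" for h \<xi>
    proof -
      have "char (density gauss (%y. ennreal (h y / m))) \<xi> = (\<integral>y. (h y / m) *\<^sub>R exp (\<i> * of_real (\<xi> * y)) \<partial>gauss)"
        unfolding char_def using that m by (subst integral_density) auto
      then show ?thesis by (simp add: scaleR_conv_of_real)
    qed
    have ic: "integrable gauss (%y. of_real (h y) * exp (\<i> * of_real (\<xi> * y)) :: complex)"
      if [measurable]: "h \<in> borel_measurable borel" and "integrable gauss h" for h \<xi>
      using that by (intro Bochner_Integration.integrable_bound[OF that(2)]) (auto simp: norm_mult)
    have "char Mp = char Mn"
    proof
      fix \<xi>
      have "(\<integral>y. of_real (fp y) * exp (\<i> * of_real (\<xi> * y)) \<partial>gauss) - (\<integral>y. of_real (fn y) * exp (\<i> * of_real (\<xi> * y)) \<partial>gauss)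
        = (\<integral>y. of_real (f y) * exp (\<i> * of_real (\<xi> * y)) \<partial>gauss)"
        using ic intp by (subst Bochner_Integration.integral_diff[symmetric]) (simp_all add: dec(1) left_diff_distrib)
      then show "char Mp \<xi> = char Mn \<xi>"
        unfolding Mp_def Mn_def char0 by (subst (1 2) charh) (use dec(2,3) in auto)
    qed
    then have "Mp = Mn"
      unfolding Mp_def Mn_def
      by (intro Levy_uniqueness dist) (use intp dec(2,3) m' m_def in \<open>simp_all\<close>)
    moreover have "sigma_finite_measure gauss"
    proof -
      have "emeasure gauss UNIV = (\<integral>\<^sup>+y. ennreal (exp (0 * y\<^sup>2)) \<partial>gauss)" by simp
      also have "\<dots> < \<infinity>" using integrable_gauss_exp[of 0] unfolding integrable_iff_bounded by simp
      finally have "finite_measure gauss" by (intro finite_measureI) auto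
      then show ?thesis by (simp add: finite_measure.axioms)
    qed
    \<comment> \<open>Equal measures have almost everywhere equal densities; as one of
      \<open>fp y\<close> and \<open>fn y\<close> is always 0, both vanish, against m > 0.\<close>
    ultimately have "AE y in gauss. ennreal (fp y / m) = ennreal (fn y / m)"
      unfolding Mp_def Mn_def by (subst (asm) sigma_finite_measure.density_unique_iff) simp_all
    then have "AE y in gauss. fp y = 0"
    proof eventually_elim
      case (elim y)
      then show ?case using dec(2-4)[of y] m by auto
    qed
    then have "m = 0" using intp unfolding m_def by (subst integral_cong_AE[where g = "%_. 0"]) auto
    then show ?thesis using False by simp
  qed
qed

section \<open>Spectral identities for the Ornstein-Uhlenbeck operator\<close>

lemma gauss_by_parts_OU:
  assumes f: "!!y. (f has_real_derivative f' y) (at y)" "!!y. (f' has_real_derivative f'' y) (at y)"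
      "continuous_on UNIV f''"
    and u: "!!y. (u has_real_derivative u' y) (at y)" "continuous_on UNIV u'"
    and g: "exp_growth (1/32) f'" "exp_growth (1/32) f''" "exp_growth (1/32) u" "exp_growth (1/32) u'"
  shows "(\<integral>y. u y * (f'' y - y / 2 * f' y) \<partial>gauss) = - (\<integral>y. u' y * f' y \<partial>gauss)"
proof -
  have cu: "continuous_on UNIV u" and cf: "continuous_on UNIV f'"
    using u(1) f(2) by (auto intro!: continuous_at_imp_continuous_on DERIV_isCont)
  note m = exp_growth_mult[where a = "1/32" and b = "1/32"]
  have gs: "exp_growth (1/16) (%y. u y * f' y)" "exp_growth (1/16) (%y. u' y * f' y)"
    "exp_growth (1/16) (%y. u y * f'' y)"
    using m[OF g(3) g(1)] m[OF g(4) g(1)] m[OF g(3) g(2)] by simp_all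
  have gL: "exp_growth (1/8) (%y. u y * (f'' y - y / 2 * f' y))"
  proof -
    have "exp_growth (1/8) (%y. u y * f'' y - 1 / 2 * (y * (u y * f' y)))"
      using exp_growth_mult[OF exp_growth_ident[of "1/16"] gs(1)] exp_growth_mono[OF gs(3), of "1/8"]
      by (intro exp_growth_diff exp_growth_cmult) auto
    then show ?thesis by (simp add: algebra_simps)
  qed
  have "(\<integral>y. (u' y * f' y + u y * f'' y) - y / 2 * (u y * f' y) \<partial>gauss) = 0"
  proof (rule gauss_by_parts)
    show "((%y. u y * f' y) has_real_derivative u' y * f' y + u y * f'' y) (at y)" for y
      using DERIV_mult[OF u(1)[of y] f(2)[of y]] by (simp add: mult.commute add.commute)
    show "continuous_on UNIV (%y. u' y * f' y + u y * f'' y)"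
      using cu u(2) cf f(3) by (intro continuous_intros) auto
    show "exp_growth (1/16) (%y. u' y * f' y + u y * f'' y)"
      using gs by (intro exp_growth_add)
  qed (use gs in auto)
  then have "(\<integral>y. u' y * f' y + u y * (f'' y - y / 2 * f' y) \<partial>gauss) = 0"
    by (simp add: algebra_simps)
  then show ?thesis
    using integrable_gauss_growth[OF gs(2)] integrable_gauss_growth[OF gL]
    by (subst (asm) Bochner_Integration.integral_add) auto
qed

lemma heat_poly_cont: "continuous_on UNIV (heat_poly n t)"
  using heat_poly_continuous[OF continuous_on_const continuous_on_id, of UNIV n t] by simp

lemma heat_poly_deriv_xx:
  "((%y. real n * heat_poly (n - 1) t y) has_real_derivative real n * real (n - 1) * heat_poly (n - 2) t y) (at y)"
  using DERIV_cmult[OF heat_poly_deriv_x[of "n - 1" t y], of "real n"] by (simp add: numeral_2_eq_2 mult.assoc)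

text \<open>Two integrations by parts move the operator onto the polynomial, which is an
  eigenfunction.\<close>

lemma gauss_OU_heat_poly:
  assumes f: "!!y. (f has_real_derivative f' y) (at y)" "!!y. (f' has_real_derivative f'' y) (at y)"
      "continuous_on UNIV f''"
    and g: "exp_growth (1/32) f" "exp_growth (1/32) f'" "exp_growth (1/32) f''"
  shows "(\<integral>y. heat_poly j (-1) y * (f'' y - y / 2 * f' y) \<partial>gauss)
    = - (real j / 2) * (\<integral>y. f y * heat_poly j (-1) y \<partial>gauss)"
proof -
  let ?h = "heat_poly j (-1)" and ?h' = "%y. real j * heat_poly (j - 1) (-1) y"
    and ?h'' = "%y. real j * real (j - 1) * heat_poly (j - 2) (-1) y"
  have c: "continuous_on UNIV ?h'" "continuous_on UNIV ?h''" "continuous_on UNIV f'"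
    using f(2) by (auto intro!: continuous_on_mult continuous_on_const heat_poly_cont)
      (auto intro!: continuous_at_imp_continuous_on DERIV_isCont)
  have gh: "exp_growth (1/32) ?h" "exp_growth (1/32) ?h'" "exp_growth (1/32) ?h''"
    by (intro heat_poly_growth exp_growth_cmult; simp)+
  have "(\<integral>y. ?h y * (f'' y - y / 2 * f' y) \<partial>gauss) = - (\<integral>y. ?h' y * f' y \<partial>gauss)"
    by (rule gauss_by_parts_OU[OF f heat_poly_deriv_x c(1) g(2,3) gh(1,2)])
  also have "\<dots> = - (\<integral>y. f' y * ?h' y \<partial>gauss)" by (simp add: mult.commute)
  also have "\<dots> = (\<integral>y. f y * (?h'' y - y / 2 * ?h' y) \<partial>gauss)"
    using gauss_by_parts_OU[OF heat_poly_deriv_x heat_poly_deriv_xx c(2) f(1) c(3) gh(2,3) g(1,2)] by simp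
  also have "\<dots> = (\<integral>y. - (real j / 2) * (f y * ?h y) \<partial>gauss)"
    unfolding heat_poly_eigen by (simp add: mult_ac)
  finally show ?thesis by simp
qed

lemma gauss_heat_poly_orthogonal:
  assumes "j ~= k"
  shows "(\<integral>y. heat_poly k (-1) y * heat_poly j (-1) y \<partial>gauss) = 0"
proof -
  have "(\<integral>y. heat_poly j (-1) y * (real k * real (k - 1) * heat_poly (k - 2) (-1) y
      - y / 2 * (real k * heat_poly (k - 1) (-1) y)) \<partial>gauss)
    = - (real j / 2) * (\<integral>y. heat_poly k (-1) y * heat_poly j (-1) y \<partial>gauss)"
    using heat_poly_cont
    by (intro gauss_OU_heat_poly heat_poly_deriv_x heat_poly_deriv_xx continuous_intros
        exp_growth_cmult heat_poly_growth) auto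
  then have "- (real k / 2) * (\<integral>y. heat_poly k (-1) y * heat_poly j (-1) y \<partial>gauss)
    = - (real j / 2) * (\<integral>y. heat_poly k (-1) y * heat_poly j (-1) y \<partial>gauss)"
    unfolding heat_poly_eigen by (simp add: mult_ac)
  then show ?thesis using assms by simp
qed

section \<open>Pointwise, moment and Hoelder bounds from the weighted energy\<close>

lemma gauss_interval_le:
  fixes F :: "real => real"
  assumes c: "continuous_on UNIV F" and "!!y. F y >= 0" and i: "integrable gauss F"
  shows "integral {a..b} (%y. F y * exp (- y\<^sup>2 / 4)) <= (\<integral>y. F y \<partial>gauss)"
proof -
  have m: "F \<in> borel_measurable borel" by (rule borel_measurable_continuous_onI[OF c])
  have i': "integrable lborel (%y. F y * exp (- y\<^sup>2 / 4))"
    using i by (simp add: integrable_gauss_iff[OF m] mult.commute)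
  have "set_integrable lborel {a..b} (%y. F y * exp (- y\<^sup>2 / 4))"
    by (intro borel_integrable_atLeastAtMost' continuous_intros continuous_on_subset[OF c]) auto
  then have "integral {a..b} (%y. F y * exp (- y\<^sup>2 / 4)) = (LBINT y:{a..b}. F y * exp (- y\<^sup>2 / 4))"
    by (rule set_borel_integral_eq_integral(2)[symmetric])
  also have "\<dots> <= (\<integral>y. F y * exp (- y\<^sup>2 / 4) \<partial>lborel)"
    unfolding set_lebesgue_integral_def using i' assms(2) m
    by (intro integral_mono integrable_mult_indicator) (auto simp: indicator_def)
  also have "\<dots> = (\<integral>y. F y \<partial>gauss)" by (simp add: integral_gauss[OF m] mult.commute)
  finally show ?thesis .
qed

text \<open>Let N and D be the two integrals. For y >= 0 the drift term in the derivative of the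
  weighted square has the good sign, so the square grows by at most N + D from 0 to y. At some point
  of [0, 1] it is at most N, and from there back to 0 it changes by at most 2 (N + D); the sum is
  below 4 (N + D). Negative y follow by reflection.\<close>

lemma gauss_pointwise_bound:
  assumes f: "!!y. (f has_real_derivative f' y) (at y)" "continuous_on UNIV f'"
    and i: "integrable gauss (%y. (f y)\<^sup>2)" "integrable gauss (%y. (f' y)\<^sup>2)"
  shows "(f y)\<^sup>2 * exp (- y\<^sup>2 / 4) <= 4 * ((\<integral>y. (f y)\<^sup>2 \<partial>gauss) + (\<integral>y. (f' y)\<^sup>2 \<partial>gauss))"
proof -
  have half: "(f y)\<^sup>2 * exp (- y\<^sup>2 / 4) <= 4 * ((\<integral>y. (f y)\<^sup>2 \<partial>gauss) + (\<integral>y. (f' y)\<^sup>2 \<partial>gauss))"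
    if f: "!!y. (f has_real_derivative f' y) (at y)" "continuous_on UNIV f'"
    and i: "integrable gauss (%y. (f y)\<^sup>2)" "integrable gauss (%y. (f' y)\<^sup>2)" and y: "y >= 0" for f f' y
  proof -
    define N D where "N = (\<integral>y. (f y)\<^sup>2 \<partial>gauss)" and "D = (\<integral>y. (f' y)\<^sup>2 \<partial>gauss)"
    have ND: "N >= 0" "D >= 0" by (simp_all add: N_def D_def)
    have cf: "continuous_on UNIV f" using f(1) by (auto intro!: continuous_at_imp_continuous_on DERIV_isCont)
    define g where "g y = exp (- y\<^sup>2 / 4)" for y :: real
    have g: "g y > 0" for y by (simp add: g_def)
    define \<phi> where "\<phi> y = (f y)\<^sup>2 * g y" for y
    define \<phi>' where "\<phi>' y = (2 * f y * f' y - y / 2 * (f y)\<^sup>2) * g y" for y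
    have d: "(\<phi> has_vector_derivative \<phi>' y) (at y within S)" for y S
      unfolding \<phi>_def[abs_def] \<phi>'_def g_def has_real_derivative_iff_has_vector_derivative[symmetric]
      by (rule derivative_eq_intros f(1)[THEN has_field_derivative_at_within] refl | simp)+ (simp add: algebra_simps power2_eq_square)
    have cont: "continuous_on S \<phi>" "continuous_on S \<phi>'" "continuous_on S g" for S
      unfolding \<phi>_def[abs_def] \<phi>'_def[abs_def] g_def[abs_def]
      using continuous_on_subset[OF cf, of S] continuous_on_subset[OF f(2), of S]
      by (auto intro!: continuous_intros)
    have ftc: "integral {a..b} \<phi>' = \<phi> b - \<phi> a" if "a <= b" for a b
      using fundamental_theorem_of_calculus[OF that d] by (simp add: integral_unique)
    have c2: "continuous_on S (%y. (f y)\<^sup>2 + (f' y)\<^sup>2)" for S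
      using continuous_on_subset[OF cf, of S] continuous_on_subset[OF f(2), of S] by (auto intro!: continuous_intros)
    have I: "integral {a..b} (%y. ((f y)\<^sup>2 + (f' y)\<^sup>2) * g y) <= N + D" for a b
      using gauss_interval_le[OF c2, of a b] i by (simp add: g_def N_def D_def)
    have I1: "integral {a..b} \<phi> <= N" for a b
      using gauss_interval_le[of "%y. (f y)\<^sup>2" a b] i cf by (simp add: g_def N_def \<phi>_def[abs_def] continuous_on_power)
    have up: "\<phi> b <= \<phi> a + (N + D)" if "0 <= a" "a <= b" for a b
    proof -
      have "integral {a..b} \<phi>' <= integral {a..b} (%y. ((f y)\<^sup>2 + (f' y)\<^sup>2) * g y)"
      proof (intro integral_le integrable_continuous_real cont continuous_on_mult c2)
        fix y assume "y \<in> {a..b}"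
        then have "0 <= y / 2 * (f y)\<^sup>2" using that by auto
        then have "2 * f y * f' y - y / 2 * (f y)\<^sup>2 <= (f y)\<^sup>2 + (f' y)\<^sup>2"
          using sum_squares_bound[of "f y" "f' y"] by linarith
        then show "\<phi>' y <= ((f y)\<^sup>2 + (f' y)\<^sup>2) * g y"
          unfolding \<phi>'_def using g[of y] by (intro mult_right_mono) auto
      qed
      then show ?thesis using I[of a b] ftc[OF that(2)] by linarith
    qed
    have "\<exists>x. 0 <= x & x <= 1 & \<phi> x <= N"
    proof (rule ccontr)
      assume *: "\<not> (\<exists>x. 0 <= x & x <= 1 & \<phi> x <= N)"
      then have gt: "\<phi> x > N" if "x \<in> {0..1}" for x using that by force
      obtain m where m: "m \<in> {0..1}" "!!x. x \<in> {0..1} ==> \<phi> m <= \<phi> x"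
        using continuous_attains_inf[of "{0..1::real}" \<phi>] cont by auto
      have "integral {0..1::real} (%_. \<phi> m) <= integral {0..1::real} \<phi>"
        by (intro integral_le integrable_continuous_real cont continuous_on_const) (use m in auto)
      then show False using I1[of 0 1] gt[OF m(1)] by simp
    qed
    then obtain x where x: "0 <= x" "x <= 1" "\<phi> x <= N" by blast
    have "integral {0..x} (%y. - \<phi>' y) <= integral {0..x} (%y. 2 * (((f y)\<^sup>2 + (f' y)\<^sup>2) * g y))"
    proof (intro integral_le integrable_continuous_real cont continuous_on_mult c2 continuous_on_minus continuous_on_const)
      fix y assume "y \<in> {0..x}"
      then have "y / 2 * (f y)\<^sup>2 <= 1 * (f y)\<^sup>2" using x by (intro mult_right_mono) auto
      moreover have "- (2 * f y * f' y) <= (f y)\<^sup>2 + (f' y)\<^sup>2"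
        using zero_le_power2[of "f y + f' y"] unfolding power2_sum by linarith
      moreover have "- (2 * f y * f' y - y / 2 * (f y)\<^sup>2) = - (2 * f y * f' y) + y / 2 * (f y)\<^sup>2" by simp
      moreover have "2 * ((f y)\<^sup>2 + (f' y)\<^sup>2) = ((f y)\<^sup>2 + (f' y)\<^sup>2) + 1 * (f y)\<^sup>2 + (f' y)\<^sup>2" by simp
      ultimately have "- (2 * f y * f' y - y / 2 * (f y)\<^sup>2) <= 2 * ((f y)\<^sup>2 + (f' y)\<^sup>2)"
        using zero_le_power2[of "f' y"] by linarith
      then have "- (2 * f y * f' y - y / 2 * (f y)\<^sup>2) * g y <= 2 * ((f y)\<^sup>2 + (f' y)\<^sup>2) * g y"
        using g[of y] by (intro mult_right_mono) auto
      then show "- \<phi>' y <= 2 * (((f y)\<^sup>2 + (f' y)\<^sup>2) * g y)"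
        unfolding \<phi>'_def by (simp add: algebra_simps)
    qed
    then have "\<phi> 0 <= \<phi> x + 2 * (N + D)" using I[of 0 x] ftc[OF x(1)] by simp
    with up[of 0 y] y x(3) have "\<phi> y <= 4 * (N + D)" using ND by auto
    then show ?thesis by (simp add: \<phi>_def g_def N_def D_def)
  qed
  show ?thesis
  proof (cases "y >= 0")
    case False
    have refl: "integrable gauss (%y. F (- y)) & (\<integral>y. F (- y) \<partial>gauss) = (\<integral>y. F y \<partial>gauss)"
      if "integrable gauss F" and [measurable]: "F \<in> borel_measurable borel" for F :: "real => real"
      using that(1) lborel_integrable_real_affine[of "%y. exp (- y\<^sup>2 / 4) * F y" "-1" 0]
        lborel_integral_real_affine[of "-1" "%y. exp (- y\<^sup>2 / 4) * F y" 0]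
      by (simp add: integrable_gauss_iff integral_gauss)
    have "((%y. f (- y)) has_real_derivative - f' (- y)) (at y)" for y
      using DERIV_chain2[OF f(1) DERIV_minus[OF DERIV_ident]] by simp
    moreover have "continuous_on UNIV (%y. - f' (- y))"
      by (intro continuous_intros continuous_on_compose2[OF f(2)]) auto
    moreover have m: "(%y. (f y)\<^sup>2) \<in> borel_measurable borel" "(%y. (f' y)\<^sup>2) \<in> borel_measurable borel"
      using f(2) DERIV_isCont[OF f(1)]
      by (auto intro!: borel_measurable_continuous_onI borel_measurable_power continuous_at_imp_continuous_on)
    ultimately show ?thesis
      using half[of "%y. f (- y)" "%y. - f' (- y)" "- y"] refl[OF i(1) m(1)] refl[OF i(2) m(2)] False by simp
  qed (use half f i in auto)
qed

text \<open>Prevents mass from escaping to infinity in the compactness argument. Integrating the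
  derivative of y * (f y)^2 gives half of the moment on one side, and Young's inequality returns
  only a quarter of it on the other.\<close>

lemma gauss_second_moment:
  assumes f: "!!y. (f has_real_derivative f' y) (at y)" "continuous_on UNIV f'"
    and g: "exp_growth (1/64) f" "exp_growth (1/64) f'"
  shows "(\<integral>y. y\<^sup>2 * (f y)\<^sup>2 \<partial>gauss) <= 4 * (\<integral>y. (f y)\<^sup>2 \<partial>gauss) + 16 * (\<integral>y. (f' y)\<^sup>2 \<partial>gauss)"
proof -
  have cf: "continuous_on UNIV f" using f(1) by (auto intro!: continuous_at_imp_continuous_on DERIV_isCont)
  note gi = exp_growth_ident[of "1/64"]
  have gf: "exp_growth (1/32) (%y. (f y)\<^sup>2)" "exp_growth (1/32) (%y. (f' y)\<^sup>2)" "exp_growth (1/32) (%y. f y * f' y)"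
    using exp_growth_mult[OF g(1) g(1)] exp_growth_mult[OF g(2) g(2)] exp_growth_mult[OF g(1) g(2)]
    by (simp_all add: power2_eq_square)
  have g1: "exp_growth (1/16) (%y. y * (f y)\<^sup>2)" "exp_growth (1/16) (%y. y * (f y * f' y))"
    using exp_growth_mono[OF exp_growth_mult[OF gi gf(1)]] exp_growth_mono[OF exp_growth_mult[OF gi gf(3)]] by auto
  have g2: "exp_growth (1/8) (%y. y\<^sup>2 * (f y)\<^sup>2)"
    using exp_growth_mono[OF exp_growth_mult[OF gi g1(1)], of "1/8"] by (simp add: power2_eq_square mult_ac)
  have g3: "exp_growth (1/16) (%y. (f y)\<^sup>2 + 2 * (y * (f y * f' y)))"
    using g1 exp_growth_mono[OF gf(1), of "1/16"] by (intro exp_growth_add exp_growth_cmult) auto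
  have i: "integrable gauss (%y. (f y)\<^sup>2)" "integrable gauss (%y. (f' y)\<^sup>2)" "integrable gauss (%y. y\<^sup>2 * (f y)\<^sup>2)"
    "integrable gauss (%y. (f y)\<^sup>2 + 2 * (y * (f y * f' y)))"
    using integrable_gauss_growth[OF gf(1)] integrable_gauss_growth[OF gf(2)] integrable_gauss_growth[OF g2]
      integrable_gauss_growth[OF g3] by auto
  have "(\<integral>y. ((f y)\<^sup>2 + 2 * (y * (f y * f' y))) - y / 2 * (y * (f y)\<^sup>2) \<partial>gauss) = 0"
  proof (rule gauss_by_parts)
    show "((%y. y * (f y)\<^sup>2) has_real_derivative (f y)\<^sup>2 + 2 * (y * (f y * f' y))) (at y)" for y
      by (rule derivative_eq_intros f(1) refl | simp)+
    show "continuous_on UNIV (%y. (f y)\<^sup>2 + 2 * (y * (f y * f' y)))"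
      using cf f(2) by (intro continuous_intros)
  qed (use g1 g3 in auto)
  then have "(\<integral>y. ((f y)\<^sup>2 + 2 * (y * (f y * f' y))) - 1 / 2 * (y\<^sup>2 * (f y)\<^sup>2) \<partial>gauss) = 0"
    by (simp add: power2_eq_square mult_ac)
  then have "1 / 2 * (\<integral>y. y\<^sup>2 * (f y)\<^sup>2 \<partial>gauss) = (\<integral>y. (f y)\<^sup>2 + 2 * (y * (f y * f' y)) \<partial>gauss)"
    using i by (subst (asm) Bochner_Integration.integral_diff) auto
  also have "\<dots> <= (\<integral>y. (f y)\<^sup>2 + (1 / 4 * (y\<^sup>2 * (f y)\<^sup>2) + 4 * (f' y)\<^sup>2) \<partial>gauss)"
  proof (rule integral_mono)
    fix y
    have "0 <= (y * f y / 2 - 2 * f' y)\<^sup>2" by simp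
    then show "(f y)\<^sup>2 + 2 * (y * (f y * f' y)) <= (f y)\<^sup>2 + (1 / 4 * (y\<^sup>2 * (f y)\<^sup>2) + 4 * (f' y)\<^sup>2)"
      by (simp add: power2_eq_square field_simps)
  qed (use i in auto)
  also have "\<dots> = (\<integral>y. (f y)\<^sup>2 \<partial>gauss) + (1 / 4 * (\<integral>y. y\<^sup>2 * (f y)\<^sup>2 \<partial>gauss) + 4 * (\<integral>y. (f' y)\<^sup>2 \<partial>gauss))"
    using i by simp
  finally show ?thesis by simp
qed

text \<open>Exponent 1/2 as for any square integrable derivative. Young's inequality with parameter
  sqrt (y - x) replaces Cauchy-Schwarz, so the energy enters linearly and an additive 1 appears; exp
  (R^2 / 4) undoes the weight on [-R, R].\<close>

lemma gauss_Hoelder: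
  assumes f: "!!y. (f has_real_derivative f' y) (at y)" "continuous_on UNIV f'"
    and i: "integrable gauss (%y. (f' y)\<^sup>2)" and x: "\<bar>x\<bar> <= R" "\<bar>y\<bar> <= R"
  shows "\<bar>f x - f y\<bar> <= (exp (R\<^sup>2 / 4) * (\<integral>y. (f' y)\<^sup>2 \<partial>gauss) + 1) * sqrt \<bar>x - y\<bar>"
proof -
  define D where "D = (\<integral>y. (f' y)\<^sup>2 \<partial>gauss)"
  have *: "\<bar>f y - f x\<bar> <= (exp (R\<^sup>2 / 4) * D + 1) * sqrt (y - x)" if xy: "x < y" "\<bar>x\<bar> <= R" "\<bar>y\<bar> <= R" for x y
  proof -
    define \<eta> where "\<eta> = sqrt (y - x)"
    have \<eta>: "\<eta> > 0" "\<eta>\<^sup>2 = y - x" using xy by (auto simp: \<eta>_def)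
    have c: "continuous_on {x..y} f'" "continuous_on {x..y} (%z. (f' z)\<^sup>2 * exp (- z\<^sup>2 / 4))"
      using continuous_on_subset[OF f(2), of "{x..y}"] by (auto intro!: continuous_intros)
    have "(f' has_integral f y - f x) {x..y}"
      using xy f(1) by (intro fundamental_theorem_of_calculus)
        (auto simp: has_real_derivative_iff_has_vector_derivative[symmetric] intro: has_field_derivative_at_within)
    then have "\<bar>f y - f x\<bar> = \<bar>integral {x..y} f'\<bar>" by (simp add: integral_unique)
    also have "\<dots> <= integral {x..y} (%z. \<eta> * exp (R\<^sup>2 / 4) * ((f' z)\<^sup>2 * exp (- z\<^sup>2 / 4)) + 1 / \<eta>)"
    proof (rule integral_norm_bound_integral[where f = f', unfolded real_norm_def])
      fix z assume z: "z \<in> {x..y}"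
      have "0 <= (\<eta> * \<bar>f' z\<bar> - 1)\<^sup>2" by simp
      then have "\<bar>f' z\<bar> * (2 * \<eta>) <= (\<eta> * (f' z)\<^sup>2 + 1 / \<eta>) * \<eta>"
        using \<eta>(1) by (simp add: power2_eq_square algebra_simps)
      then have "2 * \<bar>f' z\<bar> <= \<eta> * (f' z)\<^sup>2 + 1 / \<eta>" using \<eta>(1) by (simp add: mult.assoc[symmetric])
      then have 1: "\<bar>f' z\<bar> <= \<eta> * (f' z)\<^sup>2 + 1 / \<eta>" by linarith
      have "z\<^sup>2 <= R\<^sup>2" using z xy by (intro abs_le_square_iff[THEN iffD1]) auto
      then have "1 <= exp (R\<^sup>2 / 4 - z\<^sup>2 / 4)" by simp
      then have "\<eta> * (f' z)\<^sup>2 * 1 <= \<eta> * (f' z)\<^sup>2 * exp (R\<^sup>2 / 4 - z\<^sup>2 / 4)"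
        using \<eta>(1) by (intro mult_left_mono) auto
      also have "\<dots> = \<eta> * exp (R\<^sup>2 / 4) * ((f' z)\<^sup>2 * exp (- z\<^sup>2 / 4))"
        by (simp add: mult.assoc flip: exp_add)
      finally show "\<bar>f' z\<bar> <= \<eta> * exp (R\<^sup>2 / 4) * ((f' z)\<^sup>2 * exp (- z\<^sup>2 / 4)) + 1 / \<eta>"
        using 1 by simp
    qed (use c in \<open>auto intro!: integrable_continuous_real continuous_intros\<close>)
    also have "\<dots> = \<eta> * exp (R\<^sup>2 / 4) * integral {x..y} (%z. (f' z)\<^sup>2 * exp (- z\<^sup>2 / 4)) + (y - x) / \<eta>"
      using c xy by (subst integral_add) (auto intro!: integrable_continuous_real continuous_intros)
    also have "\<dots> <= \<eta> * exp (R\<^sup>2 / 4) * D + (y - x) / \<eta>"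
      using gauss_interval_le[of "%z. (f' z)\<^sup>2" x y] i f(2) \<eta>(1) unfolding D_def
      by (intro add_right_mono mult_left_mono) (auto intro: continuous_on_power)
    also have "(y - x) / \<eta> = \<eta>" unfolding \<eta>(2)[symmetric] using \<eta>(1) by (simp add: power2_eq_square)
    finally show ?thesis unfolding \<eta>_def[symmetric] by (simp add: algebra_simps)
  qed
  consider "x < y" | "y < x" | "x = y" by linarith
  then show ?thesis
    using *[of x y] *[of y x] x unfolding D_def by cases (auto simp: abs_minus_commute)
qed

text \<open>A sequence of normalised near-eigenfunctions is compact by the preceding bounds, and its
  limit h is nonzero because half of the mass stays in a bounded interval. Testing with heat
  polynomials gives (ql - j / 2) * I j = 0, so a single coefficient survives, and by completeness h
  is a multiple of one heat polynomial.\<close>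

lemma heat_poly_blow_up_limit:
  fixes f f' f'' :: "nat => real => real" and q :: "nat => real"
  assumes d1: "!!n y. (f n has_real_derivative f' n y) (at y)"
    and d2: "!!n y. (f' n has_real_derivative f'' n y) (at y)"
    and c2: "!!n. continuous_on UNIV (f'' n)"
    and g0: "!!n. exp_growth (1/64) (f n)" and g1: "!!n. exp_growth (1/64) (f' n)"
    and g2: "!!n. exp_growth (1/64) (f'' n)"
    and norm1: "!!n. (\<integral>y. (f n y)\<^sup>2 \<partial>gauss) = 1"
    and q: "!!n. (\<integral>y. (f' n y)\<^sup>2 \<partial>gauss) = q n" "q \<longlonglongrightarrow> ql"
    and eig: "(%n. \<integral>y. (f'' n y - y / 2 * f' n y + q n * f n y)\<^sup>2 \<partial>gauss) \<longlonglongrightarrow> 0"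
  shows "\<exists>k. ql = real k / 2 & (\<forall>\<epsilon>>0. \<exists>n a. a ~= 0 &
    (\<forall>y. \<bar>f n y / a - heat_poly k (-1) y\<bar> <= \<epsilon> * exp (y\<^sup>2 / 7)))"
proof -
  have c1: "continuous_on UNIV (f' n)" and c0: "continuous_on UNIV (f n)" for n
    using d1[of n] d2[of n] by (auto intro!: continuous_at_imp_continuous_on DERIV_isCont)
  have i2: "integrable gauss (%y. (f n y)\<^sup>2)" "integrable gauss (%y. (f' n y)\<^sup>2)" for n
    using integrable_gauss_growth[OF exp_growth_mult[OF g0 g0]] integrable_gauss_growth[OF exp_growth_mult[OF g1 g1]]
    by (simp_all add: power2_eq_square)
  obtain q0 where q0: "!!n. \<bar>q n\<bar> <= q0"
    using convergent_imp_Bseq[OF convergentI[OF q(2)]] by (auto simp: Bseq_def)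
  have q0_nonneg: "q0 >= 0" using order_trans[OF abs_ge_zero q0] .
  define M where "M = 4 * (1 + q0)"
  have M1: "M >= 1" using q0_nonneg by (simp add: M_def)
  have sq: "(f n y)\<^sup>2 * exp (- y\<^sup>2 / 4) <= M" for n y
    using gauss_pointwise_bound[OF d1 c1 i2, of n y] q0[of n] by (simp add: norm1 q M_def)
  have bound8: "\<bar>f n y * exp (- y\<^sup>2 / 8)\<bar> <= M" for n y
  proof -
    have "(f n y * exp (- y\<^sup>2 / 8))\<^sup>2 = (f n y)\<^sup>2 * exp (- y\<^sup>2 / 4)"
      by (simp add: power_mult_distrib flip: exp_double)
    also have "\<dots> <= M\<^sup>2" using sq[of n y] power_increasing[of 1 2 M] M1 by simp
    finally show ?thesis using M1 by (simp add: abs_le_square_iff[symmetric])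
  qed
  have bound: "\<bar>f n y\<bar> <= M * exp (1/8 * y\<^sup>2)" for n y
    using mult_right_mono[OF bound8[of n y], of "exp (y\<^sup>2 / 8)"] by (simp add: abs_mult mult.assoc flip: exp_add)
  define C where "C R = exp (R\<^sup>2 / 4) * q0 + 1" for R :: real
  have C: "C R >= 1" for R using q0_nonneg by (simp add: C_def)
  have Hoelder: "\<bar>f n x - f n y\<bar> <= C R * sqrt \<bar>x - y\<bar>" if "\<bar>x\<bar> <= R" "\<bar>y\<bar> <= R" for n x y R
  proof -
    have "(exp (R\<^sup>2 / 4) * q n + 1) * sqrt \<bar>x - y\<bar> <= C R * sqrt \<bar>x - y\<bar>"
      using q0[of n] unfolding C_def by (intro mult_right_mono) auto
    then show ?thesis using gauss_Hoelder[OF d1 c1 i2(2) that, of n] unfolding q by linarith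
  qed
  \<comment> \<open>Convergence is extracted at rational points only; the uniform Hoelder bound then
    gives it at every point.\<close>
  have "countable (\<rat> :: real set)" by (rule countable_rat)
  then obtain r :: "nat => nat" where r: "strict_mono r"
    and lim\<^sub>Q: "!!x. x \<in> \<rat> ==> \<exists>l. (%n. f (r n) x * exp (- x\<^sup>2 / 8)) \<longlonglongrightarrow> l"
    using function_convergent_subsequence[of \<rat> "%n x. f n x * exp (- x\<^sup>2 / 8)" M] bound8 by auto
  have "convergent (%n. f (r n) y)" for y
  proof (rule Cauchy_convergent, rule metric_CauchyI)
    fix e :: real assume e: "e > 0"
    define R where "R = \<bar>y\<bar> + 1"
    define \<delta> where "\<delta> = min 1 ((e / (4 * C R))\<^sup>2)"
    have \<delta>: "\<delta> > 0" "\<delta> <= 1" "\<delta> <= (e / (4 * C R))\<^sup>2" using e C[of R] by (auto simp: \<delta>_def)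
    obtain x where x: "x \<in> \<rat>" "y - \<delta> < x" "x < y"
      using Rats_dense_in_real[of "y - \<delta>" y] \<delta> by auto
    have "sqrt \<bar>x - y\<bar> <= e / (4 * C R)"
      using x \<delta>(3) e C[of R] by (intro real_le_lsqrt) auto
    then have "C R * sqrt \<bar>x - y\<bar> <= e / 4" using C[of R] by (simp add: field_simps)
    moreover have xR: "\<bar>x\<bar> <= R" "\<bar>y\<bar> <= R" using x \<delta>(2) unfolding R_def by linarith+
    ultimately have close: "\<bar>f n x - f n y\<bar> <= e / 4" for n
      using Hoelder[OF xR, of n] by linarith
    obtain l where "(%n. f (r n) x * exp (- x\<^sup>2 / 8)) \<longlonglongrightarrow> l" using lim\<^sub>Q x by auto
    then have "(%n. f (r n) x * exp (- x\<^sup>2 / 8) * exp (x\<^sup>2 / 8)) \<longlonglongrightarrow> l * exp (x\<^sup>2 / 8)"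
      by (intro tendsto_intros)
    then have "(%n. f (r n) x) \<longlonglongrightarrow> l * exp (x\<^sup>2 / 8)"
      by (simp add: mult.assoc flip: exp_add)
    then obtain N where N: "!!m n. m >= N ==> n >= N ==> dist (f (r m) x) (f (r n) x) < e / 4"
      using LIMSEQ_imp_Cauchy[THEN metric_CauchyD, of _ _ "e/4"] e by (metis zero_less_divide_iff zero_less_numeral)
    show "\<exists>N. \<forall>m\<ge>N. \<forall>n\<ge>N. dist (f (r m) y) (f (r n) y) < e"
    proof (intro exI[of _ N] allI impI)
      fix m n assume "m >= N" "n >= N"
      then show "dist (f (r m) y) (f (r n) y) < e"
        using N[of m n] close[of "r m"] close[of "r n"] e unfolding dist_real_def by linarith
    qed
  qed
  then obtain h where h: "!!y. (%n. f (r n) y) \<longlonglongrightarrow> h y"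
    unfolding convergent_def by metis
  have hbound: "\<bar>h y\<bar> <= M * exp (1/8 * y\<^sup>2)" for y
    using bound by (intro LIMSEQ_le_const2[OF tendsto_rabs[OF h]]) auto
  have hHoelder: "\<bar>h x - h y\<bar> <= C R * sqrt \<bar>x - y\<bar>" if "\<bar>x\<bar> <= R" "\<bar>y\<bar> <= R" for x y R
    using Hoelder[OF that] by (intro LIMSEQ_le_const2[OF tendsto_rabs[OF tendsto_diff[OF h h]]]) auto
  have hcont: "continuous_on UNIV h"
  proof (intro continuous_at_imp_continuous_on ballI)
    fix x :: real
    have "((%y. C (\<bar>x\<bar> + 1) * sqrt \<bar>y - x\<bar>) \<longlongrightarrow> C (\<bar>x\<bar> + 1) * sqrt \<bar>x - x\<bar>) (at x)"
      by (intro tendsto_intros)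
    then have "((%y. C (\<bar>x\<bar> + 1) * sqrt \<bar>y - x\<bar>) \<longlongrightarrow> 0) (at x)" by simp
    moreover have "\<forall>\<^sub>F y in at x. norm (h y - h x) <= C (\<bar>x\<bar> + 1) * sqrt \<bar>y - x\<bar>"
      unfolding eventually_at using hHoelder[of _ "\<bar>x\<bar> + 1" x]
      by (intro exI[of _ 1]) (auto simp: dist_real_def)
    ultimately have "((%y. h y - h x) \<longlongrightarrow> 0) (at x)" by (rule Lim_null_comparison[rotated])
    then show "isCont h x" by (simp add: isCont_def LIM_zero_iff)
  qed
  have hgrowth: "exp_growth (1/8) h"
    using hbound by (intro exp_growthI borel_measurable_continuous_onI hcont)
  have fm: "f n \<in> borel_measurable borel" for n by (rule borel_measurable_continuous_onI[OF c0])
  have hm: "heat_poly j (-1) \<in> borel_measurable borel" for j by (rule borel_measurable_continuous_onI[OF heat_poly_cont])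
  define I where "I j = (\<integral>y. h y * heat_poly j (-1) y \<partial>gauss)" for j
  have I_lim: "(%n. \<integral>y. f (r n) y * heat_poly j (-1) y \<partial>gauss) \<longlonglongrightarrow> I j" for j
  proof -
    obtain K where K: "!!y. \<bar>heat_poly j (-1) y\<bar> <= K * exp (1/16 * y\<^sup>2)" "K >= 0"
      using heat_poly_growth[of "1/16" j] unfolding exp_growth_def by auto
    show ?thesis unfolding I_def
    proof (rule gauss_tendsto[where K = "M * K" and c = "3/16"])
      fix n y
      have "\<bar>f (r n) y * heat_poly j (-1) y\<bar> <= (M * exp (1/8 * y\<^sup>2)) * (K * exp (1/16 * y\<^sup>2))"
        unfolding abs_mult using bound[of "r n" y] K M1 by (intro mult_mono) auto
      also have "\<dots> = M * K * (exp (1/8 * y\<^sup>2) * exp (1/16 * y\<^sup>2))" by simp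
      also have "exp (1/8 * y\<^sup>2) * exp (1/16 * y\<^sup>2) = exp (3/16 * y\<^sup>2)" by (simp flip: exp_add)
      finally show "\<bar>f (r n) y * heat_poly j (-1) y\<bar> <= M * K * exp (3/16 * y\<^sup>2)" .
    qed (use borel_measurable_times[OF fm hm] in \<open>auto intro!: tendsto_mult h\<close>)
  qed
  define \<zeta> where "\<zeta> n y = f'' n y - y / 2 * f' n y + q n * f n y" for n y
  have gL: "exp_growth (1/32) (%y. f'' n y - y / 2 * f' n y)" for n
  proof -
    have "exp_growth (1/32) (%y. f'' n y - 1 / 2 * (y * f' n y))"
      using exp_growth_mult[OF exp_growth_ident g1, of "1/64" n] exp_growth_mono[OF g2, of "1/32" n]
      by (intro exp_growth_diff exp_growth_cmult) auto
    then show ?thesis by simp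
  qed
  have g\<zeta>: "exp_growth (1/32) (\<zeta> n)" for n
    unfolding \<zeta>_def using gL exp_growth_mono[OF g0, of "1/32" n] by (intro exp_growth_add exp_growth_cmult) auto
  have small: "1/32 + 1/32 < (1/4 :: real)" by simp
  have g32: "exp_growth (1/32) (f n)" "exp_growth (1/32) (f' n)" "exp_growth (1/32) (f'' n)" for n
    using exp_growth_mono[OF g0, of "1/32" n] exp_growth_mono[OF g1, of "1/32" n] exp_growth_mono[OF g2, of "1/32" n] by auto
  \<comment> \<open>Moving the operator onto the polynomial multiplies the j-th coefficient of f n
    by - j / 2, so the eigenvalue defect \<zeta> has q n - j / 2 times that coefficient.\<close>
  have coeff: "(q n - real j / 2) * (\<integral>y. f n y * heat_poly j (-1) y \<partial>gauss) = (\<integral>y. \<zeta> n y * heat_poly j (-1) y \<partial>gauss)" for n j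
  proof -
    have gh: "exp_growth (1/32) (heat_poly j (-1))" by (rule heat_poly_growth) simp
    have i: "integrable gauss (%y. heat_poly j (-1) y * (f'' n y - y / 2 * f' n y))"
      "integrable gauss (%y. f n y * heat_poly j (-1) y)"
      using integrable_gauss_growth[OF exp_growth_mult[OF gh gL] small] integrable_gauss_growth[OF exp_growth_mult[OF g32(1) gh] small] by auto
    have "(\<integral>y. \<zeta> n y * heat_poly j (-1) y \<partial>gauss)
      = (\<integral>y. heat_poly j (-1) y * (f'' n y - y / 2 * f' n y) + q n * (f n y * heat_poly j (-1) y) \<partial>gauss)"
      unfolding \<zeta>_def by (rule Bochner_Integration.integral_cong) (auto simp: algebra_simps)
    also have "\<dots> = (\<integral>y. heat_poly j (-1) y * (f'' n y - y / 2 * f' n y) \<partial>gauss) + q n * (\<integral>y. f n y * heat_poly j (-1) y \<partial>gauss)"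
      using i by (subst Bochner_Integration.integral_add) auto
    also have "\<dots> = (q n - real j / 2) * (\<integral>y. f n y * heat_poly j (-1) y \<partial>gauss)"
      unfolding gauss_OU_heat_poly[OF d1 d2 c2 g32] by (simp add: algebra_simps)
    finally show ?thesis by simp
  qed
  have \<zeta>0: "(%n. \<integral>y. \<zeta> n y * heat_poly j (-1) y \<partial>gauss) \<longlonglongrightarrow> 0" for j
  proof (rule LIMSEQ_I)
    fix e :: real assume e: "e > 0"
    have gh: "exp_growth (1/32) (heat_poly j (-1))" by (rule heat_poly_growth) simp
    define H where "H = (\<integral>y. (heat_poly j (-1) y)\<^sup>2 \<partial>gauss)"
    have H: "H >= 0" by (simp add: H_def)
    define \<eta> where "\<eta> = e / (2 * (H + 1))"
    have \<eta>: "\<eta> > 0" "\<eta> * H <= e / 2" using e H by (auto simp: \<eta>_def field_simps)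
    have "e / 2 * \<eta> > 0" using e \<eta> by simp
    from LIMSEQ_D[OF eig this] obtain N where
      N: "!!n. n >= N ==> (\<integral>y. (\<zeta> n y)\<^sup>2 \<partial>gauss) < e / 2 * \<eta>"
      unfolding \<zeta>_def by (force simp: abs_less_iff)
    have "\<bar>\<integral>y. \<zeta> n y * heat_poly j (-1) y \<partial>gauss\<bar> < e" if "n >= N" for n
    proof -
      have i: "integrable gauss (%y. (\<zeta> n y)\<^sup>2)" "integrable gauss (%y. (heat_poly j (-1) y)\<^sup>2)"
        "integrable gauss (%y. \<zeta> n y * heat_poly j (-1) y)"
        using integrable_gauss_growth[OF exp_growth_mult[OF g\<zeta> g\<zeta>] small] integrable_gauss_growth[OF exp_growth_mult[OF gh gh] small]
          integrable_gauss_growth[OF exp_growth_mult[OF g\<zeta> gh] small] by (auto simp: power2_eq_square)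
      have "\<bar>\<integral>y. \<zeta> n y * heat_poly j (-1) y \<partial>gauss\<bar> <= (\<integral>y. \<bar>\<zeta> n y * heat_poly j (-1) y\<bar> \<partial>gauss)"
        by (rule integral_abs_bound)
      also have "\<dots> <= (\<integral>y. 1 / \<eta> * (\<zeta> n y)\<^sup>2 + \<eta> * (heat_poly j (-1) y)\<^sup>2 \<partial>gauss)"
      proof (rule integral_mono)
        fix y
        have "0 <= (\<bar>\<zeta> n y\<bar> - \<eta> * \<bar>heat_poly j (-1) y\<bar>)\<^sup>2" by simp
        then have "2 * (\<eta> * \<bar>\<zeta> n y * heat_poly j (-1) y\<bar>) <= (\<zeta> n y)\<^sup>2 + \<eta>\<^sup>2 * (heat_poly j (-1) y)\<^sup>2"
          by (simp add: power2_diff power_mult_distrib abs_mult mult_ac)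
        moreover have "0 <= \<eta> * \<bar>\<zeta> n y * heat_poly j (-1) y\<bar>" using \<eta> by simp
        ultimately have "\<eta> * \<bar>\<zeta> n y * heat_poly j (-1) y\<bar> <= (\<zeta> n y)\<^sup>2 + \<eta>\<^sup>2 * (heat_poly j (-1) y)\<^sup>2" by linarith
        then show "\<bar>\<zeta> n y * heat_poly j (-1) y\<bar> <= 1 / \<eta> * (\<zeta> n y)\<^sup>2 + \<eta> * (heat_poly j (-1) y)\<^sup>2"
          using \<eta>(1) by (simp add: field_simps power2_eq_square)
      qed (use i in auto)
      also have "\<dots> = 1 / \<eta> * (\<integral>y. (\<zeta> n y)\<^sup>2 \<partial>gauss) + \<eta> * H"
        using i by (simp add: H_def)
      also have "\<dots> < e / 2 + e / 2"
        using N[OF that] \<eta> by (intro add_less_le_mono) (auto simp: field_simps)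
      finally show ?thesis by simp
    qed
    then show "\<exists>no. \<forall>n\<ge>no. norm ((\<integral>y. \<zeta> n y * heat_poly j (-1) y \<partial>gauss) - 0) < e" by auto
  qed
  have spec: "(ql - real j / 2) * I j = 0" for j
  proof -
    have "(%n. (q (r n) - real j / 2) * (\<integral>y. f (r n) y * heat_poly j (-1) y \<partial>gauss)) \<longlonglongrightarrow> (ql - real j / 2) * I j"
      by (intro tendsto_mult tendsto_diff tendsto_const I_lim LIMSEQ_subseq_LIMSEQ[OF q(2) r, unfolded o_def])
    moreover have "(%n. (q (r n) - real j / 2) * (\<integral>y. f (r n) y * heat_poly j (-1) y \<partial>gauss)) \<longlonglongrightarrow> 0"
      unfolding coeff using LIMSEQ_subseq_LIMSEQ[OF \<zeta>0 r] by (simp add: o_def)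
    ultimately show ?thesis by (rule LIMSEQ_unique)
  qed
  have h_nonzero: "\<exists>y. h y ~= 0"
  proof (rule ccontr)
    assume "\<not> (\<exists>y. h y ~= 0)"
    then have h0: "h y = 0" for y by simp
    \<comment> \<open>By \<open>gauss_second_moment\<close> the mass outside [-R, R] is at most (4 +
      16 * q0) / R^2, which this choice makes 1/2.\<close>
    define R where "R = sqrt (2 * (4 + 16 * q0))"
    have R: "R > 0" "R\<^sup>2 = 2 * (4 + 16 * q0)" using q0_nonneg by (auto simp: R_def)
    have "(%n. \<integral>y. (f (r n) y)\<^sup>2 * indicator {-R..R} y \<partial>gauss) \<longlonglongrightarrow> (\<integral>y. (h y)\<^sup>2 * indicator {-R..R} y \<partial>gauss)"
    proof (rule gauss_tendsto[where K = "M * exp (R\<^sup>2 / 4)" and c = 0])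
      show "\<bar>(f (r n) y)\<^sup>2 * indicator {-R..R} y\<bar> <= M * exp (R\<^sup>2 / 4) * exp (0 * y\<^sup>2)" for n y
      proof (cases "y \<in> {-R..R}")
        case True
        then have "y\<^sup>2 <= R\<^sup>2" by (intro abs_le_square_iff[THEN iffD1]) auto
        then have "exp (y\<^sup>2 / 4) <= exp (R\<^sup>2 / 4)" by simp
        have "(f (r n) y)\<^sup>2 = (f (r n) y)\<^sup>2 * exp (- y\<^sup>2 / 4) * exp (y\<^sup>2 / 4)" by (simp add: mult.assoc flip: exp_add)
        also have "\<dots> <= M * exp (R\<^sup>2 / 4)" using sq[of "r n" y] M1 \<open>exp (y\<^sup>2 / 4) <= _\<close> by (intro mult_mono) auto
        finally show ?thesis using True by simp
      qed (use M1 in simp)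
    qed (auto intro!: tendsto_intros h borel_measurable_times borel_measurable_power fm)
    then have t: "(%n. \<integral>y. (f (r n) y)\<^sup>2 * indicator {-R..R} y \<partial>gauss) \<longlonglongrightarrow> 0" by (simp add: h0)
    have "1 / 2 <= (\<integral>y. (f n y)\<^sup>2 * indicator {-R..R} y \<partial>gauss)" for n
    proof -
      have gy: "exp_growth (1/8) (%y. y\<^sup>2 * (f n y)\<^sup>2)"
        using exp_growth_mono[OF exp_growth_mult[OF exp_growth_power[of "1/64" 2] exp_growth_mult[OF g0 g0]], of "1/8" n n]
        by (simp add: power2_eq_square)
      have i: "integrable gauss (%y. (f n y)\<^sup>2 * indicator {-R..R} y)" "integrable gauss (%y. y\<^sup>2 * (f n y)\<^sup>2)"
        using integrable_mult_indicator[OF _ i2(1)[of n], of "{-R..R}"] integrable_gauss_growth[OF gy] by (auto simp: mult.commute)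
      have "1 = (\<integral>y. (f n y)\<^sup>2 \<partial>gauss)" by (simp add: norm1)
      also have "\<dots> <= (\<integral>y. (f n y)\<^sup>2 * indicator {-R..R} y + 1 / R\<^sup>2 * (y\<^sup>2 * (f n y)\<^sup>2) \<partial>gauss)"
      proof (rule integral_mono)
        fix y
        show "(f n y)\<^sup>2 <= (f n y)\<^sup>2 * indicator {-R..R} y + 1 / R\<^sup>2 * (y\<^sup>2 * (f n y)\<^sup>2)"
        proof (cases "y \<in> {-R..R}")
          case False
          then have "R\<^sup>2 <= y\<^sup>2" using R by (intro abs_le_square_iff[THEN iffD1]) auto
          then have "1 * (f n y)\<^sup>2 <= y\<^sup>2 / R\<^sup>2 * (f n y)\<^sup>2" using R(1) by (intro mult_right_mono) (auto simp: le_divide_eq)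
          then show ?thesis using False by simp
        qed simp
      qed (use i i2 in auto)
      also have "\<dots> = (\<integral>y. (f n y)\<^sup>2 * indicator {-R..R} y \<partial>gauss) + 1 / R\<^sup>2 * (\<integral>y. y\<^sup>2 * (f n y)\<^sup>2 \<partial>gauss)"
        using i by simp
      also have "\<dots> <= (\<integral>y. (f n y)\<^sup>2 * indicator {-R..R} y \<partial>gauss) + 1 / R\<^sup>2 * (4 + 16 * q0)"
        using gauss_second_moment[OF d1 c1 g0 g1, of n] q0[of n] unfolding norm1 q
        by (intro add_left_mono mult_left_mono) auto
      also have "1 / R\<^sup>2 * (4 + 16 * q0) = 1 / 2" unfolding R(2) using q0_nonneg by (simp add: field_simps)
      finally show ?thesis by simp
    qed
    then have "1 / 2 <= (0 :: real)" by (intro LIMSEQ_le_const[OF t]) blast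
    then show False by simp
  qed
  have "\<exists>k. I k ~= 0"
  proof (rule ccontr)
    assume "\<not> (\<exists>k. I k ~= 0)"
    then have "(\<integral>y. h y * y ^ m \<partial>gauss) = 0" for m
      using gauss_moments_0[OF hgrowth] unfolding I_def by auto
    then show False using gauss_poly_complete[OF hgrowth hcont] h_nonzero by auto
  qed
  then obtain k where k: "I k ~= 0" by auto
  have ql: "ql = real k / 2" using spec[of k] k by simp
  have I_other: "I j = 0" if "j ~= k" for j using spec[of j] that unfolding ql by simp
  define b where "b = (\<integral>y. heat_poly k (-1) y * heat_poly k (-1) y \<partial>gauss)"
  have ihh: "integrable gauss (%y. heat_poly k (-1) y * heat_poly j (-1) y)" for j
    using integrable_gauss_growth[OF exp_growth_mult[OF heat_poly_growth[of "1/32" k] heat_poly_growth[of "1/32" j]]] by auto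
  have ih: "integrable gauss (%y. h y * heat_poly j (-1) y)" for j
    using integrable_gauss_growth[OF exp_growth_mult[OF hgrowth heat_poly_growth[of "1/32" j]]] by auto
  have b: "b ~= 0"
  proof
    assume "b = 0"
    have "continuous_on UNIV (%y. heat_poly k (-1) y * heat_poly k (-1) y)"
      by (intro continuous_on_mult heat_poly_cont)
    from gauss_integral_eq_0_iff[OF this _ ihh[of k]] \<open>b = 0\<close> have "heat_poly k (-1) y = 0" for y
      unfolding b_def by simp
    then show False using k by (simp add: I_def)
  qed
  define a where "a = I k / b"
  have a: "a ~= 0" using k b by (simp add: a_def)
  have ah: "h y = a * heat_poly k (-1) y" for y
  proof -
    let ?d = "%y. h y - a * heat_poly k (-1) y"
    have gd: "exp_growth (1/8) ?d"
      by (intro exp_growth_diff exp_growth_cmult hgrowth heat_poly_growth) simp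
    have "(\<integral>y. ?d y * heat_poly j (-1) y \<partial>gauss) = 0" for j
    proof -
      have "(\<integral>y. ?d y * heat_poly j (-1) y \<partial>gauss)
        = (\<integral>y. h y * heat_poly j (-1) y - a * (heat_poly k (-1) y * heat_poly j (-1) y) \<partial>gauss)"
        by (simp add: algebra_simps)
      also have "\<dots> = I j - a * (\<integral>y. heat_poly k (-1) y * heat_poly j (-1) y \<partial>gauss)"
        using ih ihh by (simp add: I_def)
      also have "\<dots> = 0"
        using I_other[of j] gauss_heat_poly_orthogonal[of j k] b by (cases "j = k") (auto simp: a_def b_def)
      finally show ?thesis .
    qed
    then have "?d y = 0"
      by (intro gauss_poly_complete[OF gd] gauss_moments_0[OF gd] continuous_on_diff continuous_on_mult continuous_on_const hcont heat_poly_cont)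
    then show ?thesis by simp
  qed
  have "\<exists>n. \<forall>y. \<bar>f n y / a - heat_poly k (-1) y\<bar> <= \<epsilon> * exp (y\<^sup>2 / 7)" if \<epsilon>: "\<epsilon> > 0" for \<epsilon>
  proof -
    define B where "B = 2 * M / \<bar>a\<bar>"
    have B: "B > 0" using M1 a by (simp add: B_def)
    \<comment> \<open>56 comes from 1/7 - 1/8 = 1/56: outside [-R, R] the crude bound B * exp (y^2 /
      8) on the error is below \<epsilon> * exp (y^2 / 7), so uniform convergence is needed on
      [-R, R] only.\<close>
    define R where "R = sqrt (56 * \<bar>ln (B / \<epsilon>)\<bar>)"
    have R: "R >= 0" "R\<^sup>2 = 56 * \<bar>ln (B / \<epsilon>)\<bar>" by (auto simp: R_def)
    obtain g s where s: "strict_mono (s :: nat => nat)"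
      and unif: "!!e. 0 < e ==> \<exists>N. \<forall>n x. n >= N & x \<in> {-R..R} --> norm (f (r (s n)) x - g x) < e"
    proof (rule Arzela_Ascoli[of "{-R..R}" "%n. f (r n)" "M * exp (1/8 * R\<^sup>2)"])
      fix n x assume "x \<in> {-R..R}"
      then have "x\<^sup>2 <= R\<^sup>2" by (intro abs_le_square_iff[THEN iffD1]) auto
      then have "M * exp (1/8 * x\<^sup>2) <= M * exp (1/8 * R\<^sup>2)" using M1 by auto
      then show "norm (f (r n) x) <= M * exp (1/8 * R\<^sup>2)" using bound[of "r n" x] by simp
    next
      fix x e :: real assume x: "x \<in> {-R..R}" and e: "0 < e"
      show "\<exists>d>0. \<forall>n y. y \<in> {-R..R} & norm (x - y) < d --> norm (f (r n) x - f (r n) y) < e"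
      proof (intro exI[of _ "(e / C R)\<^sup>2"] conjI allI impI)
        fix n y assume y: "y \<in> {-R..R} & norm (x - y) < (e / C R)\<^sup>2"
        have "sqrt \<bar>x - y\<bar> < e / C R"
          using y e C[of R] by (intro real_less_lsqrt) auto
        then have "C R * sqrt \<bar>x - y\<bar> < e" using C[of R] by (simp add: field_simps)
        then show "norm (f (r n) x - f (r n) y) < e"
          using Hoelder[of x R y "r n"] x y by (auto simp: abs_le_iff)
      qed (use e C[of R] in auto)
    qed auto
    have gh: "g x = h x" if "x \<in> {-R..R}" for x
    proof (rule LIMSEQ_unique)
      show "(%n. f (r (s n)) x) \<longlonglongrightarrow> g x"
        using unif that by (intro LIMSEQ_I) blast
      show "(%n. f (r (s n)) x) \<longlonglongrightarrow> h x"
        using LIMSEQ_subseq_LIMSEQ[OF h s] by (simp add: o_def)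
    qed
    have "\<epsilon> * \<bar>a\<bar> > 0" using \<epsilon> a by simp
    from unif[OF this] obtain n where n: "!!x. x \<in> {-R..R} ==> \<bar>f (r (s n)) x - g x\<bar> < \<epsilon> * \<bar>a\<bar>" by auto
    have "\<bar>f (r (s n)) y / a - heat_poly k (-1) y\<bar> <= \<epsilon> * exp (y\<^sup>2 / 7)" for y
    proof -
      have e: "\<bar>f (r (s n)) y / a - heat_poly k (-1) y\<bar> = \<bar>f (r (s n)) y - h y\<bar> / \<bar>a\<bar>"
        unfolding ah abs_divide[symmetric] using a by (simp add: field_simps)
      show ?thesis
      proof (cases "y \<in> {-R..R}")
        case True
        then have "\<bar>f (r (s n)) y - h y\<bar> / \<bar>a\<bar> <= \<epsilon>"
          using n[OF True] a gh[OF True] by (simp add: field_simps)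
        also have "\<dots> <= \<epsilon> * exp (y\<^sup>2 / 7)" using \<epsilon> by simp
        finally show ?thesis unfolding e .
      next
        case False
        then have "R\<^sup>2 <= y\<^sup>2" using R(1) by (intro abs_le_square_iff[THEN iffD1]) auto
        then have "ln (B / \<epsilon>) <= y\<^sup>2 / 56" unfolding R(2) by linarith
        then have "exp (ln (B / \<epsilon>)) <= exp (y\<^sup>2 / 56)" by simp
        then have "B / \<epsilon> <= exp (y\<^sup>2 / 56)" using B \<epsilon> by (simp add: exp_ln)
        then have "B * exp (y\<^sup>2 / 8) <= (\<epsilon> * exp (y\<^sup>2 / 56)) * exp (y\<^sup>2 / 8)"
          using \<epsilon> by (intro mult_right_mono) (auto simp: field_simps)
        also have "\<dots> = \<epsilon> * exp (y\<^sup>2 / 7)" by (simp add: mult.assoc flip: exp_add)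
        finally have 1: "B * exp (y\<^sup>2 / 8) <= \<epsilon> * exp (y\<^sup>2 / 7)" .
        have "\<bar>f (r (s n)) y - h y\<bar> <= 2 * M * exp (y\<^sup>2 / 8)"
          using bound[of "r (s n)" y] hbound[of y] by simp
        then have "\<bar>f (r (s n)) y - h y\<bar> / \<bar>a\<bar> <= B * exp (y\<^sup>2 / 8)"
          using a by (simp add: B_def field_simps)
        then show ?thesis using 1 unfolding e by linarith
      qed
    qed
    then show ?thesis by blast
  qed
  then show ?thesis using ql a by blast
qed


text \<open>\<open>P\<close> decreases and is bounded below, so its drop over unit intervals tends
  to 0, and the mean value theorem finds in each of them a time at which Z / N is small. Hence only
  some time in each unit interval is obtained. The degree is fixed by the limit of \<open>P\<close>,
  so it is the same for every sequence of intervals.\<close>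

lemma ou_flow_asymptotics:
  assumes ou: "!!s2. ou_flow v vy vyy vs s1 s2 c K"
    and nz: "!!s. s > s1 ==> \<exists>y. v s y ~= 0"
  shows "\<exists>k. \<forall>\<epsilon>>0. \<exists>\<sigma>. \<forall>s\<ge>\<sigma>. \<exists>s'\<in>{s..s + 1}. \<exists>m. m ~= 0 &
    (\<forall>y. \<bar>v s' y / m - heat_poly k (-1) y\<bar> <= \<epsilon> * exp (y\<^sup>2 / 7))"
proof -
  define N where "N = ou_flow.N v"
  define Q where "Q = ou_flow.Q v vy"
  define Z where "Z = ou_flow.Z v vy vyy"
  define P where "P = ou_flow.P v vy c"
  have iv: "s \<in> {s1<..<s + 1}" if "s > s1" for s using that by auto
  have Npos: "N s > 0" if "s > s1" for s
    using ou_flow.N_pos_iff[OF ou iv[OF that]] nz[OF that] by (simp add: N_def)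
  have Qn: "Q s >= 0" if "s > s1" for s
    using ou_flow.Q_nonneg[OF ou iv[OF that]] by (simp add: Q_def)
  have Zn: "Z s >= 0" if "s > s1" for s
    using ou_flow.Z_nonneg[OF ou iv[OF that]] by (simp add: Z_def)
  have P1: "1 + Q s <= P s" if "s > s1" for s
    using ou_flow.Q_le_P[OF ou iv[OF that]] by (simp add: Q_def P_def)
  have P_eq: "P s = (1 + Q s) * exp (2 * c\<^sup>2 * exp (- s))" for s
    using ou_flow.P_def[OF ou] by (simp add: P_def Q_def)
  have "\<exists>P'. (P has_real_derivative P') (at s) & P' <= - Z s / N s" if "s > s1" for s
    using ou_flow.P_deriv[OF ou iv[OF that]] Npos[OF that] unfolding P_def Z_def N_def by simp
  then obtain P' where P': "!!s. s > s1 ==> (P has_real_derivative P' s) (at s)"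
    "!!s. s > s1 ==> P' s <= - Z s / N s" by metis
  have P_mono: "P t <= P s" if "s1 < s" "s <= t" for s t
    using ou_flow.P_antimono[OF ou, of s t "t + 1"] Npos that unfolding P_def N_def by auto
  have "decseq (%n. P (s1 + 1 + real n))"
    unfolding decseq_def by (auto intro!: P_mono)
  moreover have "1 <= P (s1 + 1 + real n)" for n
    using P1[of "s1 + 1 + real n"] Qn[of "s1 + 1 + real n"] by simp
  ultimately obtain p where p: "(%n. P (s1 + 1 + real n)) \<longlonglongrightarrow> p"
    using decseq_convergent[of "%n. P (s1 + 1 + real n)" 1] by blast
  have lim_seq: "(%n. P (S n)) \<longlonglongrightarrow> p" if S: "!!n. S n >= s1 + 1 + real n" for S
  proof (rule LIMSEQ_I)
    have pl: "p <= P s" if "s > s1" for s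
    proof (rule LIMSEQ_le_const2[OF p])
      obtain n0 where "real n0 >= s - s1" using real_arch_simple by blast
      then have "P (s1 + 1 + real n) <= P s" if "n >= n0" for n
        using that by (intro P_mono \<open>s > s1\<close>) (simp add: order_trans)
      then show "\<exists>N. \<forall>n\<ge>N. P (s1 + 1 + real n) <= P s" by blast
    qed
    fix r :: real assume "0 < r"
    from LIMSEQ_D[OF p this] obtain n0 where n0: "!!n. n >= n0 ==> norm (P (s1 + 1 + real n) - p) < r" by auto
    have "norm (P (S n) - p) < r" if "n >= n0" for n
    proof -
      have "p <= P (S n)" "P (S n) <= P (s1 + 1 + real n)" using S[of n] by (auto intro!: pl P_mono)
      then show ?thesis using n0[OF that] by simp
    qed
    then show "\<exists>no. \<forall>n\<ge>no. norm (P (S n) - p) < r" by blast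
  qed
  \<comment> \<open>Stated for an arbitrary sequence of unit intervals going to infinity, so that it
    applies at the end to a sequence of intervals violating the claim.\<close>
  have good: "\<exists>k. p - 1 = real k / 2 & (\<forall>\<epsilon>>0. \<exists>n. \<exists>s'\<in>{S n..S n + 1}. \<exists>m. m ~= 0 &
    (\<forall>y. \<bar>v s' y / m - heat_poly k (-1) y\<bar> <= \<epsilon> * exp (y\<^sup>2 / 7)))"
    if S: "!!n. S n >= s1 + 1 + real n" for S
  proof -
    have "\<forall>n. \<exists>\<xi>. S n < \<xi> & \<xi> < S n + 1 & P (S n + 1) - P (S n) = (S n + 1 - S n) * P' \<xi>"
    proof
      fix n
      show "\<exists>\<xi>. S n < \<xi> & \<xi> < S n + 1 & P (S n + 1) - P (S n) = (S n + 1 - S n) * P' \<xi>"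
        using S[of n] by (intro MVT2 P'(1)) auto
    qed
    from choice[OF this] obtain \<xi> where
      \<xi>: "!!n. S n < \<xi> n" "!!n. \<xi> n < S n + 1" "!!n. P (S n + 1) - P (S n) = P' (\<xi> n)" by auto
    have \<xi>1: "\<xi> n > s1" and \<xi>2: "\<xi> n \<in> {s1<..<\<xi> n + 1}" for n using \<xi>(1)[of n] S[of n] by auto
    have Z0: "(%n. Z (\<xi> n) / N (\<xi> n)) \<longlonglongrightarrow> 0"
    proof (rule tendsto_sandwich[OF _ _ tendsto_const])
      show "\<forall>\<^sub>F n in sequentially. 0 <= Z (\<xi> n) / N (\<xi> n)"
        using Zn[OF \<xi>1] Npos[OF \<xi>1] by (intro always_eventually allI divide_nonneg_pos)
      show "\<forall>\<^sub>F n in sequentially. Z (\<xi> n) / N (\<xi> n) <= P (S n) - P (S n + 1)"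
      proof (intro always_eventually allI)
        show "Z (\<xi> n) / N (\<xi> n) <= P (S n) - P (S n + 1)" for n
          using P'(2)[OF \<xi>1[of n]] \<xi>(3)[of n] by simp
      qed
      have "(%n. P (S n + 1)) \<longlonglongrightarrow> p" using S by (intro lim_seq) (simp add: add_increasing2)
      then show "(%n. P (S n) - P (S n + 1)) \<longlonglongrightarrow> 0" using tendsto_diff[OF lim_seq[of S]] S by fastforce
    qed
    have Qlim: "(%n. Q (\<xi> n)) \<longlonglongrightarrow> p - 1"
    proof -
      have "(%n. P (\<xi> n)) \<longlonglongrightarrow> p" using S \<xi>(1) by (intro lim_seq) (meson less_imp_le order_trans)
      moreover have "filterlim \<xi> at_top sequentially"
      proof (rule filterlim_at_top_mono)
        show "filterlim (%n. s1 + 1 + real n) at_top sequentially" by real_asymp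
        show "\<forall>\<^sub>F n in sequentially. s1 + 1 + real n <= \<xi> n"
          using S \<xi>(1) by (intro always_eventually allI) (meson less_imp_le order_trans)
      qed
      then have "(%n. exp (- \<xi> n)) \<longlonglongrightarrow> 0"
        by (rule filterlim_compose[OF filterlim_compose[OF exp_at_bot filterlim_uminus_at_bot_at_top]])
      then have "(%n. exp (- (2 * c\<^sup>2 * exp (- \<xi> n)))) \<longlonglongrightarrow> exp (- (2 * c\<^sup>2 * 0))"
        by (intro tendsto_intros)
      ultimately have "(%n. P (\<xi> n) * exp (- (2 * c\<^sup>2 * exp (- \<xi> n))) - 1) \<longlonglongrightarrow> p * exp (- (2 * c\<^sup>2 * 0)) - 1"
        by (intro tendsto_diff tendsto_mult tendsto_const)
      then show ?thesis unfolding P_eq by (simp add: mult.assoc flip: exp_add)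
    qed
    define d where "d n = sqrt (N (\<xi> n))" for n
    have d: "d n > 0" "(d n)\<^sup>2 = N (\<xi> n)" for n using Npos[OF \<xi>1] by (auto simp: d_def less_imp_le)
    have "\<exists>k. p - 1 = real k / 2 & (\<forall>\<epsilon>>0. \<exists>n a. a ~= 0 &
      (\<forall>y. \<bar>(v (\<xi> n) y / d n) / a - heat_poly k (-1) y\<bar> <= \<epsilon> * exp (y\<^sup>2 / 7)))"
    proof (rule heat_poly_blow_up_limit[where f' = "%n y. vy (\<xi> n) y / d n" and f'' = "%n y. vyy (\<xi> n) y / d n" and q = "%n. Q (\<xi> n)"])
      fix n
      note o = ou[of "\<xi> n + 1"]
      have g: "exp_growth (1/64) (%y. h y / d n)" if "exp_growth (1/64) h" for h
        using exp_growth_cmult[OF that, of "1 / d n"] by simp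
      show "((%y. v (\<xi> n) y / d n) has_real_derivative vy (\<xi> n) y / d n) (at y)"
        "((%y. vy (\<xi> n) y / d n) has_real_derivative vyy (\<xi> n) y / d n) (at y)" for y
        using ou_flow.deriv_y[OF o \<xi>2] ou_flow.deriv_yy[OF o \<xi>2] by (auto intro: DERIV_cdivide)
      show "continuous_on UNIV (%y. vyy (\<xi> n) y / d n)"
        using ou_flow.cont_yy[OF o \<xi>2] d(1)[of n] by (intro continuous_intros) auto
      show "exp_growth (1/64) (%y. v (\<xi> n) y / d n)" "exp_growth (1/64) (%y. vy (\<xi> n) y / d n)"
        "exp_growth (1/64) (%y. vyy (\<xi> n) y / d n)"
        using ou_flow.growth_v[OF o \<xi>2] ou_flow.growth_vy[OF o \<xi>2] ou_flow.growth_vyy[OF o \<xi>2] by (auto intro: g)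
      show "(\<integral>y. (v (\<xi> n) y / d n)\<^sup>2 \<partial>gauss) = 1"
        using Npos[OF \<xi>1[of n]] unfolding power_divide d N_def ou_flow.N_def[OF o] by simp
      show "(\<integral>y. (vy (\<xi> n) y / d n)\<^sup>2 \<partial>gauss) = Q (\<xi> n)"
        unfolding power_divide d Q_def ou_flow.Q_def[OF o] ou_flow.D_def[OF o] N_def by simp
    next
      show "(%n. \<integral>y. (vyy (\<xi> n) y / d n - y / 2 * (vy (\<xi> n) y / d n) + Q (\<xi> n) * (v (\<xi> n) y / d n))\<^sup>2 \<partial>gauss) \<longlonglongrightarrow> 0"
      proof -
        have "(\<integral>y. (vyy (\<xi> n) y / d n - y / 2 * (vy (\<xi> n) y / d n) + Q (\<xi> n) * (v (\<xi> n) y / d n))\<^sup>2 \<partial>gauss)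
          = Z (\<xi> n) / N (\<xi> n)" for n
        proof -
          note o = ou[of "\<xi> n + 1"]
          have "(vyy (\<xi> n) y / d n - y / 2 * (vy (\<xi> n) y / d n) + Q (\<xi> n) * (v (\<xi> n) y / d n))\<^sup>2
            = (vyy (\<xi> n) y - y / 2 * vy (\<xi> n) y + Q (\<xi> n) * v (\<xi> n) y)\<^sup>2 / N (\<xi> n)" for y
            unfolding d(2)[symmetric] power_divide[symmetric] by (simp add: add_divide_distrib diff_divide_distrib)
          then show ?thesis by (simp add: Z_def ou_flow.Z_def[OF o] ou_flow.Lv_def[OF o] Q_def)
        qed
        then show ?thesis using Z0 by simp
      qed
    qed (rule Qlim)
    then obtain k where k: "p - 1 = real k / 2" "!!\<epsilon>. \<epsilon> > 0 ==> \<exists>n a. a ~= 0 &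
      (\<forall>y. \<bar>(v (\<xi> n) y / d n) / a - heat_poly k (-1) y\<bar> <= \<epsilon> * exp (y\<^sup>2 / 7))" by blast
    show ?thesis
    proof (rule exI[of _ k], intro conjI k(1) allI impI)
      fix \<epsilon> :: real assume "\<epsilon> > 0"
      from k(2)[OF this] obtain n a where "a ~= 0" "\<forall>y. \<bar>(v (\<xi> n) y / d n) / a - heat_poly k (-1) y\<bar> <= \<epsilon> * exp (y\<^sup>2 / 7)" by auto
      then show "\<exists>n. \<exists>s'\<in>{S n..S n + 1}. \<exists>m. m ~= 0 & (\<forall>y. \<bar>v s' y / m - heat_poly k (-1) y\<bar> <= \<epsilon> * exp (y\<^sup>2 / 7))"
        using d(1)[of n] \<xi>(1,2)[of n] by (intro exI[of _ n] bexI[of _ "\<xi> n"] exI[of _ "d n * a"]) auto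
    qed
  qed
  obtain k where k: "p - 1 = real k / 2" using good[of "%n. s1 + 1 + real n"] by auto
  show ?thesis
  proof (intro exI[of _ k] allI impI, rule ccontr)
    fix \<epsilon> :: real assume \<epsilon>: "\<epsilon> > 0"
    assume neg: "\<not> (\<exists>\<sigma>. \<forall>s\<ge>\<sigma>. \<exists>s'\<in>{s..s + 1}. \<exists>m. m ~= 0 &
      (\<forall>y. \<bar>v s' y / m - heat_poly k (-1) y\<bar> <= \<epsilon> * exp (y\<^sup>2 / 7)))"
    have "\<exists>s\<ge>s1 + 1 + real n. \<not> (\<exists>s'\<in>{s..s + 1}. \<exists>m. m ~= 0 &
      (\<forall>y. \<bar>v s' y / m - heat_poly k (-1) y\<bar> <= \<epsilon> * exp (y\<^sup>2 / 7)))" for n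
    proof -
      show ?thesis using neg by blast
    qed
    then obtain S where S: "!!n. S n >= s1 + 1 + real n" and bad: "!!n. \<not> (\<exists>s'\<in>{S n..S n + 1}. \<exists>m. m ~= 0 &
      (\<forall>y. \<bar>v s' y / m - heat_poly k (-1) y\<bar> <= \<epsilon> * exp (y\<^sup>2 / 7)))" by metis
    from good[OF S] obtain k' where k': "p - 1 = real k' / 2" "\<exists>n. \<exists>s'\<in>{S n..S n + 1}. \<exists>m. m ~= 0 &
      (\<forall>y. \<bar>v s' y / m - heat_poly k' (-1) y\<bar> <= \<epsilon> * exp (y\<^sup>2 / 7))" using \<epsilon> by blast
    have "k' = k" using k k'(1) by simp
    then show False using k'(2) bad by blast
  qed
qed

section \<open>Periodic parabolic inequalities\<close>

lemma DERIV_nonneg_of_left_max: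
  fixes h :: "real => real"
  assumes "(h has_real_derivative d) (at t1)" "t0 < t1" "!!t. t0 < t ==> t <= t1 ==> h t <= h t1"
  shows "d >= 0"
proof (rule ccontr)
  assume "\<not> d >= 0"
  then obtain \<delta> where \<delta>: "\<delta> > 0" "!!e. 0 < e ==> e < \<delta> ==> h t1 < h (t1 - e)"
    using DERIV_neg_dec_left[OF assms(1)] by auto
  define e where "e = min (\<delta> / 2) ((t1 - t0) / 2)"
  have "0 < e" "e < \<delta>" "t0 < t1 - e" using \<delta>(1) assms(2) by (auto simp: e_def min_def field_simps)
  then show False using \<delta>(2)[of e] assms(3)[of "t1 - e"] by auto
qed

lemma second_derivative_test_max:
  fixes f :: "real => real"
  assumes "e > 0" "!!x. \<bar>x - x1\<bar> < e ==> (f has_real_derivative f' x) (at x)"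
    "(f' has_real_derivative f2) (at x1)" "!!x. \<bar>x - x1\<bar> < e ==> f x <= f x1"
  shows "f' x1 = 0" "f2 <= 0"
proof -
  show 0: "f' x1 = 0"
    using assms(1,4) by (intro DERIV_local_max[OF assms(2), of x1 e]) (auto simp: abs_minus_commute)
  show "f2 <= 0"
  proof (rule ccontr)
    assume "\<not> f2 <= 0"
    then obtain \<delta> where \<delta>: "\<delta> > 0" "!!h. 0 < h ==> h < \<delta> ==> f' x1 < f' (x1 + h)"
      using DERIV_pos_inc_right[OF assms(3)] by auto
    define h where "h = min \<delta> e / 2"
    have h: "0 < h" "h < \<delta>" "h < e" using \<delta>(1) assms(1) by (auto simp: h_def)
    have "\<exists>z. x1 < z & z < x1 + h & f (x1 + h) - f x1 = (x1 + h - x1) * f' z"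
      using h by (intro MVT2 assms(2)) auto
    then obtain z where z: "x1 < z" "z < x1 + h" "f (x1 + h) - f x1 = h * f' z" by auto
    have "f' z > 0" using \<delta>(2)[of "z - x1"] z h 0 by simp
    then have "f (x1 + h) > f x1" using z(3) mult_pos_pos[OF h(1)] by fastforce
    then show False using assms(4)[of "x1 + h"] h by simp
  qed
qed

lemma periodic_add_int:
  fixes u :: "real => 'b"
  assumes "!!x. u (x + L) = u x"
  shows "u (x + of_int k * L) = u x"
proof -
  have nat: "u (x + real n * L) = u x" for n x
  proof (induction n)
    case (Suc n)
    then show ?case using assms[of "x + real n * L"] by (simp add: algebra_simps)
  qed simp
  show ?thesis
  proof (cases k)
    case (nonneg n)
    then show ?thesis using nat[of x n] by simp
  next
    case (neg n)
    have e: "x + of_int k * L + real (Suc n) * L = x" unfolding neg by (simp add: algebra_simps)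
    show ?thesis using nat[of "x + of_int k * L" "Suc n"] unfolding e by simp
  qed
qed

lemma periodic_representative:
  fixes L :: real
  assumes "L > 0"
  obtains k :: int where "x + of_int k * L \<in> {c..<c + L}"
proof
  have "of_int \<lfloor>(x - c) / L\<rfloor> <= (x - c) / L" "(x - c) / L < of_int \<lfloor>(x - c) / L\<rfloor> + 1" by linarith+
  then have "of_int \<lfloor>(x - c) / L\<rfloor> * L <= x - c" "x - c < (of_int \<lfloor>(x - c) / L\<rfloor> + 1) * L"
    using assms by (simp_all only: pos_le_divide_eq pos_divide_less_eq)
  then show "x + of_int (- \<lfloor>(x - c) / L\<rfloor>) * L \<in> {c..<c + L}"
    by (auto simp: algebra_simps)
qed

lemma periodic_continuous_bounded:
  fixes F :: "real => real => real"
  assumes "L > 0" "compact S" "continuous_on (S \<times> UNIV) (%(t, x). F t x)"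
    and per: "!!t x. t \<in> S ==> F t (x + L) = F t x"
  shows "\<exists>K\<ge>0. \<forall>t\<in>S. \<forall>x. \<bar>F t x\<bar> <= K"
proof -
  have "compact ((%(t, x). F t x) ` (S \<times> {0..L}))"
    using assms(2) by (intro compact_continuous_image continuous_on_subset[OF assms(3)] compact_Times) auto
  then obtain K where K: "!!t x. t \<in> S ==> x \<in> {0..L} ==> \<bar>F t x\<bar> <= K" "K > 0"
    by (fastforce dest!: compact_imp_bounded simp: bounded_pos)
  have "\<bar>F t x\<bar> <= K" if t: "t \<in> S" for t x
  proof -
    obtain k :: int where k: "x + of_int k * L \<in> {0..<0 + L}" using periodic_representative[OF assms(1)] .
    have "F t (x + of_int k * L) = F t x" using per[OF t] by (rule periodic_add_int)
    then show ?thesis using K(1)[OF t, of "x + of_int k * L"] k by auto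
  qed
  then show ?thesis using K(2) by (intro exI[of _ K]) auto
qed

text \<open>A t-derivative at one point and a jointly continuous x-derivative already give total
  differentiability. It is used along the curves of the similarity variables, where both arguments
  move with s.\<close>

lemma DERIV_two_variables:
  fixes F :: "real => real => real"
  assumes t: "\<tau> s \<in> {a<..<b}"
    and Ft: "((%t. F t (\<xi> s)) has_real_derivative Ft) (at (\<tau> s))"
    and Fx: "!!t x. t \<in> {a<..<b} ==> (F t has_real_derivative Fx t x) (at x)"
    and cont: "continuous_on ({a<..<b} \<times> UNIV) (%(t, x). Fx t x)"
    and d: "(\<tau> has_real_derivative \<tau>') (at s)" "(\<xi> has_real_derivative \<xi>') (at s)"
  shows "((%s. F (\<tau> s) (\<xi> s)) has_real_derivative Ft * \<tau>' + Fx (\<tau> s) (\<xi> s) * \<xi>') (at s)"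
proof -
  have op: "open ({a<..<b} \<times> (UNIV :: real set))" by (intro open_Times) auto
  have bl: "blinfun_apply (c *\<^sub>R id_blinfun) = (*) c" for c :: real
    by (auto simp: fun_eq_iff blinfun.scaleR_left)
  have "((%(t, x). F t x) has_derivative (%(dt, dx). Ft * dt + blinfun_apply (Fx (\<tau> s) (\<xi> s) *\<^sub>R id_blinfun) dx))
    (at (\<tau> s, \<xi> s) within {a<..<b} \<times> UNIV)"
  proof (rule has_derivative_partialsI)
    show "((%t. F t (\<xi> s)) has_derivative (*) Ft) (at (\<tau> s) within {a<..<b})"
      using Ft by (auto simp: has_field_derivative_def intro: has_derivative_at_withinI)
    show "(F t has_derivative blinfun_apply (Fx t x *\<^sub>R id_blinfun)) (at x within UNIV)" if "t \<in> {a<..<b}" for t x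
      using Fx[OF that, of x] unfolding bl by (simp add: has_field_derivative_def)
    have "isCont (%(t, x). Fx t x) (\<tau> s, \<xi> s)"
      using continuous_on_interior[OF cont] t op by (simp add: interior_open)
    then have "isCont (%z. (%(t, x). Fx t x) z *\<^sub>R (id_blinfun :: real \<Rightarrow>\<^sub>L real)) (\<tau> s, \<xi> s)"
      by (intro continuous_intros)
    then show "continuous (at (\<tau> s, \<xi> s) within {a<..<b} \<times> UNIV) (%(t, x). Fx t x *\<^sub>R (id_blinfun :: real \<Rightarrow>\<^sub>L real))"
      by (auto simp: case_prod_beta' intro: continuous_at_imp_continuous_at_within)
  qed auto
  then have D: "((%(t, x). F t x) has_derivative (%(dt, dx). Ft * dt + Fx (\<tau> s) (\<xi> s) * dx)) (at (\<tau> s, \<xi> s))"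
    using t op unfolding bl by (subst (asm) at_within_open) auto
  have "((%s. (\<tau> s, \<xi> s)) has_derivative (%h. (\<tau>' * h, \<xi>' * h))) (at s)"
    using d by (intro has_derivative_Pair) (auto simp: has_field_derivative_def)
  from has_derivative_compose[OF this D]
  have "((%s. F (\<tau> s) (\<xi> s)) has_derivative (%h. Ft * (\<tau>' * h) + Fx (\<tau> s) (\<xi> s) * (\<xi>' * h))) (at s)" by simp
  then show ?thesis
    unfolding has_field_derivative_def by (rule has_derivative_eq_rhs) (simp add: fun_eq_iff algebra_simps)
qed

section \<open>The parabolic inequality in similarity variables\<close>

locale parabolic_strip =
  fixes L C a b :: real and w wx wxx wt :: "real => real => real"
  assumes L: "L > 0" and C: "C >= 0"
    and periodic: "t \<in> {a<..<b} ==> w t (x + L) = w t x"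
    and deriv_x: "t \<in> {a<..<b} ==> (w t has_real_derivative wx t x) (at x)"
    and deriv_xx: "t \<in> {a<..<b} ==> (wx t has_real_derivative wxx t x) (at x)"
    and deriv_t: "t \<in> {a<..<b} ==> ((%t. w t x) has_real_derivative wt t x) (at t)"
    and cont_w: "continuous_on ({a<..<b} \<times> UNIV) (%(t, x). w t x)"
    and cont_wx: "continuous_on ({a<..<b} \<times> UNIV) (%(t, x). wx t x)"
    and cont_wxx: "continuous_on ({a<..<b} \<times> UNIV) (%(t, x). wxx t x)"
    and cont_wt: "continuous_on ({a<..<b} \<times> UNIV) (%(t, x). wt t x)"
    and ineq: "t \<in> {a<..<b} ==> \<bar>wt t x - wxx t x\<bar> <= C * (\<bar>w t x\<bar> + \<bar>wx t x\<bar>)"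
begin

lemma periodic_derivs:
  assumes t: "t \<in> {a<..<b}"
  shows "wx t (x + L) = wx t x" "wxx t (x + L) = wxx t x" "wt t (x + L) = wt t x"
proof -
  have shift: "((%x. g (x + L)) has_real_derivative g' (x + L)) (at x)"
    if "!!x. (g has_real_derivative g' x) (at x)" for g g' :: "real => real" and x
    by (rule DERIV_shift[THEN iffD1, OF that])
  have wx: "wx t (x + L) = wx t x" for x
    using shift[OF deriv_x[OF t], of x] periodic[OF t] deriv_x[OF t, of x] DERIV_unique by fastforce
  then show "wx t (x + L) = wx t x" .
  show "wxx t (x + L) = wxx t x"
    using shift[OF deriv_xx[OF t], of x] wx deriv_xx[OF t, of x] DERIV_unique by fastforce
  have "((%t. w t x) has_real_derivative wt t (x + L)) (at t)"
    using t by (intro has_field_derivative_transform_within_open[OF deriv_t[OF t, of "x + L"], of "{a<..<b}"]) (auto simp: periodic)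
  then show "wt t (x + L) = wt t x" using deriv_t[OF t] DERIV_unique by blast
qed

lemma bounds:
  assumes "a < \<alpha>" "\<beta> < b"
  shows "\<exists>K\<ge>0. \<forall>t\<in>{\<alpha>..\<beta>}. \<forall>x. \<bar>w t x\<bar> <= K & \<bar>wx t x\<bar> <= K & \<bar>wxx t x\<bar> <= K & \<bar>wt t x\<bar> <= K"
proof -
  have *: "\<exists>K\<ge>0. \<forall>t\<in>{\<alpha>..\<beta>}. \<forall>x. \<bar>F t x\<bar> <= K"
    if "continuous_on ({a<..<b} \<times> UNIV) (%(t, x). F t x)" "!!t x. t \<in> {a<..<b} ==> F t (x + L) = F t x" for F :: "real => real => real"
    using assms by (intro periodic_continuous_bounded[OF L] continuous_on_subset[OF that(1)] that(2)) auto
  obtain K1 K2 K3 K4 where K: "K1 >= 0" "\<forall>t\<in>{\<alpha>..\<beta>}. \<forall>x. \<bar>w t x\<bar> <= K1"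
    "K2 >= 0" "\<forall>t\<in>{\<alpha>..\<beta>}. \<forall>x. \<bar>wx t x\<bar> <= K2" "K3 >= 0" "\<forall>t\<in>{\<alpha>..\<beta>}. \<forall>x. \<bar>wxx t x\<bar> <= K3"
    "K4 >= 0" "\<forall>t\<in>{\<alpha>..\<beta>}. \<forall>x. \<bar>wt t x\<bar> <= K4"
    using *[OF cont_w periodic] *[OF cont_wx periodic_derivs(1)] *[OF cont_wxx periodic_derivs(2)] *[OF cont_wt periodic_derivs(3)] by blast
  show ?thesis
    using K by (intro exI[of _ "K1 + K2 + K3 + K4"]) (smt (verit, ccfv_SIG))
qed

lemma isCont_joint:
  fixes F :: "real => real => real"
  assumes "continuous_on ({a<..<b} \<times> UNIV) (%(t, x). F t x :: real)" "\<tau> s \<in> {a<..<b}" "isCont \<tau> s" "isCont \<xi> s"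
  shows "isCont (%s::real. F (\<tau> s) (\<xi> s)) s"
proof -
  have "open ({a<..<b} \<times> (UNIV :: real set))" by (intro open_Times) auto
  then have "isCont (%(t, x). F t x) (\<tau> s, \<xi> s)"
    using continuous_on_interior[OF assms(1)] assms(2) by (simp add: interior_open)
  then show ?thesis
    using isCont_o2[where f = "%s. (\<tau> s, \<xi> s)" and a = s and g = "%(t, x). F t x"] assms(3,4) by (auto intro: continuous_intros)
qed

text \<open>K is chosen before s2, so the bounds do not deteriorate as the window grows and s may go
  to infinity. The fourth function is the total s-derivative of the first one, including the motion
  of x0 + exp (- s / 2) * y.\<close>

lemma ou_flow_at:
  assumes \<alpha>\<beta>: "a < \<alpha>" "\<beta> < b"
  shows "\<exists>K. \<forall>s2. (\<forall>s\<in>{s1<..<s2}. T - exp (- s) \<in> {\<alpha>..\<beta>}) -->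
    ou_flow (%s y. w (T - exp (- s)) (x0 + exp (- s / 2) * y))
      (%s y. exp (- s / 2) * wx (T - exp (- s)) (x0 + exp (- s / 2) * y))
      (%s y. exp (- s) * wxx (T - exp (- s)) (x0 + exp (- s / 2) * y))
      (%s y. exp (- s) * wt (T - exp (- s)) (x0 + exp (- s / 2) * y)
         - y / 2 * (exp (- s / 2) * wx (T - exp (- s)) (x0 + exp (- s / 2) * y)))
      s1 s2 (C * (1 + exp (- s1 / 2))) K"
proof -
  obtain K0 where K0: "K0 >= 0" and K0b: "!!t x. t \<in> {\<alpha>..\<beta>} ==>
      \<bar>w t x\<bar> <= K0 & \<bar>wx t x\<bar> <= K0 & \<bar>wxx t x\<bar> <= K0 & \<bar>wt t x\<bar> <= K0"
    using bounds[OF \<alpha>\<beta>] by blast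
  obtain K1 :: real where K1: "K1 >= 0" "!!y. \<bar>y\<bar> <= K1 * exp (y\<^sup>2 / 64)"
    using exp_growth_ident[of "1/64"] unfolding exp_growth_def by auto
  \<comment> \<open>s1 may be negative, so exp (- s / 2) may exceed 1; E dominates both it and
    1.\<close>
  define E where "E = 1 + exp (- s1 / 2)"
  have E: "E >= 1" by (simp add: E_def)
  define K where "K = K0 * E\<^sup>2 * (1 + K1)"
  have KK: "K >= K0 * E\<^sup>2" "K0 * E\<^sup>2 >= K0 * E" "K0 * E >= K0"
    using mult_left_mono[of 1 "1 + K1" "K0 * E\<^sup>2"] mult_left_mono[of 1 E "K0 * E"] mult_left_mono[of 1 E K0] K0 E K1(1)
    by (simp_all add: K_def power2_eq_square mult.assoc)
  have e1: "exp (- s / 2) <= E" "exp (- s) <= E\<^sup>2" if "s1 < s" for s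
  proof -
    have "exp (- s / 2) <= exp (- s1 / 2)" using that by simp
    then show 1: "exp (- s / 2) <= E" unfolding E_def by linarith
    have "exp (- s) = (exp (- s / 2))\<^sup>2" by (simp flip: exp_double)
    also have "\<dots> <= E\<^sup>2" using 1 by (intro power_mono) auto
    finally show "exp (- s) <= E\<^sup>2" .
  qed
  show ?thesis
  proof (intro exI[of _ K] allI impI)
    fix s2 assume s2: "\<forall>s\<in>{s1<..<s2}. T - exp (- s) \<in> {\<alpha>..\<beta>}"
    have ab: "T - exp (- s) \<in> {a<..<b}" if "s \<in> {s1<..<s2}" for s using s2 that \<alpha>\<beta> by force
    note Kb = K0b[OF s2[rule_format]]
    let ?t = "%s. T - exp (- s)" and ?x = "%s y. x0 + exp (- s / 2) * y"
    show "ou_flow (%s y. w (?t s) (?x s y)) (%s y. exp (- s / 2) * wx (?t s) (?x s y))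
      (%s y. exp (- s) * wxx (?t s) (?x s y))
      (%s y. exp (- s) * wt (?t s) (?x s y) - y / 2 * (exp (- s / 2) * wx (?t s) (?x s y)))
      s1 s2 (C * (1 + exp (- s1 / 2))) K"
    proof
      fix s y assume s: "s \<in> {s1<..<s2}"
      note t = ab[OF s]
      have dx: "(?x s has_real_derivative exp (- s / 2)) (at y)" by (auto intro!: derivative_eq_intros)
      have dxs: "((%s. ?x s y) has_real_derivative - (y / 2 * exp (- s / 2))) (at s)"
        by (auto intro!: derivative_eq_intros)
      have dts: "(?t has_real_derivative exp (- s)) (at s)" by (auto intro!: derivative_eq_intros)
      show "((%y. w (?t s) (?x s y)) has_real_derivative exp (- s / 2) * wx (?t s) (?x s y)) (at y)"
        using DERIV_chain2[OF deriv_x[OF t] dx] by (simp add: mult.commute)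
      have "((%y. exp (- s / 2) * wx (?t s) (?x s y)) has_real_derivative exp (- s / 2) * (wxx (?t s) (?x s y) * exp (- s / 2))) (at y)"
        using DERIV_chain2[OF deriv_xx[OF t] dx] by (intro DERIV_cmult)
      moreover have "exp (- s / 2) * (wxx (?t s) (?x s y) * exp (- s / 2)) = exp (- s) * wxx (?t s) (?x s y)"
        by (simp add: mult_ac flip: exp_add)
      ultimately show "((%y. exp (- s / 2) * wx (?t s) (?x s y)) has_real_derivative exp (- s) * wxx (?t s) (?x s y)) (at y)"
        by (rule DERIV_cong)
      show "((%s. w (?t s) (?x s y)) has_real_derivative exp (- s) * wt (?t s) (?x s y)
         - y / 2 * (exp (- s / 2) * wx (?t s) (?x s y))) (at s)"
      proof (rule DERIV_cong)
        show "((%s. w (?t s) (?x s y)) has_real_derivative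
          wt (?t s) (?x s y) * exp (- s) + wx (?t s) (?x s y) * - (y / 2 * exp (- s / 2))) (at s)"
          by (rule DERIV_two_variables[where F = w and Fx = wx and \<tau> = ?t and \<xi> = "%s. ?x s y",
                OF t deriv_t[OF t] deriv_x cont_wx dts dxs])
      qed simp
      have cx: "continuous_on UNIV (%y. F (?t s) (?x s y))"
        if "continuous_on ({a<..<b} \<times> UNIV) (%(t, x). F t x)" for F :: "real => real => real"
        using isCont_joint[OF that, where \<tau> = "%_. ?t s" and \<xi> = "?x s"] t
        by (intro continuous_at_imp_continuous_on ballI) (auto intro!: continuous_intros)
      show "continuous_on UNIV (%y. exp (- s) * wxx (?t s) (?x s y))"
        "continuous_on UNIV (%y. exp (- s) * wt (?t s) (?x s y) - y / 2 * (exp (- s / 2) * wx (?t s) (?x s y)))"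
        using cx[OF cont_wxx] cx[OF cont_wt] cx[OF cont_wx] by (auto intro!: continuous_intros)
      show "isCont (%s. exp (- s / 2) * wx (?t s) (?x s y)) s"
        by (intro continuous_intros isCont_joint[OF cont_wx]) (use t in auto)
      show "isCont (%s. exp (- s) * wxx (?t s) (?x s y)) s"
        by (intro continuous_intros isCont_joint[OF cont_wxx]) (use t in auto)
      have up: "k <= K * exp (y\<^sup>2 / 64)" if "k <= K" for k
      proof -
        have "K >= 0" using KK K0 E by (meson order_trans)
        then have "K * 1 <= K * exp (y\<^sup>2 / 64)" by (intro mult_left_mono) auto
        then show ?thesis using that by simp
      qed
      show "\<bar>w (?t s) (?x s y)\<bar> <= K * exp (y\<^sup>2 / 64)" using Kb[OF s] KK by (intro up) (meson order_trans)
      have x1: "\<bar>exp (- s / 2) * wx (?t s) (?x s y)\<bar> <= E * K0"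
        unfolding abs_mult using e1[of s] s Kb[OF s] E by (intro mult_mono) auto
      then show "\<bar>exp (- s / 2) * wx (?t s) (?x s y)\<bar> <= K * exp (y\<^sup>2 / 64)" using KK by (intro up) (simp add: mult.commute)
      show "\<bar>exp (- s) * wxx (?t s) (?x s y)\<bar> <= K * exp (y\<^sup>2 / 64)"
      proof (rule up)
        have "\<bar>exp (- s) * wxx (?t s) (?x s y)\<bar> <= E\<^sup>2 * K0"
          unfolding abs_mult using e1[of s] s Kb[OF s] E by (intro mult_mono) auto
        then show "\<bar>exp (- s) * wxx (?t s) (?x s y)\<bar> <= K" using KK by (simp add: mult.commute)
      qed
      show "\<bar>exp (- s) * wt (?t s) (?x s y) - y / 2 * (exp (- s / 2) * wx (?t s) (?x s y))\<bar> <= K * exp (y\<^sup>2 / 64)"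
      proof -
        have 1: "\<bar>exp (- s) * wt (?t s) (?x s y)\<bar> <= E\<^sup>2 * K0"
          unfolding abs_mult using e1[of s] s Kb[OF s] E by (intro mult_mono) auto
        also have "\<dots> <= E\<^sup>2 * K0 * exp (y\<^sup>2 / 64)"
          using mult_left_mono[of 1 "exp (y\<^sup>2 / 64)" "E\<^sup>2 * K0"] K0 by simp
        finally have 1: "\<bar>exp (- s) * wt (?t s) (?x s y)\<bar> <= E\<^sup>2 * K0 * exp (y\<^sup>2 / 64)" .
        have "\<bar>y / 2 * (exp (- s / 2) * wx (?t s) (?x s y))\<bar> <= (K1 * exp (y\<^sup>2 / 64)) * (E * K0)"
          unfolding abs_mult[of "y / 2"]
        proof (rule mult_mono)
          show "\<bar>y / 2\<bar> <= K1 * exp (y\<^sup>2 / 64)" using K1(2)[of y] by linarith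
        qed (use x1 K1(1) in auto)
        also have "\<dots> <= (K1 * exp (y\<^sup>2 / 64)) * (E\<^sup>2 * K0)" using KK K1(1) by (intro mult_left_mono) (auto simp: mult.commute)
        finally show ?thesis using 1 unfolding K_def by (simp add: algebra_simps abs_le_iff)
      qed
      show "\<bar>exp (- s) * wt (?t s) (?x s y) - y / 2 * (exp (- s / 2) * wx (?t s) (?x s y))
          - (exp (- s) * wxx (?t s) (?x s y) - y / 2 * (exp (- s / 2) * wx (?t s) (?x s y)))\<bar>
        <= C * (1 + exp (- s1 / 2)) * exp (- s / 2) * (\<bar>w (?t s) (?x s y)\<bar> + \<bar>exp (- s / 2) * wx (?t s) (?x s y)\<bar>)"
      proof -
        let ?e = "exp (- s / 2)" and ?W = "\<bar>w (?t s) (?x s y)\<bar>" and ?X = "\<bar>wx (?t s) (?x s y)\<bar>"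
        have es: "exp (- s) = ?e * ?e" by (simp flip: exp_add)
        have "\<bar>exp (- s) * wt (?t s) (?x s y) - y / 2 * (?e * wx (?t s) (?x s y))
          - (exp (- s) * wxx (?t s) (?x s y) - y / 2 * (?e * wx (?t s) (?x s y)))\<bar>
          = exp (- s) * \<bar>wt (?t s) (?x s y) - wxx (?t s) (?x s y)\<bar>"
          by (simp add: abs_mult flip: right_diff_distrib)
        also have "\<dots> <= exp (- s) * (C * (?W + ?X))" using ineq[OF t] by (intro mult_left_mono) auto
        also have "\<dots> = C * ?e * (?e * ?W + ?e * ?X)" unfolding es by (simp add: algebra_simps)
        also have "\<dots> <= C * ?e * (E * ?W + E * (?e * ?X))"
        proof (intro mult_left_mono add_mono)
          show "?e * ?W <= E * ?W" using e1(1)[of s] s by (intro mult_right_mono) auto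
          show "?e * ?X <= E * (?e * ?X)" using mult_right_mono[of 1 E "?e * ?X"] E by simp
        qed (use C in auto)
        also have "\<dots> = C * E * ?e * (?W + \<bar>?e * wx (?t s) (?x s y)\<bar>)" by (simp add: algebra_simps abs_mult)
        finally show ?thesis unfolding E_def .
      qed
    qed (use C in auto)
  qed
qed

text \<open>Here the similarity variables are centred at a time T beyond t2, so that t2 corresponds
  to a finite s and positivity of the Gaussian norm there is enough.\<close>

lemma stays_nonzero:
  assumes "a < t1" "t1 <= t2" "t2 < b" and nz: "w t1 x1 ~= 0"
  shows "\<exists>x. w t2 x ~= 0"
proof -
  define T where "T = t2 + 1 + (b - t2)"
  define \<alpha> \<beta> where "\<alpha> = (a + t1) / 2" and "\<beta> = (t2 + b) / 2"
  have ab: "a < \<alpha>" "\<alpha> < t1" "t2 < \<beta>" "\<beta> < b" "\<beta> < T" using assms by (auto simp: \<alpha>_def \<beta>_def T_def)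
  define S where "S t = - ln (T - t)" for t
  have S: "exp (- S t) = T - t" if "t < T" for t using that by (simp add: S_def)
  have Smono: "S t < S t'" if "t < t'" "t' < T" for t t' using that by (simp add: S_def)
  have rng: "T - exp (- s) \<in> {\<alpha>..\<beta>}" if s: "s \<in> {S \<alpha><..<S \<beta>}" for s
  proof -
    have "exp (- S \<beta>) < exp (- s)" "exp (- s) < exp (- S \<alpha>)" using s by auto
    then show ?thesis using S[of \<alpha>] S[of \<beta>] ab assms by auto
  qed
  obtain K where o: "ou_flow (%s y. w (T - exp (- s)) (0 + exp (- s / 2) * y))
      (%s y. exp (- s / 2) * wx (T - exp (- s)) (0 + exp (- s / 2) * y))
      (%s y. exp (- s) * wxx (T - exp (- s)) (0 + exp (- s / 2) * y))
      (%s y. exp (- s) * wt (T - exp (- s)) (0 + exp (- s / 2) * y)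
         - y / 2 * (exp (- s / 2) * wx (T - exp (- s)) (0 + exp (- s / 2) * y)))
      (S \<alpha>) (S \<beta>) (C * (1 + exp (- S \<alpha> / 2))) K"
    using ou_flow_at[OF ab(1,4), of "S \<alpha>" T 0] rng by blast
  have i: "S t1 \<in> {S \<alpha><..<S \<beta>}" "S t2 \<in> {S \<alpha><..<S \<beta>}" "S t1 <= S t2"
    using ab assms Smono by (auto simp: S_def)
  have "exp (- S t1 / 2) > 0" by simp
  then have "\<exists>y. w (T - exp (- S t1)) (0 + exp (- S t1 / 2) * y) ~= 0"
    using nz S[of t1] ab assms by (intro exI[of _ "x1 / exp (- S t1 / 2)"]) auto
  then have "ou_flow.N (%s y. w (T - exp (- s)) (0 + exp (- s / 2) * y)) (S t1) > 0"
    using ou_flow.N_pos_iff[OF o i(1)] by simp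
  from ou_flow.N_stays_positive[OF o _ i(3) _ this]
  have "ou_flow.N (%s y. w (T - exp (- s)) (0 + exp (- s / 2) * y)) (S t2) > 0"
    using i(1,2) by simp
  then show ?thesis using ou_flow.N_pos_iff[OF o i(2)] S[of t2] ab by auto
qed

lemma blow_up:
  assumes T: "T \<in> {a<..<b}" and nz: "!!t. t \<in> {a<..<b} ==> \<exists>x. w t x ~= 0"
  shows "\<exists>k. \<forall>\<epsilon>>0. \<exists>\<sigma>. \<forall>s\<ge>\<sigma>. \<exists>s'\<in>{s..s + 1}. \<exists>m. m ~= 0 &
    (\<forall>y. \<bar>w (T - exp (- s')) (x0 + exp (- s' / 2) * y) / m - heat_poly k (-1) y\<bar> <= \<epsilon> * exp (y\<^sup>2 / 7))"
proof -
  define \<alpha> where "\<alpha> = (a + T) / 2"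
  have ab: "a < \<alpha>" "\<alpha> < T" "T < b" using T by (auto simp: \<alpha>_def)
  define s1 where "s1 = - ln (T - \<alpha>)"
  have rng: "T - exp (- s) \<in> {\<alpha>..T}" if "s > s1" for s
  proof -
    have "exp (- s) < exp (- s1)" using that by simp
    then show ?thesis using ab by (simp add: s1_def)
  qed
  then have rng': "\<forall>s\<in>{s1<..<s2}. T - exp (- s) \<in> {\<alpha>..T}" for s2 by auto
  obtain K where K: "!!s2. ou_flow (%s y. w (T - exp (- s)) (x0 + exp (- s / 2) * y))
      (%s y. exp (- s / 2) * wx (T - exp (- s)) (x0 + exp (- s / 2) * y))
      (%s y. exp (- s) * wxx (T - exp (- s)) (x0 + exp (- s / 2) * y))
      (%s y. exp (- s) * wt (T - exp (- s)) (x0 + exp (- s / 2) * y)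
         - y / 2 * (exp (- s / 2) * wx (T - exp (- s)) (x0 + exp (- s / 2) * y)))
      s1 s2 (C * (1 + exp (- s1 / 2))) K"
    using ou_flow_at[OF ab(1,3), of s1 T x0] rng' by blast
  have "\<exists>y. w (T - exp (- s)) (x0 + exp (- s / 2) * y) ~= 0" if "s > s1" for s
  proof -
    have "T - exp (- s) < b" using ab(3) exp_gt_zero[of "- s"] by linarith
    then have "T - exp (- s) \<in> {a<..<b}" using rng[OF that] ab(1) by auto
    then obtain x where "w (T - exp (- s)) x ~= 0" using nz by blast
    then show ?thesis by (intro exI[of _ "(x - x0) / exp (- s / 2)"]) auto
  qed
  from ou_flow_asymptotics[OF K this] show ?thesis .
qed

end

section \<open>Maximum principle estimates on rescaled times from -1 to 1/4\<close>

lemma heat_barrier_above: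
  fixes E Ex Exx Et :: "real => real => real"
  assumes cont: "continuous_on ({-1..1/4} \<times> UNIV) (%(t, x). E t x)"
    and dx: "!!t x. t \<in> {-1..1/4} ==> (E t has_real_derivative Ex t x) (at x)"
    and dxx: "!!t x. t \<in> {-1..1/4} ==> (Ex t has_real_derivative Exx t x) (at x)"
    and dt: "!!t x. t \<in> {-1..1/4} ==> ((%t. E t x) has_real_derivative Et t x) (at t)"
    and ineq: "!!t x. t \<in> {-1..1/4} ==> \<bar>Et t x - Exx t x\<bar> <= \<mu> * (\<bar>E t x\<bar> + \<bar>Ex t x\<bar> + K * exp (x\<^sup>2 / 7))"
    and init: "!!x. E (-1) x <= \<epsilon> * exp (x\<^sup>2 / 7)"
    and growth: "!!t x. t \<in> {-1..1/4} ==> \<bar>E t x\<bar> <= G * exp (x\<^sup>2 / 8)"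
    and cst: "0 <= \<mu>" "\<mu> <= 1/20" "\<epsilon> > 0" "K >= 0" "G >= 0"
    and t: "t \<in> {-1..1/4}"
  shows "E t x <= (\<epsilon> + \<mu> * K) * exp (x\<^sup>2 / (4 * (7/4 - 6/5 * (t + 1))) + 4 * (t + 1))"
proof -
  define A where "A = \<epsilon> + \<mu> * K"
  have A: "A > 0" "\<epsilon> <= A" "\<mu> * K <= A" using cst by (auto simp: A_def add_pos_nonneg)
  \<comment> \<open>The barrier is A * exp (x^2 / (4 * \<theta>) + 4 * (t + 1)). The start 7/4
    matches exp (x^2 / 7). The slope -6/5 instead of -1 leaves a surplus of (x / (2 * \<theta>))^2 /
    5 to absorb the gradient term, and 4 exceeds 1 / (2 * \<theta>) by at least 2, since \<theta>
    has only dropped to 1/4 at time 1/4.\<close>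
  define \<theta> where "\<theta> t = 7/4 - 6/5 * (t + 1)" for t :: real
  have \<theta>: "1/4 <= \<theta> t" "\<theta> t <= 7/4" if "t \<in> {-1..1/4}" for t using that by (auto simp: \<theta>_def)
  define \<phi> where "\<phi> t x = x\<^sup>2 / (4 * \<theta> t) + 4 * (t + 1)" for t x
  define B where "B t x = A * exp (\<phi> t x)" for t x
  have Bpos: "B t x > 0" for t x using A by (simp add: B_def)
  have \<phi>_ge: "x\<^sup>2 / 7 <= \<phi> t x" if "t \<in> {-1..1/4}" for t x
  proof -
    have "x\<^sup>2 / 7 <= x\<^sup>2 / (4 * \<theta> t)" using \<theta>[OF that] by (intro divide_left_mono) auto
    then show ?thesis using that by (simp add: \<phi>_def)
  qed
  have B_ge: "A * exp (x\<^sup>2 / 7) <= B t x" if "t \<in> {-1..1/4}" for t x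
    using A \<phi>_ge[OF that, of x] by (simp add: B_def)
  \<comment> \<open>Beyond R the a priori bound G * exp (x^2 / 8) lies below A * exp (x^2 / 7),
    again by 1/7 - 1/8 = 1/56; so only [-R, R] has to be examined.\<close>
  define R where "R = sqrt (56 * G / A) + 1"
  have R: "R >= 1" using A cst by (simp add: R_def)
  have far: "E t x < B t x" if t: "t \<in> {-1..1/4}" and x: "\<bar>x\<bar> >= R" for t x
  proof -
    have "sqrt (56 * G / A) < \<bar>x\<bar>" using x by (simp add: R_def)
    then have "56 * G / A < x\<^sup>2" using real_sqrt_less_iff[of "56 * G / A" "x\<^sup>2"] by simp
    then have "G / A < 1 + x\<^sup>2 / 56" by simp
    also have "\<dots> <= exp (x\<^sup>2 / 56)" by (rule exp_ge_add_one_self)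
    finally have "G < A * exp (x\<^sup>2 / 56)" using A by (simp add: field_simps)
    then have "G * exp (x\<^sup>2 / 8) < A * exp (x\<^sup>2 / 56) * exp (x\<^sup>2 / 8)" by simp
    also have "\<dots> = A * exp (x\<^sup>2 / 7)" by (simp add: mult.assoc flip: exp_add)
    finally show ?thesis using growth[OF t, of x] B_ge[OF t, of x] by linarith
  qed
  have contB: "continuous_on ({-1..1/4} \<times> UNIV) (%(t, x). E t x / B t x)"
  proof -
    have "continuous_on ({-1..1/4} \<times> UNIV) (%z. B (fst z) (snd z))"
      unfolding B_def \<phi>_def \<theta>_def by (intro continuous_intros) auto
    moreover have "continuous_on ({-1..1/4} \<times> UNIV) (%z. E (fst z) (snd z))"
      using cont by (simp add: case_prod_beta')
    ultimately have "continuous_on ({-1..1/4} \<times> UNIV) (%z. E (fst z) (snd z) / B (fst z) (snd z))"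
      using less_imp_neq[OF Bpos] by (intro continuous_on_divide) auto
    then show ?thesis by (simp add: case_prod_beta')
  qed
  have "\<exists>z\<in>{-1..1/4::real} \<times> {-R..R}. \<forall>y\<in>{-1..1/4} \<times> {-R..R}. (case y of (t, x) => E t x / B t x) <= (case z of (t, x) => E t x / B t x)"
    using R by (intro continuous_attains_sup compact_Times continuous_on_subset[OF contB]) auto
  then obtain t1 x1 where p: "t1 \<in> {-1..1/4}" "x1 \<in> {-R..R}"
    and sup: "!!t x. t \<in> {-1..1/4} ==> x \<in> {-R..R} ==> E t x / B t x <= E t1 x1 / B t1 x1" by auto
  \<comment> \<open>If \<kappa> exceeded 1, \<kappa> times the barrier would lie above E and touch
    it at (t1, x1); the derivative tests there contradict that the barrier is a strict
    supersolution.\<close>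
  define \<kappa> where "\<kappa> = E t1 x1 / B t1 x1"
  have "\<kappa> <= 1"
  proof (rule ccontr)
    assume "\<not> \<kappa> <= 1"
    then have \<kappa>: "\<kappa> > 1" by simp
    have le: "E t x <= \<kappa> * B t x" if t: "t \<in> {-1..1/4}" for t x
    proof (cases "x \<in> {-R..R}")
      case True
      then show ?thesis using sup[OF t True] Bpos[of t x] by (simp add: \<kappa>_def divide_le_eq)
    next
      case False
      then have "E t x < B t x" using far[OF t, of x] by auto
      also have "B t x <= \<kappa> * B t x" using \<kappa> Bpos[of t x] by simp
      finally show ?thesis by simp
    qed
    have eq: "E t1 x1 = \<kappa> * B t1 x1" using Bpos[of t1 x1] by (simp add: \<kappa>_def)
    have gt: "E t1 x1 > B t1 x1" using \<kappa> Bpos[of t1 x1] unfolding eq by simp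
    have t1: "t1 > -1"
    proof (rule ccontr)
      assume "\<not> t1 > -1"
      then have "t1 = -1" using p by simp
      then have "E t1 x1 <= A * exp (x1\<^sup>2 / 7)"
        using init[of x1] A(2) by (meson exp_ge_zero mult_right_mono order_trans)
      then show False using B_ge[OF p(1), of x1] gt by simp
    qed
    define px where "px = x1 / (2 * \<theta> t1)"
    have th: "\<theta> t1 > 0" "\<theta> t1 >= 1/4" using \<theta>[OF p(1)] by auto
    have dBx: "(B t1 has_real_derivative B t1 x * (x / (2 * \<theta> t1))) (at x)" for x
      unfolding B_def[abs_def] \<phi>_def[abs_def] using th(1) by (auto intro!: derivative_eq_intros)
    have dBxx: "((%x. B t1 x * (x / (2 * \<theta> t1))) has_real_derivative B t1 x1 * px\<^sup>2 + B t1 x1 / (2 * \<theta> t1)) (at x1)"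
    proof -
      have "((%x. x / (2 * \<theta> t1)) has_real_derivative 1 / (2 * \<theta> t1)) (at x1)"
        using th by (auto intro!: derivative_eq_intros)
      from DERIV_mult[OF dBx[of x1] this] show ?thesis
        by (rule DERIV_cong) (simp add: px_def power2_eq_square)
    qed
    have dBt: "((%t. B t x1) has_real_derivative B t1 x1 * (6/5 * px\<^sup>2 + 4)) (at t1)"
    proof -
      have "(\<theta> has_real_derivative - (6/5)) (at t1)"
        unfolding \<theta>_def[abs_def] by (auto intro!: derivative_eq_intros)
      then have "((%t. \<phi> t x1) has_real_derivative 6/5 * px\<^sup>2 + 4) (at t1)"
        unfolding \<phi>_def using th(1)
        by (auto intro!: derivative_eq_intros simp: px_def power2_eq_square field_simps)
      from DERIV_cmult[OF DERIV_fun_exp[OF this], of A] show ?thesis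
        unfolding B_def by (rule DERIV_cong) simp
    qed
    have s: "!!x. E t1 x - \<kappa> * B t1 x <= E t1 x1 - \<kappa> * B t1 x1" using le[OF p(1)] eq by simp
    have x: "Ex t1 x1 - \<kappa> * (B t1 x1 * px) = 0" and xx: "Exx t1 x1 - \<kappa> * (B t1 x1 * px\<^sup>2 + B t1 x1 / (2 * \<theta> t1)) <= 0"
    proof -
      have a: "((%x. E t1 x - \<kappa> * B t1 x) has_real_derivative Ex t1 x - \<kappa> * (B t1 x * (x / (2 * \<theta> t1)))) (at x)" for x
        using dx[OF p(1)] dBx by (intro DERIV_diff DERIV_cmult)
      have b: "((%x. Ex t1 x - \<kappa> * (B t1 x * (x / (2 * \<theta> t1)))) has_real_derivative
          Exx t1 x1 - \<kappa> * (B t1 x1 * px\<^sup>2 + B t1 x1 / (2 * \<theta> t1))) (at x1)"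
        using dxx[OF p(1)] dBxx by (intro DERIV_diff DERIV_cmult)
      show "Ex t1 x1 - \<kappa> * (B t1 x1 * px) = 0" "Exx t1 x1 - \<kappa> * (B t1 x1 * px\<^sup>2 + B t1 x1 / (2 * \<theta> t1)) <= 0"
        using second_derivative_test_max[OF zero_less_one a b s] by (auto simp: px_def)
    qed
    have tt: "Et t1 x1 - \<kappa> * (B t1 x1 * (6/5 * px\<^sup>2 + 4)) >= 0"
    proof (rule DERIV_nonneg_of_left_max[OF _ t1])
      show "((%t. E t x1 - \<kappa> * B t x1) has_real_derivative Et t1 x1 - \<kappa> * (B t1 x1 * (6/5 * px\<^sup>2 + 4))) (at t1)"
        using dt[OF p(1)] dBt by (intro DERIV_diff DERIV_cmult)
      show "E t x1 - \<kappa> * B t x1 <= E t1 x1 - \<kappa> * B t1 x1" if "-1 < t" "t <= t1" for t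
        using le[of t x1] that p eq by simp
    qed
    define b where "b = \<kappa> * B t1 x1"
    have b: "b > 0" using \<kappa> Bpos[of t1 x1] by (simp add: b_def)
    have "1 / (2 * \<theta> t1) <= 2" using th by (simp add: field_simps)
    then have "b * (1 / (2 * \<theta> t1)) <= b * 2" using b by (intro mult_left_mono) auto
    then have low: "b * (1/5 * px\<^sup>2 + 2) <= Et t1 x1 - Exx t1 x1"
      using xx tt by (simp add: b_def algebra_simps)
    have kb: "\<mu> * (K * exp (x1\<^sup>2 / 7)) <= b"
    proof -
      have "\<mu> * (K * exp (x1\<^sup>2 / 7)) <= A * exp (x1\<^sup>2 / 7)" using A(3) by (simp add: mult.assoc[symmetric])
      also have "\<dots> <= B t1 x1" by (rule B_ge[OF p(1)])
      also have "\<dots> <= b" using \<kappa> Bpos[of t1 x1] by (simp add: b_def)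
      finally show ?thesis .
    qed
    have "E t1 x1 = b" "Ex t1 x1 = b * px" using x eq by (auto simp: b_def)
    then have abs_eq: "\<bar>E t1 x1\<bar> = b" "\<bar>Ex t1 x1\<bar> = b * \<bar>px\<bar>" using b by (simp_all add: abs_mult)
    have "Et t1 x1 - Exx t1 x1 <= \<mu> * (b + b * \<bar>px\<bar> + K * exp (x1\<^sup>2 / 7))"
      using ineq[OF p(1), of x1] unfolding abs_eq by linarith
    also have "\<dots> = \<mu> * (b * (1 + \<bar>px\<bar>)) + \<mu> * (K * exp (x1\<^sup>2 / 7))"
      by (simp add: distrib_left)
    also have "\<dots> <= 1/20 * (b * (1 + \<bar>px\<bar>)) + b"
      using kb b cst by (intro add_mono mult_right_mono) auto
    also have "\<dots> <= b * (1/20 * (2 + px\<^sup>2) + 1)"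
    proof -
      have "0 <= px\<^sup>2 + 1 - 2 * \<bar>px\<bar>" using zero_le_power2[of "\<bar>px\<bar> - 1"] by (simp add: power2_diff)
      then have "\<bar>px\<bar> <= 1 + px\<^sup>2" using zero_le_power2[of px] by linarith
      then have "b * (1 + \<bar>px\<bar>) <= b * (2 + px\<^sup>2)" using b by (intro mult_left_mono) auto
      then have "1/20 * (b * (1 + \<bar>px\<bar>)) <= 1/20 * (b * (2 + px\<^sup>2))" by (rule mult_left_mono) simp
      moreover have "b * (1/20 * (2 + px\<^sup>2) + 1) = 1/20 * (b * (2 + px\<^sup>2)) + b" by (simp add: algebra_simps)
      ultimately show ?thesis by linarith
    qed
    finally have "b * (1/5 * px\<^sup>2 + 2) <= b * (1/20 * (2 + px\<^sup>2) + 1)" using low by linarith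
    then have "1/5 * px\<^sup>2 + 2 <= 1/20 * (2 + px\<^sup>2) + 1" using b by simp
    then show False using zero_le_power2[of px] unfolding distrib_left by linarith
  qed
  have "E t x <= B t x"
  proof (cases "x \<in> {-R..R}")
    case True
    then have "E t x / B t x <= 1" using sup[OF t True] \<open>\<kappa> <= 1\<close> by (simp add: \<kappa>_def)
    then show ?thesis using Bpos[of t x] by simp
  next
    case False
    then have "\<bar>x\<bar> >= R" by auto
    then show ?thesis using far[OF t, of x] by simp
  qed
  then show ?thesis by (simp add: B_def \<phi>_def \<theta>_def A_def)
qed

lemma heat_barrier:
  fixes E Ex Exx Et :: "real => real => real"
  assumes cont: "continuous_on ({-1..1/4} \<times> UNIV) (%(t, x). E t x)"
    and dx: "!!t x. t \<in> {-1..1/4} ==> (E t has_real_derivative Ex t x) (at x)"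
    and dxx: "!!t x. t \<in> {-1..1/4} ==> (Ex t has_real_derivative Exx t x) (at x)"
    and dt: "!!t x. t \<in> {-1..1/4} ==> ((%t. E t x) has_real_derivative Et t x) (at t)"
    and ineq: "!!t x. t \<in> {-1..1/4} ==> \<bar>Et t x - Exx t x\<bar> <= \<mu> * (\<bar>E t x\<bar> + \<bar>Ex t x\<bar> + K * exp (x\<^sup>2 / 7))"
    and init: "!!x. \<bar>E (-1) x\<bar> <= \<epsilon> * exp (x\<^sup>2 / 7)"
    and growth: "!!t x. t \<in> {-1..1/4} ==> \<bar>E t x\<bar> <= G * exp (x\<^sup>2 / 8)"
    and cst: "0 <= \<mu>" "\<mu> <= 1/20" "\<epsilon> > 0" "K >= 0" "G >= 0"
    and t: "t \<in> {-1..1/4}"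
  shows "\<bar>E t x\<bar> <= (\<epsilon> + \<mu> * K) * exp (x\<^sup>2 + 5)"
proof -
  have i: "E (-1) x <= \<epsilon> * exp (x\<^sup>2 / 7)" "- E (-1) x <= \<epsilon> * exp (x\<^sup>2 / 7)" for x
    using init[of x] by (auto simp: abs_le_iff)
  have up: "E t x <= (\<epsilon> + \<mu> * K) * exp (x\<^sup>2 / (4 * (7/4 - 6/5 * (t + 1))) + 4 * (t + 1))"
    by (rule heat_barrier_above[OF cont dx dxx dt ineq i(1) growth cst t])
  have "- E t x <= (\<epsilon> + \<mu> * K) * exp (x\<^sup>2 / (4 * (7/4 - 6/5 * (t + 1))) + 4 * (t + 1))"
  proof (rule heat_barrier_above[where Ex = "%t x. - Ex t x" and Exx = "%t x. - Exx t x" and Et = "%t x. - Et t x" and G = G])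
    show "continuous_on ({-1..1/4} \<times> UNIV) (%(t, x). - E t x)"
      using continuous_on_minus[OF cont] by (simp add: case_prod_beta')
    show "\<bar>- Et t x - - Exx t x\<bar> <= \<mu> * (\<bar>- E t x\<bar> + \<bar>- Ex t x\<bar> + K * exp (x\<^sup>2 / 7))" if "t \<in> {-1..1/4}" for t x
      using ineq[OF that, of x] by (simp add: abs_minus_commute)
  qed (use dx dxx dt i growth cst t in \<open>auto intro: DERIV_minus\<close>)
  then have "\<bar>E t x\<bar> <= (\<epsilon> + \<mu> * K) * exp (x\<^sup>2 / (4 * (7/4 - 6/5 * (t + 1))) + 4 * (t + 1))"
    using up by (simp add: abs_le_iff)
  also have "\<dots> <= (\<epsilon> + \<mu> * K) * exp (x\<^sup>2 + 5)"
  proof -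
    have "x\<^sup>2 / (4 * (7/4 - 6/5 * (t + 1))) <= x\<^sup>2 / 1" using t by (intro divide_left_mono) auto
    moreover have "4 * (t + 1) <= 5" using t by simp
    ultimately show ?thesis using cst by (intro mult_left_mono) auto
  qed
  finally show ?thesis .
qed

text \<open>The two-point maximum principle: \<open>E t x - E t y\<close> is compared with a concave function of
  \<open>x - y\<close>, plus terms that localise to the point \<open>(t1, z)\<close>.\<close>

lemma heat_gradient_bound_above:
  fixes E Ex Exx Et :: "real => real => real"
  assumes t01: "t0 < t1"
    and cont: "continuous_on ({t0..t1} \<times> {z - 1..z + 1}) (%(t, x). E t x)"
    and dx: "!!t x. t \<in> {t0..t1} ==> x \<in> {z - 1..z + 1} ==> (E t has_real_derivative Ex t x) (at x)"
    and dxx: "!!t x. t \<in> {t0..t1} ==> x \<in> {z - 1..z + 1} ==> (Ex t has_real_derivative Exx t x) (at x)"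
    and dt: "!!t x. t \<in> {t0..t1} ==> x \<in> {z - 1..z + 1} ==> ((%t. E t x) has_real_derivative Et t x) (at t)"
    and ineq: "!!t x. t \<in> {t0..t1} ==> x \<in> {z - 1..z + 1} ==> \<bar>Et t x - Exx t x\<bar> <= \<mu> * (K + \<bar>Ex t x\<bar>)"
    and bound: "!!t x. t \<in> {t0..t1} ==> x \<in> {z - 1..z + 1} ==> \<bar>E t x\<bar> <= \<epsilon>"
    and cst: "0 <= \<mu>" "\<mu> <= 1/8" "\<epsilon> > 0" "K >= 0"
  shows "Ex t1 z <= 2 * (2 * \<epsilon> / (t1 - t0) + 6 * \<epsilon> + \<mu> * K)"
proof -
  \<comment> \<open>Since E t x - E t y is at most 2 * \<epsilon>, a positive maximum of \<Phi> is
    kept off |x - z| = 1 and |y - z| = 1 by A1, off the initial time by A2, and off x - y = 1 by A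
    >= 2 * \<epsilon>. The weights in A make the inequality at an interior maximum fail.\<close>
  define A1 A2 A where "A1 = 2 * \<epsilon>" and "A2 = 2 * \<epsilon> / (t1 - t0)" and "A = A2 + 3 * A1 + \<mu> * K"
  have A12: "A1 > 0" "A2 > 0" "\<mu> * K >= 0" using cst t01 by (auto simp: A1_def A2_def)
  have A: "A >= 2 * \<epsilon>" "A > 0" using A12 by (auto simp: A_def A1_def)
  define B where "B t x y = A * (2 * (x - y) - (x - y)\<^sup>2) + A1 * ((x - z)\<^sup>2 + (y - z)\<^sup>2) + A2 * (t1 - t)" for t x y
  define I where "I = {z - 1..z + 1}"
  define S where "S = {p. fst (snd p) - snd (snd p) \<in> {0..1}} \<inter> ({t0..t1} \<times> I \<times> I)"
  define \<Phi> where "\<Phi> t x y = E t x - E t y - B t x y" for t x y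
  have "closed {p :: real \<times> real \<times> real. fst (snd p) - snd (snd p) \<in> {0..1}}"
    by (intro closed_Collect_conj closed_Collect_le continuous_intros | simp add: atLeastAtMost_iff)+
  then have "compact S" unfolding S_def I_def
    by (intro closed_Int_compact compact_Times) auto
  moreover have "(t1, z, z) \<in> S" using t01 by (auto simp: S_def I_def)
  moreover have "continuous_on S (%p. \<Phi> (fst p) (fst (snd p)) (snd (snd p)))"
  proof -
    have c: "continuous_on ({t0..t1} \<times> I) (%q. E (fst q) (snd q))" using cont by (simp add: case_prod_beta' I_def)
    have "continuous_on S (%p. E (fst (fst p, fst (snd p))) (snd (fst p, fst (snd p))))"
      by (rule continuous_on_compose2[OF c]) (auto simp: S_def intro!: continuous_intros)
    moreover have "continuous_on S (%p. E (fst (fst p, snd (snd p))) (snd (fst p, snd (snd p))))"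
      by (rule continuous_on_compose2[OF c]) (auto simp: S_def intro!: continuous_intros)
    ultimately show ?thesis unfolding \<Phi>_def B_def by (intro continuous_intros) auto
  qed
  ultimately obtain p where p: "p \<in> S" and sup: "!!q. q \<in> S ==> \<Phi> (fst q) (fst (snd q)) (snd (snd q)) <= \<Phi> (fst p) (fst (snd p)) (snd (snd p))"
    using continuous_attains_sup[of S] by blast
  obtain t x y where pt: "p = (t, x, y)" by (metis prod.exhaust)
  have r: "t \<in> {t0..t1}" "x \<in> I" "y \<in> I" "0 <= x - y" "x - y <= 1" using p by (auto simp: S_def pt)
  have sup: "\<Phi> t' x' y' <= \<Phi> t x y" if "t' \<in> {t0..t1}" "x' \<in> I" "y' \<in> I" "0 <= x' - y'" "x' - y' <= 1" for t' x' y'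
    using sup[of "(t', x', y')"] that by (auto simp: S_def pt)
  have "\<Phi> t x y <= 0"
  proof (rule ccontr)
    assume "\<not> \<Phi> t x y <= 0"
    then have pos: "E t x - E t y > B t x y" by (simp add: \<Phi>_def)
    have le2: "E t x - E t y <= 2 * \<epsilon>" using bound[OF r(1), of x] bound[OF r(1), of y] r by (auto simp: I_def abs_le_iff)
    have parts: "0 <= A * (2 * (x - y) - (x - y)\<^sup>2)" "0 <= A1 * ((x - z)\<^sup>2 + (y - z)\<^sup>2)" "0 <= A2 * (t1 - t)"
    proof -
      have "(x - y)\<^sup>2 <= 1 * (x - y)" unfolding power2_eq_square using r by (intro mult_right_mono) auto
      then show "0 <= A * (2 * (x - y) - (x - y)\<^sup>2)" using r A by (intro mult_nonneg_nonneg) auto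
    qed (use A12 r in auto)
    have x1: "x - y < 1"
    proof (rule ccontr)
      assume "\<not> x - y < 1"
      then have "x - y = 1" using r by simp
      then have "A * (2 * (x - y) - (x - y)\<^sup>2) = A" by simp
      then show False using pos le2 parts A unfolding B_def by linarith
    qed
    have x0: "x - y > 0"
    proof (rule ccontr)
      assume "\<not> x - y > 0"
      then have "x = y" using r by simp
      then show False using pos parts unfolding B_def by simp
    qed
    have in1: "\<bar>x - z\<bar> < 1" "\<bar>y - z\<bar> < 1"
    proof -
      have "(x - z)\<^sup>2 + (y - z)\<^sup>2 < 1"
      proof (rule ccontr)
        assume "\<not> (x - z)\<^sup>2 + (y - z)\<^sup>2 < 1"
        then have "A1 * 1 <= A1 * ((x - z)\<^sup>2 + (y - z)\<^sup>2)" using A12 by (intro mult_left_mono) auto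
        then show False using pos le2 parts unfolding B_def A1_def by linarith
      qed
      then have "(x - z)\<^sup>2 < 1" "(y - z)\<^sup>2 < 1" using zero_le_power2[of "x - z"] zero_le_power2[of "y - z"] by linarith+
      then show "\<bar>x - z\<bar> < 1" "\<bar>y - z\<bar> < 1" using abs_square_less_1 by auto
    qed
    have t0: "t0 < t"
    proof (rule ccontr)
      assume "\<not> t0 < t"
      then have "t = t0" using r by simp
      then have "A2 * (t1 - t) = 2 * \<epsilon>" using t01 by (simp add: A2_def)
      then show False using pos le2 parts unfolding B_def by linarith
    qed
    define e where "e = Min {1 - (x - y), x - y, 1 - \<bar>x - z\<bar>, 1 - \<bar>y - z\<bar>}"
    have "e > 0" unfolding e_def using x0 x1 in1 by (subst Min_gr_iff) auto
    have "e <= 1 - (x - y)" "e <= x - y" "e <= 1 - \<bar>x - z\<bar>" "e <= 1 - \<bar>y - z\<bar>" unfolding e_def by (rule Min_le; simp)+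
    note e = \<open>e > 0\<close> this
    have xin: "x' \<in> I" if "\<bar>x' - x\<bar> < e" for x' using that e by (auto simp: I_def abs_less_iff abs_if split: if_splits)
    have yin: "y' \<in> I" if "\<bar>y' - y\<bar> < e" for y' using that e by (auto simp: I_def abs_less_iff abs_if split: if_splits)
    have X: "Ex t x - (A * (2 - 2 * (x - y)) + A1 * (2 * (x - z))) = 0" "Exx t x - (- 2 * A + 2 * A1) <= 0"
    proof -
      have a: "((%x. \<Phi> t x y) has_real_derivative Ex t x' - (A * (2 - 2 * (x' - y)) + A1 * (2 * (x' - z)))) (at x')" if "\<bar>x' - x\<bar> < e" for x'
      proof -
        have "((%x. B t x y) has_real_derivative A * (2 - 2 * (x' - y)) + A1 * (2 * (x' - z))) (at x')"
          unfolding B_def by (auto intro!: derivative_eq_intros)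
        then show ?thesis
          unfolding \<Phi>_def using DERIV_diff[OF DERIV_diff[OF dx[OF r(1)] DERIV_const]] xin[OF that] by (simp add: I_def)
      qed
      have b: "((%x. Ex t x - (A * (2 - 2 * (x - y)) + A1 * (2 * (x - z)))) has_real_derivative Exx t x - (- 2 * A + 2 * A1)) (at x)"
      proof (rule DERIV_diff)
        show "((%x. A * (2 - 2 * (x - y)) + A1 * (2 * (x - z))) has_real_derivative - 2 * A + 2 * A1) (at x)"
          by (auto intro!: derivative_eq_intros)
      qed (use dxx[OF r(1)] r in \<open>simp add: I_def\<close>)
      have c: "\<Phi> t x' y <= \<Phi> t x y" if "\<bar>x' - x\<bar> < e" for x'
        using that e by (intro sup r xin) (auto simp: abs_less_iff)
      show "Ex t x - (A * (2 - 2 * (x - y)) + A1 * (2 * (x - z))) = 0" "Exx t x - (- 2 * A + 2 * A1) <= 0"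
        by (rule second_derivative_test_max(1)[where f' = "%x. Ex t x - (A * (2 - 2 * (x - y)) + A1 * (2 * (x - z)))", OF e(1) a b c], assumption+, rule second_derivative_test_max(2)[where f' = "%x. Ex t x - (A * (2 - 2 * (x - y)) + A1 * (2 * (x - z)))", OF e(1) a b c], assumption+)
    qed
    have Y: "- Ex t y - (- (A * (2 - 2 * (x - y))) + A1 * (2 * (y - z))) = 0" "- Exx t y - (- 2 * A + 2 * A1) <= 0"
    proof -
      have a: "((%y. \<Phi> t x y) has_real_derivative - Ex t y' - (- (A * (2 - 2 * (x - y'))) + A1 * (2 * (y' - z)))) (at y')" if "\<bar>y' - y\<bar> < e" for y'
      proof -
        have "((%y. B t x y) has_real_derivative - (A * (2 - 2 * (x - y'))) + A1 * (2 * (y' - z))) (at y')"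
          unfolding B_def by (auto intro!: derivative_eq_intros simp: algebra_simps)
        then have "((%y. E t x - E t y - B t x y) has_real_derivative 0 - Ex t y' - (- (A * (2 - 2 * (x - y'))) + A1 * (2 * (y' - z)))) (at y')"
          using dx[OF r(1)] yin[OF that] by (intro DERIV_diff DERIV_const) (auto simp: I_def)
        then show ?thesis unfolding \<Phi>_def by simp
      qed
      have b: "((%y. - Ex t y - (- (A * (2 - 2 * (x - y))) + A1 * (2 * (y - z)))) has_real_derivative - Exx t y - (- 2 * A + 2 * A1)) (at y)"
      proof (intro DERIV_diff DERIV_minus)
        show "((%y. - (A * (2 - 2 * (x - y))) + A1 * (2 * (y - z))) has_real_derivative - 2 * A + 2 * A1) (at y)"
          by (auto intro!: derivative_eq_intros)
      qed (use dxx[OF r(1)] r in \<open>simp add: I_def\<close>)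
      have c: "\<Phi> t x y' <= \<Phi> t x y" if "\<bar>y' - y\<bar> < e" for y'
        using that e by (intro sup r yin) (auto simp: abs_less_iff)
      show "- Ex t y - (- (A * (2 - 2 * (x - y))) + A1 * (2 * (y - z))) = 0" "- Exx t y - (- 2 * A + 2 * A1) <= 0"
        by (rule second_derivative_test_max(1)[where f' = "%y. - Ex t y - (- (A * (2 - 2 * (x - y))) + A1 * (2 * (y - z)))", OF e(1) a b c], assumption+, rule second_derivative_test_max(2)[where f' = "%y. - Ex t y - (- (A * (2 - 2 * (x - y))) + A1 * (2 * (y - z)))", OF e(1) a b c], assumption+)
    qed
    have T: "Et t x - Et t y + A2 >= 0"
    proof (rule DERIV_nonneg_of_left_max[OF _ t0])
      show "((%t. \<Phi> t x y) has_real_derivative Et t x - Et t y + A2) (at t)"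
      proof -
        have "((%t. B t x y) has_real_derivative - A2) (at t)"
          unfolding B_def by (auto intro!: derivative_eq_intros)
        then have "((%t. E t x - E t y - B t x y) has_real_derivative Et t x - Et t y - - A2) (at t)"
          using dt[OF r(1)] r by (intro DERIV_diff) (auto simp: I_def)
        then show ?thesis unfolding \<Phi>_def by simp
      qed
      show "\<Phi> t' x y <= \<Phi> t x y" if "t0 < t'" "t' <= t" for t' using that r by (intro sup) auto
    qed
    have g: "\<bar>Ex t x\<bar> <= 2 * A + 2 * A1" "\<bar>Ex t y\<bar> <= 2 * A + 2 * A1"
    proof -
      have 0: "0 <= A * (2 - 2 * (x - y))" "A * (2 - 2 * (x - y)) <= A * 2" using x0 x1 A by (auto intro: mult_nonneg_nonneg)
      have 1: "\<bar>A1 * (2 * (x - z))\<bar> <= A1 * 2" "\<bar>A1 * (2 * (y - z))\<bar> <= A1 * 2" using in1 A12 by (auto simp: abs_mult)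
      show "\<bar>Ex t x\<bar> <= 2 * A + 2 * A1" "\<bar>Ex t y\<bar> <= 2 * A + 2 * A1" using 0 1 X(1) Y(1) by linarith+
    qed
    have "Et t x - Exx t x <= \<mu> * (K + (2 * A + 2 * A1))" "- (Et t y - Exx t y) <= \<mu> * (K + (2 * A + 2 * A1))"
      using ineq[OF r(1), of x] ineq[OF r(1), of y] r g cst(1) mult_left_mono[of "K + \<bar>Ex t x\<bar>" "K + (2 * A + 2 * A1)" \<mu>]
        mult_left_mono[of "K + \<bar>Ex t y\<bar>" "K + (2 * A + 2 * A1)" \<mu>] by (auto simp: I_def)
    then have "4 * A - 4 * A1 - A2 <= 2 * (\<mu> * K) + \<mu> * (4 * A + 4 * A1)"
      using T X(2) Y(2) by (simp add: algebra_simps)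
    moreover have "\<mu> * (4 * A + 4 * A1) <= 1/8 * (4 * A + 4 * A1)" using cst A A12 by (intro mult_right_mono) auto
    moreover have "1/8 * (4 * A + 4 * A1) = A / 2 + A1 / 2" by simp
    ultimately show False using A12 A_def by linarith
  qed
  \<comment> \<open>At y = z and t = t1 the localising terms are of order \<xi>^2, so dividing by
    \<xi> and letting it tend to 0 leaves the slope 2 * A of the concave profile at 0.\<close>
  then have main: "E t1 (z + \<xi>) - E t1 z <= A * (2 * \<xi> - \<xi>\<^sup>2) + A1 * \<xi>\<^sup>2" if "0 < \<xi>" "\<xi> < 1" for \<xi>
    using sup[of t1 "z + \<xi>" z] that t01 unfolding \<Phi>_def B_def I_def by simp
  have "((%\<xi>. (E t1 (z + \<xi>) - E t1 z) / \<xi>) \<longlongrightarrow> Ex t1 z) (at_right 0)"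
    using dx[of t1 z] t01 unfolding DERIV_def by (auto intro: filterlim_mono at_le)
  moreover have "((%\<xi>. A * (2 - \<xi>) + A1 * \<xi>) \<longlongrightarrow> A * (2 - 0) + A1 * 0) (at_right 0)"
    by (intro tendsto_intros)
  moreover have "\<forall>\<^sub>F \<xi> in at_right 0. (E t1 (z + \<xi>) - E t1 z) / \<xi> <= A * (2 - \<xi>) + A1 * \<xi>"
    using eventually_at_right_real[of 0 "1::real", OF zero_less_one]
  proof eventually_elim
    case (elim \<xi>)
    then have "E t1 (z + \<xi>) - E t1 z <= (A * (2 - \<xi>) + A1 * \<xi>) * \<xi>"
      using main[of \<xi>] by (simp add: power2_eq_square algebra_simps)
    then show ?case using elim by (simp add: divide_le_eq)
  qed
  ultimately have "Ex t1 z <= A * (2 - 0) + A1 * 0" by (intro tendsto_le[OF trivial_limit_at_right_real])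
  then show ?thesis by (simp add: A_def A1_def A2_def)
qed

lemma heat_gradient_bound:
  fixes E Ex Exx Et :: "real => real => real"
  assumes t01: "t0 < t1"
    and cont: "continuous_on ({t0..t1} \<times> {z - 1..z + 1}) (%(t, x). E t x)"
    and dx: "!!t x. t \<in> {t0..t1} ==> x \<in> {z - 1..z + 1} ==> (E t has_real_derivative Ex t x) (at x)"
    and dxx: "!!t x. t \<in> {t0..t1} ==> x \<in> {z - 1..z + 1} ==> (Ex t has_real_derivative Exx t x) (at x)"
    and dt: "!!t x. t \<in> {t0..t1} ==> x \<in> {z - 1..z + 1} ==> ((%t. E t x) has_real_derivative Et t x) (at t)"
    and ineq: "!!t x. t \<in> {t0..t1} ==> x \<in> {z - 1..z + 1} ==> \<bar>Et t x - Exx t x\<bar> <= \<mu> * (K + \<bar>Ex t x\<bar>)"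
    and bound: "!!t x. t \<in> {t0..t1} ==> x \<in> {z - 1..z + 1} ==> \<bar>E t x\<bar> <= \<epsilon>"
    and cst: "0 <= \<mu>" "\<mu> <= 1/8" "\<epsilon> > 0" "K >= 0"
  shows "\<bar>Ex t1 z\<bar> <= 2 * (2 * \<epsilon> / (t1 - t0) + 6 * \<epsilon> + \<mu> * K)"
proof -
  have "Ex t1 z <= 2 * (2 * \<epsilon> / (t1 - t0) + 6 * \<epsilon> + \<mu> * K)"
    by (rule heat_gradient_bound_above[OF t01 cont dx dxx dt ineq bound cst])
  moreover have "- Ex t1 z <= 2 * (2 * \<epsilon> / (t1 - t0) + 6 * \<epsilon> + \<mu> * K)"
  proof (rule heat_gradient_bound_above[OF t01, where E = "%t x. - E t x" and Exx = "%t x. - Exx t x" and Et = "%t x. - Et t x" and Ex = "%t x. - Ex t x"])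
    show "continuous_on ({t0..t1} \<times> {z - 1..z + 1}) (%(t, x). - E t x)"
      using continuous_on_minus[OF cont] by (simp add: case_prod_beta')
    show "\<bar>- Et t x - - Exx t x\<bar> <= \<mu> * (K + \<bar>- Ex t x\<bar>)" if "t \<in> {t0..t1}" "x \<in> {z - 1..z + 1}" for t x
      using ineq[OF that] by (simp add: abs_minus_commute)
  qed (use dx dxx dt bound cst in \<open>auto intro: DERIV_minus\<close>)
  ultimately show ?thesis by (simp add: abs_le_iff)
qed

text \<open>By scaling, the value at Y is Y ^ k times the value at time -1 / Y^2 and position 1,
  which tends to 1.\<close>

lemma heat_poly_eventually_pos: "\<exists>Y0>0. \<forall>Y\<ge>Y0. heat_poly k (-1) Y > 0"
proof -
  have "continuous_on UNIV (%t. heat_poly k t 1)"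
    by (intro heat_poly_continuous continuous_on_id continuous_on_const)
  then have "isCont (%t. heat_poly k t 1) 0" by (simp add: continuous_on_eq_continuous_at)
  have "((%Y::real. - 1 / Y\<^sup>2) \<longlongrightarrow> 0) at_top" by real_asymp
  from isCont_tendsto_compose[OF \<open>isCont _ 0\<close> this]
  have "((%Y. heat_poly k (- 1 / Y\<^sup>2) 1) \<longlongrightarrow> 1) at_top" by simp
  then have "\<forall>\<^sub>F Y in at_top. heat_poly k (- 1 / Y\<^sup>2) 1 > 0" by (rule order_tendstoD) simp
  then have "\<forall>\<^sub>F Y in at_top. heat_poly k (-1) Y > 0"
    using eventually_gt_at_top[of 0]
  proof eventually_elim
    case (elim Y)
    then show ?case using heat_poly_scale[of k Y "- 1 / Y\<^sup>2" 1] by simp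
  qed
  then obtain Y0 where "!!Y. Y >= Y0 ==> heat_poly k (-1) Y > 0" by (auto simp: eventually_at_top_linorder)
  then show ?thesis by (intro exI[of _ "max Y0 1"]) auto
qed

text \<open>Positivity far out and parity give the outer signs. The missing negative value comes
  from orthogonality to degree 0 (k even) or degree 1 (k odd): without it the integrand of a
  vanishing integral would be nonnegative.\<close>

lemma heat_poly_sign_changes:
  assumes "k >= 2"
  shows "\<exists>y1 y2 y3. y1 < y2 & y2 < y3 & heat_poly k (-1) y1 * heat_poly k (-1) y2 < 0 &
    heat_poly k (-1) y2 * heat_poly k (-1) y3 < 0"
proof -
  let ?h = "heat_poly k (-1)"
  obtain Y0 where Y0: "Y0 > 0" "!!Y. Y >= Y0 ==> ?h Y > 0" using heat_poly_eventually_pos by blast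
  have int: "integrable gauss (%y. ?h y * heat_poly j (-1) y)" for j
    using integrable_gauss_growth[OF exp_growth_mult[OF heat_poly_growth[of "1/32" k] heat_poly_growth[of "1/32" j]]] by auto
  have cont: "continuous_on UNIV (%y. ?h y * heat_poly j (-1) y)" for j
    by (intro continuous_on_mult heat_poly_cont)
  show ?thesis
  proof (cases "even k")
    case True
    have "\<exists>y. ?h y < 0"
    proof (rule ccontr)
      assume "\<not> (\<exists>y. ?h y < 0)"
      then have "?h Y0 * heat_poly 0 (-1) Y0 = 0"
        using gauss_integral_eq_0_iff[OF cont _ int, of 0] gauss_heat_poly_orthogonal[of 0 k] assms
        by (simp add: not_less)
      then show False using Y0(2)[of Y0] by simp
    qed
    then obtain y where y: "?h y < 0" by blast
    define Y where "Y = max Y0 (\<bar>y\<bar> + 1)"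
    have Y: "?h Y > 0" "?h (- Y) > 0" "- Y < y" "y < Y"
      using Y0(2)[of Y] heat_poly_minus[of k "-1" Y] True by (auto simp: Y_def)
    then show ?thesis using y by (intro exI[of _ "- Y"] exI[of _ y] exI[of _ Y]) (auto simp: mult_pos_neg mult_neg_pos)
  next
    case False
    have minus: "?h (- y) = - ?h y" for y using heat_poly_minus[of k "-1" y] False by simp
    have "\<exists>y>0. ?h y < 0"
    proof (rule ccontr)
      assume "\<not> (\<exists>y>0. ?h y < 0)"
      then have h: "?h y >= 0" if "y > 0" for y using that by force
      have "?h y * heat_poly (Suc 0) (-1) y >= 0" for y
        using h[of y] h[of "- y"] minus[of y] by (cases "y > 0"; cases "y = 0") (auto intro: mult_nonneg_nonneg mult_nonpos_nonpos)
      then have "?h Y0 * heat_poly (Suc 0) (-1) Y0 = 0"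
        using gauss_integral_eq_0_iff[OF cont _ int, of "Suc 0"] gauss_heat_poly_orthogonal[of "Suc 0" k] assms by simp
      then show False using Y0(2)[of Y0] Y0(1) by simp
    qed
    then obtain y where y: "y > 0" "?h y < 0" by blast
    define Y where "Y = max Y0 (y + 1)"
    have Y: "?h Y > 0" "y < Y" using Y0(2)[of Y] by (auto simp: Y_def)
    then show ?thesis using y minus[of y] mult_pos_neg[of "- ?h y" "?h y"] mult_neg_pos[of "?h y" "?h Y"]
      by (intro exI[of _ "- y"] exI[of _ y] exI[of _ Y]) simp
  qed
qed

section \<open>Blow-up at a point, before and after its time\<close>

locale parabolic_nonzero = parabolic_strip +
  assumes nonzero: "t \<in> {a<..<b} ==> \<exists>x. w t x ~= 0"
begin

text \<open>\<open>blow_up\<close> gives closeness at rescaled time -1 only, and for one scale in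
  each s-window of length 1, that is, up to a factor exp (1/2) <= 2 in r.
  \<open>heat_barrier\<close> carries it through time 0 to time 1/4, and
  \<open>heat_gradient_bound\<close>, after a waiting time of 1/2, adds the derivative.\<close>

lemma blow_up_uniform:
  assumes T: "T \<in> {a<..<b}"
  shows "\<exists>k. \<forall>R\<ge>0. \<forall>\<eta>>0. \<exists>\<rho>0>0. \<forall>\<rho>. 0 < \<rho> --> \<rho> < \<rho>0 --> (\<exists>r\<in>{\<rho>..2 * \<rho>}. \<exists>m. m ~= 0 &
    (\<forall>t\<in>{-1..1/4}. \<forall>x. \<bar>x\<bar> <= R --> \<bar>w (T + r\<^sup>2 * t) (x0 + r * x) / m - heat_poly k t x\<bar> <= \<eta>) &
    (\<forall>t\<in>{-1/2..1/4}. \<forall>x. \<bar>x\<bar> <= R -->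
       \<bar>r * wx (T + r\<^sup>2 * t) (x0 + r * x) / m - real k * heat_poly (k - 1) t x\<bar> <= \<eta>))"
proof -
  obtain k where k: "!!\<epsilon>. \<epsilon> > 0 ==> \<exists>\<sigma>. \<forall>s\<ge>\<sigma>. \<exists>s'\<in>{s..s + 1}. \<exists>m. m ~= 0 &
    (\<forall>y. \<bar>w (T - exp (- s')) (x0 + exp (- s' / 2) * y) / m - heat_poly k (-1) y\<bar> <= \<epsilon> * exp (y\<^sup>2 / 7))"
    using blow_up[OF T nonzero, of x0] by blast
  obtain K1 where K1: "K1 >= 0" "!!t x. \<bar>t\<bar> <= 1 ==> \<bar>heat_poly k t x\<bar> <= K1 * exp (1/8 * x\<^sup>2)"
    using heat_poly_bound[of "1/8" k] by auto
  obtain K2 where K2: "K2 >= 0" "!!t x. \<bar>t\<bar> <= 1 ==> \<bar>heat_poly (k - 1) t x\<bar> <= K2 * exp (1/8 * x\<^sup>2)"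
    using heat_poly_bound[of "1/8" "k - 1"] by auto
  define K where "K = K1 + real k * K2"
  have K: "K >= 0" using K1 K2 by (simp add: K_def)
  define d where "d = min 1 (min (T - a) (b - T) / 2)"
  have d: "0 < d" "d <= 1" "a < T - d" "T + d < b" using T by (auto simp: d_def min_def field_simps)
  obtain K0 where K0: "K0 >= 0" "!!t x. t \<in> {T - d..T + d} ==> \<bar>w t x\<bar> <= K0"
    using bounds[OF d(3,4)] by blast
  show ?thesis
  proof (rule exI[of _ k], intro allI impI)
    fix R \<eta> :: real assume R: "R >= 0" and \<eta>: "\<eta> > 0"
    define M where "M = exp ((R + 1)\<^sup>2 + 5)"
    define K' where "K' = K * exp ((R + 1)\<^sup>2 / 7)"
    \<comment> \<open>The gradient estimate below ends with 20 * \<eta>' + \<eta> / 2; the divisor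
      40 keeps this at most \<eta>.\<close>
    define \<eta>' where "\<eta>' = min \<eta> 1 / 40"
    have M: "M >= 1" "K' >= 0" "\<eta>' > 0" "\<eta>' <= 1" "20 * \<eta>' <= \<eta> / 2" "\<eta>' <= \<eta>" using K \<eta> by (auto simp: M_def K'_def \<eta>'_def min_def)
    define \<epsilon> where "\<epsilon> = \<eta>' / (2 * M)"
    have \<epsilon>: "\<epsilon> > 0" "\<epsilon> * M = \<eta>' / 2" using M by (auto simp: \<epsilon>_def)
    \<comment> \<open>An upper bound for the rescaled coefficient C * r: 1/20 is what the barrier
      admits, the second term serves the gradient estimate, the third the error \<mu> * K of the
      barrier.\<close>
    define \<mu>0 where "\<mu>0 = min (1/20) (min (\<eta> / (4 * (1 + K'))) (\<eta>' / (2 * (K + 1) * M)))"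
    have \<mu>0: "\<mu>0 > 0" "\<mu>0 <= 1/20" "\<mu>0 <= \<eta> / (4 * (1 + K'))" "\<mu>0 <= \<eta>' / (2 * (K + 1) * M)"
    proof -
      show "\<mu>0 > 0" using \<eta> M K by (auto simp: \<mu>0_def)
      show "\<mu>0 <= 1/20" "\<mu>0 <= \<eta> / (4 * (1 + K'))" "\<mu>0 <= \<eta>' / (2 * (K + 1) * M)"
        unfolding \<mu>0_def by (rule min.cobounded1 min.coboundedI1[OF order_refl] min.coboundedI2[OF min.cobounded1] min.coboundedI2[OF min.cobounded2])+
    qed
    obtain \<sigma> where \<sigma>: "!!s. s >= \<sigma> ==> \<exists>s'\<in>{s..s + 1}. \<exists>m. m ~= 0 &
      (\<forall>y. \<bar>w (T - exp (- s')) (x0 + exp (- s' / 2) * y) / m - heat_poly k (-1) y\<bar> <= \<epsilon> * exp (y\<^sup>2 / 7))"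
      using k[OF \<epsilon>(1)] by blast
    define \<rho>0 where "\<rho>0 = min (\<mu>0 / (2 * (C + 1))) (min (d / 2) (exp (- (\<sigma> + 1) / 2)))"
    have \<rho>0: "\<rho>0 > 0" "\<rho>0 <= \<mu>0 / (2 * (C + 1))" "\<rho>0 <= d / 2" "\<rho>0 <= exp (- (\<sigma> + 1) / 2)"
    proof -
      show "\<rho>0 > 0" using \<mu>0(1) C d by (auto simp: \<rho>0_def)
      show "\<rho>0 <= \<mu>0 / (2 * (C + 1))" "\<rho>0 <= d / 2" "\<rho>0 <= exp (- (\<sigma> + 1) / 2)"
        unfolding \<rho>0_def by (rule min.cobounded1 min.coboundedI2[OF min.cobounded1] min.coboundedI2[OF min.cobounded2])+
    qed
    show "\<exists>\<rho>0>0. \<forall>\<rho>. 0 < \<rho> --> \<rho> < \<rho>0 --> (\<exists>r\<in>{\<rho>..2 * \<rho>}. \<exists>m. m ~= 0 &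
      (\<forall>t\<in>{-1..1/4}. \<forall>x. \<bar>x\<bar> <= R --> \<bar>w (T + r\<^sup>2 * t) (x0 + r * x) / m - heat_poly k t x\<bar> <= \<eta>) &
      (\<forall>t\<in>{-1/2..1/4}. \<forall>x. \<bar>x\<bar> <= R -->
         \<bar>r * wx (T + r\<^sup>2 * t) (x0 + r * x) / m - real k * heat_poly (k - 1) t x\<bar> <= \<eta>))"
    proof (rule exI[of _ \<rho>0], intro conjI \<rho>0(1) allI impI)
      fix \<rho> :: real assume \<rho>: "0 < \<rho>" "\<rho> < \<rho>0"
      have "ln \<rho> < - (\<sigma> + 1) / 2"
        using \<rho> \<rho>0(4) ln_less_cancel_iff[of \<rho> "exp (- (\<sigma> + 1) / 2)"] by simp
      \<comment> \<open>The unit window starting here makes r = exp (- s' / 2) lie between \<rho>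
        and exp (1/2) * \<rho>.\<close>
      then have "- 2 * ln \<rho> - 1 >= \<sigma>" by simp
      from \<sigma>[OF this] obtain s' m where s': "- 2 * ln \<rho> - 1 <= s'" "s' <= - 2 * ln \<rho>" and m: "m ~= 0"
        and init0: "!!y. \<bar>w (T - exp (- s')) (x0 + exp (- s' / 2) * y) / m - heat_poly k (-1) y\<bar> <= \<epsilon> * exp (y\<^sup>2 / 7)"
        by auto
      define r where "r = exp (- s' / 2)"
      have r2: "exp (- s') = r\<^sup>2" by (simp add: r_def flip: exp_double)
      have rr: "r \<in> {\<rho>..2 * \<rho>}"
      proof -
        have "exp (ln \<rho>) <= r" "r <= exp (ln \<rho> + 1/2)" unfolding r_def using s' by (auto simp del: exp_ln)
        moreover have "exp (ln \<rho> + 1/2) <= \<rho> * 2"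
          unfolding exp_add using \<rho> exp_half_le2 by (intro mult_mono) auto
        ultimately show ?thesis using \<rho> by auto
      qed
      have rpos: "r > 0" by (simp add: r_def)
      have rd: "r <= d" "r <= 1" using rr \<rho> \<rho>0(3) d by auto
      have r2d: "r\<^sup>2 <= d" using rd rpos mult_mono[of r 1 r d] by (simp add: power2_eq_square)
      have "2 * (\<mu>0 / (2 * (C + 1))) = \<mu>0 / (C + 1)" using C by (simp add: field_simps)
      then have "r <= \<mu>0 / (C + 1)" using rr \<rho> \<rho>0(2) by auto
      then have "C * r <= C * (\<mu>0 / (C + 1))" using C by (rule mult_left_mono)
      also have "\<dots> <= \<mu>0" using C \<mu>0(1) by (simp add: field_simps)
      finally have \<mu>: "C * r <= \<mu>0" "C * r >= 0" using C rpos by auto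
      define tt where "tt t = T + r\<^sup>2 * t" for t
      have tt: "tt t \<in> {T - d..T + d}" "tt t \<in> {a<..<b}" if "t \<in> {-1..1/4}" for t
      proof -
        have "\<bar>r\<^sup>2 * t\<bar> <= r\<^sup>2 * 1" unfolding abs_mult using that by (intro mult_mono) auto
        then have "\<bar>r\<^sup>2 * t\<bar> <= d" using r2d by simp
        then show "tt t \<in> {T - d..T + d}" by (auto simp: tt_def abs_le_iff)
        then show "tt t \<in> {a<..<b}" using d by auto
      qed
      define xx where "xx x = x0 + r * x" for x
      define E where "E t x = w (tt t) (xx x) / m - heat_poly k t x" for t x
      define Ex where "Ex t x = r * wx (tt t) (xx x) / m - real k * heat_poly (k - 1) t x" for t x
      define Exx where "Exx t x = r\<^sup>2 * wxx (tt t) (xx x) / m - real k * real (k - 1) * heat_poly (k - 2) t x" for t x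
      define Et where "Et t x = r\<^sup>2 * wt (tt t) (xx x) / m - real k * real (k - 1) * heat_poly (k - 2) t x" for t x
      have dxx': "(xx has_real_derivative r) (at x)" for x unfolding xx_def[abs_def] by (auto intro!: derivative_eq_intros)
      have dtt: "(tt has_real_derivative r\<^sup>2) (at t)" for t unfolding tt_def[abs_def] by (auto intro!: derivative_eq_intros)
      have dx: "(E t has_real_derivative Ex t x) (at x)" if t: "t \<in> {-1..1/4}" for t x
        unfolding E_def[abs_def] Ex_def using DERIV_chain2[OF deriv_x[OF tt(2)[OF t]] dxx'[of x]]
        by (intro DERIV_diff heat_poly_deriv_x DERIV_cdivide) (simp add: mult.commute)
      have dxx: "(Ex t has_real_derivative Exx t x) (at x)" if t: "t \<in> {-1..1/4}" for t x
        unfolding Ex_def[abs_def] Exx_def using DERIV_cmult[OF DERIV_chain2[OF deriv_xx[OF tt(2)[OF t]] dxx'[of x]], of r]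
        by (intro DERIV_diff heat_poly_deriv_xx DERIV_cdivide) (simp add: power2_eq_square mult_ac)
      have dt: "((%t. E t x) has_real_derivative Et t x) (at t)" if t: "t \<in> {-1..1/4}" for t x
        unfolding E_def[abs_def] Et_def using DERIV_chain2[OF deriv_t[OF tt(2)[OF t], of "xx x"] dtt[of t]]
        by (intro DERIV_diff heat_poly_deriv_t DERIV_cdivide) (simp add: mult.commute)
      have cont: "continuous_on ({-1..1/4} \<times> UNIV) (%(t, x). E t x)"
      proof -
        have "continuous_on ({-1..1/4} \<times> UNIV) (%p. (%(t, x). w t x) (tt (fst p), xx (snd p)))"
          using tt by (intro continuous_on_compose2[OF cont_w]) (auto simp: tt_def xx_def intro!: continuous_intros)
        then have "continuous_on ({-1..1/4} \<times> UNIV) (%p. w (tt (fst p)) (xx (snd p)) / m - heat_poly k (fst p) (snd p))"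
          using m by (intro continuous_on_diff continuous_on_divide heat_poly_continuous continuous_on_const continuous_on_fst continuous_on_snd continuous_on_id) auto
        then show ?thesis by (simp add: E_def case_prod_beta')
      qed
      have Hb: "\<bar>heat_poly k t x\<bar> + \<bar>real k * heat_poly (k - 1) t x\<bar> <= K * exp (x\<^sup>2 / 7)" if t: "t \<in> {-1..1/4}" for t x
      proof -
        have t1: "\<bar>t\<bar> <= 1" using t by auto
        have "\<bar>real k * heat_poly (k - 1) t x\<bar> <= real k * (K2 * exp (1/8 * x\<^sup>2))"
          unfolding abs_mult using K2(2)[OF t1, of x] by (intro mult_mono) auto
        then have "\<bar>heat_poly k t x\<bar> + \<bar>real k * heat_poly (k - 1) t x\<bar> <= K * exp (1/8 * x\<^sup>2)"
          using K1(2)[OF t1, of x] unfolding K_def by (simp add: algebra_simps)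
        also have "\<dots> <= K * exp (x\<^sup>2 / 7)" using K by (intro mult_left_mono) auto
        finally show ?thesis .
      qed
      have tri: "\<bar>u\<bar> <= \<bar>u - v\<bar> + \<bar>v\<bar>" for u v :: real by linarith
      have ineq': "\<bar>Et t x - Exx t x\<bar> <= C * r * (\<bar>E t x\<bar> + \<bar>Ex t x\<bar> + K * exp (x\<^sup>2 / 7))" if t: "t \<in> {-1..1/4}" for t x
      proof -
        let ?W = "w (tt t) (xx x) / m" and ?X = "r * wx (tt t) (xx x) / m"
        have "Et t x - Exx t x = r\<^sup>2 * (wt (tt t) (xx x) - wxx (tt t) (xx x)) / m"
          by (simp add: Et_def Exx_def diff_divide_distrib right_diff_distrib)
        then have "\<bar>Et t x - Exx t x\<bar> = r\<^sup>2 * \<bar>wt (tt t) (xx x) - wxx (tt t) (xx x)\<bar> / \<bar>m\<bar>" by (simp add: abs_mult)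
        also have "\<dots> <= r\<^sup>2 * (C * (\<bar>w (tt t) (xx x)\<bar> + \<bar>wx (tt t) (xx x)\<bar>)) / \<bar>m\<bar>"
          using ineq[OF tt(2)[OF t], of "xx x"] by (intro divide_right_mono mult_left_mono) auto
        also have "\<dots> = C * r * (r * \<bar>?W\<bar> + \<bar>?X\<bar>)"
          using m rpos by (simp add: abs_mult field_simps power2_eq_square)
        also have "\<dots> <= C * r * (1 * \<bar>?W\<bar> + \<bar>?X\<bar>)"
          using \<mu>(2) rd by (intro mult_left_mono add_right_mono mult_right_mono) auto
        also have "\<dots> <= C * r * (\<bar>E t x\<bar> + \<bar>Ex t x\<bar> + K * exp (x\<^sup>2 / 7))"
        proof (rule mult_left_mono[OF _ \<mu>(2)])
          have "\<bar>?W\<bar> <= \<bar>E t x\<bar> + \<bar>heat_poly k t x\<bar>" "\<bar>?X\<bar> <= \<bar>Ex t x\<bar> + \<bar>real k * heat_poly (k - 1) t x\<bar>"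
            unfolding E_def Ex_def by (rule tri)+
          then show "1 * \<bar>?W\<bar> + \<bar>?X\<bar> <= \<bar>E t x\<bar> + \<bar>Ex t x\<bar> + K * exp (x\<^sup>2 / 7)"
            using Hb[OF t, of x] by linarith
        qed
        finally show ?thesis .
      qed
      have init: "\<bar>E (-1) x\<bar> <= \<epsilon> * exp (x\<^sup>2 / 7)" for x
        using init0[of x] unfolding E_def tt_def xx_def r2 r_def[symmetric] by simp
      have growth: "\<bar>E t x\<bar> <= (K0 / \<bar>m\<bar> + K1) * exp (x\<^sup>2 / 8)" if t: "t \<in> {-1..1/4}" for t x
      proof -
        have t1: "\<bar>t\<bar> <= 1" using t by auto
        have "\<bar>w (tt t) (xx x) / m\<bar> <= K0 / \<bar>m\<bar>"
          using K0(2)[OF tt(1)[OF t]] by (simp add: divide_right_mono)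
        also have "\<dots> <= K0 / \<bar>m\<bar> * exp (x\<^sup>2 / 8)" using K0(1) mult_left_mono[of 1 "exp (x\<^sup>2 / 8)" "K0 / \<bar>m\<bar>"] by simp
        finally have 1: "\<bar>w (tt t) (xx x) / m\<bar> <= K0 / \<bar>m\<bar> * exp (x\<^sup>2 / 8)" .
        have 2: "\<bar>heat_poly k t x\<bar> <= K1 * exp (x\<^sup>2 / 8)" using K1(2)[OF t1, of x] by simp
        show ?thesis using abs_triangle_ineq4[of "w (tt t) (xx x) / m" "heat_poly k t x"] 1 2
          unfolding E_def distrib_right by linarith
      qed
      have Eb: "\<bar>E t x\<bar> <= \<eta>'" if t: "t \<in> {-1..1/4}" and x: "\<bar>x\<bar> <= R + 1" for t x
      proof -
        have "\<bar>E t x\<bar> <= (\<epsilon> + C * r * K) * exp (x\<^sup>2 + 5)"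
          by (rule heat_barrier[OF cont dx dxx dt ineq' init growth \<mu>(2) _ \<epsilon>(1) K _ t])
            (use \<mu>(1) \<mu>0(2) K0(1) K1(1) in auto)
        also have "\<dots> <= (\<epsilon> + C * r * K) * M"
        proof -
          have "x\<^sup>2 <= (R + 1)\<^sup>2" using x R by (intro abs_le_square_iff[THEN iffD1]) auto
          then show ?thesis using \<epsilon>(1) \<mu>(2) K unfolding M_def by (intro mult_left_mono) auto
        qed
        also have "\<dots> = \<eta>' / 2 + C * r * K * M" using \<epsilon>(2) by (simp add: distrib_right)
        also have "C * r * K * M <= \<eta>' / (2 * (K + 1) * M) * (K + 1) * M"
          using \<mu> \<mu>0(4) K M(1) by (intro mult_right_mono mult_mono) auto
        also have "\<dots> = \<eta>' / 2"
        proof -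
          have "e / (2 * D) * D = e / 2" if "D ~= 0" for e D :: real using that by simp
          from this[of "(K + 1) * M" \<eta>'] show ?thesis using K M(1) by (simp only: mult.assoc) simp
        qed
        finally show ?thesis by simp
      qed
      have Exb: "\<bar>Ex t x\<bar> <= \<eta>" if t: "t \<in> {-1/2..1/4}" and x: "\<bar>x\<bar> <= R" for t x
      proof -
        have tin: "s \<in> {-1..1/4}" if "s \<in> {-1..t}" for s using that t by auto
        have xin: "\<bar>y\<bar> <= R + 1" if "y \<in> {x - 1..x + 1}" for y using that x by (auto simp: abs_le_iff)
        have "\<bar>Ex t x\<bar> <= 2 * (2 * \<eta>' / (t - (-1)) + 6 * \<eta>' + C * r * (\<eta>' + K'))"
        proof (rule heat_gradient_bound[where E = E and Ex = Ex and Exx = Exx and Et = Et and ?t1.0 = t and z = x])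
          show "continuous_on ({-1..t} \<times> {x - 1..x + 1}) (%(t, x). E t x)"
            using tin by (intro continuous_on_subset[OF cont]) auto
          show "\<bar>Et s y - Exx s y\<bar> <= C * r * ((\<eta>' + K') + \<bar>Ex s y\<bar>)" if s: "s \<in> {-1..t}" and y: "y \<in> {x - 1..x + 1}" for s y
          proof -
            have "y\<^sup>2 <= (R + 1)\<^sup>2" using xin[OF y] R by (intro abs_le_square_iff[THEN iffD1]) auto
            then have "K * exp (y\<^sup>2 / 7) <= K'" unfolding K'_def using K by (intro mult_left_mono) auto
            then have "\<bar>E s y\<bar> + \<bar>Ex s y\<bar> + K * exp (y\<^sup>2 / 7) <= (\<eta>' + K') + \<bar>Ex s y\<bar>"
              using Eb[OF tin[OF s] xin[OF y]] by linarith
            then show ?thesis using ineq'[OF tin[OF s], of y] mult_left_mono[OF _ \<mu>(2)] by (meson order_trans)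
          qed
        qed (use t dx dxx dt tin xin Eb M \<mu> \<mu>0(2) in auto)
        also have "\<dots> <= 2 * (2 * \<eta>' * 2 + 6 * \<eta>' + \<eta> / (4 * (1 + K')) * (1 + K'))"
        proof -
          have "2 * \<eta>' / (t - (-1)) <= 2 * \<eta>' / (1/2)" using t M(3) by (intro divide_left_mono) auto
          moreover have "C * r * (\<eta>' + K') <= \<eta> / (4 * (1 + K')) * (1 + K')"
            using \<mu> \<mu>0(3) M by (intro mult_mono) auto
          ultimately show ?thesis by simp
        qed
        also have "\<dots> = 20 * \<eta>' + \<eta> / 2" using M(2) by (simp add: field_simps)
        finally show ?thesis using M(5) by linarith
      qed
      have "\<bar>E t x\<bar> <= \<eta>" if t: "t \<in> {-1..1/4}" and x: "\<bar>x\<bar> <= R" for t x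
        using Eb[OF t, of x] x M(6) by simp
      then show "\<exists>r\<in>{\<rho>..2 * \<rho>}. \<exists>m. m ~= 0 &
        (\<forall>t\<in>{-1..1/4}. \<forall>x. \<bar>x\<bar> <= R --> \<bar>w (T + r\<^sup>2 * t) (x0 + r * x) / m - heat_poly k t x\<bar> <= \<eta>) &
        (\<forall>t\<in>{-1/2..1/4}. \<forall>x. \<bar>x\<bar> <= R -->
           \<bar>r * wx (T + r\<^sup>2 * t) (x0 + r * x) / m - real k * heat_poly (k - 1) t x\<bar> <= \<eta>)"
        using rr m Exb unfolding E_def Ex_def tt_def xx_def by (intro bexI[of _ r] exI[of _ m]) auto
    qed
  qed
qed

end

lemma heat_poly_abs_ge:
  assumes "t >= 0" shows "\<bar>heat_poly k t x\<bar> >= \<bar>x\<bar> ^ k"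
proof (cases "x >= 0")
  case True
  then show ?thesis using heat_poly_nonneg[OF assms True, of k] by simp
next
  case False
  then have "(- x) ^ k <= heat_poly k t (- x)" using heat_poly_nonneg[OF assms, of "- x" k] by simp
  then have "\<bar>x\<bar> ^ k <= \<bar>heat_poly k t (- x)\<bar>" using False by simp
  then show ?thesis by (simp add: heat_poly_minus abs_mult power_abs)
qed

lemma IVT_sign_change:
  fixes f :: "real => real"
  assumes "continuous_on UNIV f" "a < b" "f a * f b < 0"
  shows "\<exists>x. a < x & x < b & f x = 0"
proof -
  have c: "continuous_on {a..b} f" using assms(1) by (rule continuous_on_subset) simp
  have "\<exists>x. a <= x & x <= b & f x = 0"
  proof (cases "f a < 0")
    case True
    then have "f b > 0" using assms(3) by (simp add: mult_less_0_iff)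
    then show ?thesis using IVT'[OF _ _ _ c, of 0] True assms(2) by auto
  next
    case False
    then have "f a > 0" "f b < 0" using assms(3) by (auto simp: mult_less_0_iff)
    then show ?thesis using IVT2'[OF _ _ _ c, of 0] assms(2) by auto
  qed
  then obtain x where "a <= x" "x <= b" "f x = 0" by blast
  moreover have "x ~= a" "x ~= b" using assms(3) \<open>f x = 0\<close> by auto
  ultimately show ?thesis by (intro exI[of _ x]) auto
qed

section \<open>Zeros near a zero, before and after its time\<close>

context parabolic_nonzero
begin

lemma continuous_w: "t \<in> {a<..<b} ==> continuous_on UNIV (w t)"
  by (intro continuous_at_imp_continuous_on ballI DERIV_isCont[OF deriv_x])

text \<open>The blow-up profile has degree k, the order of the zero. After T, zeros outside the
  parabola (x - x0)^2 = 4 (t - T) are excluded by the size of the profile, and inside it positivity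
  of a polynomial of even degree leaves at most one. Before T, sign changes of the profile produce
  zeros.\<close>

lemma local_zeros:
  assumes T: "T \<in> {a<..<b}" and zero: "w T x0 = 0"
  shows "\<exists>\<delta>0>0. \<forall>\<delta>. 0 < \<delta> & \<delta> <= \<delta>0 --> (\<forall>x. 0 < \<bar>x - x0\<bar> & \<bar>x - x0\<bar> <= \<delta> --> w T x ~= 0) &
    (\<exists>\<tau>>0. (\<forall>t\<in>{T - \<tau><..<T}. \<exists>x1. \<bar>x1 - x0\<bar> < \<delta> & w t x1 = 0 &
        (wx T x0 = 0 --> (\<exists>x2. x2 ~= x1 & \<bar>x2 - x0\<bar> < \<delta> & w t x2 = 0))) &
      (\<forall>t\<in>{T<..<T + \<tau>}. \<forall>x1 x2. \<bar>x1 - x0\<bar> <= \<delta> & \<bar>x2 - x0\<bar> <= \<delta> & w t x1 = 0 & w t x2 = 0 --> x1 = x2))"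
proof -
  from blow_up_uniform[OF T, of x0] obtain k where
    k0: "\<forall>R\<ge>0. \<forall>\<eta>>0. \<exists>\<rho>0>0. \<forall>\<rho>. 0 < \<rho> --> \<rho> < \<rho>0 --> (\<exists>r\<in>{\<rho>..2 * \<rho>}. \<exists>m. m ~= 0 &
    (\<forall>t\<in>{-1..1/4}. \<forall>x. \<bar>x\<bar> <= R --> \<bar>w (T + r\<^sup>2 * t) (x0 + r * x) / m - heat_poly k t x\<bar> <= \<eta>) &
    (\<forall>t\<in>{-1/2..1/4}. \<forall>x. \<bar>x\<bar> <= R -->
       \<bar>r * wx (T + r\<^sup>2 * t) (x0 + r * x) / m - real k * heat_poly (k - 1) t x\<bar> <= \<eta>))" by blast
  define good where "good R \<eta> r m \<longleftrightarrow> m ~= 0 &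
    (\<forall>t\<in>{-1..1/4}. \<forall>x. \<bar>x\<bar> <= R --> \<bar>w (T + r\<^sup>2 * t) (x0 + r * x) / m - heat_poly k t x\<bar> <= \<eta>) &
    (\<forall>t\<in>{-1/2..1/4}. \<forall>x. \<bar>x\<bar> <= R -->
       \<bar>r * wx (T + r\<^sup>2 * t) (x0 + r * x) / m - real k * heat_poly (k - 1) t x\<bar> <= \<eta>)" for R \<eta> r m
  have BU: "\<exists>\<rho>0>0. \<forall>\<rho>. 0 < \<rho> --> \<rho> < \<rho>0 --> (\<exists>r\<in>{\<rho>..2 * \<rho>}. \<exists>m. good R \<eta> r m)" if "R >= 0" "\<eta> > 0" for R \<eta>
    using k0[rule_format, OF that] unfolding good_def .
  have m0: "m ~= 0" if "good R \<eta> r m" for R \<eta> r m using that by (simp add: good_def)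
  have wr: "\<bar>w (T + r\<^sup>2 * t) (x0 + r * x) / m - heat_poly k t x\<bar> <= \<eta>"
    if "good R \<eta> r m" "-1 <= t" "t <= 1/4" "\<bar>x\<bar> <= R" for R \<eta> r m t x using that by (simp add: good_def)
  have wxr: "\<bar>r * wx (T + r\<^sup>2 * t) (x0 + r * x) / m - real k * heat_poly (k - 1) t x\<bar> <= \<eta>"
    if "good R \<eta> r m" "-1/2 <= t" "t <= 1/4" "\<bar>x\<bar> <= R" for R \<eta> r m t x using that by (simp add: good_def)
  \<comment> \<open>At the origin the profile is 0 ^ k and its derivative k * 0 ^ (k - 1), which are
    1 for k = 0 and for k = 1 respectively; an error of 1/2 excludes these degrees.\<close>
  have k1: "k >= 1" and k2: "wx T x0 = 0 ==> k >= 2"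
  proof -
    obtain \<rho>0 where r0: "\<rho>0 > 0" and l: "!!\<rho>. 0 < \<rho> ==> \<rho> < \<rho>0 ==> \<exists>r\<in>{\<rho>..2 * \<rho>}. \<exists>m. good 0 (1/2) r m"
      using BU[of 0 "1/2"] by auto
    from l[of "\<rho>0 / 2"] r0 obtain r m where g: "good 0 (1/2) r m" by auto
    have rm: "\<bar>w T x0 / m - 0 ^ k\<bar> <= 1/2" "\<bar>r * wx T x0 / m - real k * 0 ^ (k - 1)\<bar> <= 1/2"
      using wr[OF g, of 0 0] wxr[OF g, of 0 0] by auto
    show "k >= 1" using rm(1) zero by (cases k) auto
    then show "k >= 2" if "wx T x0 = 0" using rm(2) that by (cases "k = 1") auto
  qed
  \<comment> \<open>Outside the parabola r is taken comparable to |x - x0|: the rescaled point then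
    has 1/2 <= |x'| <= 1 and 0 <= t' <= 1/4, where the profile is at least (1/2) ^ k in
    modulus.\<close>
  obtain \<rho>A where \<rho>A: "\<rho>A > 0" and A: "!!t x. T <= t ==> 0 < \<bar>x - x0\<bar> ==> \<bar>x - x0\<bar> < \<rho>A ==> t - T <= (x - x0)\<^sup>2 / 4 ==> w t x ~= 0"
  proof -
    have p: "(1/2 :: real) ^ (k + 1) > 0" by simp
    obtain \<rho>0 where l0: "\<rho>0 > 0" and l: "!!\<rho>. 0 < \<rho> ==> \<rho> < \<rho>0 ==> \<exists>r\<in>{\<rho>..2 * \<rho>}. \<exists>m. good 1 ((1/2) ^ (k + 1)) r m"
      using BU[OF zero_le_one p] by blast
    have "w t x ~= 0" if tx: "T <= t" "0 < \<bar>x - x0\<bar>" "\<bar>x - x0\<bar> < \<rho>0" "t - T <= (x - x0)\<^sup>2 / 4" for t x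
    proof
      assume w0: "w t x = 0"
      from l[OF tx(2,3)] obtain r m where r: "\<bar>x - x0\<bar> <= r" "r <= 2 * \<bar>x - x0\<bar>" and g: "good 1 ((1/2) ^ (k + 1)) r m" by auto
      have rpos: "r > 0" using r tx by linarith
      define t' x' where "t' = (t - T) / r\<^sup>2" and "x' = (x - x0) / r"
      have "(x - x0)\<^sup>2 <= r\<^sup>2" using r rpos by (intro abs_le_square_iff[THEN iffD1]) auto
      then have t': "0 <= t'" "t' <= 1/4" using tx rpos by (auto simp: t'_def field_simps)
      have x': "1/2 <= \<bar>x'\<bar>" "\<bar>x'\<bar> <= 1" using r rpos by (auto simp: x'_def abs_divide field_simps)
      have e: "T + r\<^sup>2 * t' = t" "x0 + r * x' = x" using rpos by (auto simp: t'_def x'_def)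
      have "\<bar>heat_poly k t' x'\<bar> <= (1/2) ^ (k + 1)" using wr[OF g, of t' x'] t' x' w0 unfolding e by simp
      moreover have "(1/2) ^ k <= \<bar>heat_poly k t' x'\<bar>"
        using heat_poly_abs_ge[OF t'(1), of x' k] power_mono[OF x'(1), of k] by simp
      ultimately have "(1/2 :: real) ^ k <= (1/2) ^ (k + 1)" by linarith
      then show False by simp
    qed
    then show ?thesis using that l0 by blast
  qed
  \<comment> \<open>Inside the parabola r is taken comparable to 2 * sqrt (t - T), so that the
    rescaled time lies in [1/16, 1/4], away from 0.\<close>
  obtain \<rho>B where \<rho>B: "\<rho>B > 0" and B: "!!t x1 x2. T < t ==> 2 * sqrt (t - T) < \<rho>B ==> t < b ==> \<bar>x1 - x0\<bar> <= 2 * sqrt (t - T) ==>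
    \<bar>x2 - x0\<bar> <= 2 * sqrt (t - T) ==> x1 < x2 ==> w t x1 = 0 ==> w t x2 = 0 ==> False"
  proof -
    \<comment> \<open>For even k the profile itself is positive and excludes zeros; for odd k its
      derivative is positive and the mean value theorem excludes a second zero.\<close>
    define g where "g t x = (if even k then heat_poly k t x else real k * heat_poly (k - 1) t x)" for t x
    have gpos: "g t x > 0" if "t > 0" for t x
      using heat_poly_even_pos[OF that, of k x] heat_poly_even_pos[OF that, of "k - 1" x] k1 by (auto simp: g_def)
    have "continuous_on ({1/16..1/4} \<times> {-1..1}) (%p. g (fst p) (snd p))"
      unfolding g_def by (cases "even k") (auto intro!: continuous_intros)
    then have "\<exists>p\<in>{1/16..1/4} \<times> {-1..1}. \<forall>q\<in>{1/16..1/4} \<times> {-1..1}. g (fst p) (snd p) <= g (fst q) (snd q)"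
      by (intro continuous_attains_inf compact_Times) auto
    then obtain t0 y0 where "t0 \<in> {1/16..1/4}" "y0 \<in> {-1..1}" "!!t x. t \<in> {1/16..1/4} ==> x \<in> {-1..1} ==> g t0 y0 <= g t x" by force
    then obtain c where c: "c > 0" "!!t x. t \<in> {1/16..1/4} ==> x \<in> {-1..1} ==> c <= g t x"
      using gpos[of t0 y0] by auto
    have c2: "c / 2 > 0" using c by simp
    obtain \<rho>0 where l0: "\<rho>0 > 0" and l: "!!\<rho>. 0 < \<rho> ==> \<rho> < \<rho>0 ==> \<exists>r\<in>{\<rho>..2 * \<rho>}. \<exists>m. good 1 (c / 2) r m"
      using BU[OF zero_le_one c2] by blast
    have False if tx: "T < t" "2 * sqrt (t - T) < \<rho>0" "t < b" "\<bar>x1 - x0\<bar> <= 2 * sqrt (t - T)"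
      "\<bar>x2 - x0\<bar> <= 2 * sqrt (t - T)" "x1 < x2" "w t x1 = 0" "w t x2 = 0" for t x1 x2
    proof -
      have "0 < 2 * sqrt (t - T)" using tx by simp
      from l[OF this tx(2)] obtain r m where r: "2 * sqrt (t - T) <= r" "r <= 2 * (2 * sqrt (t - T))" and g: "good 1 (c / 2) r m" by auto
      have rpos: "r > 0" using r(1) \<open>0 < 2 * sqrt (t - T)\<close> by linarith
      define t' where "t' = (t - T) / r\<^sup>2"
      have "(2 * sqrt (t - T))\<^sup>2 <= r\<^sup>2" "r\<^sup>2 <= (2 * (2 * sqrt (t - T)))\<^sup>2"
        using \<open>0 < 2 * sqrt (t - T)\<close> rpos by (intro power_mono r; simp)+
      then have "4 * (t - T) <= r\<^sup>2" "r\<^sup>2 <= 16 * (t - T)" using tx by (simp_all add: power_mult_distrib)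
      then have t': "1/16 <= t'" "t' <= 1/4" using rpos by (auto simp: t'_def field_simps)
      have et: "T + r\<^sup>2 * t' = t" using rpos by (simp add: t'_def)
      have ex: "x0 + r * ((x - x0) / r) = x" for x using rpos by simp
      have x': "\<bar>(x - x0) / r\<bar> <= 1" if "\<bar>x - x0\<bar> <= 2 * sqrt (t - T)" for x using that r(1) rpos by (simp add: abs_divide)
      have in1: "(x - x0) / r \<in> {-1..1}" if "\<bar>x - x0\<bar> <= 2 * sqrt (t - T)" for x
        using x'[OF that] unfolding atLeastAtMost_iff abs_le_iff by linarith
      have tin: "t' \<in> {1/16..1/4}" using t' by simp
      show False
      proof (cases "even k")
        case True
        have "\<bar>0 / m - heat_poly k t' ((x1 - x0) / r)\<bar> <= c / 2"
          using wr[OF g, of t' "(x1 - x0) / r"] t' x'[OF tx(4)] unfolding et ex tx(7) by auto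
        moreover have "c <= heat_poly k t' ((x1 - x0) / r)" using c(2)[OF tin in1[OF tx(4)]] True by (simp add: g_def)
        ultimately show False using c(1) by simp
      next
        case False
        have tab: "t \<in> {a<..<b}" using tx T by auto
        have "\<exists>z. x1 < z & z < x2 & w t x2 - w t x1 = (x2 - x1) * wx t z"
          using tx(6) deriv_x[OF tab] by (intro MVT2) auto
        then obtain z where z: "x1 < z" "z < x2" "wx t z = 0" using tx by auto
        have zb: "\<bar>z - x0\<bar> <= 2 * sqrt (t - T)" using z tx(4,5) by (auto simp: abs_le_iff)
        have "\<bar>r * 0 / m - real k * heat_poly (k - 1) t' ((z - x0) / r)\<bar> <= c / 2"
          using wxr[OF g, of t' "(z - x0) / r"] t' x'[OF zb] unfolding et ex z(3) by auto
        moreover have "c <= real k * heat_poly (k - 1) t' ((z - x0) / r)" using c(2)[OF tin in1[OF zb]] False by (simp add: g_def)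
        ultimately show False using c(1) by simp
      qed
    qed
    then show ?thesis using that l0 by blast
  qed
  obtain Y \<rho>C where \<rho>C: "\<rho>C > 0" "Y > 0" and Cz: "!!t. t < T ==> a < t ==> sqrt (T - t) < \<rho>C ==>
    \<exists>x1. \<bar>x1 - x0\<bar> < 2 * sqrt (T - t) * Y & w t x1 = 0 &
        (k >= 2 --> (\<exists>x2. x2 ~= x1 & \<bar>x2 - x0\<bar> < 2 * sqrt (T - t) * Y & w t x2 = 0))"
  proof -
    let ?h = "heat_poly k (-1)"
    obtain y1 y2 y3 where y: "y1 < y2" "y2 < y3" "?h y1 * ?h y2 < 0" "?h y3 ~= 0" "k >= 2 ==> ?h y2 * ?h y3 < 0"
    proof (cases "k >= 2")
      case True
      then show ?thesis using heat_poly_sign_changes[OF True] that by (metis mult_zero_right order_less_irrefl)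
    next
      case False
      then have "k = 1" using k1 by simp
      then show ?thesis using that[of "-1" 1 2] by auto
    qed
    define c where "c = Min {\<bar>?h y1\<bar>, \<bar>?h y2\<bar>, \<bar>?h y3\<bar>}"
    have c: "c > 0" "c <= \<bar>?h y1\<bar>" "c <= \<bar>?h y2\<bar>" "c <= \<bar>?h y3\<bar>"
      using y unfolding c_def by (auto intro!: Min_le)
    define Y where "Y = \<bar>y1\<bar> + \<bar>y2\<bar> + \<bar>y3\<bar> + 1"
    have Y: "Y > 0" "\<bar>y1\<bar> < Y" "\<bar>y2\<bar> < Y" "\<bar>y3\<bar> < Y" by (auto simp: Y_def)
    have p: "c * (1/2) ^ (k + 1) > 0" using c by simp
    have Y0: "0 <= Y" using Y by simp
    obtain \<rho>0 where l0: "\<rho>0 > 0" and l: "!!\<rho>. 0 < \<rho> ==> \<rho> < \<rho>0 ==> \<exists>r\<in>{\<rho>..2 * \<rho>}. \<exists>m. good Y (c * (1/2) ^ (k + 1)) r m"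
      using BU[OF Y0 p] by blast
    have "\<exists>x1. \<bar>x1 - x0\<bar> < 2 * sqrt (T - t) * Y & w t x1 = 0 &
        (k >= 2 --> (\<exists>x2. x2 ~= x1 & \<bar>x2 - x0\<bar> < 2 * sqrt (T - t) * Y & w t x2 = 0))"
      if t: "t < T" "a < t" "sqrt (T - t) < \<rho>0" for t
    proof -
      have s0: "0 < sqrt (T - t)" using t by simp
      from l[OF s0 t(3)] obtain r m where r: "sqrt (T - t) <= r" "r <= 2 * sqrt (T - t)" and g: "good Y (c * (1/2) ^ (k + 1)) r m" by auto
      have r3: "m ~= 0" using m0[OF g] .
      have rpos: "r > 0" using r(1) s0 by linarith
      \<comment> \<open>The given t is rescaled time - q^2 rather than -1. Homogeneity of
        \<open>heat_poly\<close> transfers the sign pattern, at the price of a factor q ^ k >= (1/2)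
        ^ k, which the error bound has allowed for.\<close>
      define q where "q = sqrt (T - t) / r"
      have q: "1/2 <= q" "q <= 1" "q > 0" unfolding q_def using r rpos s0
        by (simp_all only: pos_le_divide_eq[OF rpos] pos_divide_le_eq[OF rpos] divide_pos_pos)
      have q2: "q\<^sup>2 * (-1) >= -1" "q\<^sup>2 * (-1) <= 1/4"
      proof -
        have "q\<^sup>2 <= 1" using power_mono[of q 1 2] q by simp
        then show "q\<^sup>2 * (-1) >= -1" "q\<^sup>2 * (-1) <= 1/4" using zero_le_power2[of q] by linarith+
      qed
      have et: "T + r\<^sup>2 * (q\<^sup>2 * (-1)) = t" using rpos t by (simp add: q_def power_divide)
      have same: "(w t (x0 + r * (q * y)) / m) * ?h y > 0" if yy: "\<bar>y\<bar> < Y" "c <= \<bar>?h y\<bar>" for y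
      proof -
        have "\<bar>q * y\<bar> <= 1 * Y" unfolding abs_mult using q yy by (intro mult_mono) auto
        then have 1: "\<bar>w t (x0 + r * (q * y)) / m - q ^ k * ?h y\<bar> <= c * (1/2) ^ (k + 1)"
          using wr[OF g q2, of "q * y"] unfolding et heat_poly_scale by simp
        have "(1/2) ^ k * c <= q ^ k * \<bar>?h y\<bar>"
          using q yy c(1) by (intro mult_mono power_mono) auto
        moreover have "c * (1/2) ^ (k + 1) < (1/2) ^ k * c" using c(1) by simp
        ultimately have 2: "\<bar>w t (x0 + r * (q * y)) / m - q ^ k * ?h y\<bar> < q ^ k * \<bar>?h y\<bar>" using 1 by linarith
        have qk: "q ^ k > 0" using q by simp
        show ?thesis
        proof (cases "?h y > 0")
          case True
          then have "w t (x0 + r * (q * y)) / m > 0" using 2 by (simp add: abs_less_iff)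
          then show ?thesis using True by (rule mult_pos_pos)
        next
          case False
          then have neg: "?h y < 0" using yy(2) c(1) by linarith
          then have "w t (x0 + r * (q * y)) / m < 0" using 2 by (simp add: abs_less_iff)
          then show ?thesis using neg by (rule mult_neg_neg)
        qed
      qed
      have tab: "t \<in> {a<..<b}" using t T by auto
      have zero: "\<exists>x. x0 + r * (q * y) < x & x < x0 + r * (q * y') & w t x = 0"
        if yy: "y < y'" "\<bar>y\<bar> < Y" "c <= \<bar>?h y\<bar>" "\<bar>y'\<bar> < Y" "c <= \<bar>?h y'\<bar>" "?h y * ?h y' < 0" for y y'
      proof (rule IVT_sign_change[OF continuous_w[OF tab]])
        show "x0 + r * (q * y) < x0 + r * (q * y')" using yy(1) rpos q(3) by simp
        let ?A = "w t (x0 + r * (q * y)) / m" and ?B = "w t (x0 + r * (q * y')) / m"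
        have "(?A * ?h y) * (?B * ?h y') > 0" using same[OF yy(2,3)] same[OF yy(4,5)] by (rule mult_pos_pos)
        then have "(?A * ?B) * (?h y * ?h y') > 0" by (simp add: mult_ac)
        moreover have "X < 0" if "0 < X * Y" "Y < 0" for X Y :: real using that by (simp add: zero_less_mult_iff)
        ultimately have "?A * ?B < 0" using yy(6) by blast
        moreover have "w t (x0 + r * (q * y)) * w t (x0 + r * (q * y')) = (?A * ?B) * (m * m)" using r3 by simp
        moreover have "m * m > 0" using r3 by (simp add: zero_less_mult_iff linorder_neq_iff disj_commute)
        ultimately show "w t (x0 + r * (q * y)) * w t (x0 + r * (q * y')) < 0" by (simp only: mult_neg_pos)
      qed
      have near: "\<bar>x - x0\<bar> < 2 * sqrt (T - t) * Y" if xx: "x0 + r * (q * y) < x" "x < x0 + r * (q * y')" "\<bar>y\<bar> < Y" "\<bar>y'\<bar> < Y" for x y y'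
      proof -
        have b: "\<bar>r * (q * u)\<bar> <= 2 * sqrt (T - t) * Y" if "\<bar>u\<bar> < Y" for u
        proof -
          have "\<bar>r * (q * u)\<bar> <= (2 * sqrt (T - t)) * (1 * Y)"
            unfolding abs_mult using r rpos q that t by (intro mult_mono) auto
          then show ?thesis by simp
        qed
        show ?thesis using b[OF xx(3)] b[OF xx(4)] xx(1,2) by (auto simp: abs_le_iff abs_less_iff)
      qed
      obtain x1 where x1: "x0 + r * (q * y1) < x1" "x1 < x0 + r * (q * y2)" "w t x1 = 0"
        using zero[OF y(1) Y(2) c(2) Y(3) c(3) y(3)] by blast
      show ?thesis
      proof (rule exI[of _ x1], intro conjI impI)
        show "\<bar>x1 - x0\<bar> < 2 * sqrt (T - t) * Y" using near x1 Y by blast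
        show "\<exists>x2. x2 ~= x1 & \<bar>x2 - x0\<bar> < 2 * sqrt (T - t) * Y & w t x2 = 0" if kk: "k >= 2"
        proof -
          obtain x2 where x2: "x0 + r * (q * y2) < x2" "x2 < x0 + r * (q * y3)" "w t x2 = 0"
            using zero[OF y(2) Y(3) c(3) Y(4) c(4) y(5)[OF kk]] by blast
          then show ?thesis using x1 near Y by (intro exI[of _ x2]) auto
        qed
      qed (rule x1)
    qed
    then show ?thesis using that l0 Y(1) by blast
  qed
  show ?thesis
  proof (rule exI[of _ "\<rho>A / 2"], intro conjI allI impI)
    show "\<rho>A / 2 > 0" using \<rho>A by simp
    fix \<delta> assume \<delta>: "0 < \<delta> & \<delta> <= \<rho>A / 2"
    show "w T x ~= 0" if "0 < \<bar>x - x0\<bar> & \<bar>x - x0\<bar> <= \<delta>" for x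
      using A[of T x] that \<delta> \<rho>A by auto
    define e where "e = min (\<rho>B / 2) (min \<rho>C (\<delta> / (2 * Y)))"
    have e: "e > 0" "e <= \<rho>B / 2" "e <= \<rho>C" "e <= \<delta> / (2 * Y)" using \<rho>B \<rho>C \<delta> by (auto simp: e_def)
    define \<tau> where "\<tau> = min (e\<^sup>2) (min (T - a) (b - T))"
    have \<tau>: "\<tau> > 0" "\<tau> <= e\<^sup>2" "\<tau> <= T - a" "\<tau> <= b - T" using e T by (auto simp: \<tau>_def)
    have sq: "sqrt u < e" if "0 <= u" "u < \<tau>" for u using that \<tau>(2) e by (intro real_less_lsqrt) auto
    show "\<exists>\<tau>>0. (\<forall>t\<in>{T - \<tau><..<T}. \<exists>x1. \<bar>x1 - x0\<bar> < \<delta> & w t x1 = 0 &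
        (wx T x0 = 0 --> (\<exists>x2. x2 ~= x1 & \<bar>x2 - x0\<bar> < \<delta> & w t x2 = 0))) &
      (\<forall>t\<in>{T<..<T + \<tau>}. \<forall>x1 x2. \<bar>x1 - x0\<bar> <= \<delta> & \<bar>x2 - x0\<bar> <= \<delta> & w t x1 = 0 & w t x2 = 0 --> x1 = x2)"
    proof (rule exI[of _ \<tau>], intro conjI \<tau>(1) ballI allI impI)
      fix t assume t: "t \<in> {T - \<tau><..<T}"
      then have s: "sqrt (T - t) < e" by (intro sq) auto
      then have "2 * sqrt (T - t) * Y < 2 * e * Y" using \<rho>C by simp
      also have "\<dots> <= \<delta>" using e(4) \<rho>C by (simp add: field_simps)
      finally have small: "2 * sqrt (T - t) * Y < \<delta>" .
      have "t < T" "a < t" "sqrt (T - t) < \<rho>C" using t s e \<tau> by auto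
      from Cz[OF this] obtain x1 where x1: "\<bar>x1 - x0\<bar> < 2 * sqrt (T - t) * Y" "w t x1 = 0"
        "k >= 2 ==> \<exists>x2. x2 ~= x1 & \<bar>x2 - x0\<bar> < 2 * sqrt (T - t) * Y & w t x2 = 0" by blast
      show "\<exists>x1. \<bar>x1 - x0\<bar> < \<delta> & w t x1 = 0 & (wx T x0 = 0 --> (\<exists>x2. x2 ~= x1 & \<bar>x2 - x0\<bar> < \<delta> & w t x2 = 0))"
        using x1 k2 small by (meson order_less_trans)
    next
      fix t x1 x2 assume t: "t \<in> {T<..<T + \<tau>}" and h: "\<bar>x1 - x0\<bar> <= \<delta> & \<bar>x2 - x0\<bar> <= \<delta> & w t x1 = 0 & w t x2 = 0"
      have s: "sqrt (t - T) < e" using t by (intro sq) auto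
      have c: "T < t" "2 * sqrt (t - T) < \<rho>B" "t < b" using t s e \<tau> by auto
      have close: "\<bar>x - x0\<bar> <= 2 * sqrt (t - T)" if "\<bar>x - x0\<bar> <= \<delta>" "w t x = 0" for x
      proof (rule ccontr)
        assume n: "\<not> \<bar>x - x0\<bar> <= 2 * sqrt (t - T)"
        then have "(2 * sqrt (t - T))\<^sup>2 <= \<bar>x - x0\<bar>\<^sup>2" using t by (intro power_mono) auto
        then have "t - T <= (x - x0)\<^sup>2 / 4" using t by (simp add: power_mult_distrib)
        moreover have "0 < \<bar>x - x0\<bar>" using n real_sqrt_ge_zero[of "t - T"] t by auto
        ultimately show False using A[of t x] that \<delta> \<rho>A t by auto
      qed
      show "x1 = x2"
        using B[OF c, of x1 x2] B[OF c, of x2 x1] close[of x1] close[of x2] h by (metis linorder_neqE_linordered_idom)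
    qed
  qed
qed

end

section \<open>Zero numbers\<close>

lemma card_le_windows:
  fixes F Z :: "real set"
  assumes "finite Z" and ex: "!!x. x \<in> F ==> \<exists>z\<in>Z. \<bar>z - x\<bar> < \<delta>"
    and sep: "!!x y. x \<in> F ==> y \<in> F ==> x ~= y ==> 2 * \<delta> < \<bar>x - y\<bar>"
  shows "card F <= card Z"
proof -
  obtain f where f: "!!x. x \<in> F ==> f x \<in> Z & \<bar>f x - x\<bar> < \<delta>" using ex by metis
  have "inj_on f F"
  proof (rule inj_onI, rule ccontr)
    fix x y assume "x \<in> F" "y \<in> F" "f x = f y" "x ~= y"
    then show False using f[of x] f[of y] sep[of x y] by (auto simp: abs_if split: if_splits)
  qed
  then show ?thesis using assms(1) f by (intro card_inj_on_le[of f]) auto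
qed

lemma card_less_windows:
  fixes F Z :: "real set"
  assumes "finite Z" and ex: "!!x. x \<in> F ==> \<exists>z\<in>Z. \<bar>z - x\<bar> < \<delta>"
    and sep: "!!x y. x \<in> F ==> y \<in> F ==> x ~= y ==> 2 * \<delta> < \<bar>x - y\<bar>"
    and x: "x \<in> F" and two: "z1 \<in> Z" "z2 \<in> Z" "z1 ~= z2" "\<bar>z1 - x\<bar> < \<delta>" "\<bar>z2 - x\<bar> < \<delta>"
  shows "card F < card Z"
proof -
  have "card (F - {x}) <= card (Z - {z1, z2})"
  proof (rule card_le_windows[where \<delta> = \<delta>])
    fix y assume y: "y \<in> F - {x}"
    then obtain z where z: "z \<in> Z" "\<bar>z - y\<bar> < \<delta>" using ex by blast
    have "z ~= z1" "z ~= z2" using z two sep[of x y] x y by (auto simp: abs_if split: if_splits)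
    then show "\<exists>z\<in>Z - {z1, z2}. \<bar>z - y\<bar> < \<delta>" using z by blast
  qed (use assms in auto)
  moreover have "card (Z - {z1, z2}) = card Z - 2" using two assms(1) by (subst card_Diff_subset) auto
  moreover have "card {z1, z2} <= card Z" using two assms(1) by (intro card_mono) auto
  moreover have "card F <= card (F - {x}) + 1"
    using x by (cases "finite F") (simp_all add: card_Diff_singleton)
  ultimately show ?thesis using two(3) by simp
qed

lemma card_ge_windows:
  fixes F Z :: "real set"
  assumes "finite F" and ex: "!!z. z \<in> Z ==> \<exists>x\<in>F. \<bar>z - x\<bar> < \<delta>"
    and uniq: "!!x z z'. x \<in> F ==> z \<in> Z ==> z' \<in> Z ==> \<bar>z - x\<bar> < \<delta> ==> \<bar>z' - x\<bar> < \<delta> ==> z = z'"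
  shows "finite Z" "card Z <= card F"
proof -
  obtain f where f: "!!z. z \<in> Z ==> f z \<in> F & \<bar>z - f z\<bar> < \<delta>" using ex by metis
  have i: "inj_on f Z" using f uniq by (intro inj_onI) metis
  show "finite Z" using inj_on_finite[OF i _ assms(1)] f by blast
  show "card Z <= card F" using assms(1) f by (intro card_inj_on_le[OF i]) auto
qed

text \<open>A shifted period allows a cut point at which the function does not vanish, so that no
  zero sits on the boundary of the window.\<close>

lemma zero_number_window:
  assumes L: "L > 0" and per: "!!x. u (x + L) = u x" and fin: "finite {x \<in> {c..<c + L}. u x = 0}"
  shows "zero_number L u = enat (card {x \<in> {c..<c + L}. u x = 0})"
proof -
  define rep where "rep c x = x + of_int (- \<lfloor>(x - c) / L\<rfloor>) * L" for c x
  have rep_in: "rep c x \<in> {c..<c + L}" for c x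
  proof -
    have "of_int \<lfloor>(x - c) / L\<rfloor> <= (x - c) / L" "(x - c) / L < of_int \<lfloor>(x - c) / L\<rfloor> + 1" by linarith+
    then have "of_int \<lfloor>(x - c) / L\<rfloor> * L <= x - c" "x - c < (of_int \<lfloor>(x - c) / L\<rfloor> + 1) * L"
      using L by (simp_all only: pos_le_divide_eq pos_divide_less_eq)
    then show ?thesis by (auto simp: rep_def algebra_simps)
  qed
  have u_rep: "u (rep c x) = u x" for c x unfolding rep_def by (rule periodic_add_int[of u L, OF per])
  have rep_id: "rep c (x + of_int k * L) = x" if "x \<in> {c..<c + L}" for c x k
  proof -
    have "(x + of_int k * L - c) / L = (x - c) / L + of_int k" using L by (simp add: field_simps)
    moreover have "\<lfloor>(x - c) / L\<rfloor> = 0" using that L by (auto simp: floor_eq_iff field_simps)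
    ultimately have "\<lfloor>(x + of_int k * L - c) / L\<rfloor> = k" by simp
    then show ?thesis by (simp add: rep_def)
  qed
  have rr: "rep c (rep d x) = x" if "x \<in> {c..<c + L}" for c d x
    unfolding rep_def[of d x] by (rule rep_id[OF that])
  have bij: "bij_betw (rep c) {x \<in> {0..<L}. u x = 0} {x \<in> {c..<c + L}. u x = 0}"
    using rep_in[of c] rep_in[of 0] u_rep rr[of _ 0 c] rr[of _ c 0]
    by (intro bij_betw_byWitness[where f' = "rep 0"]) auto
  show ?thesis
    using fin bij_betw_finite[OF bij] bij_betw_same_card[OF bij] unfolding zero_number_def by simp
qed

lemma separation:
  fixes F :: "real set"
  assumes fin: "finite F" and sub: "F \<subseteq> {c<..<d}" and pos: "!!x. x \<in> F ==> e x > 0"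
  obtains \<delta> where "\<delta> > 0" "!!x. x \<in> F ==> \<delta> <= e x" "!!x. x \<in> F ==> c < x - \<delta> & x + \<delta> < d"
    "!!x y. x \<in> F ==> y \<in> F ==> x ~= y ==> 2 * \<delta> < \<bar>x - y\<bar>"
proof -
  \<comment> \<open>All gaps that matter, with 1 added so that the minimum exists even for empty F.
    A third of the minimum is enough for every conclusion.\<close>
  define S where "S = insert 1 (e ` F \<union> (%x. x - c) ` F \<union> (%x. d - x) ` F \<union> (%(x, y). \<bar>x - y\<bar>) ` {p \<in> F \<times> F. fst p ~= snd p})"
  have S: "finite S" "S ~= {}" unfolding S_def using fin by auto
  have "s > 0" if "s \<in> S" for s using that sub pos unfolding S_def by (auto simp: subset_iff)
  then have m: "Min S > 0" using S by simp
  have le: "Min S <= s" if "s \<in> S" for s using S that by simp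
  show ?thesis
  proof (rule that[of "Min S / 3"])
    show "Min S / 3 > 0" using m by simp
    show "Min S / 3 <= e x" if "x \<in> F" for x
    proof -
      have "e x \<in> S" using that by (auto simp: S_def)
      then show ?thesis using m le[of "e x"] by simp
    qed
    show "c < x - Min S / 3 & x + Min S / 3 < d" if "x \<in> F" for x
    proof -
      have "x - c \<in> S" "d - x \<in> S" using that by (auto simp: S_def)
      then show ?thesis using m le[of "x - c"] le[of "d - x"] by simp
    qed
    show "2 * (Min S / 3) < \<bar>x - y\<bar>" if "x \<in> F" "y \<in> F" "x ~= y" for x y
    proof -
      have "\<bar>x - y\<bar> \<in> S" using that by (force simp: S_def)
      then show ?thesis using m le[of "\<bar>x - y\<bar>"] by linarith
    qed
  qed
qed

lemma finite_of_isolated: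
  fixes u :: "real => real"
  assumes c: "continuous_on UNIV u" and iso: "!!x. u x = 0 ==> \<exists>d>0. \<forall>y. 0 < \<bar>y - x\<bar> & \<bar>y - x\<bar> <= d --> u y ~= 0"
  shows "finite {x \<in> {p..q}. u x = 0}"
proof (rule ccontr)
  assume inf: "infinite {x \<in> {p..q}. u x = 0}"
  have "closed {x. u x = 0}" using c by (intro closed_Collect_eq) (auto intro: continuous_on_const)
  then have "compact ({p..q} \<inter> {x. u x = 0})" by (intro compact_Int_closed) auto
  then have "compact {x \<in> {p..q}. u x = 0}" by (simp add: Int_def)
  then obtain x where x: "x \<in> {x \<in> {p..q}. u x = 0}" "x islimpt {x \<in> {p..q}. u x = 0}"
    using inf unfolding compact_eq_Bolzano_Weierstrass by blast
  then obtain d where d: "d > 0" "!!y. 0 < \<bar>y - x\<bar> ==> \<bar>y - x\<bar> <= d ==> u y ~= 0" using iso[of x] by auto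
  obtain y where "y \<in> {x \<in> {p..q}. u x = 0}" "y ~= x" "dist y x < d"
    using x(2) d(1) unfolding islimpt_approachable by blast
  then show False using d(2)[of y] by (auto simp: dist_real_def)
qed

text \<open>Near the zeros u' is bounded away from 0, so the perturbed function has at most one zero
  in each small window; elsewhere u is bounded away from 0 and the signs agree. At the ends of a
  window u has opposite signs, so the zero is not lost.\<close>

lemma zero_number_C1_stable:
  assumes L: "L > 0" and per: "!!x. u (x + L) = u x"
    and du: "!!x. (u has_real_derivative u' x) (at x)" "continuous_on UNIV u'"
    and simple: "!!x. u x = 0 ==> u' x ~= 0"
  shows "\<exists>\<epsilon>>0. \<forall>v v'. (\<forall>x. v (x + L) = v x) --> (\<forall>x. (v has_real_derivative v' x) (at x)) -->
    (\<forall>x. \<bar>v x - u x\<bar> < \<epsilon> & \<bar>v' x - u' x\<bar> < \<epsilon>) --> zero_number L v = zero_number L u & zero_number L u < \<infinity>"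
proof -
  have cu: "continuous_on UNIV u" using du(1) by (auto intro!: continuous_at_imp_continuous_on DERIV_isCont)
  have nbhd: "\<exists>d>0. \<forall>y. \<bar>y - x\<bar> <= d --> u' x * u' y > 0" if "u x = 0" for x
  proof -
    have "isCont (%y. u' x * u' y) x" using du(2) by (auto simp: continuous_on_eq_continuous_at)
    moreover have "u' x * u' x > 0" using simple[OF that] by (simp add: zero_less_mult_iff linorder_neq_iff disj_commute)
    ultimately have "\<forall>\<^sub>F y in at x. u' x * u' y > 0"
      unfolding isCont_def by (intro order_tendstoD(1)[where a = 0])
    then obtain e where "e > 0" "!!y. y ~= x ==> dist y x < e ==> u' x * u' y > 0"
      unfolding eventually_at by auto
    then have "e > 0" "!!y. dist y x < e ==> u' x * u' y > 0" using \<open>u' x * u' x > 0\<close> by metis+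
    then show ?thesis by (intro exI[of _ "e / 2"]) (auto simp: dist_real_def)
  qed
  then obtain e where e: "!!x. u x = 0 ==> e x > 0" "!!x y. u x = 0 ==> \<bar>y - x\<bar> <= e x ==> u' x * u' y > 0" by metis
  have rolle: "y = z" if "u x = 0" "\<bar>y - x\<bar> <= d" "\<bar>z - x\<bar> <= d" "v y = v z"
    "!!s. (v has_real_derivative v' s) (at s)" "!!s. \<bar>s - x\<bar> <= d ==> v' s ~= 0" for x y z d v v'
  proof (rule ccontr)
    have *: False if yz: "y < z" "\<bar>y - x\<bar> <= d" "\<bar>z - x\<bar> <= d" "v y = v z" for y z
    proof -
      have "\<exists>s. y < s & s < z & v z - v y = (z - y) * v' s" using yz(1) \<open>!!s. (v has_real_derivative v' s) (at s)\<close> by (intro MVT2) auto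
      then obtain s where s: "y < s" "s < z" "v' s = 0" using yz by auto
      have "\<bar>s - x\<bar> <= d" using s yz(2,3) by (auto simp: abs_le_iff)
      then show False using s(3) \<open>!!s. \<bar>s - x\<bar> <= d ==> v' s ~= 0\<close> by blast
    qed
    assume "y ~= z"
    then show False using *[of y z] *[of z y] that(2-4) by (cases "y < z") auto
  qed
  have iso: "\<exists>d>0. \<forall>y. 0 < \<bar>y - x\<bar> & \<bar>y - x\<bar> <= d --> u y ~= 0" if x: "u x = 0" for x
  proof (intro exI[of _ "e x"] conjI allI impI e(1)[OF x])
    fix y assume y: "0 < \<bar>y - x\<bar> & \<bar>y - x\<bar> <= e x"
    have "u' s ~= 0" if "\<bar>s - x\<bar> <= e x" for s using e(2)[OF x that] by auto
    then show "u y ~= 0" using rolle[OF x, of y "e x" x u u'] y x du(1) e(1)[OF x] by auto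
  qed
  have fin: "finite {x \<in> {p..q}. u x = 0}" for p q by (rule finite_of_isolated[OF cu iso])
  obtain c where c: "u c ~= 0"
  proof (rule ccontr)
    assume "\<not> thesis"
    then have "u x = 0" for x using that by blast
    then show False using iso[of 0] by (metis abs_of_pos diff_zero order_refl)
  qed
  have cL: "u (c + L) ~= 0" using c per by simp
  define F where "F = {x \<in> {c..c + L}. u x = 0}"
  have F: "finite F" "F \<subseteq> {c<..<c + L}" "!!x. x \<in> F ==> u x = 0"
    using fin c cL by (auto simp: F_def less_le)
  have F_eq: "{x \<in> {c..<c + L}. u x = 0} = F" using cL by (auto simp: F_def less_le)
  obtain \<delta> where \<delta>: "\<delta> > 0" "!!x. x \<in> F ==> \<delta> <= e x" "!!x. x \<in> F ==> c < x - \<delta> & x + \<delta> < c + L"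
    "!!x y. x \<in> F ==> y \<in> F ==> x ~= y ==> 2 * \<delta> < \<bar>x - y\<bar>"
    using separation[OF F(1,2), of e] e(1) F(3) by blast
  define K1 where "K1 = {c..c + L} - (\<Union>x\<in>F. ball x \<delta>)"
  define K2 where "K2 = (\<Union>x\<in>F. cball x \<delta>)"
  have K: "compact K1" "compact K2"
    unfolding K1_def K2_def using F(1) by (auto intro!: compact_diff compact_UN)
  have pos1: "\<exists>m>0. \<forall>x\<in>S. m <= \<bar>g x\<bar>" if "compact S" "continuous_on UNIV g" "!!x. x \<in> S ==> g x ~= 0" for S and g :: "real => real"
  proof (cases "S = {}")
    case False
    have "\<exists>x\<in>S. \<forall>y\<in>S. \<bar>g x\<bar> <= \<bar>g y\<bar>"
      using that(1) False continuous_on_subset[OF that(2)] by (intro continuous_attains_inf continuous_on_rabs) auto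
    then show ?thesis using that(3) by (metis zero_less_abs_iff)
  qed (auto intro: exI[of _ 1])
  have "u x ~= 0" if "x \<in> K1" for x using that \<delta>(1) by (auto simp: K1_def F_def)
  then obtain m1 where m1: "m1 > 0" "!!x. x \<in> K1 ==> m1 <= \<bar>u x\<bar>" using pos1[OF K(1) cu] by blast
  have "u' y ~= 0" if y: "y \<in> K2" for y
  proof -
    obtain x where "x \<in> F" "\<bar>y - x\<bar> <= \<delta>" using y by (auto simp: K2_def dist_real_def abs_minus_commute)
    then show ?thesis using e(2)[of x y] \<delta>(2)[of x] F(3)[of x] by auto
  qed
  then obtain m2 where m2: "m2 > 0" "!!x. x \<in> K2 ==> m2 <= \<bar>u' x\<bar>" using pos1[OF K(2) du(2)] by blast
  show ?thesis
  proof (intro exI[of _ "min m1 m2"] conjI allI impI)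
    show "min m1 m2 > 0" using m1 m2 by simp
    fix v v' assume vper: "\<forall>x. v (x + L) = v x" and dv: "\<forall>x. (v has_real_derivative v' x) (at x)"
      and close: "\<forall>x. \<bar>v x - u x\<bar> < min m1 m2 & \<bar>v' x - u' x\<bar> < min m1 m2"
    have cv: "continuous_on UNIV v" using dv by (auto intro!: continuous_at_imp_continuous_on DERIV_isCont)
    have sgn: "u x * v x > 0" if "x \<in> K1" for x
    proof -
      have "\<bar>v x - u x\<bar> < \<bar>u x\<bar>" using m1(2)[OF that] close by (meson less_le_trans min_less_iff_conj)
      then show ?thesis by (cases "u x > 0") (auto simp: zero_less_mult_iff abs_if split: if_splits)
    qed
    have v'0: "v' y ~= 0" if "y \<in> K2" for y
    proof -
      have "\<bar>v' y - u' y\<bar> < \<bar>u' y\<bar>" using m2(2)[OF that] close by (meson less_le_trans min_less_iff_conj)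
      then show ?thesis by auto
    qed
    define Z where "Z = {x \<in> {c..<c + L}. v x = 0}"
    have near: "\<exists>x\<in>F. \<bar>z - x\<bar> < \<delta>" if "z \<in> Z" for z
    proof (rule ccontr)
      assume "\<not> (\<exists>x\<in>F. \<bar>z - x\<bar> < \<delta>)"
      then have "z \<in> K1" using that by (auto simp: K1_def Z_def dist_real_def abs_minus_commute)
      then show False using sgn[of z] that by (simp add: Z_def)
    qed
    have uniq: "z = z'" if "x \<in> F" "z \<in> Z" "z' \<in> Z" "\<bar>z - x\<bar> < \<delta>" "\<bar>z' - x\<bar> < \<delta>" for x z z'
    proof (rule rolle[of x z \<delta> z' v v'])
      show "v' s ~= 0" if "\<bar>s - x\<bar> <= \<delta>" for s
        using that \<open>x \<in> F\<close> by (intro v'0) (auto simp: K2_def dist_real_def abs_minus_commute)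
    qed (use that F(3) dv in \<open>auto simp: Z_def\<close>)
    have 1: "finite Z" "card Z <= card F"
      by (rule card_ge_windows[where F = F and \<delta> = \<delta>, OF F(1) near], assumption, rule uniq, assumption+)+
    have ex: "\<exists>z\<in>Z. \<bar>z - x\<bar> < \<delta>" if x: "x \<in> F" for x
    proof -
      have ends: "x - \<delta> \<in> K1" "x + \<delta> \<in> K1"
      proof -
        have "\<not> \<bar>x - \<delta> - y\<bar> < \<delta>" "\<not> \<bar>x + \<delta> - y\<bar> < \<delta>" if "y \<in> F" for y
          using \<delta>(4)[OF x that] \<delta>(1) by (cases "x = y"; auto simp: abs_if split: if_splits)+
        then show "x - \<delta> \<in> K1" "x + \<delta> \<in> K1"
          using \<delta>(3)[OF x] \<delta>(1) by (auto simp: K1_def dist_real_def abs_minus_commute)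
      qed
      have "u (x - \<delta>) * u (x + \<delta>) < 0"
      proof -
        have "\<exists>s. x - \<delta> < s & s < x & u x - u (x - \<delta>) = (x - (x - \<delta>)) * u' s" using \<delta>(1) du(1) by (intro MVT2) auto
        then obtain s1 where s1: "x - \<delta> < s1" "s1 < x" "u (x - \<delta>) = - \<delta> * u' s1" using F(3)[OF x] by auto
        have "\<exists>s. x < s & s < x + \<delta> & u (x + \<delta>) - u x = (x + \<delta> - x) * u' s" using \<delta>(1) du(1) by (intro MVT2) auto
        then obtain s2 where s2: "x < s2" "s2 < x + \<delta>" "u (x + \<delta>) = \<delta> * u' s2" using F(3)[OF x] by auto
        have "u' x * u' s1 > 0" "u' x * u' s2 > 0" using s1 s2 \<delta>(2)[OF x] by (auto intro!: e(2) F(3)[OF x])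
        then have "(u' x * u' s1) * (u' x * u' s2) > 0" by (rule mult_pos_pos)
        then have "(u' x * u' x) * (u' s1 * u' s2) > 0" by (simp add: mult_ac)
        then have "u' s1 * u' s2 > 0" using zero_le_square[of "u' x"] by (simp add: zero_less_mult_iff)
        then have "\<delta> * \<delta> * (u' s1 * u' s2) > 0" using \<delta>(1) by simp
        then show ?thesis unfolding s1(3) s2(3) by (simp add: mult_ac)
      qed
      moreover have "(u (x - \<delta>) * v (x - \<delta>)) * (u (x + \<delta>) * v (x + \<delta>)) > 0"
        using sgn[OF ends(1)] sgn[OF ends(2)] by (rule mult_pos_pos)
      then have "(u (x - \<delta>) * u (x + \<delta>)) * (v (x - \<delta>) * v (x + \<delta>)) > 0" by (simp add: mult_ac)
      moreover have "Q < 0" if "P < 0" "0 < P * Q" for P Q :: real using that by (simp add: zero_less_mult_iff)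
      ultimately have "v (x - \<delta>) * v (x + \<delta>) < 0" by blast
      then obtain z where z: "x - \<delta> < z" "z < x + \<delta>" "v z = 0"
        using IVT_sign_change[OF cv, of "x - \<delta>" "x + \<delta>"] \<delta>(1) by auto
      then have "z \<in> Z" using \<delta>(3)[OF x] by (auto simp: Z_def)
      then show ?thesis using z by (intro bexI[of _ z]) (auto simp: abs_less_iff)
    qed
    have "card F <= card Z" by (rule card_le_windows[OF 1(1) ex \<delta>(4)])
    then have eq: "card Z = card F" using 1(2) by simp
    have zu: "zero_number L u = enat (card F)"
      using zero_number_window[where u = u and c = c, OF L per] F(1) unfolding F_eq by blast
    moreover have "zero_number L v = enat (card Z)"
      using zero_number_window[where u = v and c = c, OF L] vper 1(1) unfolding Z_def by blast
    ultimately show "zero_number L v = zero_number L u" using eq by simp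
    show "zero_number L u < \<infinity>" using zu by simp
  qed
qed

text \<open>A continuation argument for a function without continuity: the supremum of the times up
  to which the bound f s holds is attained by the left condition and passed by the right
  one.\<close>

lemma locally_antimono_imp_antimono:
  fixes f :: "real => nat"
  assumes left: "!!T. T \<in> {a<..<b} ==> \<exists>\<tau>>0. \<forall>t. T - \<tau> < t & t < T & a < t --> f T <= f t"
    and right: "!!T. T \<in> {a<..<b} ==> \<exists>\<tau>>0. \<forall>t. T < t & t < T + \<tau> & t < b --> f t <= f T"
    and st: "a < s" "s <= t" "t < b"
  shows "f t <= f s"
proof -
  define S where "S = {u \<in> {s..t}. \<forall>v\<in>{s..u}. f v <= f s}"
  have s: "s \<in> S" using st by (auto simp: S_def)
  have bdd: "bdd_above S" unfolding S_def by (rule bdd_aboveI[of _ t]) auto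
  define m where "m = Sup S"
  have "s <= m" unfolding m_def using s bdd by (rule cSup_upper)
  moreover have "m <= t" unfolding m_def using s by (intro cSup_least) (auto simp: S_def)
  ultimately have m: "s <= m" "m <= t" by auto
  have mab: "m \<in> {a<..<b}" using m st by auto
  have below: "f v <= f s" if v: "s <= v" "v < m" for v
  proof -
    obtain u where "u \<in> S" "v < u" using v(2) less_cSup_iff[OF _ bdd, of v] s unfolding m_def by auto
    then show ?thesis using v(1) by (auto simp: S_def)
  qed
  have fm: "f m <= f s"
  proof (cases "m = s")
    case False
    obtain \<tau> where \<tau>: "\<tau> > 0" "!!t. m - \<tau> < t ==> t < m ==> a < t ==> f m <= f t" using left[OF mab] by blast
    define v where "v = max s (m - \<tau> / 2)"
    have "s <= v" "v < m" "m - \<tau> < v" "a < v" using False m \<tau>(1) st by (auto simp: v_def)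
    then show ?thesis using \<tau>(2)[of v] below[of v] by auto
  qed simp
  have "m = t"
  proof (rule ccontr)
    assume "m ~= t"
    then have "m < t" using m by simp
    obtain \<tau> where \<tau>: "\<tau> > 0" "!!t. m < t ==> t < m + \<tau> ==> t < b ==> f t <= f m" using right[OF mab] by blast
    define u where "u = min t (m + \<tau> / 2)"
    have u: "m < u" "u <= t" "u < m + \<tau>" using \<open>m < t\<close> \<tau>(1) by (auto simp: u_def)
    have "f v <= f s" if v: "v \<in> {s..u}" for v
    proof -
      consider "v < m" | "v = m" | "v > m" by linarith
      then show ?thesis
      proof cases
        case 3
        then show ?thesis using \<tau>(2)[of v] v u st fm by auto
      qed (use below v fm in auto)
    qed
    then have "u \<in> S" using u m by (auto simp: S_def)
    then show False using cSup_upper[OF _ bdd] u(1) unfolding m_def by fastforce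
  qed
  then show ?thesis using fm by simp
qed

section \<open>Time dependence of the zero number\<close>

context parabolic_nonzero
begin

definition zcount :: "real => nat" where "zcount t = card {x \<in> {0..<L}. w t x = 0}"

lemma finite_zeros:
  assumes t: "t \<in> {a<..<b}"
  shows "finite {x \<in> {p..q}. w t x = 0}"
proof (rule finite_of_isolated[OF continuous_w[OF t]])
  fix x assume x: "w t x = 0"
  obtain d where d: "d > 0" and l: "\<forall>\<delta>. 0 < \<delta> & \<delta> <= d --> (\<forall>y. 0 < \<bar>y - x\<bar> & \<bar>y - x\<bar> <= \<delta> --> w t y ~= 0) &
    (\<exists>\<tau>>0. (\<forall>t'\<in>{t - \<tau><..<t}. \<exists>x1. \<bar>x1 - x\<bar> < \<delta> & w t' x1 = 0 &
        (wx t x = 0 --> (\<exists>x2. x2 ~= x1 & \<bar>x2 - x\<bar> < \<delta> & w t' x2 = 0))) &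
      (\<forall>t'\<in>{t<..<t + \<tau>}. \<forall>x1 x2. \<bar>x1 - x\<bar> <= \<delta> & \<bar>x2 - x\<bar> <= \<delta> & w t' x1 = 0 & w t' x2 = 0 --> x1 = x2))"
    using local_zeros[OF t x] by (elim exE conjE)
  show "\<exists>d>0. \<forall>y. 0 < \<bar>y - x\<bar> & \<bar>y - x\<bar> <= d --> w t y ~= 0"
    using l[rule_format, of d] d by (intro exI[of _ d]) simp
qed

lemma zero_number_window_eq:
  assumes t: "t \<in> {a<..<b}"
  shows "zero_number L (w t) = enat (card {x \<in> {c..<c + L}. w t x = 0})"
proof (rule zero_number_window[where u = "w t", OF L periodic[OF t]])
  show "finite {x \<in> {c..<c + L}. w t x = 0}"
    by (rule finite_subset[OF _ finite_zeros[OF t, of c "c + L"]]) auto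
qed

lemma zero_number_eq: "t \<in> {a<..<b} ==> zero_number L (w t) = enat (zcount t)"
  unfolding zcount_def by (rule zero_number_window_eq[of t 0, unfolded add_0_left])

lemma zcount_window: "t \<in> {a<..<b} ==> zcount t = card {x \<in> {c..<c + L}. w t x = 0}"
  using zero_number_window_eq[of t c] zero_number_eq[of t] by (metis enat.inject)

text \<open>\<open>local_zeros\<close> controls small disjoint windows around the zeros in one
  period; on the remaining compact set w stays nonzero for nearby times. The two earlier zeros near
  a multiple one give the strict inequality.\<close>

lemma zcount_local:
  assumes T: "T \<in> {a<..<b}"
  shows "\<exists>\<tau>>0. (\<forall>t. T - \<tau> < t & t < T & a < t --> zcount T <= zcount t &
      ((\<exists>x. w T x = 0 & wx T x = 0) --> zcount T < zcount t)) &
    (\<forall>t. T < t & t < T + \<tau> & t < b --> zcount t <= zcount T)"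
proof -
  obtain c where c: "w T c ~= 0" using nonzero[OF T] by blast
  have cL: "w T (c + L) ~= 0" using c periodic[OF T] by simp
  define F where "F = {x \<in> {c..c + L}. w T x = 0}"
  have F: "finite F" "F \<subseteq> {c<..<c + L}" "!!x. x \<in> F ==> w T x = 0"
    using finite_zeros[OF T] c cL by (auto simp: F_def less_le)
  have F_eq: "{x \<in> {c..<c + L}. w T x = 0} = F" using cL by (auto simp: F_def less_le)
  have zT: "zcount T = card F" using zcount_window[OF T, of c] unfolding F_eq .
  define P where "P x \<delta> \<longleftrightarrow> (\<exists>\<tau>>0. (\<forall>t\<in>{T - \<tau><..<T}. \<exists>x1. \<bar>x1 - x\<bar> < \<delta> & w t x1 = 0 &
        (wx T x = 0 --> (\<exists>x2. x2 ~= x1 & \<bar>x2 - x\<bar> < \<delta> & w t x2 = 0))) &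
      (\<forall>t\<in>{T<..<T + \<tau>}. \<forall>x1 x2. \<bar>x1 - x\<bar> <= \<delta> & \<bar>x2 - x\<bar> <= \<delta> & w t x1 = 0 & w t x2 = 0 --> x1 = x2))" for x \<delta>
  have "\<forall>x\<in>F. \<exists>\<delta>0>0. \<forall>\<delta>. 0 < \<delta> & \<delta> <= \<delta>0 --> P x \<delta>"
  proof
    fix x assume "x \<in> F"
    have "\<exists>\<delta>0>0. \<forall>\<delta>. 0 < \<delta> & \<delta> <= \<delta>0 --> (\<forall>y. 0 < \<bar>y - x\<bar> & \<bar>y - x\<bar> <= \<delta> --> w T y ~= 0) & P x \<delta>"
      unfolding P_def by (rule local_zeros[OF T F(3)[OF \<open>x \<in> F\<close>]])
    then show "\<exists>\<delta>0>0. \<forall>\<delta>. 0 < \<delta> & \<delta> <= \<delta>0 --> P x \<delta>" by blast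
  qed
  from bchoice[OF this] obtain e where e: "!!x. x \<in> F ==> e x > 0"
    "!!x \<delta>. x \<in> F ==> 0 < \<delta> ==> \<delta> <= e x ==> P x \<delta>" by blast
  obtain \<delta> where \<delta>: "\<delta> > 0" "!!x. x \<in> F ==> \<delta> <= e x" "!!x. x \<in> F ==> c < x - \<delta> & x + \<delta> < c + L"
    "!!x y. x \<in> F ==> y \<in> F ==> x ~= y ==> 2 * \<delta> < \<bar>x - y\<bar>"
    using separation[OF F(1,2), of e] e(1) by blast
  define R where "R x \<tau> \<longleftrightarrow> (\<forall>t\<in>{T - \<tau><..<T}. \<exists>x1. \<bar>x1 - x\<bar> < \<delta> & w t x1 = 0 &
        (wx T x = 0 --> (\<exists>x2. x2 ~= x1 & \<bar>x2 - x\<bar> < \<delta> & w t x2 = 0))) &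
      (\<forall>t\<in>{T<..<T + \<tau>}. \<forall>x1 x2. \<bar>x1 - x\<bar> <= \<delta> & \<bar>x2 - x\<bar> <= \<delta> & w t x1 = 0 & w t x2 = 0 --> x1 = x2)" for x \<tau>
  have "\<forall>x\<in>F. \<exists>\<tau>. \<tau> > 0 & R x \<tau>"
  proof
    fix x assume "x \<in> F"
    then have "P x \<delta>" using e(2) \<delta>(1,2) by blast
    then show "\<exists>\<tau>. \<tau> > 0 & R x \<tau>" unfolding P_def R_def .
  qed
  from bchoice[OF this] obtain \<tau> where \<tau>0: "\<forall>x\<in>F. \<tau> x > 0 & R x (\<tau> x)" by blast
  have \<tau>: "\<tau> x > 0" and R: "R x (\<tau> x)" if "x \<in> F" for x using \<tau>0 that by auto
  have \<tau>2: "\<exists>x1. \<bar>x1 - x\<bar> < \<delta> & w t x1 = 0 & (wx T x = 0 --> (\<exists>x2. x2 ~= x1 & \<bar>x2 - x\<bar> < \<delta> & w t x2 = 0))"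
    if "x \<in> F" "T - \<tau> x < t" "t < T" for x t
    using bspec[OF conjunct1[OF R[OF that(1), unfolded R_def]], of t] that(2,3) by simp
  have \<tau>3: "x1 = x2" if "x \<in> F" "T < t" "t < T + \<tau> x" "\<bar>x1 - x\<bar> <= \<delta>" "\<bar>x2 - x\<bar> <= \<delta>" "w t x1 = 0" "w t x2 = 0" for x t x1 x2
  proof -
    have t: "t \<in> {T<..<T + \<tau> x}" using that by simp
    show ?thesis using bspec[OF conjunct2[OF R[OF that(1), unfolded R_def]] t] that(4-7) by blast
  qed
  define K1 where "K1 = {c..c + L} - (\<Union>x\<in>F. ball x \<delta>)"
  have K1: "compact K1" unfolding K1_def by (auto intro!: compact_diff)
  have wK: "w T x ~= 0" if "x \<in> K1" for x using that \<delta>(1) by (auto simp: K1_def F_def)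
  define d where "d = min (T - a) (b - T) / 2"
  have d: "d > 0" "{T - d..T + d} \<subseteq> {a<..<b}" using T by (auto simp: d_def min_def field_simps)
  \<comment> \<open>The times near T at which w vanishes somewhere on K1. This set is compact and
    misses T, hence misses a neighbourhood of T.\<close>
  define G where "G = fst ` ({p \<in> {T - d..T + d} \<times> K1. w (fst p) (snd p) = 0})"
  have "compact {p \<in> {T - d..T + d} \<times> K1. w (fst p) (snd p) = 0}"
  proof -
    have "continuous_on ({T - d..T + d} \<times> K1) (%p. w (fst p) (snd p))"
      using continuous_on_subset[OF cont_w, of "{T - d..T + d} \<times> K1"] d(2) by (auto simp: case_prod_beta')
    then have "closed {p \<in> {T - d..T + d} \<times> K1. w (fst p) (snd p) = 0}"
      using K1 by (intro continuous_closed_preimage_constant closed_Times compact_imp_closed[OF K1] closed_atLeastAtMost)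
    then have "compact (({T - d..T + d} \<times> K1) \<inter> {p \<in> {T - d..T + d} \<times> K1. w (fst p) (snd p) = 0})"
      by (rule compact_Int_closed[OF compact_Times[OF compact_Icc K1]])
    then show ?thesis by (rule back_subst[where P = compact]) auto
  qed
  then have "compact G" unfolding G_def by (intro compact_continuous_image continuous_on_fst continuous_on_id)
  then have "closed G" by (rule compact_imp_closed)
  moreover have "T \<notin> G" using wK by (auto simp: G_def)
  ultimately obtain \<tau>k where \<tau>k: "\<tau>k > 0" "ball T \<tau>k \<subseteq> - G"
    using open_contains_ball[of "- G"] by (auto simp: open_Compl)
  have away: "w t x ~= 0" if "\<bar>t - T\<bar> < \<tau>k" "\<bar>t - T\<bar> <= d" "x \<in> K1" for t x
  proof
    assume "w t x = 0"
    then have "t \<in> G" using that unfolding G_def by (intro image_eqI[of _ _ "(t, x)"]) (auto simp: abs_le_iff)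
    moreover have "t \<in> ball T \<tau>k" using that by (auto simp: dist_real_def abs_minus_commute)
    ultimately show False using \<tau>k(2) by blast
  qed
  define \<tau>m where "\<tau>m = Min (insert \<tau>k (insert d (\<tau> ` F)))"
  have finS: "finite (insert \<tau>k (insert d (\<tau> ` F)))" using F(1) by simp
  have "\<tau>m > 0" unfolding \<tau>m_def using F(1) \<tau> \<tau>k(1) d(1) by (subst Min_gr_iff) auto
  moreover have "\<tau>m <= \<tau>k" "\<tau>m <= d" unfolding \<tau>m_def by (rule Min_le[OF finS]; simp)+
  moreover have "\<tau>m <= \<tau> x" if "x \<in> F" for x unfolding \<tau>m_def using that by (intro Min_le[OF finS]) simp
  ultimately have \<tau>m: "\<tau>m > 0" "\<tau>m <= \<tau>k" "\<tau>m <= d" "!!x. x \<in> F ==> \<tau>m <= \<tau> x" by auto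
  define Z where "Z t = {x \<in> {c..<c + L}. w t x = 0}" for t
  have finZ: "finite (Z t)" if "t \<in> {a<..<b}" for t
    by (rule finite_subset[OF _ finite_zeros[OF that, of c "c + L"]]) (auto simp: Z_def)
  have zZ: "zcount t = card (Z t)" if "t \<in> {a<..<b}" for t
    using zcount_window[OF that, of c] by (simp add: Z_def)
  have inZ: "z \<in> Z t" if "x \<in> F" "\<bar>z - x\<bar> < \<delta>" "w t z = 0" for x z t
    using \<delta>(3)[OF that(1)] that(2,3) by (auto simp: Z_def abs_less_iff)
  show ?thesis
  proof (intro exI[of _ \<tau>m] conjI allI impI \<tau>m(1))
    fix t assume t: "T - \<tau>m < t & t < T & a < t"
    then have tab: "t \<in> {a<..<b}" using T by auto
    have near: "\<exists>x1. \<bar>x1 - x\<bar> < \<delta> & w t x1 = 0 & (wx T x = 0 --> (\<exists>x2. x2 ~= x1 & \<bar>x2 - x\<bar> < \<delta> & w t x2 = 0))"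
      if "x \<in> F" for x
      using \<tau>2[OF that, of t] t \<tau>m(4)[OF that] by simp
    have ex: "\<exists>z\<in>Z t. \<bar>z - x\<bar> < \<delta>" if "x \<in> F" for x using near[OF that] inZ[OF that] by blast
    show "zcount T <= zcount t"
      unfolding zT zZ[OF tab] by (rule card_le_windows[OF finZ[OF tab] ex \<delta>(4)])
    assume "\<exists>x. w T x = 0 & wx T x = 0"
    then obtain x where x: "w T x = 0" "wx T x = 0" by blast
    obtain k :: int where k: "x + of_int k * L \<in> {c..<c + L}" using periodic_representative[OF L] .
    have "w T (x + of_int k * L) = 0" "wx T (x + of_int k * L) = 0"
      using periodic_add_int[of "w T" L x k] periodic_add_int[of "wx T" L x k] periodic[OF T] periodic_derivs(1)[OF T] x by auto
    with k have xF: "x + of_int k * L \<in> F" by (auto simp: F_def)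
    then obtain x1 x2 where "\<bar>x1 - (x + of_int k * L)\<bar> < \<delta>" "w t x1 = 0" "x2 ~= x1" "\<bar>x2 - (x + of_int k * L)\<bar> < \<delta>" "w t x2 = 0"
      using near[OF xF] \<open>wx T (x + of_int k * L) = 0\<close> by blast
    then show "zcount T < zcount t"
      unfolding zT zZ[OF tab] using inZ[OF xF]
      by (intro card_less_windows[OF finZ[OF tab] ex \<delta>(4) xF, of x1 x2]) auto
  next
    fix t assume t: "T < t & t < T + \<tau>m & t < b"
    then have tab: "t \<in> {a<..<b}" using T by auto
    show "zcount t <= zcount T"
      unfolding zT zZ[OF tab]
    proof (rule card_ge_windows(2)[OF F(1)])
      show "\<exists>x\<in>F. \<bar>z - x\<bar> < \<delta>" if "z \<in> Z t" for z
      proof (rule ccontr)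
        assume "\<not> (\<exists>x\<in>F. \<bar>z - x\<bar> < \<delta>)"
        then have "z \<in> K1" using that by (auto simp: K1_def Z_def dist_real_def abs_minus_commute)
        then show False using away[of t z] t \<tau>m that by (auto simp: Z_def)
      qed
      show "z = z'" if "x \<in> F" "z \<in> Z t" "z' \<in> Z t" "\<bar>z - x\<bar> < \<delta>" "\<bar>z' - x\<bar> < \<delta>" for x z z'
        using \<tau>3[OF that(1), of t z z'] that t \<tau>m(4)[OF that(1)] by (auto simp: Z_def)
    qed
  qed
qed

lemma zcount_left: "T \<in> {a<..<b} ==> \<exists>\<tau>>0. \<forall>t. T - \<tau> < t & t < T & a < t --> zcount T <= zcount t"
  and zcount_left_drop: "T \<in> {a<..<b} ==> \<exists>x. w T x = 0 & wx T x = 0 ==> \<exists>\<tau>>0. \<forall>t. T - \<tau> < t & t < T & a < t --> zcount T < zcount t"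
  and zcount_right: "T \<in> {a<..<b} ==> \<exists>\<tau>>0. \<forall>t. T < t & t < T + \<tau> & t < b --> zcount t <= zcount T"
proof -
  assume T: "T \<in> {a<..<b}"
  define E where "E \<longleftrightarrow> (\<exists>x. w T x = 0 & wx T x = 0)"
  have l: "\<exists>\<tau>>0. (\<forall>t. T - \<tau> < t & t < T & a < t --> zcount T <= zcount t & (E --> zcount T < zcount t)) &
    (\<forall>t. T < t & t < T + \<tau> & t < b --> zcount t <= zcount T)"
    unfolding E_def by (rule zcount_local[OF T])
  show "\<exists>\<tau>>0. \<forall>t. T - \<tau> < t & t < T & a < t --> zcount T <= zcount t" using l by blast
  show "\<exists>\<tau>>0. \<forall>t. T < t & t < T + \<tau> & t < b --> zcount t <= zcount T" using l by blast
  assume "\<exists>x. w T x = 0 & wx T x = 0"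
  then have E unfolding E_def .
  then show "\<exists>\<tau>>0. \<forall>t. T - \<tau> < t & t < T & a < t --> zcount T < zcount t" using l by blast
qed

lemma zcount_antimono:
  assumes "a < s" "s <= t" "t < b"
  shows "zcount t <= zcount s"
  by (rule locally_antimono_imp_antimono[where f = zcount, OF _ _ assms]) (use zcount_left zcount_right in simp_all)

lemma zcount_drop:
  assumes "a < s" "s < T" "T < b" "w T x = 0" "wx T x = 0"
  shows "zcount T < zcount s"
proof -
  have T: "T \<in> {a<..<b}" using assms by auto
  obtain \<tau> where \<tau>: "\<tau> > 0" "!!t. T - \<tau> < t ==> t < T ==> a < t ==> zcount T < zcount t"
    using zcount_left_drop[OF T] assms(4,5) by blast
  define t where "t = max s (T - \<tau> / 2)"
  have "s <= t" "t < T" "T - \<tau> < t" using assms \<tau>(1) by (auto simp: t_def)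
  then show ?thesis using \<tau>(2)[of t] zcount_antimono[of s t] assms by auto
qed

end

section \<open>The phase space\<close>

lemma C1_differentiable_deriv:
  fixes u :: "real => real"
  assumes "u C1_differentiable_on UNIV"
  shows "(u has_real_derivative deriv u x) (at x)" "continuous_on UNIV (deriv u)"
proof -
  obtain D where D: "!!x. (u has_vector_derivative D x) (at x)" "continuous_on UNIV D"
    using assms unfolding C1_differentiable_on_def by auto
  then have d: "(u has_real_derivative D x) (at x)" for x by (simp add: has_real_derivative_iff_has_vector_derivative)
  then have "deriv u = D" by (auto intro!: DERIV_imp_deriv)
  then show "(u has_real_derivative deriv u x) (at x)" "continuous_on UNIV (deriv u)" using d D by auto
qed

lemma C1_differentiable_onI:
  fixes u :: "real => real"
  assumes "!!x. (u has_real_derivative u' x) (at x)" "continuous_on UNIV u'"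
  shows "u C1_differentiable_on UNIV"
  unfolding C1_differentiable_on_def
  using assms by (intro exI[of _ u']) (simp add: has_real_derivative_iff_has_vector_derivative)

lemma integral_periodic_shift:
  fixes h :: "real => complex"
  assumes a: "0 <= a" "a <= L" and c: "continuous_on UNIV h" and per: "!!x. h (x + L) = h x"
  shows "integral {0..L} (%x. h (x + a)) = integral {0..L} h"
proof -
  have int: "h integrable_on {p..q}" for p q
    by (rule integrable_continuous_real[OF continuous_on_subset[OF c]]) simp
  have sh: "integral {p..q} (%x. h (x + d)) = integral {p + d..q + d} h" for p q d
    using integral_shift_Icc_real[of p q h d] by (simp add: o_def add.commute)
  have "integral {0..L} (%x. h (x + a)) = integral {a..L + a} h" using sh[of 0 L a] by simp
  also have "\<dots> = integral {a..L} h + integral {L..L + a} h"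
    using a int by (intro Henstock_Kurzweil_Integration.integral_combine[symmetric]) auto
  also have "integral {L..L + a} h = integral {0..a} h" using sh[of 0 a L] per by (simp add: add.commute)
  also have "integral {a..L} h + integral {0..a} h = integral {0..L} h"
    using a int Henstock_Kurzweil_Integration.integral_combine[of 0 a L h] by (simp add: add.commute)
  finally show ?thesis .
qed

text \<open>Minkowski's inequality for finite sums, passed to the supremum over finite sets.\<close>

lemma l2_triangle:
  fixes a b c :: "'k => real"
  assumes a: "(%k. (a k)\<^sup>2) summable_on UNIV" and b: "(%k. (b k)\<^sup>2) summable_on UNIV"
    and c: "!!k. 0 <= c k" "!!k. c k <= a k + b k"
  shows "(%k. (c k)\<^sup>2) summable_on UNIV"
    "sqrt (\<Sum>\<^sub>\<infinity>k. (c k)\<^sup>2) <= sqrt (\<Sum>\<^sub>\<infinity>k. (a k)\<^sup>2) + sqrt (\<Sum>\<^sub>\<infinity>k. (b k)\<^sup>2)"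
proof -
  define S where "S = sqrt (\<Sum>\<^sub>\<infinity>k. (a k)\<^sup>2) + sqrt (\<Sum>\<^sub>\<infinity>k. (b k)\<^sup>2)"
  have S: "S >= 0" unfolding S_def by (intro add_nonneg_nonneg real_sqrt_ge_zero infsum_nonneg) auto
  have fin: "sum (%k. (c k)\<^sup>2) F <= S\<^sup>2" if "finite F" for F
  proof -
    have "sum (%k. (a k)\<^sup>2) F <= (\<Sum>\<^sub>\<infinity>k. (a k)\<^sup>2)" "sum (%k. (b k)\<^sup>2) F <= (\<Sum>\<^sub>\<infinity>k. (b k)\<^sup>2)"
      using a b that by (auto intro!: finite_sum_le_infsum)
    then have ab: "L2_set a F + L2_set b F <= S" unfolding L2_set_def S_def by (intro add_mono real_sqrt_le_mono)
    have "L2_set c F <= L2_set (%k. a k + b k) F" using c by (intro L2_set_mono)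
    also have "\<dots> <= L2_set a F + L2_set b F" by (rule L2_set_triangle_ineq)
    finally have "L2_set c F <= S" using ab by simp
    then have "(L2_set c F)\<^sup>2 <= S\<^sup>2" by (intro power_mono L2_set_nonneg)
    moreover have "(L2_set c F)\<^sup>2 = sum (%k. (c k)\<^sup>2) F" unfolding L2_set_def by (simp add: sum_nonneg)
    ultimately show ?thesis by simp
  qed
  show s: "(%k. (c k)\<^sup>2) summable_on UNIV"
    by (rule nonneg_bdd_above_summable_on) (use fin in \<open>auto intro!: bdd_aboveI2[where M = "S\<^sup>2"]\<close>)
  have "(\<Sum>\<^sub>\<infinity>k. (c k)\<^sup>2) <= S\<^sup>2" using fin by (intro infsum_le_finite_sums[OF s])
  then show "sqrt (\<Sum>\<^sub>\<infinity>k. (c k)\<^sup>2) <= sqrt (\<Sum>\<^sub>\<infinity>k. (a k)\<^sup>2) + sqrt (\<Sum>\<^sub>\<infinity>k. (b k)\<^sup>2)"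
    unfolding S_def[symmetric] using S by (rule real_le_lsqrt[rotated])
qed

lemma continuous_on_Times_of_uniform:
  fixes U :: "real => real => real"
  assumes "!!t. t \<in> S ==> continuous_on UNIV (U t)"
    and "!!t e. t \<in> S ==> e > 0 ==> \<exists>d>0. \<forall>s\<in>S. \<bar>s - t\<bar> < d --> (\<forall>x. \<bar>U s x - U t x\<bar> < e)"
  shows "continuous_on (S \<times> UNIV) (%(t, x). U t x)"
  unfolding continuous_on_iff
proof (intro ballI allI impI)
  fix p and e :: real assume p: "p \<in> S \<times> (UNIV :: real set)" and e: "e > 0"
  obtain t x where tx: "p = (t, x)" "t \<in> S" using p by auto
  obtain d1 where d1: "d1 > 0" "!!s x. s \<in> S ==> \<bar>s - t\<bar> < d1 ==> \<bar>U s x - U t x\<bar> < e / 2"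
    using assms(2)[OF tx(2), of "e / 2"] e by (meson half_gt_zero)
  obtain d2 where d2: "d2 > 0" "!!y. \<bar>y - x\<bar> < d2 ==> \<bar>U t y - U t x\<bar> < e / 2"
    using assms(1)[OF tx(2)] e unfolding continuous_on_iff dist_real_def by (metis UNIV_I half_gt_zero)
  show "\<exists>d>0. \<forall>q\<in>S \<times> UNIV. dist q p < d --> dist (case q of (t, x) => U t x) (case p of (t, x) => U t x) < e"
  proof (intro exI[of _ "min d1 d2"] conjI ballI impI)
    fix q assume q: "q \<in> S \<times> (UNIV :: real set)" "dist q p < min d1 d2"
    obtain s y where sy: "q = (s, y)" "s \<in> S" using q(1) by auto
    have "dist s t <= dist q p" "dist y x <= dist q p"
      using dist_fst_le[of q p] dist_snd_le[of q p] by (simp_all add: sy tx)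
    then have "\<bar>U s y - U t y\<bar> < e / 2" "\<bar>U t y - U t x\<bar> < e / 2"
      using d1(2)[of s y] d2(2)[of y] sy q(2) by (auto simp: dist_real_def)
    then show "dist (case q of (t, x) => U t x) (case p of (t, x) => U t x) < e"
      unfolding sy tx prod.case dist_real_def by linarith
  qed (use d1 d2 in auto)
qed

lemma C1_circle_D:
  assumes "u \<in> C1_circle L"
  shows "u (x + L) = u x" "(u has_real_derivative deriv u x) (at x)" "continuous_on UNIV (deriv u)"
    "continuous_on UNIV u" "deriv u (x + L) = deriv u x"
proof -
  have p: "!!x. u (x + L) = u x" using assms by (auto simp: C1_circle_def L_periodic_def)
  show "u (x + L) = u x" by (rule p)
  have d: "!!x. (u has_real_derivative deriv u x) (at x)" and "continuous_on UNIV (deriv u)"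
    using assms C1_differentiable_deriv by (auto simp: C1_circle_def)
  then show "(u has_real_derivative deriv u x) (at x)" "continuous_on UNIV (deriv u)" by auto
  show "continuous_on UNIV u" using d by (auto intro!: continuous_at_imp_continuous_on DERIV_isCont)
  have "((%x. u (x + L)) has_real_derivative deriv u (x + L)) (at x)" using DERIV_shift[of u] d by blast
  then have "(u has_real_derivative deriv u (x + L)) (at x)" using p by simp
  then show "deriv u (x + L) = deriv u x" using DERIV_imp_deriv by metis
qed

lemma C1_circleI:
  assumes "!!x. u (x + L) = u x" "!!x. (u has_real_derivative u' x) (at x)" "continuous_on UNIV u'"
  shows "u \<in> C1_circle L" "deriv u = u'"
proof -
  show "u \<in> C1_circle L" using assms(1) C1_differentiable_onI[OF assms(2,3)] by (auto simp: C1_circle_def L_periodic_def)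
  show "deriv u = u'" using assms(2) by (auto intro!: DERIV_imp_deriv)
qed

lemma C1_circle_combine:
  assumes "u \<in> C1_circle L" "v \<in> C1_circle L"
  shows "(%x. u x - v x) \<in> C1_circle L" "deriv (%x. u x - v x) = (%x. deriv u x - deriv v x)"
    "(%x. c * u x) \<in> C1_circle L" "deriv (%x. c * u x) = (%x. c * deriv u x)"
proof -
  note U = C1_circle_D[OF assms(1)] and V = C1_circle_D[OF assms(2)]
  have 1: "!!x. ((%x. u x - v x) has_real_derivative deriv u x - deriv v x) (at x)" using U V by (auto intro!: DERIV_diff)
  have 2: "!!x. ((%x. c * u x) has_real_derivative c * deriv u x) (at x)" using U by (auto intro!: DERIV_cmult)
  have c1: "continuous_on UNIV (%x. deriv u x - deriv v x)" and c2: "continuous_on UNIV (%x. c * deriv u x)"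
    using U V by (auto intro!: continuous_intros)
  show "(%x. u x - v x) \<in> C1_circle L" by (rule C1_circleI(1)[OF _ 1 c1]) (simp add: U V)
  show "(%x. c * u x) \<in> C1_circle L" by (rule C1_circleI(1)[OF _ 2 c2]) (simp add: U V)
  show "deriv (%x. u x - v x) = (%x. deriv u x - deriv v x)" "deriv (%x. c * u x) = (%x. c * deriv u x)"
    using 1 2 by (auto intro!: DERIV_imp_deriv)
qed

lemma C1_circle_shift:
  assumes "u \<in> C1_circle L"
  shows "shift a u \<in> C1_circle L" "deriv (shift a u) = shift a (deriv u)"
proof -
  note U = C1_circle_D[OF assms]
  have 1: "!!x. (shift a u has_real_derivative shift a (deriv u) x) (at x)"
    unfolding shift_def using DERIV_shift[of u] U(2) by blast
  have 2: "continuous_on UNIV (shift a (deriv u))" unfolding shift_def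
    by (rule continuous_on_compose2[OF U(3)]) (auto intro!: continuous_intros)
  have 3: "shift a u (x + L) = shift a u x" for x using U(1)[of "x + a"] by (simp add: shift_def add_ac)
  show "shift a u \<in> C1_circle L" "deriv (shift a u) = shift a (deriv u)"
    by (rule C1_circleI[OF 3 1 2])+
qed

lemma periodic_bounded:
  assumes "L > 0" "continuous_on UNIV (u :: real => real)" "!!x. u (x + L) = u x"
  shows "\<exists>B\<ge>0. \<forall>x. \<bar>u x\<bar> <= B"
proof -
  have "\<exists>K\<ge>0. \<forall>t\<in>{0 :: real}. \<forall>x. \<bar>u x\<bar> <= K"
  proof (rule periodic_continuous_bounded[OF assms(1), of "{0}" "%_. u"])
    have "continuous_on ({0 :: real} \<times> UNIV) (%p. u (snd p))"
      by (rule continuous_on_compose2[OF assms(2)]) (auto intro!: continuous_intros)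
    then show "continuous_on ({0 :: real} \<times> UNIV) (%(t, x). u x)" by (simp add: case_prod_beta')
  qed (use assms in auto)
  then show ?thesis by auto
qed

section \<open>The fractional power norm, its control of C1, and space shifts\<close>

locale circle_phase_space =
  fixes L \<alpha> :: real
  assumes L: "L > 0" and embedded: "compactly_embedded_C1 L \<alpha>"
begin

abbreviation X where "X \<equiv> phase_space L \<alpha>"
abbreviation fn where "fn \<equiv> frac_norm L \<alpha>"

definition coef where "coef u k = (1 + eigenvalue L k) powr \<alpha> * cmod (fourier_coeff L u k)"

lemma coef_nonneg: "coef u k >= 0" by (simp add: coef_def)

lemma fn_coef: "fn u = sqrt (\<Sum>\<^sub>\<infinity>k. (coef u k)\<^sup>2)" by (simp add: frac_norm_def coef_def)

lemma fn_nonneg: "fn u >= 0" unfolding fn_coef by (intro real_sqrt_ge_zero infsum_nonneg) auto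

lemma C1_L2: "u \<in> C1_circle L ==> u \<in> L2_circle L"
  unfolding L2_circle_def L_periodic_def mem_Collect_eq
  by (intro conjI allI borel_measurable_continuous_onI borel_integrable_atLeastAtMost' continuous_on_power)
    (auto simp: C1_circle_D intro: continuous_on_subset[OF C1_circle_D(4)])

lemma X_iff: "u \<in> X \<longleftrightarrow> u \<in> C1_circle L & (%k. (coef u k)\<^sup>2) summable_on UNIV"
  by (auto simp: phase_space_def frac_domain_def coef_def C1_L2)

lemma fourier_integrable:
  assumes "continuous_on UNIV u"
  shows "set_integrable lborel {0..L} (%x. complex_of_real (u x) * cis (- (2 * pi * real_of_int k * x / L)))"
  using L by (intro borel_integrable_atLeastAtMost') (auto intro!: continuous_intros continuous_on_subset[OF assms])

lemma fourier_diff: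
  assumes "u \<in> C1_circle L" "v \<in> C1_circle L"
  shows "fourier_coeff L (%x. u x - v x) k = fourier_coeff L u k - fourier_coeff L v k"
proof -
  have eq: "complex_of_real (u x - v x) * cis y = complex_of_real (u x) * cis y - complex_of_real (v x) * cis y" for x y
    by (simp add: left_diff_distrib)
  show ?thesis unfolding fourier_coeff_def eq right_diff_distrib[symmetric]
    by (subst set_integral_diff(2)) (use assms in \<open>auto intro!: fourier_integrable C1_circle_D(4)\<close>)
qed

lemma fourier_scale: "fourier_coeff L (%x. c * u x) k = of_real c * fourier_coeff L u k"
  unfolding fourier_coeff_def by (simp add: mult.assoc mult.left_commute[of _ "complex_of_real c"])

lemma X_diff:
  assumes "u \<in> X" "v \<in> X"
  shows "(%x. u x - v x) \<in> X" "fn (%x. u x - v x) <= fn u + fn v"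
proof -
  have le: "coef (%x. u x - v x) k <= coef u k + coef v k" for k
    using assms unfolding coef_def X_iff
    by (auto simp: fourier_diff distrib_left[symmetric] intro!: mult_left_mono norm_triangle_ineq4)
  show "(%x. u x - v x) \<in> X" "fn (%x. u x - v x) <= fn u + fn v"
    using assms l2_triangle[OF _ _ coef_nonneg le] C1_circle_combine(1)[of u L v] unfolding X_iff fn_coef by auto
qed

lemma X_scale:
  assumes "u \<in> X"
  shows "(%x. c * u x) \<in> X" "fn (%x. c * u x) = \<bar>c\<bar> * fn u"
proof -
  have co: "coef (%x. c * u x) k = \<bar>c\<bar> * coef u k" for k by (simp add: coef_def fourier_scale norm_mult)
  show "(%x. c * u x) \<in> X"
    using assms C1_circle_combine(3)[of u L u c] by (auto simp: X_iff co power_mult_distrib intro!: summable_on_cmult_right)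
  show "fn (%x. c * u x) = \<bar>c\<bar> * fn u"
    unfolding fn_coef co power_mult_distrib infsum_cmult_right' by (simp add: real_sqrt_mult)
qed

text \<open>A scaling argument turns the sequential compactness of the embedding into a norm bound.\<close>

lemma C1_bound: "\<exists>C>0. \<forall>u\<in>X. \<forall>x. \<bar>u x\<bar> <= C * fn u & \<bar>deriv u x\<bar> <= C * fn u"
proof (rule ccontr)
  assume no: "\<not> ?thesis"
  have "\<exists>u x. u \<in> X & max \<bar>u x\<bar> \<bar>deriv u x\<bar> > real (Suc n) * fn u" for n
  proof (rule ccontr)
    assume "\<not> ?thesis"
    then have "\<forall>u\<in>X. \<forall>x. \<bar>u x\<bar> <= real (Suc n) * fn u & \<bar>deriv u x\<bar> <= real (Suc n) * fn u"
      by (metis max.bounded_iff not_less)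
    then show False using no by (metis of_nat_0_less_iff zero_less_Suc)
  qed
  then obtain U x where U: "!!n. U n \<in> X" "!!n. max \<bar>U n (x n)\<bar> \<bar>deriv (U n) (x n)\<bar> > real (Suc n) * fn (U n)" by metis
  define m where "m n = max \<bar>U n (x n)\<bar> \<bar>deriv (U n) (x n)\<bar>" for n
  have mU: "m n > real (Suc n) * fn (U n)" for n using U(2) by (simp add: m_def)
  have m: "m n > 0" for n using mU[of n] fn_nonneg[of "U n"] by (smt (verit) mult_nonneg_nonneg of_nat_0_le_iff)
  \<comment> \<open>The rescaled functions have norm at most 1, while their C1 size at x n equals
    \<open>Suc n\<close>; no subsequence can converge in C1.\<close>
  define c where "c n = real (Suc n) / m n" for n
  have c: "c n > 0" for n using m by (simp add: c_def)
  define w where "w n = (%y. c n * U n y)" for n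
  have w: "w n \<in> X" "fn (w n) = c n * fn (U n)" for n using X_scale[OF U(1), of "c n"] c[of n] by (auto simp: w_def)
  have "fn (w n) <= 1" for n unfolding w c_def using mU[of n] m[of n] by (simp add: divide_simps)
  then have bdd: "bounded (range (%n. fn (w n)))" using fn_nonneg by (intro boundedI[of _ 1]) auto
  have wX: "\<forall>n. w n \<in> frac_domain L \<alpha> \<inter> C1_circle L" using w(1) by (simp add: phase_space_def)
  obtain r v where r: "strict_mono (r :: nat => nat)" "v \<in> C1_circle L" "uniform_limit UNIV (%n. w (r n)) v sequentially"
    "uniform_limit UNIV (%n. deriv (w (r n))) (deriv v) sequentially"
    using embedded wX bdd unfolding compactly_embedded_C1_def by blast
  note V = C1_circle_D[OF r(2)]
  obtain B1 where B1: "!!x. \<bar>v x\<bar> <= B1" using periodic_bounded[OF L V(4) V(1)] by blast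
  obtain B2 where B2: "!!x. \<bar>deriv v x\<bar> <= B2" using periodic_bounded[OF L V(3) V(5)] by blast
  have "\<forall>\<^sub>F n in sequentially. \<forall>y\<in>UNIV. dist (w (r n) y) (v y) < 1" "\<forall>\<^sub>F n in sequentially. \<forall>y\<in>UNIV. dist (deriv (w (r n)) y) (deriv v y) < 1"
    using uniform_limitD[OF r(3), of 1] uniform_limitD[OF r(4), of 1] by auto
  then have "\<forall>\<^sub>F n in sequentially. (\<forall>y\<in>UNIV. dist (w (r n) y) (v y) < 1) & (\<forall>y\<in>UNIV. dist (deriv (w (r n)) y) (deriv v y) < 1)
      & n > nat \<lceil>max B1 B2 + 1\<rceil>"
    by (intro eventually_conj eventually_gt_at_top)
  then obtain n where n: "!!y. dist (w (r n) y) (v y) < 1" "!!y. dist (deriv (w (r n)) y) (deriv v y) < 1" "n > nat \<lceil>max B1 B2 + 1\<rceil>"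
    using eventually_happens' sequentially_bot by blast
  define k where "k = r n"
  have "n <= k" unfolding k_def using r(1) by (rule seq_suble)
  have Uk: "U k \<in> C1_circle L" using U(1) by (simp add: phase_space_def)
  have dw: "deriv (w k) = (%y. c k * deriv (U k) y)" unfolding w_def by (rule C1_circle_combine(4)[OF Uk Uk])
  have "c k * m k = real (Suc k)" using m[of k] by (simp add: c_def)
  moreover have "c k * m k = max \<bar>w k (x k)\<bar> \<bar>deriv (w k) (x k)\<bar>"
    unfolding dw using c[of k] by (simp add: m_def w_def max_mult_distrib_left abs_mult)
  moreover have "\<bar>w k (x k)\<bar> < B1 + 1" using n(1)[of "x k"] B1[of "x k"] unfolding k_def dist_real_def by linarith
  moreover have "\<bar>deriv (w k) (x k)\<bar> < B2 + 1" using n(2)[of "x k"] B2[of "x k"] unfolding k_def dist_real_def by linarith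
  ultimately have "real (Suc k) < max B1 B2 + 1" by linarith
  then show False using n(3) \<open>n <= k\<close> by linarith
qed

lemma X_C1: "u \<in> X ==> u \<in> C1_circle L" by (simp add: X_iff)

sublocale M: Metric_space X "%u v. fn (%x. u x - v x)"
proof
  show "0 <= fn (%x. u x - v x)" for u v by (rule fn_nonneg)
  have cs: "coef (%x. u x - v x) = coef (%x. v x - u x)" for u v
  proof
    fix k
    have "(%x. u x - v x) = (%x. (- 1) * (v x - u x))" by auto
    then have "fourier_coeff L (%x. u x - v x) k = of_real (- 1) * fourier_coeff L (%x. v x - u x) k"
      using fourier_scale[of "- 1" "%x. v x - u x" k] by simp
    then show "coef (%x. u x - v x) k = coef (%x. v x - u x) k" by (simp add: coef_def)
  qed
  show "fn (%x. u x - v x) = fn (%x. v x - u x)" for u v unfolding fn_coef cs[of u v] ..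
  \<comment> \<open>Definiteness rests on \<open>C1_bound\<close>, which controls the genuine
    function and not only its class modulo null sets.\<close>
  show "(fn (%x. u x - v x) = 0) = (u = v)" if "u \<in> X" "v \<in> X" for u v
  proof
    assume 0: "fn (%x. u x - v x) = 0"
    obtain C where "!!u x. u \<in> X ==> \<bar>u x\<bar> <= C * fn u" using C1_bound by blast
    from this[OF X_diff(1)[OF that]] 0 show "u = v" by auto
  next
    assume "u = v"
    then show "fn (%x. u x - v x) = 0" by (simp add: fn_coef coef_def fourier_coeff_def)
  qed
  show "fn (%x. u x - w x) <= fn (%x. u x - v x) + fn (%x. v x - w x)" if "u \<in> X" "v \<in> X" "w \<in> X" for u v w
  proof -
    have "fn (%x. (u x - v x) - (w x - v x)) <= fn (%x. u x - v x) + fn (%x. w x - v x)"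
      using that by (intro X_diff)
    moreover have "fn (%x. w x - v x) = fn (%x. v x - w x)"
      using X_scale(2)[OF X_diff(1)[OF that(2,3)], of "- 1"] by simp
    ultimately show ?thesis by simp
  qed
qed

lemma phase_topology_eq: "phase_topology L \<alpha> = M.mtopology" by (simp add: phase_topology_def)

lemma topspace_phase: "topspace (phase_topology L \<alpha>) = X" by (simp add: phase_topology_eq)

lemma fourier_shift:
  assumes u: "u \<in> C1_circle L" and a: "0 <= a" "a <= L"
  shows "fourier_coeff L (shift a u) k = cis (2 * pi * real_of_int k * a / L) * fourier_coeff L u k"
proof -
  define h where "h x = complex_of_real (u x) * cis (- (2 * pi * real_of_int k * x / L))" for x
  note U = C1_circle_D[OF u]
  have c: "continuous_on UNIV h" unfolding h_def using L U(4) by (auto intro!: continuous_intros)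
  have per: "h (x + L) = h x" for x
  proof -
    have 1: "- (2 * pi * real_of_int k * (x + L) / L) = - (2 * pi * real_of_int k * x / L) + 2 * pi * of_int (- k)"
      using L by (simp add: field_simps)
    have 2: "cis (2 * pi * of_int (- k)) = 1" by (rule cis_multiple_2pi) simp
    show ?thesis unfolding h_def U(1) 1 cis_mult[symmetric] 2 mult_1_right ..
  qed
  have sh: "complex_of_real (shift a u x) * cis (- (2 * pi * real_of_int k * x / L)) = cis (2 * pi * real_of_int k * a / L) * h (x + a)" for x
  proof -
    have "- (2 * pi * real_of_int k * x / L) = 2 * pi * real_of_int k * a / L + - (2 * pi * real_of_int k * (x + a) / L)"
      using L by (simp add: field_simps)
    then show ?thesis unfolding h_def shift_def by (simp only: cis_mult[symmetric] mult_ac)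
  qed
  have eq: "(LBINT x:{0..L}. h (x + d)) = integral {0..L} (%x. h (x + d))" for d
    by (intro set_borel_integral_eq_integral borel_integrable_atLeastAtMost' continuous_on_compose2[OF c]) (auto intro!: continuous_intros)
  have "(LBINT x:{0..L}. h (x + a)) = (LBINT x:{0..L}. h x)"
    using eq[of a] eq[of 0] integral_periodic_shift[OF a c per] by simp
  then show ?thesis unfolding fourier_coeff_def sh h_def[symmetric] by simp
qed

lemma shift_X:
  assumes u: "u \<in> X"
  shows "shift a u \<in> X" "fn (shift a u) = fn u"
proof -
  have C1: "u \<in> C1_circle L" using u by (rule X_C1)
  \<comment> \<open>\<open>fourier_shift\<close> treats shifts within one period, so a is first
    reduced modulo L.\<close>
  obtain k :: int where k: "a + of_int k * L \<in> {0..<0 + L}" using periodic_representative[OF L] .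
  define b where "b = a + of_int k * L"
  have b: "0 <= b" "b <= L" using k by (auto simp: b_def)
  have sb: "shift a u = shift b u"
  proof
    fix x show "shift a u x = shift b u x"
      using periodic_add_int[of u L "x + a" k] C1_circle_D(1)[OF C1] by (simp add: shift_def b_def add_ac)
  qed
  have co: "coef (shift a u) = coef u" unfolding coef_def sb by (simp add: fourier_shift[OF C1 b] norm_mult fun_eq_iff)
  show "shift a u \<in> X" using u C1_circle_shift(1)[OF C1, of a] by (simp add: X_iff co)
  show "fn (shift a u) = fn u" by (simp add: fn_coef co)
qed

lemma solution_continuous_fn:
  fixes \<phi> :: "real => real => real"
  assumes "continuous_map (top_of_set {0..<T}) (phase_topology L \<alpha>) \<phi>" "t0 \<in> {0..<T}" "e > 0"
  shows "\<exists>d>0. \<forall>t\<in>{0..<T}. \<bar>t - t0\<bar> < d --> \<phi> t \<in> X & fn (%x. \<phi> t0 x - \<phi> t x) < e"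
proof -
  obtain U where U: "openin (top_of_set {0..<T}) U" "t0 \<in> U" "\<forall>y\<in>U. \<phi> y \<in> M.mball (\<phi> t0) e"
    using assms(1)[unfolded phase_topology_eq M.continuous_map_to_metric] assms(2,3) by (metis topspace_euclidean_subtopology)
  obtain d where "d > 0" "\<forall>x'\<in>{0..<T}. dist x' t0 < d --> x' \<in> U"
    using U(1,2) unfolding openin_euclidean_subtopology_iff by blast
  then show ?thesis using U(3) by (intro exI[of _ d]) (auto simp: dist_real_def)
qed

lemma solution_in_X:
  assumes "is_solution L \<alpha> g T \<phi>" "t \<in> {0..<T}"
  shows "\<phi> t \<in> X"
proof -
  have "\<phi> ` {0..<T} \<subseteq> X"
    using assms(1) unfolding is_solution_def by (auto dest!: continuous_map_image_subset_topspace simp: topspace_phase image_subset_iff)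
  then show ?thesis using assms(2) by blast
qed

lemma solution_continuous:
  assumes "is_solution L \<alpha> g T \<phi>" "t0 \<in> {0..<T}" "e > 0"
  shows "\<exists>d>0. \<forall>t\<in>{0..<T}. \<bar>t - t0\<bar> < d --> (\<forall>x. \<bar>\<phi> t x - \<phi> t0 x\<bar> < e & \<bar>deriv (\<phi> t) x - deriv (\<phi> t0) x\<bar> < e)"
proof -
  obtain C where C: "C > 0" "!!u x. u \<in> X ==> \<bar>u x\<bar> <= C * fn u & \<bar>deriv u x\<bar> <= C * fn u" using C1_bound by blast
  have "e / C > 0" using C assms by simp
  then obtain d where d: "d > 0" "!!t. t \<in> {0..<T} ==> \<bar>t - t0\<bar> < d ==> \<phi> t \<in> X & fn (%x. \<phi> t0 x - \<phi> t x) < e / C"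
    using solution_continuous_fn[OF _ assms(2), of \<phi> "e / C"] assms(1) unfolding is_solution_def by blast
  have t0: "\<phi> t0 \<in> X" by (rule solution_in_X[OF assms(1,2)])
  show ?thesis
  proof (intro exI[of _ d] conjI ballI impI allI d(1))
    fix t x assume t: "t \<in> {0..<T}" "\<bar>t - t0\<bar> < d"
    have tX: "\<phi> t \<in> X" and lt: "C * fn (%x. \<phi> t0 x - \<phi> t x) < e" using d(2)[OF t] C(1) by (auto simp: field_simps)
    note D = C1_circle_combine(2)[OF X_C1[OF t0] X_C1[OF tX]]
    show "\<bar>\<phi> t x - \<phi> t0 x\<bar> < e" "\<bar>deriv (\<phi> t) x - deriv (\<phi> t0) x\<bar> < e"
      using C(2)[OF X_diff(1)[OF t0 tX], of x] lt unfolding D by linarith+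
  qed
qed

end

section \<open>Classical solutions\<close>

text \<open>A solution concept on an arbitrary open time interval, without the phase space norm: it
  can be shifted in space and time and restricted, and it serves orbits extended to negative times,
  whereas \<open>is_solution\<close> always starts at time 0.\<close>

definition classical_with where
  "classical_with L g a b U Ut Uxx \<longleftrightarrow> (\<forall>t\<in>{a<..<b}. U t \<in> C1_circle L) &
     continuous_on ({a<..<b} \<times> UNIV) (%(t, x). U t x) & continuous_on ({a<..<b} \<times> UNIV) (%(t, x). deriv (U t) x) &
     continuous_on ({a<..<b} \<times> UNIV) (%(t, x). Ut t x) & continuous_on ({a<..<b} \<times> UNIV) (%(t, x). Uxx t x) &
     (\<forall>t\<in>{a<..<b}. \<forall>x. ((%s. U s x) has_real_derivative Ut t x) (at t)) &
     (\<forall>t\<in>{a<..<b}. \<forall>x. (deriv (U t) has_real_derivative Uxx t x) (at x)) &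
     (\<forall>t\<in>{a<..<b}. \<forall>x. Ut t x = Uxx t x + g (t, U t x, deriv (U t) x))"
  for L a b :: real and g :: nonlinearity and U Ut Uxx :: "real => real => real"

definition classical_solution where
  "classical_solution L g a b U \<longleftrightarrow> (\<exists>Ut Uxx. classical_with L g a b U Ut Uxx)"

lemma classical_withD:
  assumes "classical_with L g a b U Ut Uxx"
  shows "t \<in> {a<..<b} ==> U t \<in> C1_circle L"
    "continuous_on ({a<..<b} \<times> UNIV) (%(t, x). U t x)" "continuous_on ({a<..<b} \<times> UNIV) (%(t, x). deriv (U t) x)"
    "continuous_on ({a<..<b} \<times> UNIV) (%(t, x). Ut t x)" "continuous_on ({a<..<b} \<times> UNIV) (%(t, x). Uxx t x)"
    "t \<in> {a<..<b} ==> ((%s. U s x) has_real_derivative Ut t x) (at t)"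
    "t \<in> {a<..<b} ==> (deriv (U t) has_real_derivative Uxx t x) (at x)"
    "t \<in> {a<..<b} ==> Ut t x = Uxx t x + g (t, U t x, deriv (U t) x)"
  using assms unfolding classical_with_def by blast+

lemma classical_solutionI:
  assumes "!!t. t \<in> {a<..<b} ==> U t \<in> C1_circle L"
    "continuous_on ({a<..<b} \<times> UNIV) (%(t, x). U t x)" "continuous_on ({a<..<b} \<times> UNIV) (%(t, x). deriv (U t) x)"
    "continuous_on ({a<..<b} \<times> UNIV) (%(t, x). Ut t x)" "continuous_on ({a<..<b} \<times> UNIV) (%(t, x). Uxx t x)"
    "!!t x. t \<in> {a<..<b} ==> ((%s. U s x) has_real_derivative Ut t x) (at t)"
    "!!t x. t \<in> {a<..<b} ==> (deriv (U t) has_real_derivative Uxx t x) (at x)"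
    "!!t x. t \<in> {a<..<b} ==> Ut t x = Uxx t x + g (t, U t x, deriv (U t) x)"
  shows "classical_solution L g a b U"
proof -
  have "classical_with L g a b U Ut Uxx" unfolding classical_with_def using assms by blast
  then show ?thesis unfolding classical_solution_def by blast
qed

lemma continuous_on_Times_compose:
  assumes "continuous_on (S \<times> UNIV) (%(t, x). F t x)" "!!t. t \<in> S' ==> t + c \<in> S"
  shows "continuous_on (S' \<times> UNIV) (%(t, x). F (t + c :: real) (x + d :: real) :: real)"
proof -
  have "continuous_on (S' \<times> UNIV) (%p. (%(t, x). F t x) (fst p + c, snd p + d))"
    by (rule continuous_on_compose2[OF assms(1)]) (use assms(2) in \<open>auto intro!: continuous_intros\<close>)
  then show ?thesis by (simp add: case_prod_beta')
qed

lemma classical_solution_shift: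
  assumes "classical_solution L g a b U"
  shows "classical_solution L g a b (%t. shift c (U t))"
proof -
  obtain Ut Uxx where cwU: "classical_with L g a b U Ut Uxx"
    using assms unfolding classical_solution_def by blast
  note U = classical_withD(1)[OF cwU] and c = classical_withD(2-5)[OF cwU] and d = classical_withD(6-8)[OF cwU]
  note sh = continuous_on_Times_compose[where c = 0 and d = c and S = "{a<..<b}" and S' = "{a<..<b}", simplified]
  have ds: "deriv (shift c (U t)) x = deriv (U t) (x + c)" if "t \<in> {a<..<b}" for t x
    using C1_circle_shift(2)[OF U[OF that], of c] by (simp add: shift_def)
  have cd: "continuous_on ({a<..<b} \<times> UNIV) (%(t, x). deriv (shift c (U t)) x)"
    by (rule continuous_on_eq[OF sh[OF c(2)]]) (auto simp: ds)
  have dd: "(deriv (shift c (U t)) has_real_derivative Uxx t (x + c)) (at x)" if "t \<in> {a<..<b}" for t x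
  proof -
    have "deriv (shift c (U t)) = (%x. deriv (U t) (x + c))" using ds[OF that] by auto
    then show ?thesis using d(2)[OF that, of "x + c"] DERIV_shift[of "deriv (U t)" _ x c] by simp
  qed
  show ?thesis
  proof (rule classical_solutionI[where Ut = "%t x. Ut t (x + c)" and Uxx = "%t x. Uxx t (x + c)"])
    fix t x assume t: "t \<in> {a<..<b}"
    show "shift c (U t) \<in> C1_circle L" by (rule C1_circle_shift(1)[OF U[OF t]])
    show "((%s. shift c (U s) x) has_real_derivative Ut t (x + c)) (at t)" using d(1)[OF t] by (simp add: shift_def)
    show "Ut t (x + c) = Uxx t (x + c) + g (t, shift c (U t) x, deriv (shift c (U t)) x)"
      unfolding ds[OF t] d(3)[OF t] by (simp add: shift_def)
  qed (use sh[OF c(1)] sh[OF c(3)] sh[OF c(4)] dd cd in \<open>simp_all add: shift_def\<close>)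
qed

lemma classical_solution_translate:
  assumes "classical_solution L (translate s g) a b U"
  shows "classical_solution L g (a + s) (b + s) (%t. U (t - s))"
proof -
  obtain Ut Uxx where cwU: "classical_with L (translate s g) a b U Ut Uxx"
    using assms unfolding classical_solution_def by blast
  note U = classical_withD(1)[OF cwU] and c = classical_withD(2-5)[OF cwU] and d = classical_withD(6-8)[OF cwU]
  have mem: "t - s \<in> {a<..<b}" if "t \<in> {a + s<..<b + s}" for t using that by auto
  have sh: "continuous_on ({a + s<..<b + s} \<times> UNIV) (%(t, x). F (t - s) x)"
    if "continuous_on ({a<..<b} \<times> UNIV) (%(t, x). F t x)" for F :: "real => real => real"
    using continuous_on_Times_compose[OF that, of "{a + s<..<b + s}" "- s" 0] by auto
  have dt: "((%t. U (t - s) x) has_real_derivative Ut (t - s) x) (at t)" if "t \<in> {a + s<..<b + s}" for t x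
    using d(1)[OF mem[OF that], of x] DERIV_shift[of "%t. U t x" _ t "- s"] by simp
  show ?thesis
  proof (rule classical_solutionI[where Ut = "%t. Ut (t - s)" and Uxx = "%t. Uxx (t - s)"])
    fix t x assume t: "t \<in> {a + s<..<b + s}"
    show "U (t - s) \<in> C1_circle L" by (rule U[OF mem[OF t]])
    show "((%t. U (t - s) x) has_real_derivative Ut (t - s) x) (at t)" by (rule dt[OF t])
    show "(deriv (U (t - s)) has_real_derivative Uxx (t - s) x) (at x)" by (rule d(2)[OF mem[OF t]])
    show "Ut (t - s) x = Uxx (t - s) x + g (t, U (t - s) x, deriv (U (t - s)) x)"
      using d(3)[OF mem[OF t], of x] by (simp add: translate_def)
  qed (use sh[OF c(1)] sh[OF c(2)] sh[OF c(3)] sh[OF c(4)] in simp_all)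
qed

lemma classical_solution_subinterval:
  assumes "classical_solution L g a b U" "{a'<..<b'} \<subseteq> {a<..<b}" "!!t. t \<in> {a'<..<b'} ==> U t = V t"
  shows "classical_solution L g a' b' V"
proof -
  obtain Ut Uxx where cwU: "classical_with L g a b U Ut Uxx"
    using assms(1) unfolding classical_solution_def by blast
  note U = classical_withD(1)[OF cwU] and c = classical_withD(2-5)[OF cwU] and d = classical_withD(6-8)[OF cwU]
  have sub: "t \<in> {a<..<b}" if "t \<in> {a'<..<b'}" for t using assms(2) that by blast
  have res: "continuous_on ({a'<..<b'} \<times> UNIV) F" if "continuous_on ({a<..<b} \<times> UNIV) F" for F :: "real \<times> real => real"
    using that by (rule continuous_on_subset) (use assms(2) in blast)
  have 1: "continuous_on ({a'<..<b'} \<times> UNIV) (%(t, x). V t x)" "continuous_on ({a'<..<b'} \<times> UNIV) (%(t, x). deriv (V t) x)"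
    by (rule continuous_on_eq[OF res[OF c(1)]], use assms(3) in force)
      (rule continuous_on_eq[OF res[OF c(2)]], use assms(3) in force)
  have dt: "((%t. V t x) has_real_derivative Ut t x) (at t)" if "t \<in> {a'<..<b'}" for t x
    by (rule has_field_derivative_transform_within_open[OF d(1)[OF sub[OF that]], of "{a'<..<b'}"]) (use that assms(3) in auto)
  show ?thesis
  proof (rule classical_solutionI[where Ut = Ut and Uxx = Uxx])
    fix t x assume t: "t \<in> {a'<..<b'}"
    show "V t \<in> C1_circle L" using U[OF sub[OF t]] assms(3)[OF t] by simp
    show "((%t. V t x) has_real_derivative Ut t x) (at t)" by (rule dt[OF t])
    show "(deriv (V t) has_real_derivative Uxx t x) (at x)" using d(2)[OF sub[OF t], of x] assms(3)[OF t] by simp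
    show "Ut t x = Uxx t x + g (t, V t x, deriv (V t) x)" using d(3)[OF sub[OF t], of x] assms(3)[OF t] by simp
  qed (use 1 res[OF c(3)] res[OF c(4)] in simp_all)
qed

lemma classical_diff_strip:
  assumes L: "L > 0" and C: "C >= 0" and U: "classical_solution L g a b U" and V: "classical_solution L g a b V"
    and bd: "!!t x. t \<in> {a<..<b} ==> \<bar>U t x\<bar> <= R & \<bar>deriv (U t) x\<bar> <= R & \<bar>V t x\<bar> <= R & \<bar>deriv (V t) x\<bar> <= R"
    and lip: "!!t u v p q. \<bar>u\<bar> <= R ==> \<bar>v\<bar> <= R ==> \<bar>p\<bar> <= R ==> \<bar>q\<bar> <= R ==>
      \<bar>g (t, u, p) - g (t, v, q)\<bar> <= C * (\<bar>u - v\<bar> + \<bar>p - q\<bar>)"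
  shows "\<exists>wxx wt. parabolic_strip L C a b (%t x. U t x - V t x) (%t x. deriv (U t) x - deriv (V t) x) wxx wt"
proof -
  obtain Ut Uxx where cwU: "classical_with L g a b U Ut Uxx"
    using U unfolding classical_solution_def by blast
  note U = classical_withD(1)[OF cwU] and cU = classical_withD(2-5)[OF cwU] and dU = classical_withD(6-8)[OF cwU]
  obtain Vt Vxx where cwV: "classical_with L g a b V Vt Vxx"
    using V unfolding classical_solution_def by blast
  note V = classical_withD(1)[OF cwV] and cV = classical_withD(2-5)[OF cwV] and dV = classical_withD(6-8)[OF cwV]
  have diff: "continuous_on ({a<..<b} \<times> UNIV) (%(t, x). F t x - G t x)"
    if "continuous_on ({a<..<b} \<times> UNIV) (%(t, x). F t x)" "continuous_on ({a<..<b} \<times> UNIV) (%(t, x). G t x)"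
    for F G :: "real => real => real"
    using continuous_on_diff[OF that] by (simp add: case_prod_beta')
  have "parabolic_strip L C a b (%t x. U t x - V t x) (%t x. deriv (U t) x - deriv (V t) x)
    (%t x. Uxx t x - Vxx t x) (%t x. Ut t x - Vt t x)"
  proof
    fix t x assume t: "t \<in> {a<..<b}"
    show "U t (x + L) - V t (x + L) = U t x - V t x" using C1_circle_D(1)[OF U[OF t]] C1_circle_D(1)[OF V[OF t]] by simp
    show "((%x. U t x - V t x) has_real_derivative deriv (U t) x - deriv (V t) x) (at x)"
      using C1_circle_D(2)[OF U[OF t]] C1_circle_D(2)[OF V[OF t]] by (rule DERIV_diff)
    show "((%x. deriv (U t) x - deriv (V t) x) has_real_derivative Uxx t x - Vxx t x) (at x)"
      using dU(2)[OF t] dV(2)[OF t] by (rule DERIV_diff)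
    show "((%t. U t x - V t x) has_real_derivative Ut t x - Vt t x) (at t)"
      using dU(1)[OF t] dV(1)[OF t] by (rule DERIV_diff)
    show "\<bar>Ut t x - Vt t x - (Uxx t x - Vxx t x)\<bar> <= C * (\<bar>U t x - V t x\<bar> + \<bar>deriv (U t) x - deriv (V t) x\<bar>)"
      using lip[of "U t x" "V t x" "deriv (U t) x" "deriv (V t) x" t] bd[OF t, of x] unfolding dU(3)[OF t] dV(3)[OF t] by simp
  qed (use L C diff[OF cU(1) cV(1)] diff[OF cU(2) cV(2)] diff[OF cU(3) cV(3)] diff[OF cU(4) cV(4)] in auto)
  then show ?thesis by blast
qed

lemma classical_stability_upper:
  assumes L: "L > 0" and C: "C >= 0" and \<delta>: "\<delta> >= 0" "\<eta> >= 0"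
    and U: "classical_solution L g 0 T U" and V: "classical_solution L h 0 T V"
    and cont: "continuous_on ({0..<T} \<times> UNIV) (%(t, x). U t x)" "continuous_on ({0..<T} \<times> UNIV) (%(t, x). V t x)"
    and per: "!!x. U 0 (x + L) = U 0 x" "!!x. V 0 (x + L) = V 0 x"
    and bd: "!!t x. t \<in> {0<..<T} ==> \<bar>U t x\<bar> <= R & \<bar>deriv (U t) x\<bar> <= R & \<bar>V t x\<bar> <= R & \<bar>deriv (V t) x\<bar> <= R"
    and lip: "!!t u v p q. t \<in> {0<..<T} ==> \<bar>u\<bar> <= R ==> \<bar>v\<bar> <= R ==> \<bar>p\<bar> <= R ==> \<bar>q\<bar> <= R ==>
      \<bar>g (t, u, p) - h (t, v, q)\<bar> <= C * (\<bar>u - v\<bar> + \<bar>p - q\<bar>) + \<delta>"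
    and init: "!!x. U 0 x - V 0 x <= \<eta>" and t1: "t1 \<in> {0..<T}"
  shows "U t1 x - V t1 x <= (\<eta> + \<delta>) * exp ((C + 1) * t1)"
proof -
  obtain Ut Uxx where cwU: "classical_with L g 0 T U Ut Uxx"
    using U unfolding classical_solution_def by blast
  note UC = classical_withD(1)[OF cwU] and dU = classical_withD(6-8)[OF cwU]
  obtain Vt Vxx where cwV: "classical_with L h 0 T V Vt Vxx"
    using V unfolding classical_solution_def by blast
  note VC = classical_withD(1)[OF cwV] and dV = classical_withD(6-8)[OF cwV]
  define W where "W t x = U t x - V t x" for t x
  define Y where "Y t x = W t x * exp (- ((C + 1) * t))" for t x
  have per': "W t (x + L) = W t x" if "t \<in> {0..<T}" for t x
    using C1_circle_D(1)[OF UC, of t] C1_circle_D(1)[OF VC, of t] per that by (cases "t = 0") (auto simp: W_def)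
  have "continuous_on ({0..t1} \<times> {0..L}) (%p. U (fst p) (snd p) - V (fst p) (snd p))"
    using t1 by (intro continuous_on_diff continuous_on_subset[OF cont(1)[unfolded case_prod_beta']] continuous_on_subset[OF cont(2)[unfolded case_prod_beta']]) auto
  then have "continuous_on ({0..t1} \<times> {0..L}) (%p. Y (fst p) (snd p))"
    unfolding Y_def W_def by (auto intro!: continuous_intros)
  then have cY: "continuous_on ({0..t1} \<times> {0..L}) (%p. Y (fst p) (snd p))" .
  have ne: "{0..t1} \<times> {0..L} ~= {}" using t1 L by auto
  obtain p where p: "p \<in> {0..t1} \<times> {0..L}" "!!q. q \<in> {0..t1} \<times> {0..L} ==> Y (fst q) (snd q) <= Y (fst p) (snd p)"
    using continuous_attains_sup[OF compact_Times[OF compact_Icc compact_Icc] ne cY] by blast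
  define t0 x0 where "t0 = fst p" and "x0 = snd p"
  have t0: "0 <= t0" "t0 <= t1" using p(1) by (auto simp: t0_def)
  have max: "Y t y <= Y t0 x0" if t: "t \<in> {0..t1}" for t y
  proof -
    obtain k :: int where k: "y + of_int k * L \<in> {0..<0 + L}" using periodic_representative[OF L] .
    have "W t (y + of_int k * L) = W t y" using per' t t1 by (intro periodic_add_int) auto
    then show ?thesis using p(2)[of "(t, y + of_int k * L)"] k t by (auto simp: t0_def x0_def Y_def)
  qed
  have "Y t0 x0 <= \<eta> + \<delta>"
  proof (rule ccontr)
    assume big: "\<not> ?thesis"
    have "t0 ~= 0" using big init[of x0] \<delta> by (auto simp: Y_def W_def)
    then have t0T: "t0 \<in> {0<..<T}" using t0 t1 by auto
    have Wpos: "W t0 x0 > \<eta> + \<delta>"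
    proof (rule ccontr)
      assume "\<not> ?thesis"
      moreover have "exp (- ((C + 1) * t0)) <= 1" using C t0 by simp
      ultimately have "Y t0 x0 <= \<eta> + \<delta>"
        unfolding Y_def using \<delta> mult_mono[of "W t0 x0" "\<eta> + \<delta>" "exp (- ((C + 1) * t0))" 1] by simp
      then show False using big by simp
    qed
    have maxx: "W t0 y <= W t0 x0" for y using max[of t0 y] t0 by (simp add: Y_def)
    have dWx: "(W t0 has_real_derivative deriv (U t0) y - deriv (V t0) y) (at y)" for y
      unfolding W_def using C1_circle_D(2)[OF UC[OF t0T]] C1_circle_D(2)[OF VC[OF t0T]] by (rule DERIV_diff)
    have dWxx: "((%y. deriv (U t0) y - deriv (V t0) y) has_real_derivative Uxx t0 x0 - Vxx t0 x0) (at x0)"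
      using dU(2)[OF t0T] dV(2)[OF t0T] by (rule DERIV_diff)
    have Wx: "deriv (U t0) x0 - deriv (V t0) x0 = 0" and Wxx: "Uxx t0 x0 - Vxx t0 x0 <= 0"
      using second_derivative_test_max[where f = "W t0" and e = 1, OF _ dWx dWxx] maxx by auto
    have "((%t. Y t x0) has_real_derivative (Ut t0 x0 - Vt t0 x0 - (C + 1) * W t0 x0) * exp (- ((C + 1) * t0))) (at t0)"
      unfolding Y_def W_def by (auto intro!: derivative_eq_intros dU(1)[OF t0T] dV(1)[OF t0T] simp: algebra_simps)
    then have "(Ut t0 x0 - Vt t0 x0 - (C + 1) * W t0 x0) * exp (- ((C + 1) * t0)) >= 0"
      by (rule DERIV_nonneg_of_left_max[of _ _ _ 0]) (use t0T t0 max in auto)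
    then have 1: "(C + 1) * W t0 x0 <= Ut t0 x0 - Vt t0 x0" by (simp add: zero_le_mult_iff)
    have "Ut t0 x0 - Vt t0 x0 <= g (t0, U t0 x0, deriv (U t0) x0) - h (t0, V t0 x0, deriv (V t0) x0)"
      using dU(3)[OF t0T, of x0] dV(3)[OF t0T, of x0] Wxx by linarith
    also have "\<dots> <= C * (\<bar>U t0 x0 - V t0 x0\<bar> + \<bar>deriv (U t0) x0 - deriv (V t0) x0\<bar>) + \<delta>"
      using lip[OF t0T, of "U t0 x0" "V t0 x0" "deriv (U t0) x0" "deriv (V t0) x0"] bd[OF t0T, of x0] by linarith
    also have "\<dots> = C * W t0 x0 + \<delta>" using Wx Wpos \<delta> by (simp add: W_def)
    finally show False using 1 Wpos \<delta> by (simp add: algebra_simps)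
  qed
  then have "Y t1 x <= \<eta> + \<delta>" using max[of t1 x] t1 by auto
  then have "Y t1 x * exp ((C + 1) * t1) <= (\<eta> + \<delta>) * exp ((C + 1) * t1)" by (intro mult_right_mono) auto
  then show ?thesis by (simp add: Y_def W_def mult.assoc exp_minus)
qed

lemma classical_stability:
  assumes L: "L > 0" and C: "C >= 0" and \<delta>: "\<delta> >= 0" "\<eta> >= 0"
    and U: "classical_solution L g 0 T U" and V: "classical_solution L h 0 T V"
    and cont: "continuous_on ({0..<T} \<times> UNIV) (%(t, x). U t x)" "continuous_on ({0..<T} \<times> UNIV) (%(t, x). V t x)"
    and per: "!!x. U 0 (x + L) = U 0 x" "!!x. V 0 (x + L) = V 0 x"
    and bd: "!!t x. t \<in> {0<..<T} ==> \<bar>U t x\<bar> <= R & \<bar>deriv (U t) x\<bar> <= R & \<bar>V t x\<bar> <= R & \<bar>deriv (V t) x\<bar> <= R"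
    and lip: "!!t u v p q. t \<in> {0<..<T} ==> \<bar>u\<bar> <= R ==> \<bar>v\<bar> <= R ==> \<bar>p\<bar> <= R ==> \<bar>q\<bar> <= R ==>
      \<bar>g (t, u, p) - h (t, v, q)\<bar> <= C * (\<bar>u - v\<bar> + \<bar>p - q\<bar>) + \<delta>"
    and init: "!!x. \<bar>U 0 x - V 0 x\<bar> <= \<eta>" and t1: "t1 \<in> {0..<T}"
  shows "\<bar>U t1 x - V t1 x\<bar> <= (\<eta> + \<delta>) * exp ((C + 1) * t1)"
proof -
  have 1: "U t1 x - V t1 x <= (\<eta> + \<delta>) * exp ((C + 1) * t1)"
    by (rule classical_stability_upper[OF L C \<delta> U V cont per bd lip _ t1]) (use init in \<open>auto simp: abs_le_iff\<close>)
  have "V t1 x - U t1 x <= (\<eta> + \<delta>) * exp ((C + 1) * t1)"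
  proof (rule classical_stability_upper[OF L C \<delta> V U cont(2) cont(1) per(2) per(1) _ _ _ t1])
    show "\<bar>V t x\<bar> <= R & \<bar>deriv (V t) x\<bar> <= R & \<bar>U t x\<bar> <= R & \<bar>deriv (U t) x\<bar> <= R" if "t \<in> {0<..<T}" for t x
      using bd[OF that, of x] by simp
    show "\<bar>h (t, u, p) - g (t, v, q)\<bar> <= C * (\<bar>u - v\<bar> + \<bar>p - q\<bar>) + \<delta>"
      if "t \<in> {0<..<T}" "\<bar>u\<bar> <= R" "\<bar>v\<bar> <= R" "\<bar>p\<bar> <= R" "\<bar>q\<bar> <= R" for t u v p q
      using lip[OF that(1,3,2,5,4)] by (simp only: abs_minus_commute[of "h _"] abs_minus_commute[of u v] abs_minus_commute[of p q])
    show "V 0 x - U 0 x <= \<eta>" for x using init[of x] by linarith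
  qed
  with 1 show ?thesis by linarith
qed

definition locally_lipschitz :: "nonlinearity => bool" where
  "locally_lipschitz g \<longleftrightarrow> (\<forall>R. \<exists>C\<ge>0. \<forall>t u v p q. \<bar>u\<bar> <= R --> \<bar>v\<bar> <= R --> \<bar>p\<bar> <= R --> \<bar>q\<bar> <= R -->
     \<bar>g (t, u, p) - g (t, v, q)\<bar> <= C * (\<bar>u - v\<bar> + \<bar>p - q\<bar>))"

section \<open>Solutions in the phase space and their uniqueness\<close>

context circle_phase_space
begin

lemma is_solution_jointly_continuous:
  assumes "is_solution L \<alpha> g T \<phi>"
  shows "continuous_on ({0..<T} \<times> UNIV) (%(t, x). \<phi> t x)" "continuous_on ({0..<T} \<times> UNIV) (%(t, x). deriv (\<phi> t) x)"
proof -
  have c: "\<exists>d>0. \<forall>s\<in>{0..<T}. \<bar>s - t\<bar> < d --> (\<forall>x. \<bar>\<phi> s x - \<phi> t x\<bar> < e)"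
    "\<exists>d>0. \<forall>s\<in>{0..<T}. \<bar>s - t\<bar> < d --> (\<forall>x. \<bar>deriv (\<phi> s) x - deriv (\<phi> t) x\<bar> < e)"
    if te: "t \<in> {0..<T}" "e > 0" for t e
  proof -
    obtain d where d: "d > 0" "!!s x. s \<in> {0..<T} ==> \<bar>s - t\<bar> < d ==> \<bar>\<phi> s x - \<phi> t x\<bar> < e & \<bar>deriv (\<phi> s) x - deriv (\<phi> t) x\<bar> < e"
      using solution_continuous[OF assms te] by blast
    show "\<exists>d>0. \<forall>s\<in>{0..<T}. \<bar>s - t\<bar> < d --> (\<forall>x. \<bar>\<phi> s x - \<phi> t x\<bar> < e)"
      "\<exists>d>0. \<forall>s\<in>{0..<T}. \<bar>s - t\<bar> < d --> (\<forall>x. \<bar>deriv (\<phi> s) x - deriv (\<phi> t) x\<bar> < e)"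
      by (rule exI[of _ d], simp add: d)+
  qed
  note C = C1_circle_D(3,4)[OF X_C1[OF solution_in_X[OF assms]]]
  show "continuous_on ({0..<T} \<times> UNIV) (%(t, x). \<phi> t x)" by (rule continuous_on_Times_of_uniform[OF C(2) c(1)])
  show "continuous_on ({0..<T} \<times> UNIV) (%(t, x). deriv (\<phi> t) x)" by (rule continuous_on_Times_of_uniform[OF C(1) c(2)])
qed

lemma is_solution_classical:
  assumes "is_solution L \<alpha> g T \<phi>"
  shows "classical_solution L g 0 T \<phi>"
proof -
  obtain \<phi>t \<phi>xx where d: "continuous_on ({0<..<T} \<times> UNIV) \<phi>t" "continuous_on ({0<..<T} \<times> UNIV) \<phi>xx"
    "\<forall>t\<in>{0<..<T}. \<forall>x. ((%s. \<phi> s x) has_real_derivative \<phi>t (t, x)) (at t) &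
           (deriv (\<phi> t) has_real_derivative \<phi>xx (t, x)) (at x) & \<phi>t (t, x) = \<phi>xx (t, x) + g (t, \<phi> t x, deriv (\<phi> t) x)"
    using assms unfolding is_solution_def by (elim conjE exE)
  have j: "continuous_on ({0<..<T} \<times> UNIV) (%(t, x). \<phi> t x)" "continuous_on ({0<..<T} \<times> UNIV) (%(t, x). deriv (\<phi> t) x)"
    by (rule continuous_on_subset[OF is_solution_jointly_continuous(1)[OF assms]], force)
      (rule continuous_on_subset[OF is_solution_jointly_continuous(2)[OF assms]], force)
  have d': "!!t x. t \<in> {0<..<T} ==> ((%s. \<phi> s x) has_real_derivative \<phi>t (t, x)) (at t)"
    "!!t x. t \<in> {0<..<T} ==> (deriv (\<phi> t) has_real_derivative \<phi>xx (t, x)) (at x)"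
    "!!t x. t \<in> {0<..<T} ==> \<phi>t (t, x) = \<phi>xx (t, x) + g (t, \<phi> t x, deriv (\<phi> t) x)"
    using d(3) by blast+
  show ?thesis
    by (rule classical_solutionI[where Ut = "%t x. \<phi>t (t, x)" and Uxx = "%t x. \<phi>xx (t, x)", OF X_C1[OF solution_in_X[OF assms]] j _ _ d'])
      (use d(1,2) in simp_all)
qed

lemma is_solutionI:
  assumes "continuous_map (top_of_set {0..<T}) (phase_topology L \<alpha>) \<phi>" "classical_solution L g 0 T \<phi>"
  shows "is_solution L \<alpha> g T \<phi>"
proof -
  obtain Ut Uxx where cwU: "classical_with L g 0 T \<phi> Ut Uxx"
    using assms(2) unfolding classical_solution_def by blast
  note c = classical_withD(4-5)[OF cwU] and d = classical_withD(6-8)[OF cwU]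
  have "\<forall>t\<in>{0<..<T}. \<forall>x. ((%s. \<phi> s x) has_real_derivative (%(t, x). Ut t x) (t, x)) (at t) &
    (deriv (\<phi> t) has_real_derivative (%(t, x). Uxx t x) (t, x)) (at x) &
    (%(t, x). Ut t x) (t, x) = (%(t, x). Uxx t x) (t, x) + g (t, \<phi> t x, deriv (\<phi> t) x)"
    unfolding prod.case using d by blast
  with c have "\<exists>\<phi>t \<phi>xx. continuous_on ({0<..<T} \<times> UNIV) \<phi>t & continuous_on ({0<..<T} \<times> UNIV) \<phi>xx &
        (\<forall>t\<in>{0<..<T}. \<forall>x. ((%s. \<phi> s x) has_real_derivative \<phi>t (t, x)) (at t) &
           (deriv (\<phi> t) has_real_derivative \<phi>xx (t, x)) (at x) &
           \<phi>t (t, x) = \<phi>xx (t, x) + g (t, \<phi> t x, deriv (\<phi> t) x))"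
    by (intro exI conjI)
  then show ?thesis unfolding is_solution_def using assms(1) by simp
qed

lemma is_solution_shift:
  assumes "is_solution L \<alpha> g T \<phi>"
  shows "is_solution L \<alpha> g T (%t. shift a (\<phi> t))"
proof -
  have cm: "continuous_map (top_of_set {0..<T}) (phase_topology L \<alpha>) \<phi>" using assms by (simp add: is_solution_def)
  have "continuous_map (top_of_set {0..<T}) (phase_topology L \<alpha>) (%t. shift a (\<phi> t))"
    unfolding phase_topology_eq M.continuous_map_to_metric
  proof (intro ballI allI impI)
    fix t0 \<epsilon> :: real assume t0: "t0 \<in> topspace (top_of_set {0..<T})" and "\<epsilon> > 0"
    then obtain U where U: "openin (top_of_set {0..<T}) U" "t0 \<in> U" "\<forall>y\<in>U. \<phi> y \<in> M.mball (\<phi> t0) \<epsilon>"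
      using cm[unfolded phase_topology_eq M.continuous_map_to_metric] by metis
    have "shift a (\<phi> y) \<in> M.mball (shift a (\<phi> t0)) \<epsilon>" if "y \<in> U" for y
    proof -
      have X: "\<phi> t0 \<in> X" "\<phi> y \<in> X" "fn (%x. \<phi> t0 x - \<phi> y x) < \<epsilon>" using U(3) that by auto
      have "(%x. shift a (\<phi> t0) x - shift a (\<phi> y) x) = shift a (%x. \<phi> t0 x - \<phi> y x)" by (simp add: shift_def)
      then show ?thesis using shift_X[OF X(1)] shift_X[OF X(2)] shift_X(2)[OF X_diff(1)[OF X(1,2)], of a] X(3) by simp
    qed
    then show "\<exists>U. openin (top_of_set {0..<T}) U & t0 \<in> U & (\<forall>y\<in>U. shift a (\<phi> y) \<in> M.mball (shift a (\<phi> t0)) \<epsilon>)"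
      using U(1,2) by blast
  qed
  then show ?thesis by (rule is_solutionI) (rule classical_solution_shift[OF is_solution_classical[OF assms]])
qed

lemma is_solution_translate:
  assumes "is_solution L \<alpha> g T \<phi>" "0 <= s"
  shows "is_solution L \<alpha> (translate s g) (T - s) (%t. \<phi> (t + s))"
proof -
  have 1: "continuous_map (top_of_set {0..<T - s}) (top_of_set {0..<T}) (%t. t + s)"
    using assms(2) by (auto intro!: continuous_intros)
  have 2: "continuous_map (top_of_set {0..<T}) (phase_topology L \<alpha>) \<phi>" using assms by (simp add: is_solution_def)
  have "continuous_map (top_of_set {0..<T - s}) (phase_topology L \<alpha>) (%t. \<phi> (t + s))"
    using continuous_map_compose[OF 1 2] unfolding o_def .
  moreover
  have "classical_solution L (translate (- s) (translate s g)) 0 T \<phi>"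
    using is_solution_classical[OF assms(1)] by (simp add: translate_def)
  then have "classical_solution L (translate s g) (0 + - s) (T + - s) (%t. \<phi> (t - - s))" by (rule classical_solution_translate)
  then have "classical_solution L (translate s g) 0 (T - s) (%t. \<phi> (t + s))"
    by (rule classical_solution_subinterval) (use assms(2) in auto)
  ultimately show ?thesis by (rule is_solutionI)
qed

lemma is_solution_bounded:
  assumes "is_solution L \<alpha> g T \<phi>" "T' < T"
  shows "\<exists>R. \<forall>t\<in>{0..T'}. \<forall>x. \<bar>\<phi> t x\<bar> <= R & \<bar>deriv (\<phi> t) x\<bar> <= R"
proof -
  have C1: "\<phi> t \<in> C1_circle L" if "t \<in> {0..T'}" for t using X_C1[OF solution_in_X[OF assms(1)], of t] that assms(2) by auto
  have c: "continuous_on ({0..T'} \<times> UNIV) (%(t, x). \<phi> t x)" "continuous_on ({0..T'} \<times> UNIV) (%(t, x). deriv (\<phi> t) x)"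
    by (rule continuous_on_subset[OF is_solution_jointly_continuous(1)[OF assms(1)]], use assms(2) in force)
      (rule continuous_on_subset[OF is_solution_jointly_continuous(2)[OF assms(1)]], use assms(2) in force)
  obtain K1 where K1: "\<forall>t\<in>{0..T'}. \<forall>x. \<bar>\<phi> t x\<bar> <= K1"
    using periodic_continuous_bounded[OF L compact_Icc c(1)] C1_circle_D(1)[OF C1] by blast
  obtain K2 where K2: "\<forall>t\<in>{0..T'}. \<forall>x. \<bar>deriv (\<phi> t) x\<bar> <= K2"
    using periodic_continuous_bounded[OF L compact_Icc c(2)] C1_circle_D(5)[OF C1] by blast
  show ?thesis using K1 K2 by (intro exI[of _ "max K1 K2"]) (meson max.coboundedI1 max.coboundedI2)
qed

lemma is_solution_unique:
  assumes lip: "locally_lipschitz g" and 1: "is_solution L \<alpha> g T1 \<phi>" and 2: "is_solution L \<alpha> g T2 \<psi>"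
    and eq: "\<phi> 0 = \<psi> 0" and t: "0 <= t" "t < T1" "t < T2"
  shows "\<phi> t = \<psi> t"
proof
  fix x
  define T where "T = (t + min T1 T2) / 2"
  have T: "t < T" "T < T1" "T < T2" using t by (auto simp: T_def min_def field_simps)
  obtain R1 where R1: "\<forall>t\<in>{0..T}. \<forall>x. \<bar>\<phi> t x\<bar> <= R1 & \<bar>deriv (\<phi> t) x\<bar> <= R1" using is_solution_bounded[OF 1 T(2)] by blast
  obtain R2 where R2: "\<forall>t\<in>{0..T}. \<forall>x. \<bar>\<psi> t x\<bar> <= R2 & \<bar>deriv (\<psi> t) x\<bar> <= R2" using is_solution_bounded[OF 2 T(3)] by blast
  define R where "R = max R1 R2"
  obtain C where C: "C >= 0" "!!t u v p q. \<bar>u\<bar> <= R ==> \<bar>v\<bar> <= R ==> \<bar>p\<bar> <= R ==> \<bar>q\<bar> <= R ==>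
     \<bar>g (t, u, p) - g (t, v, q)\<bar> <= C * (\<bar>u - v\<bar> + \<bar>p - q\<bar>)"
    using lip unfolding locally_lipschitz_def by meson
  have c1: "continuous_on ({0..<T} \<times> UNIV) (%(t, x). \<phi> t x)" "continuous_on ({0..<T} \<times> UNIV) (%(t, x). \<psi> t x)"
    by (rule continuous_on_subset[OF is_solution_jointly_continuous(1)[OF 1]], use T in force)
      (rule continuous_on_subset[OF is_solution_jointly_continuous(1)[OF 2]], use T in force)
  have cl: "classical_solution L g 0 T \<phi>" "classical_solution L g 0 T \<psi>"
    by (rule classical_solution_subinterval[OF is_solution_classical[OF 1]], use T in auto)
      (rule classical_solution_subinterval[OF is_solution_classical[OF 2]], use T in auto)
  have "\<phi> 0 \<in> X" using solution_in_X[OF 1, of 0] t by auto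
  then have per: "!!x. \<phi> 0 (x + L) = \<phi> 0 x" "!!x. \<psi> 0 (x + L) = \<psi> 0 x" using C1_circle_D(1)[OF X_C1] eq by auto
  have "\<bar>\<phi> t x - \<psi> t x\<bar> <= (0 + 0) * exp ((C + 1) * t)"
  proof (rule classical_stability[OF L C(1) _ _ cl c1 per])
    show "\<bar>\<phi> t x\<bar> <= R & \<bar>deriv (\<phi> t) x\<bar> <= R & \<bar>\<psi> t x\<bar> <= R & \<bar>deriv (\<psi> t) x\<bar> <= R" if "t \<in> {0<..<T}" for t x
      using R1 R2 that unfolding R_def by (simp add: le_max_iff_disj)
    show "\<bar>g (t, u, p) - g (t, v, q)\<bar> <= C * (\<bar>u - v\<bar> + \<bar>p - q\<bar>) + 0"
      if "\<bar>u\<bar> <= R" "\<bar>v\<bar> <= R" "\<bar>p\<bar> <= R" "\<bar>q\<bar> <= R" for t u v p q using C(2)[OF that, of t] by simp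
    show "\<bar>\<phi> 0 x - \<psi> 0 x\<bar> <= 0" for x using eq by simp
    show "t \<in> {0..<T}" using t T by simp
  qed simp_all
  then show "\<phi> t x = \<psi> t x" by simp
qed

text \<open>Uniqueness makes the definite description in \<open>phi\<close> return the value of any
  solution that lives beyond t.\<close>

lemma reaches_phi:
  assumes lip: "locally_lipschitz g" and "is_solution L \<alpha> g T \<phi>" "0 <= t" "t < T"
  shows "phi L \<alpha> t (\<phi> 0) g = \<phi> t"
  unfolding phi_def
proof (rule the_equality)
  show "reaches L \<alpha> t (\<phi> 0) g (\<phi> t)" using assms unfolding reaches_def by blast
  fix v assume "reaches L \<alpha> t (\<phi> 0) g v"
  then obtain T' \<psi> where "T' > t" "is_solution L \<alpha> g T' \<psi>" "\<psi> 0 = \<phi> 0" "\<psi> t = v" unfolding reaches_def by blast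
  then show "v = \<phi> t" using is_solution_unique[OF lip assms(2), of T' \<psi> t] assms by simp
qed

end

section \<open>The hull and the minimal set\<close>

text \<open>A subbasic set only restricts the image of a compact set. Cutting K into finitely many
  pieces on which g varies by less than e / 2 turns such restrictions into uniform closeness on
  K.\<close>

lemma compact_open_nbhd:
  fixes g :: "'a::metric_space => real"
  assumes g: "continuous_on UNIV g" and K: "compact K" and e: "e > 0"
  shows "\<exists>T. openin compact_open_topology T & g \<in> T & (\<forall>h\<in>T. \<forall>z\<in>K. \<bar>h z - g z\<bar> < e)"
proof -
  have "\<forall>z\<in>K. \<exists>d>0. \<forall>y\<in>cball z d. \<bar>g y - g z\<bar> < e / 2"
  proof
    fix z
    obtain d where "d > 0" "!!y. dist y z < d ==> dist (g y) (g z) < e / 2"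
      using g e unfolding continuous_on_iff by (metis UNIV_I half_gt_zero)
    then show "\<exists>d>0. \<forall>y\<in>cball z d. \<bar>g y - g z\<bar> < e / 2"
      by (intro exI[of _ "d / 2"]) (auto simp: dist_real_def dist_commute)
  qed
  from bchoice[OF this] obtain d where d: "!!z. z \<in> K ==> d z > 0" "!!z y. z \<in> K ==> y \<in> cball z (d z) ==> \<bar>g y - g z\<bar> < e / 2" by blast
  obtain F where F: "F \<subseteq> K" "finite F" "K \<subseteq> (\<Union>z\<in>F. ball z (d z))"
    by (rule compactE_image[OF K, of K "%z. ball z (d z)"]) (use d(1) in force)+
  define B where "B z = {h. continuous_on UNIV h & h ` (K \<inter> cball z (d z)) \<subseteq> ball (g z) (e / 2)}" for z
  \<comment> \<open>The set of all continuous functions; it keeps the intersection T open when K,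
    and with it F, is empty.\<close>
  define B0 where "B0 = {h :: 'a => real. continuous_on UNIV h & h ` {} \<subseteq> UNIV}"
  have oB: "openin compact_open_topology (B z)" for z
    unfolding compact_open_topology_def B_def using K
    by (intro topology_generated_by_Basis) (blast intro: compact_Int_closed)
  have oB0: "openin compact_open_topology B0"
    unfolding compact_open_topology_def B0_def by (intro topology_generated_by_Basis) blast
  define T where "T = \<Inter> (insert B0 (B ` F))"
  have "openin compact_open_topology T" unfolding T_def using F(2) oB oB0 by (intro openin_Inter) auto
  moreover have "g \<in> T" unfolding T_def B_def B0_def using g d F(1) by (auto simp: dist_real_def abs_minus_commute subset_eq)
  moreover have "\<bar>h z - g z\<bar> < e" if h: "h \<in> T" and z: "z \<in> K" for h z
  proof -
    obtain y where y: "y \<in> F" "z \<in> ball y (d y)" using F(3) z by blast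
    have "h \<in> B y" using h y(1) by (auto simp: T_def)
    moreover have "z \<in> K \<inter> cball y (d y)" using z y(2) by (auto simp: less_imp_le)
    ultimately have "h z \<in> ball (g y) (e / 2)" unfolding B_def by blast
    then have "\<bar>g y - h z\<bar> < e / 2" by (simp add: dist_real_def)
    moreover have "\<bar>g z - g y\<bar> < e / 2" using d(2)[of y z] y F(1) by auto
    ultimately show ?thesis by linarith
  qed
  ultimately show ?thesis by blast
qed

lemma topspace_compact_open:
  "topspace (compact_open_topology :: ('a::topological_space => 'b::topological_space) topology) \<subseteq> {g. continuous_on UNIV g}"
  unfolding compact_open_topology_def topology_generated_by_topspace by (rule Union_least) auto

lemma translation_hull_continuous:
  assumes "g \<in> translation_hull f"
  shows "continuous_on UNIV g"
proof -
  have "g \<in> topspace compact_open_topology" using assms unfolding translation_hull_def in_closure_of by (rule conjunct1)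
  then have "g \<in> {g. continuous_on UNIV g}" by (rule subsetD[OF topspace_compact_open])
  then show ?thesis by simp
qed

lemma translation_hull_approx:
  assumes g: "g \<in> translation_hull f" and K: "compact K" and e: "e > 0"
  shows "\<exists>\<tau>. \<forall>z\<in>K. \<bar>translate \<tau> f z - g z\<bar> < e"
proof -
  obtain T where T: "openin compact_open_topology T" "g \<in> T" "\<forall>h\<in>T. \<forall>z\<in>K. \<bar>h z - g z\<bar> < e"
    using compact_open_nbhd[OF translation_hull_continuous[OF g] K e] by blast
  then obtain h where "h \<in> range (%\<tau>. translate \<tau> f)" "h \<in> T" using g unfolding translation_hull_def in_closure_of by blast
  then show ?thesis using T(3) by blast
qed

section \<open>Uniform Lipschitz bounds on the hull\<close>

lemma partial_bound:
  assumes F: "C1_function (f :: nonlinearity)" and ap: "uniformly_almost_periodic UNIV (partial b f)" and b: "b \<in> Basis"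
    and path: "!!s s'. c s + s' *\<^sub>R b = c (s + s')" "!!s. \<bar>s\<bar> <= R ==> c s \<in> UNIV \<times> ({-R..R} \<times> {-R..R})"
    and B: "!!z. z \<in> UNIV \<times> ({-R..R} \<times> {-R..R}) ==> \<bar>partial b f z\<bar> <= B" and uv: "\<bar>u\<bar> <= R" "\<bar>v\<bar> <= R"
  shows "\<bar>f (c u) - f (c v)\<bar> <= B * \<bar>u - v\<bar>"
proof -
  have d: "((%s. f (c s)) has_real_derivative partial b f (c s0)) (at s0)" for s0
  proof -
    have "(%s. f (c s0 + s *\<^sub>R b)) field_differentiable at 0" using F b unfolding C1_function_def by blast
    then have "((%s. f (c s0 + s *\<^sub>R b)) has_field_derivative partial b f (c s0)) (at 0)"
      unfolding partial_def by (rule field_differentiable_derivI)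
    then have "((%s. f (c (s + s0))) has_field_derivative partial b f (c s0)) (at 0)" by (simp add: path(1) add.commute)
    then show ?thesis using DERIV_shift[of "%s. f (c s)" "partial b f (c s0)" 0 s0] by simp
  qed
  have "norm (f (c u) - f (c v)) <= B * norm (u - v)"
    by (rule field_differentiable_bound[of "{-R..R}" "%s. f (c s)" "%s. partial b f (c s)"])
      (use d B path(2) uv in \<open>auto simp: abs_le_iff intro: has_field_derivative_at_within\<close>)
  then show ?thesis by simp
qed

text \<open>Admissibility bounds the partial derivatives on all times and a compact set of (u, p),
  so the constant does not depend on t.\<close>

lemma C1_function_lipschitz:
  assumes F: "C1_function (f :: nonlinearity)" and ap: "!!b. b \<in> Basis ==> uniformly_almost_periodic UNIV (partial b f)"
  shows "\<exists>C\<ge>0. \<forall>t u v p q. \<bar>u\<bar> <= R --> \<bar>v\<bar> <= R --> \<bar>p\<bar> <= R --> \<bar>q\<bar> <= R -->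
     \<bar>f (t, u, p) - f (t, v, q)\<bar> <= C * (\<bar>u - v\<bar> + \<bar>p - q\<bar>)"
proof -
  define K where "K = {-R..R} \<times> {-R..R}"
  have K: "compact K" unfolding K_def by (intro compact_Times compact_Icc)
  have bnd: "\<exists>B\<ge>0. \<forall>z\<in>UNIV \<times> K. \<bar>partial b f z\<bar> <= B" if "b \<in> Basis" for b
  proof -
    have "bounded (partial b f ` (UNIV \<times> K))"
      using ap[OF that] K unfolding uniformly_almost_periodic_def admissible_def by blast
    then obtain B where "\<forall>z\<in>UNIV \<times> K. \<bar>partial b f z\<bar> <= B" unfolding bounded_iff by auto
    then show ?thesis by (intro exI[of _ "max B 0"]) (auto simp: le_max_iff_disj)
  qed
  have Bas: "(0, 1, 0) \<in> (Basis :: (real \<times> real \<times> real) set)" "(0, 0, 1) \<in> (Basis :: (real \<times> real \<times> real) set)"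
    by (auto simp: Basis_prod_def)
  obtain B1 where B1: "B1 >= 0" "!!z. z \<in> UNIV \<times> K ==> \<bar>partial (0, 1, 0) f z\<bar> <= B1" using bnd[OF Bas(1)] by blast
  obtain B2 where B2: "B2 >= 0" "!!z. z \<in> UNIV \<times> K ==> \<bar>partial (0, 0, 1) f z\<bar> <= B2" using bnd[OF Bas(2)] by blast
  show ?thesis
  proof (intro exI[of _ "B1 + B2"] conjI allI impI)
    fix t u v p q assume R: "\<bar>u\<bar> <= R" "\<bar>v\<bar> <= R" "\<bar>p\<bar> <= R" "\<bar>q\<bar> <= R"
    have 1: "\<bar>f (t, u, p) - f (t, v, p)\<bar> <= B1 * \<bar>u - v\<bar>"
      by (rule partial_bound[OF F ap[OF Bas(1)] Bas(1), where c = "%s. (t, s, p)" and R = R])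
        (use R B1(2) in \<open>auto simp: abs_le_iff K_def\<close>)
    have 2: "\<bar>f (t, v, p) - f (t, v, q)\<bar> <= B2 * \<bar>p - q\<bar>"
      by (rule partial_bound[OF F ap[OF Bas(2)] Bas(2), where c = "%s. (t, v, s)" and R = R])
        (use R B2(2) in \<open>auto simp: abs_le_iff K_def\<close>)
    have "(B1 + B2) * (\<bar>u - v\<bar> + \<bar>p - q\<bar>) = B1 * \<bar>u - v\<bar> + B2 * \<bar>p - q\<bar> + (B2 * \<bar>u - v\<bar> + B1 * \<bar>p - q\<bar>)"
      by (simp add: algebra_simps)
    moreover have "0 <= B2 * \<bar>u - v\<bar> + B1 * \<bar>p - q\<bar>" using B1 B2 by simp
    ultimately show "\<bar>f (t, u, p) - f (t, v, q)\<bar> <= (B1 + B2) * (\<bar>u - v\<bar> + \<bar>p - q\<bar>)" using 1 2 by linarith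
  qed (use B1 B2 in auto)
qed

text \<open>The Lipschitz inequality survives pointwise approximation, so it passes from the
  translates of f to the hull with the same constant.\<close>

lemma translation_hull_lipschitz:
  assumes F: "C1_function (f :: nonlinearity)" and ap: "!!b. b \<in> Basis ==> uniformly_almost_periodic UNIV (partial b f)"
  shows "\<exists>C\<ge>0. \<forall>g\<in>translation_hull f. \<forall>t u v p q. \<bar>u\<bar> <= R --> \<bar>v\<bar> <= R --> \<bar>p\<bar> <= R --> \<bar>q\<bar> <= R -->
     \<bar>g (t, u, p) - g (t, v, q)\<bar> <= C * (\<bar>u - v\<bar> + \<bar>p - q\<bar>)"
proof -
  obtain C where C: "C >= 0" "!!t u v p q. \<bar>u\<bar> <= R ==> \<bar>v\<bar> <= R ==> \<bar>p\<bar> <= R ==> \<bar>q\<bar> <= R ==>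
     \<bar>f (t, u, p) - f (t, v, q)\<bar> <= C * (\<bar>u - v\<bar> + \<bar>p - q\<bar>)"
    using C1_function_lipschitz[OF F ap, of R] by blast
  show ?thesis
  proof (intro exI[of _ C] conjI ballI allI impI C(1), rule field_le_epsilon)
    fix g t u v p q and e :: real
    assume g: "g \<in> translation_hull f" and R: "\<bar>u\<bar> <= R" "\<bar>v\<bar> <= R" "\<bar>p\<bar> <= R" "\<bar>q\<bar> <= R" and e: "e > 0"
    obtain \<tau> where \<tau>: "\<forall>z\<in>{(t, u, p), (t, v, q)}. \<bar>translate \<tau> f z - g z\<bar> < e / 2"
      using translation_hull_approx[OF g, of "{(t, u, p), (t, v, q)}" "e / 2"] e by (auto intro: finite_imp_compact)
    have "\<bar>translate \<tau> f (t, u, p) - translate \<tau> f (t, v, q)\<bar> <= C * (\<bar>u - v\<bar> + \<bar>p - q\<bar>)"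
      using C(2)[OF R] by (simp add: translate_def)
    moreover have "\<bar>translate \<tau> f (t, u, p) - g (t, u, p)\<bar> < e / 2" "\<bar>translate \<tau> f (t, v, q) - g (t, v, q)\<bar> < e / 2" using \<tau> by auto
    ultimately show "\<bar>g (t, u, p) - g (t, v, q)\<bar> <= C * (\<bar>u - v\<bar> + \<bar>p - q\<bar>) + e" by linarith
  qed
qed

section \<open>Sequential compactness of the minimal set\<close>

locale minimal_flow = circle_phase_space +
  fixes f :: nonlinearity and M
  assumes f_C1: "C1_function f" and f_ap: "!!b. b \<in> Basis ==> uniformly_almost_periodic UNIV (partial b f)"
    and minimal: "minimal_set L \<alpha> f M"
begin

abbreviation E where "E \<equiv> extended_phase_topology L \<alpha> f"

abbreviation SP where "SP \<equiv> skew_product L \<alpha>"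

text \<open>The sequential content of the topology \<open>E\<close> used later: C1 convergence of
  the first component and locally uniform convergence of the second. On the compact set M it turns
  out to follow from pointwise convergence.\<close>

definition conv where
  "conv P p \<longleftrightarrow> uniform_limit UNIV (%n. fst (P n)) (fst p) sequentially &
     uniform_limit UNIV (%n. deriv (fst (P n))) (deriv (fst p)) sequentially &
     (\<forall>K. compact K --> uniform_limit K (%n. snd (P n)) (snd p) sequentially)"
  for P :: "nat => (real => real) \<times> nonlinearity" and p

lemma M_props: "M ~= {}" "compactin E M" "positively_invariant L \<alpha> M"
  using minimal unfolding minimal_set_def compact_positively_invariant_def by blast+

lemma M_memD:
  assumes "p \<in> M"
  shows "fst p \<in> X" "snd p \<in> translation_hull f" "fst p \<in> C1_circle L" "continuous_on UNIV (snd p)" "locally_lipschitz (snd p)"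
proof -
  have "M \<subseteq> topspace E" using M_props(2) by (rule compactin_subset_topspace)
  then have "p \<in> topspace E" using assms by blast
  then show *: "fst p \<in> X" "snd p \<in> translation_hull f"
    by (auto simp: extended_phase_topology_def topspace_prod_topology topspace_phase topspace_subtopology)
  show "fst p \<in> C1_circle L" using *(1) by (rule X_C1)
  show "continuous_on UNIV (snd p)" using *(2) by (rule translation_hull_continuous)
  show "locally_lipschitz (snd p)" unfolding locally_lipschitz_def
    using translation_hull_lipschitz[OF f_C1 f_ap] *(2) by meson
qed

lemma base_nbhd:
  assumes p: "p \<in> M" and e: "e > 0" and K: "compact K"
  shows "\<exists>T. openin E T & p \<in> T & (\<forall>q\<in>T. (\<forall>x. \<bar>fst q x - fst p x\<bar> < e & \<bar>deriv (fst q) x - deriv (fst p) x\<bar> < e) &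
     (\<forall>z\<in>K. \<bar>snd q z - snd p z\<bar> < e))"
proof -
  obtain C where C: "C > 0" "!!u x. u \<in> X ==> \<bar>u x\<bar> <= C * fn u & \<bar>deriv u x\<bar> <= C * fn u" using C1_bound by blast
  obtain T where T: "openin compact_open_topology T" "snd p \<in> T" "\<forall>h\<in>T. \<forall>z\<in>K. \<bar>h z - snd p z\<bar> < e"
    using compact_open_nbhd[OF M_memD(4)[OF p] K e] by blast
  define B where "B = M.mball (fst p) (e / C)"
  have "openin (phase_topology L \<alpha>) B" unfolding B_def phase_topology_eq by simp
  moreover have "openin (subtopology compact_open_topology (translation_hull f)) (translation_hull f \<inter> T)"
    using T(1) by (rule openin_subtopology_Int2)
  ultimately have o: "openin E (B \<times> (translation_hull f \<inter> T))"
    unfolding extended_phase_topology_def by (auto simp: openin_prod_Times_iff)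
  have pX: "fst p \<in> X" by (rule M_memD(1)[OF p])
  have "fn (%x. 0) = 0" by (simp add: fn_coef coef_def fourier_coeff_def)
  then have pin: "p \<in> B \<times> (translation_hull f \<inter> T)"
    using T(2) pX M_memD(2)[OF p] C(1) e by (auto simp: B_def mem_Times_iff)
  have "(\<forall>x. \<bar>fst q x - fst p x\<bar> < e & \<bar>deriv (fst q) x - deriv (fst p) x\<bar> < e) & (\<forall>z\<in>K. \<bar>snd q z - snd p z\<bar> < e)"
    if q: "q \<in> B \<times> (translation_hull f \<inter> T)" for q
  proof -
    have qX: "fst q \<in> X" and lt: "fn (%x. fst p x - fst q x) < e / C" using q by (auto simp: B_def mem_Times_iff)
    have lt': "C * fn (%x. fst p x - fst q x) < e" using lt C(1) by (simp add: field_simps)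
    note D = C1_circle_combine(2)[OF X_C1[OF pX] X_C1[OF qX]]
    have "\<bar>fst q x - fst p x\<bar> < e & \<bar>deriv (fst q) x - deriv (fst p) x\<bar> < e" for x
      using C(2)[OF X_diff(1)[OF pX qX], of x] lt' unfolding D by linarith
    then show ?thesis using T(3) q by (auto simp: mem_Times_iff)
  qed
  with o pin show ?thesis by blast
qed

text \<open>A fixed countable family of neighbourhoods of p; being eventually in each of them forces
  \<open>conv\<close>. It takes the place of a countable neighbourhood base of
  \<open>E\<close>.\<close>

definition nb where "nb p k = (SOME T. openin E T & p \<in> T & (\<forall>q\<in>T. (\<forall>x. \<bar>fst q x - fst p x\<bar> < 1 / real (Suc k) &
     \<bar>deriv (fst q) x - deriv (fst p) x\<bar> < 1 / real (Suc k)) & (\<forall>z\<in>cball 0 (real k). \<bar>snd q z - snd p z\<bar> < 1 / real (Suc k))))"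
  for p :: "(real => real) \<times> nonlinearity"

lemma nb:
  assumes "p \<in> M"
  shows "openin E (nb p k)" "p \<in> nb p k"
    "q \<in> nb p k ==> \<bar>fst q x - fst p x\<bar> < 1 / real (Suc k)" "q \<in> nb p k ==> \<bar>deriv (fst q) x - deriv (fst p) x\<bar> < 1 / real (Suc k)"
    "q \<in> nb p k ==> z \<in> cball 0 (real k) ==> \<bar>snd q z - snd p z\<bar> < 1 / real (Suc k)"
proof -
  have "1 / real (Suc k) > 0" by simp
  from someI_ex[OF base_nbhd[OF assms this compact_cball[of 0 "real k"]], folded nb_def]
  show "openin E (nb p k)" "p \<in> nb p k"
    "q \<in> nb p k ==> \<bar>fst q x - fst p x\<bar> < 1 / real (Suc k)" "q \<in> nb p k ==> \<bar>deriv (fst q) x - deriv (fst p) x\<bar> < 1 / real (Suc k)"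
    "q \<in> nb p k ==> z \<in> cball 0 (real k) ==> \<bar>snd q z - snd p z\<bar> < 1 / real (Suc k)"
    by blast+
qed

lemma conv_nb:
  assumes p: "p \<in> M" and ev: "!!k. \<forall>\<^sub>F n in sequentially. P n \<in> nb p k"
  shows "conv P p"
proof -
  have small: "\<exists>k0. \<forall>k\<ge>k0. 1 / real (Suc k) < e" if e: "e > 0" for e :: real
  proof -
    obtain k0 where k0: "1 / real (Suc k0) < e" using nat_approx_posE[OF e] by blast
    have "1 / real (Suc k) < e" if "k >= k0" for k
    proof -
      have "1 / real (Suc k) <= 1 / real (Suc k0)" using that by (intro divide_left_mono) auto
      then show ?thesis using k0 by linarith
    qed
    then show ?thesis by blast
  qed
  show ?thesis unfolding conv_def
  proof (intro conjI allI impI)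
    show "uniform_limit UNIV (%n. fst (P n)) (fst p) sequentially" unfolding uniform_limit_iff dist_real_def
    proof (intro allI impI)
      fix e :: real assume "e > 0"
      then obtain k where k: "1 / real (Suc k) < e" using small by blast
      show "\<forall>\<^sub>F n in sequentially. \<forall>x\<in>UNIV. \<bar>fst (P n) x - fst p x\<bar> < e"
        by (rule eventually_mono[OF ev[of k]], intro ballI, rule less_trans[OF nb(3)[OF p] k])
    qed
    show "uniform_limit UNIV (%n. deriv (fst (P n))) (deriv (fst p)) sequentially" unfolding uniform_limit_iff dist_real_def
    proof (intro allI impI)
      fix e :: real assume "e > 0"
      then obtain k where k: "1 / real (Suc k) < e" using small by blast
      show "\<forall>\<^sub>F n in sequentially. \<forall>x\<in>UNIV. \<bar>deriv (fst (P n)) x - deriv (fst p) x\<bar> < e"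
        by (rule eventually_mono[OF ev[of k]], intro ballI, rule less_trans[OF nb(4)[OF p] k])
    qed
    fix K :: "(real \<times> real \<times> real) set" assume "compact K"
    then obtain B where B: "!!z. z \<in> K ==> norm z <= B" using compact_imp_bounded bounded_iff by metis
    show "uniform_limit K (%n. snd (P n)) (snd p) sequentially" unfolding uniform_limit_iff dist_real_def
    proof (intro allI impI)
      fix e :: real assume "e > 0"
      then obtain k0 where k0: "!!k. k >= k0 ==> 1 / real (Suc k) < e" using small by blast
      define k where "k = max k0 (nat \<lceil>B\<rceil>)"
      have k: "1 / real (Suc k) < e" "B <= real k" using k0[of k] by (auto simp: k_def) linarith
      have K: "z \<in> cball 0 (real k)" if "z \<in> K" for z using B[OF that] k(2) by simp
      show "\<forall>\<^sub>F n in sequentially. \<forall>x\<in>K. \<bar>snd (P n) x - snd p x\<bar> < e"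
        by (rule eventually_mono[OF ev[of k]], intro ballI, rule less_trans[OF nb(5)[OF p _ K] k(1)])
    qed
  qed
qed

lemma nb_decreasing_conv:
  assumes p: "p \<in> M" and T: "!!k. \<forall>j\<le>k. P k \<in> nb p j"
  shows "conv P p"
proof (rule conv_nb[OF p])
  show "\<forall>\<^sub>F n in sequentially. P n \<in> nb p k" for k
    using eventually_ge_at_top[of k] by eventually_elim (use T in blast)
qed

lemma convD:
  assumes "conv P p"
  shows "uniform_limit UNIV (%n. fst (P n)) (fst p) sequentially"
    "uniform_limit UNIV (%n. deriv (fst (P n))) (deriv (fst p)) sequentially"
    "compact K ==> uniform_limit K (%n. snd (P n)) (snd p) sequentially"
  using assms unfolding conv_def by blast+

lemma conv_pointwise:
  assumes "conv P p"
  shows "(%n. fst (P n) x) \<longlonglongrightarrow> fst p x" "(%n. snd (P n) z) \<longlonglongrightarrow> snd p z"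
proof -
  have K: "\<forall>K. compact K --> uniform_limit K (%n. snd (P n)) (snd p) sequentially"
    and 0: "uniform_limit UNIV (%n. fst (P n)) (fst p) sequentially"
    using assms unfolding conv_def by blast+
  have 2: "uniform_limit {z} (%n. snd (P n)) (snd p) sequentially" by (rule K[rule_format]) simp
  show "(%n. fst (P n) x) \<longlonglongrightarrow> fst p x" by (rule tendsto_uniform_limitI[OF 0]) simp
  show "(%n. snd (P n) z) \<longlonglongrightarrow> snd p z" by (rule tendsto_uniform_limitI[OF 2]) simp
qed

lemma conv_unique:
  assumes "conv P p" "conv P q"
  shows "p = q"
proof (intro prod_eqI ext)
  show "fst p x = fst q x" for x by (rule LIMSEQ_unique[OF conv_pointwise(1)[OF assms(1)] conv_pointwise(1)[OF assms(2)]])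
  show "snd p z = snd q z" for z by (rule LIMSEQ_unique[OF conv_pointwise(2)[OF assms(1)] conv_pointwise(2)[OF assms(2)]])
qed

lemma conv_subseq:
  assumes "conv P p" "strict_mono (r :: nat => nat)"
  shows "conv (%n. P (r n)) p"
proof -
  note c = filterlim_compose[OF _ filterlim_subseq[OF assms(2)]]
  show ?thesis using assms(1) c[of "%n. fst (P n)"] c[of "%n. deriv (fst (P n))"] c[of "%n. snd (P n)"]
    unfolding conv_def by blast
qed

text \<open>Otherwise the open sets visited only finitely often would cover M, and finitely many of
  them would contain the whole sequence.\<close>

lemma M_cluster:
  assumes P: "!!n::nat. P n \<in> M"
  shows "\<exists>p\<in>M. \<forall>T. openin E T --> p \<in> T --> (\<forall>m. \<exists>n>m. P n \<in> T)"
proof (rule ccontr)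
  assume no: "\<not> ?thesis"
  define \<U> where "\<U> = {T. openin E T & finite {n. P n \<in> T}}"
  have "M \<subseteq> \<Union>\<U>"
  proof
    fix p assume "p \<in> M"
    then have "\<not> (\<forall>T. openin E T --> p \<in> T --> (\<forall>m. \<exists>n>m. P n \<in> T))" using no by (rule_tac notI, elim notE, intro bexI)
    then have "\<exists>T. openin E T & p \<in> T & (\<exists>m. \<not> (\<exists>n>m. P n \<in> T))" by (simp only: not_all not_imp)
    then obtain T m where T: "openin E T" "p \<in> T" "\<not> (\<exists>n>m. P n \<in> T)" by blast
    have "{n. P n \<in> T} \<subseteq> {..m}" using T(3) by (auto simp: not_less[symmetric])
    then have "T \<in> \<U>" using T(1) by (auto simp: \<U>_def intro: finite_subset)
    then show "p \<in> \<Union>\<U>" using T(2) by blast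
  qed
  then obtain \<F> where F: "finite \<F>" "\<F> \<subseteq> \<U>" "M \<subseteq> \<Union>\<F>"
    using compactinD[OF M_props(2), of \<U>] by (auto simp: \<U>_def)
  have "UNIV = (\<Union>T\<in>\<F>. {n. P n \<in> T})" using P F(3) by blast
  moreover have "finite (\<Union>T\<in>\<F>. {n. P n \<in> T})" using F(1,2) by (intro finite_UN_I) (auto simp: \<U>_def)
  ultimately show False using infinite_UNIV_nat by simp
qed

lemma finite_nb_open:
  assumes "p \<in> M"
  shows "openin E (\<Inter>j\<in>{..k}. nb p j)" "p \<in> (\<Inter>j\<in>{..k}. nb p j)"
  using nb(1,2)[OF assms] by (auto intro!: openin_Inter)

text \<open>The last conjunct keeps the topological cluster property, about all open sets of
  \<open>E\<close> and not just the sets \<open>nb\<close>; it is what later turns uniqueness of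
  sequential limits into convergence in \<open>E\<close>.\<close>

lemma M_subseq:
  assumes P: "!!n::nat. P n \<in> M"
  shows "\<exists>r p. strict_mono (r :: nat => nat) & p \<in> M & conv (%n. P (r n)) p &
    (\<forall>T. openin E T --> p \<in> T --> (\<forall>m. \<exists>n>m. P n \<in> T))"
proof -
  obtain p where p: "p \<in> M" "!!T m. openin E T ==> p \<in> T ==> \<exists>n>m. P n \<in> T" using M_cluster[where P = P, OF P] by blast
  define B where "B k = (\<Inter>j\<in>{..k}. nb p j)" for k
  have B: "openin E (B k)" "p \<in> B k" for k unfolding B_def by (rule finite_nb_open[OF p(1)])+
  have "\<exists>r. \<forall>k. P (r k) \<in> B k & r k < r (Suc k)"
  proof (rule dependent_nat_choice)
    show "\<exists>n. P n \<in> B 0" using p(2)[OF B] by blast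
    show "\<exists>y. P y \<in> B (Suc n) & x < y" for x n using p(2)[OF B] by blast
  qed
  then obtain r where r: "!!k. P (r k) \<in> B k" "!!k. r k < r (Suc k)" by blast
  have "strict_mono r" using r(2) by (simp add: strict_mono_Suc_iff)
  moreover have "conv (%k. P (r k)) p" by (rule nb_decreasing_conv[OF p(1)]) (use r(1) in \<open>auto simp: B_def\<close>)
  ultimately show ?thesis using p by blast
qed

lemma M_conv_of_unique:
  assumes P: "!!n::nat. P n \<in> M"
    and u: "!!r q. strict_mono (r :: nat => nat) ==> q \<in> M ==> conv (%n. P (r n)) q ==> q = p"
  shows "p \<in> M" "conv P p" "openin E T ==> p \<in> T ==> \<forall>\<^sub>F n in sequentially. P n \<in> T"
proof -
  show p: "p \<in> M" using M_subseq[where P = P, OF P] u by blast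
  show ev: "\<forall>\<^sub>F n in sequentially. P n \<in> T" if T: "openin E T" "p \<in> T" for T
  proof (rule ccontr)
    assume "\<not> ?thesis"
    then have "\<exists>\<^sub>F n in sequentially. P n \<notin> T" by (simp add: frequently_def)
    then have inf: "infinite {n. P n \<notin> T}" by (simp add: frequently_cofinite[symmetric] cofinite_eq_sequentially)
    define r where "r = enumerate {n. P n \<notin> T}"
    have r: "strict_mono r" unfolding r_def using inf by (rule strict_mono_enumerate)
    have rT: "P (r n) \<notin> T" for n using enumerate_in_set[OF inf, of n] by (simp add: r_def)
    obtain r' q where q: "strict_mono (r' :: nat => nat)" "q \<in> M" "conv (%n. P (r (r' n))) q"
      "\<forall>T. openin E T --> q \<in> T --> (\<forall>m. \<exists>n>m. P (r n) \<in> T)"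
      using M_subseq[where P = "%n. P (r n)", OF P] by blast
    have "q = p" using u[of "r \<circ> r'" q] strict_mono_o[OF r q(1)] q(2,3) by (simp add: o_def)
    then show False using q(4) T rT by blast
  qed
  show "conv P p" by (rule conv_nb[OF p ev[OF nb(1,2)[OF p]]])
qed

text \<open>Pointwise limits determine a point, so all subsequential limits coincide; compactness
  then upgrades pointwise convergence to convergence in \<open>E\<close>.\<close>

lemma M_limit:
  assumes P: "!!n::nat. P n \<in> M"
    and lim: "!!x. (%n. fst (P n) x) \<longlonglongrightarrow> fst p x" "!!z. (%n. snd (P n) z) \<longlonglongrightarrow> snd p z"
  shows "p \<in> M" "conv P p" "openin E T ==> p \<in> T ==> \<forall>\<^sub>F n in sequentially. P n \<in> T"
proof -
  have u: "q = p" if "strict_mono (r :: nat => nat)" "conv (%n. P (r n)) q" for r q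
  proof (intro prod_eqI ext)
    show "fst q x = fst p x" for x
      using conv_pointwise(1)[OF that(2), of x] LIMSEQ_subseq_LIMSEQ[OF lim(1) that(1), of x] LIMSEQ_unique by (auto simp: o_def)
    show "snd q z = snd p z" for z
      using conv_pointwise(2)[OF that(2), of z] LIMSEQ_subseq_LIMSEQ[OF lim(2) that(1), of z] LIMSEQ_unique by (auto simp: o_def)
  qed
  show "p \<in> M" "conv P p" "openin E T ==> p \<in> T ==> \<forall>\<^sub>F n in sequentially. P n \<in> T"
    using M_conv_of_unique[where P = P and p = p, OF P] u by blast+
qed

lemma M_bounded: "\<exists>R\<ge>0. \<forall>p\<in>M. \<forall>x. \<bar>fst p x\<bar> <= R & \<bar>deriv (fst p) x\<bar> <= R"
proof (rule ccontr)
  assume no: "\<not> ?thesis"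
  have "\<exists>p x. p \<in> M & max \<bar>fst p x\<bar> \<bar>deriv (fst p) x\<bar> > real n" for n
    using no by (metis max.bounded_iff not_less of_nat_0_le_iff)
  then obtain P y where P: "!!n. P n \<in> M" "!!n. max \<bar>fst (P n) (y n)\<bar> \<bar>deriv (fst (P n)) (y n)\<bar> > real n" by metis
  obtain r p where r: "strict_mono (r :: nat => nat)" "p \<in> M" "conv (%n. P (r n)) p" using M_subseq[where P = P, OF P(1)] by blast
  note V = C1_circle_D[OF M_memD(3)[OF r(2)]]
  obtain B1 where B1: "!!x. \<bar>fst p x\<bar> <= B1" using periodic_bounded[OF L V(4) V(1)] by blast
  obtain B2 where B2: "!!x. \<bar>deriv (fst p) x\<bar> <= B2" using periodic_bounded[OF L V(3) V(5)] by blast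
  have "\<forall>\<^sub>F n in sequentially. \<forall>y\<in>UNIV. dist (fst (P (r n)) y) (fst p y) < 1"
    "\<forall>\<^sub>F n in sequentially. \<forall>y\<in>UNIV. dist (deriv (fst (P (r n))) y) (deriv (fst p) y) < 1"
    by (rule uniform_limitD[OF convD(1)[OF r(3)] zero_less_one], rule uniform_limitD[OF convD(2)[OF r(3)] zero_less_one])
  then have "\<forall>\<^sub>F n in sequentially. (\<forall>y\<in>UNIV. dist (fst (P (r n)) y) (fst p y) < 1) &
     (\<forall>y\<in>UNIV. dist (deriv (fst (P (r n))) y) (deriv (fst p) y) < 1) & n > nat \<lceil>max B1 B2 + 1\<rceil>"
    by (intro eventually_conj eventually_gt_at_top)
  then obtain n where n: "!!y. dist (fst (P (r n)) y) (fst p y) < 1" "!!y. dist (deriv (fst (P (r n))) y) (deriv (fst p) y) < 1"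
    "n > nat \<lceil>max B1 B2 + 1\<rceil>"
    using eventually_happens' sequentially_bot by blast
  have "n <= r n" using r(1) by (rule seq_suble)
  moreover have "\<bar>fst (P (r n)) (y (r n))\<bar> < B1 + 1" using n(1)[of "y (r n)"] B1[of "y (r n)"] unfolding dist_real_def by linarith
  moreover have "\<bar>deriv (fst (P (r n))) (y (r n))\<bar> < B2 + 1" using n(2)[of "y (r n)"] B2[of "y (r n)"] unfolding dist_real_def by linarith
  ultimately show False using P(2)[of "r n"] n(3) by linarith
qed

lemma M_defined: "p \<in> M ==> t >= 0 ==> phi_defined L \<alpha> t (fst p) (snd p)"
  and SP_in_M: "p \<in> M ==> t >= 0 ==> SP t p \<in> M"
  using M_props(3) unfolding positively_invariant_def by (cases p; fastforce)+

lemma SP_simps: "fst (SP t p) = phi L \<alpha> t (fst p) (snd p)" "snd (SP t p) = translate t (snd p)"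
  by (simp_all add: skew_product_def case_prod_beta')

text \<open>Positive invariance provides a solution beyond max T 0, and uniqueness identifies it
  with the orbit, so one formula serves every T.\<close>

lemma M_solution:
  assumes p: "p \<in> M"
  shows "is_solution L \<alpha> (snd p) T (%t. fst (SP t p))" "fst (SP 0 p) = fst p"
proof -
  obtain T' \<phi> where \<phi>: "T' > max T 0" "is_solution L \<alpha> (snd p) T' \<phi>" "\<phi> 0 = fst p"
    using M_defined[OF p, of "max T 0"] unfolding phi_defined_def reaches_def by auto
  have eq: "fst (SP t p) = \<phi> t" if "0 <= t" "t < T'" for t
    unfolding SP_simps using reaches_phi[OF M_memD(5)[OF p] \<phi>(2) that] \<phi>(3) by simp
  show "fst (SP 0 p) = fst p" using eq[of 0] \<phi> by simp
  have "continuous_map (top_of_set {0..<T'}) (phase_topology L \<alpha>) \<phi>" using \<phi>(2) by (simp add: is_solution_def)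
  then have "continuous_map (subtopology (top_of_set {0..<T'}) {0..<T}) (phase_topology L \<alpha>) \<phi>" by (rule continuous_map_from_subtopology)
  moreover have "subtopology (top_of_set {0..<T'}) {0..<T} = top_of_set {0..<T}"
    using \<phi>(1) by (simp add: subtopology_subtopology Int_absorb1 ivl_subset max_def split: if_splits)
  ultimately have "continuous_map (top_of_set {0..<T}) (phase_topology L \<alpha>) \<phi>" by simp
  then have "continuous_map (top_of_set {0..<T}) (phase_topology L \<alpha>) (%t. fst (SP t p))"
    by (rule continuous_map_eq) (use eq \<phi>(1) in auto)
  moreover have "classical_solution L (snd p) 0 T (%t. fst (SP t p))"
    by (rule classical_solution_subinterval[OF is_solution_classical[OF \<phi>(2)]]) (use \<phi>(1) eq in auto)
  ultimately show "is_solution L \<alpha> (snd p) T (%t. fst (SP t p))" by (rule is_solutionI)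
qed

lemma SP_zero: "p \<in> M ==> SP 0 p = p"
  using M_solution(2)[of p] by (intro prod_eqI) (auto simp: SP_simps translate_def)

lemma SP_add:
  assumes p: "p \<in> M" and st: "s >= 0" "t >= 0"
  shows "SP (t + s) p = SP t (SP s p)"
proof (rule prod_eqI)
  show "snd (SP (t + s) p) = snd (SP t (SP s p))" by (auto simp: SP_simps translate_def add_ac)
  have sol: "is_solution L \<alpha> (snd (SP s p)) (t + s + 1 - s) (%t. fst (SP (t + s) p))"
    using is_solution_translate[OF M_solution(1)[OF p, of "t + s + 1"] st(1)] by (simp add: SP_simps)
  have "phi L \<alpha> t (fst (SP (0 + s) p)) (snd (SP s p)) = fst (SP (t + s) p)"
    by (rule reaches_phi[OF M_memD(5)[OF SP_in_M[OF p st(1)]] sol st(2)]) simp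
  then show "fst (SP (t + s) p) = fst (SP t (SP s p))" by (simp add: SP_simps)
qed

lemma phi_shift_M:
  assumes p: "p \<in> M" and t: "t >= 0"
  shows "phi L \<alpha> t (shift a (fst p)) (snd p) = shift a (fst (SP t p))"
  using reaches_phi[OF M_memD(5)[OF p] is_solution_shift[OF M_solution(1)[OF p, of "t + 1"], of a] t] M_solution(2)[OF p] by simp

text \<open>\<open>classical_stability\<close> only estimates the sup norm, but pointwise
  convergence is all that \<open>M_limit\<close> asks for; compactness of M supplies the
  rest.\<close>

lemma conv_SP:
  assumes P: "!!n. P n \<in> M" and p: "p \<in> M" and c: "conv P p" and s: "s >= 0"
  shows "conv (%n. SP s (P n)) (SP s p)"
proof (rule M_limit(2))
  show "SP s (P n) \<in> M" for n by (rule SP_in_M[OF P s])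
  show "(%n. snd (SP s (P n)) z) \<longlonglongrightarrow> snd (SP s p) z" for z
    using conv_pointwise(2)[OF c] by (cases z) (auto simp: SP_simps translate_def)
  show "(%n. fst (SP s (P n)) x) \<longlonglongrightarrow> fst (SP s p) x" for x
  proof (rule LIMSEQ_I)
    fix e :: real assume e: "e > 0"
    obtain R where R: "R >= 0" "!!p x. p \<in> M ==> \<bar>fst p x\<bar> <= R & \<bar>deriv (fst p) x\<bar> <= R" using M_bounded by blast
    obtain C where C: "C >= 0" "!!g t u v p q. g \<in> translation_hull f ==> \<bar>u\<bar> <= R ==> \<bar>v\<bar> <= R ==> \<bar>p\<bar> <= R ==> \<bar>q\<bar> <= R ==>
        \<bar>g (t, u, p) - g (t, v, q)\<bar> <= C * (\<bar>u - v\<bar> + \<bar>p - q\<bar>)"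
      using translation_hull_lipschitz[OF f_C1 f_ap, of R] by blast
    define e' where "e' = e / (4 * exp ((C + 1) * s))"
    have e': "e' > 0" using e by (simp add: e'_def)
    define T where "T = s + 1"
    define K where "K = {0..T} \<times> {-R..R} \<times> {-R..R}"
    have "compact K" unfolding K_def by (intro compact_Times compact_Icc)
    then have "\<forall>\<^sub>F n in sequentially. \<forall>z\<in>K. dist (snd (P n) z) (snd p z) < e'"
      "\<forall>\<^sub>F n in sequentially. \<forall>x\<in>UNIV. dist (fst (P n) x) (fst p x) < e'"
      using uniform_limitD[OF convD(3)[OF c] e'] uniform_limitD[OF convD(1)[OF c] e'] by blast+
    then have "\<forall>\<^sub>F n in sequentially. norm (fst (SP s (P n)) x - fst (SP s p) x) < e"
    proof eventually_elim
      case (elim n)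
      have "\<bar>fst (SP s (P n)) x - fst (SP s p) x\<bar> <= (e' + e') * exp ((C + 1) * s)"
      proof (rule classical_stability[OF L C(1), where T = T and R = R and g = "snd (P n)" and h = "snd p"
            and U = "%t. fst (SP t (P n))" and V = "%t. fst (SP t p)"])
        show "classical_solution L (snd (P n)) 0 T (%t. fst (SP t (P n)))" "classical_solution L (snd p) 0 T (%t. fst (SP t p))"
          by (rule is_solution_classical[OF M_solution(1)]; rule P p)+
        show "continuous_on ({0..<T} \<times> UNIV) (%(t, x). fst (SP t (P n)) x)" "continuous_on ({0..<T} \<times> UNIV) (%(t, x). fst (SP t p) x)"
          by (rule is_solution_jointly_continuous(1)[OF M_solution(1)]; rule P p)+
        show "fst (SP 0 (P n)) (x + L) = fst (SP 0 (P n)) x" "fst (SP 0 p) (x + L) = fst (SP 0 p) x" for x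
          using C1_circle_D(1)[OF M_memD(3)] P p by (simp_all add: SP_zero)
        show "\<bar>fst (SP t (P n)) x\<bar> <= R & \<bar>deriv (fst (SP t (P n))) x\<bar> <= R & \<bar>fst (SP t p) x\<bar> <= R & \<bar>deriv (fst (SP t p)) x\<bar> <= R"
          if "t \<in> {0<..<T}" for t x
          using R(2)[OF SP_in_M[OF P], of t n x] R(2)[OF SP_in_M[OF p], of t x] that by auto
        show "\<bar>snd (P n) (t, u, p') - snd p (t, v, q)\<bar> <= C * (\<bar>u - v\<bar> + \<bar>p' - q\<bar>) + e'"
          if "t \<in> {0<..<T}" "\<bar>u\<bar> <= R" "\<bar>v\<bar> <= R" "\<bar>p'\<bar> <= R" "\<bar>q\<bar> <= R" for t u v p' q
        proof -
          have "(t, v, q) \<in> K" using that by (auto simp: K_def abs_le_iff)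
          then have "\<bar>snd (P n) (t, v, q) - snd p (t, v, q)\<bar> < e'" using elim(1) by (auto simp: dist_real_def)
          then show ?thesis using C(2)[OF M_memD(2)[OF P[of n]] that(2-5), of t] by linarith
        qed
        show "\<bar>fst (SP 0 (P n)) x - fst (SP 0 p) x\<bar> <= e'" for x
          using elim(2) P p by (auto simp: SP_zero dist_real_def less_imp_le)
      qed (use e' s in \<open>auto simp: T_def\<close>)
      also have "\<dots> = e / 2" by (simp add: e'_def field_simps)
      finally show ?case using e by simp
    qed
    then show "\<exists>no. \<forall>n\<ge>no. norm (fst (SP s (P n)) x - fst (SP s p) x) < e" unfolding eventually_sequentially .
  qed
qed

text \<open>The limit set of an orbit, forward (\<open>\<sigma> = 1\<close>) or backward (\<open>\<sigma> = -1\<close>), is a compact positively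
  invariant subset of \<open>M\<close>.\<close>

lemma limit_set_eq_M:
  assumes \<xi>: "!!t. t >= 0 ==> \<xi> t \<in> M" and \<sigma>: "\<sigma> = 1 \<or> \<sigma> = - 1"
    and flow: "!!s t. 0 <= s ==> s <= t ==> SP s (\<xi> t) = \<xi> (t + \<sigma> * s)" and p: "p \<in> M"
  shows "\<exists>\<tau>. (\<forall>n. \<tau> n >= real n) & conv (%n. \<xi> (\<tau> n)) p"
proof -
  define \<Omega> where "\<Omega> = {p \<in> M. \<exists>\<tau>. (\<forall>n. \<tau> n >= real n) & conv (%n. \<xi> (\<tau> n)) p}"
  \<comment> \<open>The topological version of the limit set, visibly closed. Intersected with M it
    equals the sequential version \<Omega>, which is therefore compact.\<close>
  define \<Omega>' where "\<Omega>' = {p \<in> topspace E. \<forall>T. openin E T --> p \<in> T --> (\<forall>m::nat. \<exists>t\<ge>real m. \<xi> t \<in> T)}"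
  have "openin E (topspace E - \<Omega>')"
  proof (subst openin_subopen, intro ballI)
    fix q assume q: "q \<in> topspace E - \<Omega>'"
    then obtain T m where T: "openin E T" "q \<in> T" "!!t. t >= real m ==> \<xi> t \<notin> T" by (auto simp: \<Omega>'_def)
    have "T \<subseteq> topspace E - \<Omega>'" using T openin_subset[OF T(1)] by (auto simp: \<Omega>'_def) (use order_refl in blast)
    then show "\<exists>T. openin E T & q \<in> T & T \<subseteq> topspace E - \<Omega>'" using T by blast
  qed
  then have "closedin E \<Omega>'" by (auto simp: closedin_def \<Omega>'_def)
  then have "compactin E (M \<inter> \<Omega>')" by (rule compact_Int_closedin[OF M_props(2)])
  moreover have "M \<inter> \<Omega>' = \<Omega>"
  proof (intro equalityI subsetI)
    fix q assume q: "q \<in> M \<inter> \<Omega>'"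
    have "\<exists>t\<ge>real k. \<xi> t \<in> (\<Inter>j\<in>{..k}. nb q j)" for k
      using q finite_nb_open[of q k] unfolding \<Omega>'_def by blast
    then obtain \<tau> where \<tau>: "!!k. \<tau> k >= real k" "!!k. \<xi> (\<tau> k) \<in> (\<Inter>j\<in>{..k}. nb q j)" by metis
    have "conv (%n. \<xi> (\<tau> n)) q" by (rule nb_decreasing_conv) (use q \<tau>(2) in auto)
    then show "q \<in> \<Omega>" using q \<tau>(1) by (auto simp: \<Omega>_def)
  next
    fix q assume "q \<in> \<Omega>"
    then obtain \<tau> where q: "q \<in> M" and \<tau>: "!!n. \<tau> n >= real n" "conv (%n. \<xi> (\<tau> n)) q" by (auto simp: \<Omega>_def)
    have in_M: "\<xi> (\<tau> n) \<in> M" for n using \<tau>(1)[of n] by (intro \<xi>) linarith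
    have "\<exists>t\<ge>real m. \<xi> t \<in> T" if "openin E T" "q \<in> T" for T m
    proof -
      have "\<forall>\<^sub>F n in sequentially. \<xi> (\<tau> n) \<in> T"
        by (rule M_limit(3)[where p = q, OF in_M conv_pointwise[OF \<tau>(2)] that])
      then have "\<forall>\<^sub>F n in sequentially. \<xi> (\<tau> n) \<in> T & n >= m" using eventually_ge_at_top by (rule eventually_conj)
      then obtain n where "\<xi> (\<tau> n) \<in> T" "n >= m" using eventually_happens' sequentially_bot by blast
      then show ?thesis using \<tau>(1)[of n] by (intro exI[of _ "\<tau> n"]) auto
    qed
    moreover have "q \<in> topspace E" using q compactin_subset_topspace[OF M_props(2)] by blast
    ultimately show "q \<in> M \<inter> \<Omega>'" using q by (auto simp: \<Omega>'_def)
  qed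
  ultimately have c: "compactin E \<Omega>" by simp
  have inv: "SP s q \<in> \<Omega>" if q: "q \<in> \<Omega>" and s: "s >= 0" for s q
  proof -
    obtain \<tau> where qM: "q \<in> M" and \<tau>: "!!n. \<tau> n >= real n" "conv (%n. \<xi> (\<tau> n)) q" using q by (auto simp: \<Omega>_def)
    define m where "m = nat \<lceil>s\<rceil>"
    have m: "real m >= s" using s unfolding m_def by linarith
    \<comment> \<open>Dropping m terms leaves room for a move by s in either direction while the
      times stay at least n.\<close>
    define \<tau>' where "\<tau>' n = \<tau> (n + m)" for n
    have \<tau>': "\<tau>' n >= real n + s" for n using \<tau>(1)[of "n + m"] m by (simp add: \<tau>'_def)
    have "conv (%n. \<xi> (\<tau>' n)) q"
      unfolding \<tau>'_def by (rule conv_subseq[OF \<tau>(2), of "%n. n + m"]) (simp add: strict_mono_def)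
    then have "conv (%n. SP s (\<xi> (\<tau>' n))) (SP s q)"
      using \<tau>' s by (intro conv_SP qM \<xi>) (auto intro: order_trans[OF _ \<tau>'])
    moreover have "SP s (\<xi> (\<tau>' n)) = \<xi> (\<tau>' n + \<sigma> * s)" for n using \<tau>'[of n] s by (intro flow) auto
    ultimately have "conv (%n. \<xi> (\<tau>' n + \<sigma> * s)) (SP s q)" by simp
    moreover have "\<tau>' n + \<sigma> * s >= real n" for n using \<tau>'[of n] \<sigma> s by auto
    ultimately show ?thesis using SP_in_M[OF qM s] unfolding \<Omega>_def
      by (intro CollectI conjI exI[of _ "%n. \<tau>' n + \<sigma> * s"]) auto
  qed
  have "\<xi> (real n) \<in> M" for n by (rule \<xi>) simp
  then obtain r q where r: "strict_mono (r :: nat => nat)" "q \<in> M" "conv (%n. \<xi> (real (r n))) q"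
    using M_subseq[where P = "%n. \<xi> (real n)"] by blast
  have "real (r n) >= real n" for n using seq_suble[OF r(1), of n] by simp
  then have "q \<in> \<Omega>" unfolding \<Omega>_def using r(2,3) by (intro CollectI conjI exI[of _ "%n. real (r n)"]) auto
  then have ne: "\<Omega> ~= {}" by blast
  have "positively_invariant L \<alpha> \<Omega>" unfolding positively_invariant_def
  proof (intro ballI, clarify)
    fix u g and t :: real assume ug: "(u, g) \<in> \<Omega>" and "0 <= t"
    then show "phi_defined L \<alpha> t u g & SP t (u, g) \<in> \<Omega>"
      using inv[OF ug] M_defined[of "(u, g)" t] by (auto simp: \<Omega>_def)
  qed
  then have "\<Omega> = M"
    using minimal c ne unfolding minimal_set_def compact_positively_invariant_def by (metis (no_types, lifting) \<Omega>_def mem_Collect_eq subsetI)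
  then show ?thesis using p by (auto simp: \<Omega>_def)
qed

end

section \<open>The flow on the minimal set\<close>

lemma translate_translate: "translate s (translate t g) = translate (s + t) g" "translate 0 g = g"
  by (auto simp: translate_def add_ac)

lemma shift_simps: "shift a u x = u (x + a)" "shift a (shift b u) = shift (a + b) u" "shift 0 u = u"
  by (auto simp: shift_def add_ac)

context minimal_flow
begin

lemma hull_strip:
  assumes g: "g \<in> translation_hull f" and U: "classical_solution L g a b U" and V: "classical_solution L g a b V"
    and R: "!!t x. t \<in> {a<..<b} ==> \<bar>U t x\<bar> <= R & \<bar>deriv (U t) x\<bar> <= R & \<bar>V t x\<bar> <= R & \<bar>deriv (V t) x\<bar> <= R"
  shows "\<exists>C wxx wt. parabolic_strip L C a b (%t x. U t x - V t x) (%t x. deriv (U t) x - deriv (V t) x) wxx wt"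
proof -
  obtain C where C: "C >= 0" "!!g t u v p q. g \<in> translation_hull f ==> \<bar>u\<bar> <= R ==> \<bar>v\<bar> <= R ==> \<bar>p\<bar> <= R ==> \<bar>q\<bar> <= R ==>
      \<bar>g (t, u, p) - g (t, v, q)\<bar> <= C * (\<bar>u - v\<bar> + \<bar>p - q\<bar>)"
    using translation_hull_lipschitz[OF f_C1 f_ap, of R] by blast
  show ?thesis using classical_diff_strip[OF L C(1) U V R C(2)[OF g]] by blast
qed

definition bnd where "bnd R \<longleftrightarrow> (\<forall>p\<in>M. \<forall>x. \<bar>fst p x\<bar> <= R & \<bar>deriv (fst p) x\<bar> <= R)"

lemma M_bounds: "\<exists>R. bnd R"
  using M_bounded unfolding bnd_def by blast

lemma bndD:
  assumes "bnd R" and p: "p \<in> M"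
  shows "\<bar>fst p x\<bar> <= R" "\<bar>deriv (fst p) x\<bar> <= R" "\<bar>deriv (shift a (fst p)) x\<bar> <= R" "\<bar>shift a (fst p) x\<bar> <= R"
  using assms C1_circle_shift(2)[OF M_memD(3)[OF p], of a] by (simp_all add: bnd_def shift_simps)

lemma SP_inj:
  assumes q: "q1 \<in> M" "q2 \<in> M" and s: "s >= 0" and eq: "SP s q1 = SP s q2"
  shows "q1 = q2"
proof -
  have "translate (- s) (snd (SP s q1)) = translate (- s) (snd (SP s q2))" using eq by simp
  then have g: "snd q1 = snd q2" by (simp add: SP_simps translate_translate)
  have "fst q1 x0 = fst q2 x0" for x0
  proof (rule ccontr)
    assume ne: "fst q1 x0 ~= fst q2 x0"
    \<comment> \<open>\<open>stays_nonzero\<close> needs a nonzero value at a positive time, because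
      the strip starts at time 0. Continuity provides one: for a short time each solution moves by
      less than half of their distance at x0.\<close>
    define e where "e = \<bar>fst q1 x0 - fst q2 x0\<bar> / 2"
    have e: "e > 0" using ne by (simp add: e_def)
    have s0: "s > 0" using s eq ne SP_zero q by (cases "s = 0") auto
    have near: "\<exists>d>0. \<forall>t\<in>{0..<s + 1}. \<bar>t - 0\<bar> < d --> \<bar>fst (SP t q) x0 - fst q x0\<bar> < e" if qM: "q \<in> M" for q
    proof -
      have "0 \<in> {0..<s + 1}" using s by simp
      then obtain d where d: "d > 0" "\<forall>t\<in>{0..<s + 1}. \<bar>t - 0\<bar> < d --> (\<forall>x. \<bar>fst (SP t q) x - fst (SP 0 q) x\<bar> < e & \<bar>deriv (fst (SP t q)) x - deriv (fst (SP 0 q)) x\<bar> < e)"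
        using solution_continuous[OF M_solution(1)[OF qM, of "s + 1"] _ e] by blast
      then show ?thesis unfolding SP_zero[OF qM] by blast
    qed
    obtain d1 where d1: "d1 > 0" "!!t. t \<in> {0..<s + 1} ==> \<bar>t - 0\<bar> < d1 ==> \<bar>fst (SP t q1) x0 - fst q1 x0\<bar> < e" using near[OF q(1)] by blast
    obtain d2 where d2: "d2 > 0" "!!t. t \<in> {0..<s + 1} ==> \<bar>t - 0\<bar> < d2 ==> \<bar>fst (SP t q2) x0 - fst q2 x0\<bar> < e" using near[OF q(2)] by blast
    define t1 where "t1 = min s (min (d1 / 2) (d2 / 2))"
    have t1: "0 < t1" "t1 <= s" "t1 < d1" "t1 < d2" using s0 d1(1) d2(1) by (auto simp: t1_def)
    have "\<bar>fst (SP t1 q1) x0 - fst q1 x0\<bar> < e" "\<bar>fst (SP t1 q2) x0 - fst q2 x0\<bar> < e" using d1(2)[of t1] d2(2)[of t1] t1 by auto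
    then have W: "fst (SP t1 q1) x0 - fst (SP t1 q2) x0 ~= 0" unfolding e_def by (auto simp: abs_if split: if_splits)
    obtain R where bR: "bnd R" using M_bounds by blast
    note R = bndD[OF bR]
    have "\<exists>C wxx wt. parabolic_strip L C 0 (s + 1) (%t x. fst (SP t q1) x - fst (SP t q2) x) (%t x. deriv (fst (SP t q1)) x - deriv (fst (SP t q2)) x) wxx wt"
    proof (rule hull_strip[OF M_memD(2)[OF q(1)]])
      show "classical_solution L (snd q1) 0 (s + 1) (%t. fst (SP t q1))" by (rule is_solution_classical[OF M_solution(1)[OF q(1)]])
      show "classical_solution L (snd q1) 0 (s + 1) (%t. fst (SP t q2))" unfolding g by (rule is_solution_classical[OF M_solution(1)[OF q(2)]])
      show "\<bar>fst (SP t q1) x\<bar> <= R & \<bar>deriv (fst (SP t q1)) x\<bar> <= R & \<bar>fst (SP t q2) x\<bar> <= R & \<bar>deriv (fst (SP t q2)) x\<bar> <= R"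
        if "t \<in> {0<..<s + 1}" for t x using R SP_in_M[OF q(1), of t] SP_in_M[OF q(2), of t] that by auto
    qed
    then obtain C wxx wt where st: "parabolic_strip L C 0 (s + 1) (%t x. fst (SP t q1) x - fst (SP t q2) x) (%t x. deriv (fst (SP t q1)) x - deriv (fst (SP t q2)) x) wxx wt"
      by (elim exE)
    have "\<exists>x. fst (SP s q1) x - fst (SP s q2) x ~= 0"
      by (rule parabolic_strip.stays_nonzero[OF st t1(1,2) _ W]) simp
    then show False using eq by simp
  qed
  then show ?thesis using g by (intro prod_eqI ext) auto
qed

text \<open>By minimality p is a forward limit of its own orbit. The orbit points s units of time
  earlier have a limit point, and continuity of the semiflow sends it to p.\<close>

lemma SP_surj:
  assumes p: "p \<in> M" and s: "s >= 0"
  shows "\<exists>q\<in>M. SP s q = p"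
proof -
  have "\<exists>\<tau>. (\<forall>n. \<tau> n >= real n) & conv (%n. SP (\<tau> n) p) p"
  proof (rule limit_set_eq_M[where \<sigma> = 1, OF SP_in_M[OF p] _ _ p])
    show "SP s (SP t p) = SP (t + 1 * s) p" if "0 <= s" "s <= t" for s t
      using SP_add[OF p, of t s] that by (simp add: add.commute)
  qed simp_all
  then obtain \<tau> where \<tau>: "!!n. \<tau> n >= real n" "conv (%n. SP (\<tau> n) p) p" by blast
  define m where "m = nat \<lceil>s\<rceil>"
  have m: "real m >= s" using s unfolding m_def by linarith
  have ge: "\<tau> (n + m) >= s" for n using \<tau>(1)[of "n + m"] m by simp
  define P where "P n = SP (\<tau> (n + m) - s) p" for n
  have P: "P n \<in> M" for n unfolding P_def using ge by (intro SP_in_M[OF p]) simp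
  obtain r q where q: "strict_mono (r :: nat => nat)" "q \<in> M" "conv (%n. P (r n)) q" using M_subseq[where P = P, OF P] by blast
  have "SP s (P n) = SP (\<tau> (n + m)) p" for n
    unfolding P_def using SP_add[OF p, of "\<tau> (n + m) - s" s] ge[of n] s by simp
  then have "conv (%n. SP (\<tau> (r n + m)) p) (SP s q)" using conv_SP[OF P q(2,3) s] by simp
  moreover have "conv (%n. SP (\<tau> (r n + m)) p) p"
    by (rule conv_subseq[OF \<tau>(2), of "%n. r n + m"]) (use q(1) in \<open>simp add: strict_mono_def\<close>)
  ultimately show ?thesis using conv_unique q(2) by blast
qed

definition Fl where "Fl t p = (phi_flow L \<alpha> M t (fst p) (snd p), translate t (snd p))"

lemma Fl_nonneg: "t >= 0 ==> Fl t p = SP t p"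
  by (rule prod_eqI) (simp_all add: Fl_def phi_flow_def SP_simps)

lemma Fl_neg:
  assumes p: "p \<in> M" and t: "t < 0"
  shows "Fl t p \<in> M" "SP (- t) (Fl t p) = p"
proof -
  obtain q where q: "q \<in> M" "SP (- t) q = p" using SP_surj[OF p, of "- t"] t by auto
  have "snd p = translate (- t) (snd q)" using q(2) SP_simps(2)[of "- t" q] by simp
  then have sq: "translate t (snd p) = snd q" by (simp add: translate_translate)
  have "(THE v. (v, translate t (snd p)) \<in> M & SP (- t) (v, translate t (snd p)) = (fst p, snd p)) = fst q"
  proof (rule the_equality)
    show "(fst q, translate t (snd p)) \<in> M & SP (- t) (fst q, translate t (snd p)) = (fst p, snd p)"
      using q by (simp add: sq)
    fix v assume v: "(v, translate t (snd p)) \<in> M & SP (- t) (v, translate t (snd p)) = (fst p, snd p)"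
    have "(v, translate t (snd p)) = q"
      by (rule SP_inj[of _ _ "- t"]) (use v q t in auto)
    then show "v = fst q" by auto
  qed
  then have "Fl t p = q" unfolding Fl_def phi_flow_def using t sq by simp
  then show "Fl t p \<in> M" "SP (- t) (Fl t p) = p" using q by auto
qed

lemma Fl_in_M: "p \<in> M ==> Fl t p \<in> M"
  using Fl_nonneg[of t p] SP_in_M[of p t] Fl_neg(1)[of p t] by (cases "t >= 0") auto

lemma snd_Fl: "snd (Fl t p) = translate t (snd p)" by (simp add: Fl_def)

lemma SP_Fl:
  assumes p: "p \<in> M" and r: "r >= 0" "r + t >= 0"
  shows "SP r (Fl t p) = SP (r + t) p"
proof (cases "t >= 0")
  case True
  then show ?thesis using SP_add[OF p True r(1)] by (simp add: Fl_nonneg)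
next
  case False
  then have t: "t < 0" by simp
  have "SP (r + t) p = SP (r + t) (SP (- t) (Fl t p))" using Fl_neg(2)[OF p t] by simp
  also have "\<dots> = SP (r + t + - t) (Fl t p)" using SP_add[OF Fl_neg(1)[OF p t], of "- t" "r + t"] t r by simp
  finally show ?thesis by simp
qed

text \<open>Moving forward by |s| + |t| makes all times nonnegative, where the semiflow law holds;
  injectivity then removes the move.\<close>

lemma Fl_add:
  assumes p: "p \<in> M"
  shows "Fl s (Fl t p) = Fl (s + t) p"
proof (rule SP_inj[OF Fl_in_M[OF Fl_in_M[OF p]] Fl_in_M[OF p], of "\<bar>s\<bar> + \<bar>t\<bar>"])
  show "SP (\<bar>s\<bar> + \<bar>t\<bar>) (Fl s (Fl t p)) = SP (\<bar>s\<bar> + \<bar>t\<bar>) (Fl (s + t) p)"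
    using SP_Fl[OF Fl_in_M[OF p], of "\<bar>s\<bar> + \<bar>t\<bar>" s t] SP_Fl[OF p, of "\<bar>s\<bar> + \<bar>t\<bar> + s" t] SP_Fl[OF p, of "\<bar>s\<bar> + \<bar>t\<bar>" "s + t"]
    by (simp add: add_ac)
qed simp

lemma Fl_zero: "p \<in> M ==> Fl 0 p = p" by (simp add: Fl_nonneg SP_zero)

lemma Fl_classical:
  assumes p: "p \<in> M"
  shows "classical_solution L (snd p) a b (%t. fst (Fl t p))"
proof -
  \<comment> \<open>Started at time - |a|, the orbit is a forward solution that covers the whole
    interval.\<close>
  define n where "n = \<bar>a\<bar>"
  define q where "q = Fl (- n) p"
  have q: "q \<in> M" unfolding q_def by (rule Fl_in_M[OF p])
  have "classical_solution L (translate (- n) (snd p)) 0 (b + n) (%t. fst (SP t q))"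
    using is_solution_classical[OF M_solution(1)[OF q, of "b + n"]] by (simp add: q_def snd_Fl)
  from classical_solution_translate[OF this]
  have "classical_solution L (snd p) (- n) b (%t. fst (SP (t + n) q))" by simp
  then show ?thesis
  proof (rule classical_solution_subinterval)
    show "{a<..<b} \<subseteq> {- n<..<b}" by (auto simp: n_def)
    show "fst (SP (t + n) q) = fst (Fl t p)" if "t \<in> {a<..<b}" for t
      using SP_Fl[OF p, of "t + n" "- n"] that Fl_add[OF p, of "t + n" "- n"] Fl_nonneg[of "t + n" q] by (auto simp: q_def n_def)
  qed
qed

section \<open>The zero number of a pair of orbits\<close>

abbreviation diff_flow where
  "diff_flow p1 p2 a \<equiv> (%t x. fst (Fl t p1) x - shift a (fst (Fl t p2)) x)"

abbreviation diff_flow_x where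
  "diff_flow_x p1 p2 a \<equiv> (%t x. deriv (fst (Fl t p1)) x - deriv (shift a (fst (Fl t p2))) x)"

text \<open>Forward in time this is uniqueness. Backward, the shifted function need not belong to M,
  so \<open>SP_inj\<close> does not apply and backward uniqueness is used directly for the shifted
  solution.\<close>

lemma Fl_shift_eq:
  assumes p: "p1 \<in> M" "p2 \<in> M" "snd p1 = snd p2" and eq: "fst p1 = shift a (fst p2)"
  shows "fst (Fl t p1) = shift a (fst (Fl t p2))"
proof (cases "t >= 0")
  case True
  then show ?thesis using phi_shift_M[OF p(2) True, of a] eq p(3) by (simp add: Fl_nonneg SP_simps)
next
  case False
  define n where "n = - t"
  define P1 P2 where "P1 = Fl t p1" and "P2 = Fl t p2"
  have P: "P1 \<in> M" "P2 \<in> M" "snd P1 = snd P2" unfolding P1_def P2_def using p by (auto intro: Fl_in_M simp: snd_Fl)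
  have n: "n > 0" using False by (simp add: n_def)
  have bk: "fst (SP n P1) = shift a (fst (SP n P2))"
    using Fl_neg(2)[OF p(1), of t] Fl_neg(2)[OF p(2), of t] False eq by (simp add: n_def P1_def P2_def)
  have "fst P1 x = shift a (fst P2) x" for x
  proof (rule ccontr)
    assume ne: "fst P1 x ~= shift a (fst P2) x"
    obtain R where bR: "bnd R" using M_bounds by blast
    note R = bndD[OF bR]
    have "\<exists>C wxx wt. parabolic_strip L C (- 1) (n + 1) (diff_flow P1 P2 a)
      (diff_flow_x P1 P2 a) wxx wt"
      by (rule hull_strip[OF M_memD(2)[OF P(1)] Fl_classical[OF P(1)], where R = R], unfold P(3), rule classical_solution_shift[OF Fl_classical[OF P(2)]])
        (use R Fl_in_M[OF P(1)] Fl_in_M[OF P(2)] in simp_all)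
    then obtain C wxx wt where st: "parabolic_strip L C (- 1) (n + 1) (diff_flow P1 P2 a)
      (diff_flow_x P1 P2 a) wxx wt" by (elim exE)
    have "\<exists>x. fst (Fl n P1) x - shift a (fst (Fl n P2)) x ~= 0"
      by (rule parabolic_strip.stays_nonzero[OF st, of 0 n x]) (use n ne P in \<open>auto simp: Fl_zero\<close>)
    then show False using bk n by (simp add: Fl_nonneg)
  qed
  then show ?thesis unfolding P1_def P2_def by blast
qed

definition zn where "zn p1 p2 a t = card {x \<in> {0..<L}. fst (Fl t p1) x - shift a (fst (Fl t p2)) x = 0}"

definition simple where
  "simple p1 p2 a t \<longleftrightarrow> (\<forall>x. fst (Fl t p1) x - shift a (fst (Fl t p2)) x = 0 --> deriv (fst (Fl t p1)) x - deriv (shift a (fst (Fl t p2))) x ~= 0)"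

definition pair where "pair p1 p2 a \<longleftrightarrow> p1 \<in> M & p2 \<in> M & snd p1 = snd p2 & fst p1 ~= shift a (fst p2)"

lemma pair_Fl: "pair p1 p2 a ==> pair (Fl t p1) (Fl t p2) a"
  using Fl_shift_eq[of "Fl t p1" "Fl t p2" a "- t"] by (auto simp: pair_def Fl_in_M snd_Fl Fl_add Fl_zero)

lemma pair_strip:
  assumes "pair p1 p2 a"
  obtains C wxx wt where "parabolic_nonzero L C t0 t1 (diff_flow p1 p2 a)
    (diff_flow_x p1 p2 a) wxx wt"
proof -
  have P: "p1 \<in> M" "p2 \<in> M" "snd p1 = snd p2" using assms by (auto simp: pair_def)
  obtain R where bR: "bnd R" using M_bounds by blast
    note R = bndD[OF bR]
  have "\<exists>C wxx wt. parabolic_strip L C t0 t1 (diff_flow p1 p2 a)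
      (diff_flow_x p1 p2 a) wxx wt"
    by (rule hull_strip[OF M_memD(2)[OF P(1)] Fl_classical[OF P(1)], where R = R], unfold P(3), rule classical_solution_shift[OF Fl_classical[OF P(2)]])
      (use R Fl_in_M[OF P(1)] Fl_in_M[OF P(2)] in simp_all)
  then obtain C wxx wt where st: "parabolic_strip L C t0 t1 (diff_flow p1 p2 a)
      (diff_flow_x p1 p2 a) wxx wt" by (elim exE)
  have nz: "\<exists>x. fst (Fl t p1) x - shift a (fst (Fl t p2)) x ~= 0" for t
  proof (rule ccontr)
    assume "\<not> ?thesis"
    then have "fst (Fl t p1) = shift a (fst (Fl t p2))" by auto
    then show False using pair_Fl[OF assms, of t] by (simp add: pair_def)
  qed
  show ?thesis by (rule that, rule parabolic_nonzero.intro[OF st], unfold_locales) (rule nz)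
qed

lemma zn_zero_number:
  assumes "pair p1 p2 a"
  shows "zero_number L (%x. fst (Fl t p1) x - shift a (fst (Fl t p2)) x) = enat (zn p1 p2 a t)"
proof -
  obtain C wxx wt where "parabolic_nonzero L C (t - 1) (t + 1) (diff_flow p1 p2 a)
    (diff_flow_x p1 p2 a) wxx wt" by (rule pair_strip[OF assms])
  then interpret parabolic_nonzero L C "t - 1" "t + 1" "diff_flow p1 p2 a"
    "diff_flow_x p1 p2 a" wxx wt .
  have "t \<in> {t - 1<..<t + 1}" by simp
  from zero_number_eq[OF this] show ?thesis by (simp add: zn_def zcount_def)
qed

lemma zn_antimono:
  assumes "pair p1 p2 a" "s <= t"
  shows "zn p1 p2 a t <= zn p1 p2 a s"
proof -
  obtain C wxx wt where "parabolic_nonzero L C (s - 1) (t + 1) (diff_flow p1 p2 a)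
    (diff_flow_x p1 p2 a) wxx wt" by (rule pair_strip[OF assms(1)])
  then interpret parabolic_nonzero L C "s - 1" "t + 1" "diff_flow p1 p2 a"
    "diff_flow_x p1 p2 a" wxx wt .
  show ?thesis using zcount_antimono[of s t] assms(2) by (simp add: zn_def zcount_def)
qed

lemma zn_drop:
  assumes "pair p1 p2 a" "s < t" "\<not> simple p1 p2 a t"
  shows "zn p1 p2 a t < zn p1 p2 a s"
proof -
  obtain C wxx wt where "parabolic_nonzero L C (s - 1) (t + 1) (diff_flow p1 p2 a)
    (diff_flow_x p1 p2 a) wxx wt" by (rule pair_strip[OF assms(1)])
  then interpret parabolic_nonzero L C "s - 1" "t + 1" "diff_flow p1 p2 a"
    "diff_flow_x p1 p2 a" wxx wt .
  obtain x where x: "fst (Fl t p1) x - shift a (fst (Fl t p2)) x = 0" "deriv (fst (Fl t p1)) x - deriv (shift a (fst (Fl t p2))) x = 0"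
    using assms(3) by (auto simp: simple_def)
  show ?thesis using zcount_drop[OF _ assms(2) _ x] by (simp add: zn_def zcount_def)
qed

text \<open>Every time that is not simple costs a strict drop of a natural number, so an increasing
  sequence of such times cannot go on forever.\<close>

lemma simple_time:
  assumes P: "pair p1 p2 a" and st: "s < t"
  shows "\<exists>T. s < T & T < t & simple p1 p2 a T"
proof (rule ccontr)
  assume no: "\<not> ?thesis"
  \<comment> \<open>Any strictly increasing sequence inside (s, t) would do; the offset 2 keeps T 0
    above s.\<close>
  define T where "T i = t - (t - s) / real (i + 2)" for i
  have T: "s < T i" "T i < t" for i
  proof -
    have "(t - s) / real (i + 2) < t - s" "(t - s) / real (i + 2) > 0" using st by (auto simp: divide_simps)
    then show "s < T i" "T i < t" by (auto simp: T_def)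
  qed
  have step: "T i < T (Suc i)" for i unfolding T_def using st by (auto intro!: divide_strict_left_mono)
  have "zn p1 p2 a (T i) + i <= zn p1 p2 a s" for i
  proof (induction i)
    case 0
    then show ?case using zn_antimono[OF P, of s "T 0"] T[of 0] by simp
  next
    case (Suc i)
    have "\<not> simple p1 p2 a (T (Suc i))" using no T by blast
    then show ?case using zn_drop[OF P step[of i]] Suc by simp
  qed
  from this[of "Suc (zn p1 p2 a s)"] show False by simp
qed

lemma simple_stable:
  assumes P: "pair p1 p2 a" and s: "simple p1 p2 a t"
  shows "\<exists>\<epsilon>>0. \<forall>v\<in>C1_circle L. (\<forall>x. \<bar>v x - (fst (Fl t p1) x - shift a (fst (Fl t p2)) x)\<bar> < \<epsilon> &
     \<bar>deriv v x - (deriv (fst (Fl t p1)) x - deriv (shift a (fst (Fl t p2))) x)\<bar> < \<epsilon>) --> zero_number L v = enat (zn p1 p2 a t)"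
proof -
  have P12: "p1 \<in> M" "p2 \<in> M" using P by (auto simp: pair_def)
  have C1: "fst (Fl t p1) \<in> C1_circle L" "shift a (fst (Fl t p2)) \<in> C1_circle L"
    using M_memD(3)[OF Fl_in_M[OF P12(1)]] C1_circle_shift(1)[OF M_memD(3)[OF Fl_in_M[OF P12(2)]]] by auto
  note U = C1_circle_D[OF C1(1)] and V = C1_circle_D[OF C1(2)]
  define u where "u = (%x. fst (Fl t p1) x - shift a (fst (Fl t p2)) x)"
  define u' where "u' = (%x. deriv (fst (Fl t p1)) x - deriv (shift a (fst (Fl t p2))) x)"
  have z: "zero_number L u = enat (zn p1 p2 a t)" unfolding u_def by (rule zn_zero_number[OF P])
  have "\<exists>\<epsilon>>0. \<forall>v v'. (\<forall>x. v (x + L) = v x) --> (\<forall>x. (v has_real_derivative v' x) (at x)) -->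
    (\<forall>x. \<bar>v x - u x\<bar> < \<epsilon> & \<bar>v' x - u' x\<bar> < \<epsilon>) --> zero_number L v = zero_number L u & zero_number L u < \<infinity>"
  proof (rule zero_number_C1_stable[OF L])
    show "u (x + L) = u x" for x using U(1) V(1) by (simp add: u_def)
    show "(u has_real_derivative u' x) (at x)" for x unfolding u_def u'_def using U(2) V(2) by (rule DERIV_diff)
    show "continuous_on UNIV u'" unfolding u'_def using U(3) V(3) by (rule continuous_on_diff)
    show "u' x ~= 0" if "u x = 0" for x using s that by (simp add: simple_def u_def u'_def)
  qed
  then obtain \<epsilon> where e: "\<epsilon> > 0" "!!v v'. (\<forall>x. v (x + L) = v x) ==> (\<forall>x. (v has_real_derivative v' x) (at x)) ==>
    (\<forall>x. \<bar>v x - u x\<bar> < \<epsilon> & \<bar>v' x - u' x\<bar> < \<epsilon>) ==> zero_number L v = zero_number L u" by blast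
  show ?thesis
  proof (intro exI[of _ \<epsilon>] conjI ballI impI e(1))
    fix v assume v: "v \<in> C1_circle L" "\<forall>x. \<bar>v x - (fst (Fl t p1) x - shift a (fst (Fl t p2)) x)\<bar> < \<epsilon> & \<bar>deriv v x - (deriv (fst (Fl t p1)) x - deriv (shift a (fst (Fl t p2))) x)\<bar> < \<epsilon>"
    have "zero_number L v = zero_number L u"
      by (rule e(2)[of v "deriv v"]) (use C1_circle_D(1,2)[OF v(1)] v(2) in \<open>simp_all add: u_def u'_def\<close>)
    then show "zero_number L v = enat (zn p1 p2 a t)" using z by simp
  qed
qed

text \<open>Simple times are dense and the count is monotone, so the value at t is squeezed between
  two simple times.\<close>

lemma zn_const_of_simple:
  assumes P: "pair p1 p2 a" and N: "!!s. simple p1 p2 a s ==> zn p1 p2 a s = N"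
  shows "zn p1 p2 a t = N"
proof -
  obtain T1 where T1: "t - 1 < T1" "T1 < t" "simple p1 p2 a T1" using simple_time[OF P, of "t - 1" t] by auto
  obtain T2 where T2: "t < T2" "simple p1 p2 a T2" using simple_time[OF P, of t "t + 1"] by auto
  show ?thesis using zn_antimono[OF P, of T1 t] zn_antimono[OF P, of t T2] N[OF T1(3)] N[OF T2(2)] T1 T2 by simp
qed

text \<open>For negative s every subsequential limit is mapped to p by \<open>SP (- s)\<close>, so
  injectivity determines it and compactness gives convergence.\<close>

lemma conv_Fl:
  assumes P: "!!n. P n \<in> M" and p: "p \<in> M" and c: "conv P p"
  shows "conv (%n. Fl s (P n)) (Fl s p)"
proof (cases "s >= 0")
  case True
  then show ?thesis using conv_SP[OF P p c True] by (simp add: Fl_nonneg)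
next
  case False
  show ?thesis
  proof (rule M_conv_of_unique(2))
    show "Fl s (P n) \<in> M" for n by (rule Fl_in_M[OF P])
    fix r q assume r: "strict_mono (r :: nat => nat)" "q \<in> M" "conv (%n. Fl s (P (r n))) q"
    have "conv (%n. SP (- s) (Fl s (P (r n)))) (SP (- s) q)"
      by (rule conv_SP[OF Fl_in_M[OF P] r(2,3)]) (use False in simp)
    moreover have "SP (- s) (Fl s (P n)) = P n" for n using Fl_neg(2)[OF P] False by simp
    ultimately have "SP (- s) q = p" using conv_unique conv_subseq[OF c r(1)] by simp
    then show "q = Fl s p" using SP_inj[OF r(2) Fl_in_M[OF p], of "- s" s] Fl_neg(2)[OF p, of s] False by simp
  qed
qed

text \<open>Both components are followed along the same times, which run to plus infinity for
  \<sigma> = 1 and to minus infinity for \<sigma> = - 1, so the limits lie over a common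
  nonlinearity.\<close>

definition lim_pair where
  "lim_pair \<sigma> p1 p2 \<tau> q1 q2 \<longleftrightarrow> (\<forall>n::nat. \<sigma> * \<tau> n >= real n) & conv (%n. Fl (\<tau> n) p1) q1 & conv (%n. Fl (\<tau> n) p2) q2 &
     q1 \<in> M & q2 \<in> M & snd q1 = snd q2"

lemma lim_pairI:
  assumes p: "p1 \<in> M" "p2 \<in> M" "snd p1 = snd p2" and \<tau>: "!!n::nat. \<sigma> * \<tau> n >= real n"
  shows "\<exists>r q1 q2. strict_mono (r :: nat => nat) & lim_pair \<sigma> p1 p2 (%n. \<tau> (r n)) q1 q2"
proof -
  obtain r1 q1 where 1: "strict_mono (r1 :: nat => nat)" "q1 \<in> M" "conv (%n. Fl (\<tau> (r1 n)) p1) q1"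
    using M_subseq[where P = "%n. Fl (\<tau> n) p1", OF Fl_in_M[OF p(1)]] by blast
  obtain r2 q2 where 2: "strict_mono (r2 :: nat => nat)" "q2 \<in> M" "conv (%n. Fl (\<tau> (r1 (r2 n))) p2) q2"
    using M_subseq[where P = "%n. Fl (\<tau> (r1 n)) p2", OF Fl_in_M[OF p(2)]] by blast
  have c1: "conv (%n. Fl (\<tau> (r1 (r2 n))) p1) q1" by (rule conv_subseq[OF 1(3) 2(1)])
  define r where "r n = r1 (r2 n)" for n
  have r: "strict_mono r" using 1(1) 2(1) by (simp add: r_def strict_mono_def)
  have "snd q1 z = snd q2 z" for z
    using conv_pointwise(2)[OF c1, of z] conv_pointwise(2)[OF 2(3), of z] LIMSEQ_unique by (simp add: snd_Fl p(3)) blast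
  then have "snd q1 = snd q2" by blast
  moreover have "\<sigma> * \<tau> (r n) >= real n" for n using \<tau>[of "r n"] seq_suble[OF r, of n] by linarith
  ultimately show ?thesis using r c1 2 1(2) unfolding lim_pair_def r_def by blast
qed

lemma reach:
  assumes p: "p1 \<in> M" and q: "q \<in> M" and \<sigma>: "\<sigma> = 1 \<or> \<sigma> = - 1"
  shows "\<exists>\<tau>. (\<forall>n::nat. \<sigma> * \<tau> n >= real n) & conv (%n. Fl (\<tau> n) p1) q"
proof -
  have "\<exists>\<tau>. (\<forall>n. \<tau> n >= real n) & conv (%n. Fl (\<sigma> * \<tau> n) p1) q"
  proof (rule limit_set_eq_M[where \<xi> = "%t. Fl (\<sigma> * t) p1", OF Fl_in_M[OF p] \<sigma> _ q])
    fix s t :: real assume st: "0 <= s" "s <= t"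
    have "\<sigma> * (t + \<sigma> * s) = s + \<sigma> * t" using \<sigma> by auto
    then show "SP s (Fl (\<sigma> * t) p1) = Fl (\<sigma> * (t + \<sigma> * s)) p1" using Fl_add[OF p, of s "\<sigma> * t"] st by (simp add: Fl_nonneg)
  qed
  then obtain \<tau> where "!!n. \<tau> n >= real n" "conv (%n. Fl (\<sigma> * \<tau> n) p1) q" by blast
  then show ?thesis using \<sigma> by (intro exI[of _ "%n. \<sigma> * \<tau> n"]) auto
qed

lemma lim_pair_shift_eq:
  assumes l: "lim_pair \<sigma> p1 p2 \<tau> q1 q2" and p: "p1 \<in> M" "p2 \<in> M" "snd p1 = snd p2" and eq: "fst p1 = shift a (fst p2)"
  shows "fst q1 = shift a (fst q2)"
proof
  fix x
  have "(%n. fst (Fl (\<tau> n) p1) x) \<longlonglongrightarrow> fst q1 x" "(%n. fst (Fl (\<tau> n) p2) (x + a)) \<longlonglongrightarrow> fst q2 (x + a)"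
    using l conv_pointwise(1) unfolding lim_pair_def by blast+
  then show "fst q1 x = shift a (fst q2) x"
    using LIMSEQ_unique by (simp add: Fl_shift_eq[OF p eq] shift_simps(1)) blast
qed

text \<open>At a simple time s of the limit pair its count agrees with that of the original pair at
  \<tau> n + s for large n. Counts are monotone in time, so one such s fixes the original count near
  the end of time, and every other simple s then gives the same number. For \<sigma> = - 1 this also
  shows that the count is bounded in the past.\<close>

lemma lim_pair_zn:
  assumes l: "lim_pair \<sigma> p1 p2 \<tau> q1 q2" and \<sigma>: "\<sigma> = 1 \<or> \<sigma> = - 1" and P: "pair p1 p2 a" and ne: "fst q1 ~= shift a (fst q2)"
  shows "\<exists>N t0. (\<forall>s. zn q1 q2 a s = N) & (\<forall>t. \<sigma> * t >= t0 --> zn p1 p2 a t = N)"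
proof -
  have p: "p1 \<in> M" "p2 \<in> M" using P by (auto simp: pair_def)
  have Q: "pair q1 q2 a" using l ne by (auto simp: lim_pair_def pair_def)
  have q: "q1 \<in> M" "q2 \<in> M" using Q by (auto simp: pair_def)
  have \<tau>: "!!n. \<sigma> * \<tau> n >= real n" and c1: "conv (%n. Fl (\<tau> n) p1) q1" and c2: "conv (%n. Fl (\<tau> n) p2) q2"
    using l by (auto simp: lim_pair_def)
  have ev: "\<exists>n0. \<forall>n\<ge>n0. zn p1 p2 a (\<tau> n + s) = zn q1 q2 a s" if s: "simple q1 q2 a s" for s
  proof -
    obtain \<epsilon> where e: "\<epsilon> > 0" "!!v. v \<in> C1_circle L ==> (\<forall>x. \<bar>v x - (fst (Fl s q1) x - shift a (fst (Fl s q2)) x)\<bar> < \<epsilon> &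
       \<bar>deriv v x - (deriv (fst (Fl s q1)) x - deriv (shift a (fst (Fl s q2))) x)\<bar> < \<epsilon>) ==> zero_number L v = enat (zn q1 q2 a s)"
      using simple_stable[OF Q s] by blast
    have d1: "conv (%n. Fl (\<tau> n + s) p1) (Fl s q1)" and d2: "conv (%n. Fl (\<tau> n + s) p2) (Fl s q2)"
      using conv_Fl[OF Fl_in_M[OF p(1)] q(1) c1, of s] conv_Fl[OF Fl_in_M[OF p(2)] q(2) c2, of s] Fl_add[OF p(1)] Fl_add[OF p(2)]
      by (simp_all add: add.commute)
    have e2: "\<epsilon> / 2 > 0" using e(1) by simp
    note D = uniform_limitD[OF convD(1)[OF d1] e2] uniform_limitD[OF convD(2)[OF d1] e2] uniform_limitD[OF convD(1)[OF d2] e2] uniform_limitD[OF convD(2)[OF d2] e2]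
    have "\<forall>\<^sub>F n in sequentially. zn p1 p2 a (\<tau> n + s) = zn q1 q2 a s"
      using D
    proof eventually_elim
      case (elim n)
      have A: "fst (Fl (\<tau> n + s) p1) \<in> C1_circle L" "fst (Fl (\<tau> n + s) p2) \<in> C1_circle L" "fst (Fl s q2) \<in> C1_circle L"
        using M_memD(3) Fl_in_M p q by auto
      note S = C1_circle_shift[OF A(2), of a] and S2 = C1_circle_shift(2)[OF A(3), of a]
      have "zero_number L (%x. fst (Fl (\<tau> n + s) p1) x - shift a (fst (Fl (\<tau> n + s) p2)) x) = enat (zn q1 q2 a s)"
      proof (rule e(2)[OF C1_circle_combine(1)[OF A(1) S(1)]], intro allI)
        fix x
        have B: "\<bar>fst (Fl (\<tau> n + s) p1) x - fst (Fl s q1) x\<bar> < \<epsilon> / 2" "\<bar>deriv (fst (Fl (\<tau> n + s) p1)) x - deriv (fst (Fl s q1)) x\<bar> < \<epsilon> / 2"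
          "\<bar>fst (Fl (\<tau> n + s) p2) (x + a) - fst (Fl s q2) (x + a)\<bar> < \<epsilon> / 2" "\<bar>deriv (fst (Fl (\<tau> n + s) p2)) (x + a) - deriv (fst (Fl s q2)) (x + a)\<bar> < \<epsilon> / 2"
          using elim unfolding dist_real_def by blast+
        have D: "deriv (%x. fst (Fl (\<tau> n + s) p1) x - shift a (fst (Fl (\<tau> n + s) p2)) x) x =
            deriv (fst (Fl (\<tau> n + s) p1)) x - deriv (fst (Fl (\<tau> n + s) p2)) (x + a)"
          using fun_cong[OF C1_circle_combine(2)[OF A(1) S(1)], of x] unfolding S(2) shift_simps(1)[of a "deriv _"] .
        have D2: "deriv (shift a (fst (Fl s q2))) x = deriv (fst (Fl s q2)) (x + a)" unfolding S2 shift_simps(1) ..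
        show "\<bar>fst (Fl (\<tau> n + s) p1) x - shift a (fst (Fl (\<tau> n + s) p2)) x - (fst (Fl s q1) x - shift a (fst (Fl s q2)) x)\<bar> < \<epsilon> &
          \<bar>deriv (%x. fst (Fl (\<tau> n + s) p1) x - shift a (fst (Fl (\<tau> n + s) p2)) x) x - (deriv (fst (Fl s q1)) x - deriv (shift a (fst (Fl s q2))) x)\<bar> < \<epsilon>"
          unfolding D D2 shift_simps(1)[of a _ x] using B by (intro conjI; linarith)
      qed
      then show ?case using zn_zero_number[OF P, of "\<tau> n + s"] by simp
    qed
    then show ?thesis by (simp add: eventually_sequentially)
  qed
  obtain s0 where s0: "simple q1 q2 a s0" using simple_time[OF Q, of 0 1] by auto
  define N where "N = zn q1 q2 a s0"
  obtain n1 where n1: "!!n. n >= n1 ==> zn p1 p2 a (\<tau> n + s0) = N" using ev[OF s0] unfolding N_def by blast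
  define t0 where "t0 = \<sigma> * (\<tau> n1 + s0)"
  have large: "zn p1 p2 a t = N" if t: "\<sigma> * t >= t0" for t
  proof -
    \<comment> \<open>With this n, t lies between \<tau> n1 + s0 and \<tau> n + s0. The count is N
      at both, so monotonicity fixes it at t.\<close>
    define n where "n = max n1 (nat \<lceil>\<sigma> * (t - s0)\<rceil>)"
    have "real n >= \<sigma> * (t - s0)" unfolding n_def by linarith
    then have nt: "\<sigma> * \<tau> n >= \<sigma> * (t - s0)" using \<tau>[of n] by linarith
    have zs: "zn p1 p2 a (\<tau> n + s0) = N" "zn p1 p2 a (\<tau> n1 + s0) = N" using n1 by (auto simp: n_def)
    from \<sigma> show ?thesis
    proof
      assume "\<sigma> = 1"
      then have "\<tau> n1 + s0 <= t" "t <= \<tau> n + s0" using t nt by (auto simp: t0_def)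
      then show ?thesis using zn_antimono[OF P] zs by (metis le_antisym)
    next
      assume "\<sigma> = - 1"
      then have "t <= \<tau> n1 + s0" "\<tau> n + s0 <= t" using t nt by (auto simp: t0_def)
      then show ?thesis using zn_antimono[OF P] zs by (metis le_antisym)
    qed
  qed
  have "zn q1 q2 a s = N" if s: "simple q1 q2 a s" for s
  proof -
    obtain n2 where n2: "!!n. n >= n2 ==> zn p1 p2 a (\<tau> n + s) = zn q1 q2 a s" using ev[OF s] by blast
    define n where "n = max n2 (nat \<lceil>t0 - \<sigma> * s\<rceil>)"
    have "real n >= t0 - \<sigma> * s" unfolding n_def by linarith
    then have "\<sigma> * (\<tau> n + s) >= t0" using \<tau>[of n] by (simp add: distrib_left)
    then show ?thesis using large n2[of n] by (simp add: n_def)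
  qed
  then have "zn q1 q2 a s = N" for s by (rule zn_const_of_simple[OF Q])
  then show ?thesis using large by blast
qed

lemma simple_of_const:
  assumes "pair p1 p2 a" "!!s. zn p1 p2 a s = N"
  shows "simple p1 p2 a t"
  using zn_drop[OF assms(1), of "t - 1" t] assms(2) by (metis diff_less less_irrefl zero_less_one less_add_one diff_add_cancel)

section \<open>Maxima and proximal limit pairs\<close>

definition mx :: "(real => real) => real" where "mx u = Sup (range u)"

lemma mx:
  assumes u: "u \<in> C1_circle L"
  shows "u x <= mx u" "\<exists>y. u y = mx u & deriv u y = 0"
proof -
  note U = C1_circle_D[OF u]
  obtain y where y: "y \<in> {0..L}" "!!x. x \<in> {0..L} ==> u x <= u y"
    using continuous_attains_sup[OF compact_Icc _ continuous_on_subset[OF U(4)], of 0 L] L by auto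
  have le: "u x <= u y" for x
  proof -
    obtain k :: int where k: "x + of_int k * L \<in> {0..<0 + L}" using periodic_representative[OF L] .
    then show ?thesis using y(2)[of "x + of_int k * L"] periodic_add_int[of u L x k] U(1) by auto
  qed
  have "mx u = u y" unfolding mx_def by (rule cSup_eq_maximum) (use le in auto)
  moreover have "deriv u y = 0" by (rule DERIV_local_max[OF U(2), of 1]) (use le in auto)
  ultimately show "u x <= mx u" "\<exists>y. u y = mx u & deriv u y = 0" using le by auto
qed

lemma mx_diff:
  assumes u: "u \<in> C1_circle L" and v: "v \<in> C1_circle L" and e: "!!x. \<bar>u x - v x\<bar> < e"
  shows "\<bar>mx u - mx v\<bar> < e"
proof -
  obtain y z where "u y = mx u" "v z = mx v" using mx(2)[OF u] mx(2)[OF v] by blast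
  then show ?thesis using mx(1)[OF u, of z] mx(1)[OF v, of y] e[of y] e[of z] by linarith
qed

lemma conv_mx:
  assumes "conv P p" "!!n. P n \<in> M" "p \<in> M"
  shows "(%n. mx (fst (P n))) \<longlonglongrightarrow> mx (fst p)"
proof (rule LIMSEQ_I)
  fix e :: real assume e: "e > 0"
  have "\<forall>\<^sub>F n in sequentially. norm (mx (fst (P n)) - mx (fst p)) < e"
    using uniform_limitD[OF convD(1)[OF assms(1)] e]
  proof eventually_elim
    case (elim n)
    then have "\<bar>fst (P n) x - fst p x\<bar> < e" for x by (auto simp: dist_real_def)
    then show ?case using mx_diff[OF M_memD(3)[OF assms(2)] M_memD(3)[OF assms(3)]] by simp
  qed
  then show "\<exists>no. \<forall>n\<ge>no. norm (mx (fst (P n)) - mx (fst p)) < e" by (simp add: eventually_sequentially)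
qed

lemma mx_attained: "\<exists>p\<in>M. \<forall>q\<in>M. mx (fst q) <= mx (fst p)"
proof -
  obtain R where bR: "bnd R" using M_bounds by blast
    note R = bndD[OF bR]
  define S where "S = (%p. mx (fst p)) ` M"
  have bd: "bdd_above S" unfolding S_def
  proof (rule bdd_aboveI2)
    fix p assume "p \<in> M"
    then show "mx (fst p) <= R" using mx(2)[OF M_memD(3)] R(1) by (metis abs_le_D1)
  qed
  have ne: "S ~= {}" using M_props(1) by (simp add: S_def)
  have "\<exists>p\<in>M. Sup S - 1 / real (Suc n) < mx (fst p)" for n
    using less_cSup_iff[OF ne bd, of "Sup S - 1 / real (Suc n)"] by (auto simp: S_def)
  then obtain P where P: "!!n. P n \<in> M" "!!n. Sup S - 1 / real (Suc n) < mx (fst (P n))" by metis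
  obtain r q where r: "strict_mono (r :: nat => nat)" "q \<in> M" "conv (%n. P (r n)) q" using M_subseq[where P = P, OF P(1)] by blast
  have lim: "(%n. mx (fst (P (r n)))) \<longlonglongrightarrow> mx (fst q)" by (rule conv_mx[OF r(3) P(1) r(2)])
  have "(%n. 1 / real (Suc n)) \<longlonglongrightarrow> 0" using LIMSEQ_inverse_real_of_nat by (simp add: inverse_eq_divide)
  from LIMSEQ_subseq_LIMSEQ[OF this r(1)] have "(%n. Sup S - 1 / real (Suc (r n))) \<longlonglongrightarrow> Sup S - 0"
    unfolding o_def by (intro tendsto_diff tendsto_const)
  then have "Sup S - 0 <= mx (fst q)" by (rule LIMSEQ_le[OF _ lim]) (use P(2) less_imp_le in blast)
  then have "mx (fst p) <= mx (fst q)" if "p \<in> M" for p using cSup_upper[OF _ bd, of "mx (fst p)"] that by (auto simp: S_def)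
  then show ?thesis using r(2) by blast
qed

lemma mx_continuous:
  assumes p: "p \<in> M"
  shows "isCont (%t. mx (fst (Fl t p))) t0"
  unfolding continuous_at_eps_delta
proof (intro allI impI)
  fix e :: real assume e: "e > 0"
  define q where "q = Fl (t0 - 1) p"
  have q: "q \<in> M" unfolding q_def by (rule Fl_in_M[OF p])
  have eq: "Fl t p = SP (1 + (t - t0)) q" if "1 + (t - t0) >= 0" for t
    using Fl_nonneg[OF that, of q] Fl_add[OF p, of "1 + (t - t0)" "t0 - 1"] by (simp add: q_def)
  have "(1::real) \<in> {0..<2}" by simp
  then obtain d where d: "d > 0" "\<forall>t\<in>{0..<2}. \<bar>t - 1\<bar> < d --> (\<forall>x. \<bar>fst (SP t q) x - fst (SP 1 q) x\<bar> < e & \<bar>deriv (fst (SP t q)) x - deriv (fst (SP 1 q)) x\<bar> < e)"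
    using solution_continuous[OF M_solution(1)[OF q, of 2] _ e] by blast
  show "\<exists>d>0. \<forall>t. dist t t0 < d --> dist (mx (fst (Fl t p))) (mx (fst (Fl t0 p))) < e"
  proof (intro exI[of _ "min d 1"] conjI allI impI)
    fix t assume t: "dist t t0 < min d 1"
    then have "1 + (t - t0) \<in> {0..<2}" "\<bar>1 + (t - t0) - 1\<bar> < d" by (auto simp: dist_real_def)
    then have "\<bar>fst (Fl t p) x - fst (Fl t0 p) x\<bar> < e" for x using d(2) eq[of t] eq[of t0] by auto
    then show "dist (mx (fst (Fl t p))) (mx (fst (Fl t0 p))) < e"
      using mx_diff[OF M_memD(3)[OF Fl_in_M[OF p]] M_memD(3)[OF Fl_in_M[OF p]]] by (simp add: dist_real_def)
  qed (use d in auto)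
qed

text \<open>If the limit pairs were never shifts of each other, aligning the maxima of a limit pair with equal
  maxima would produce a multiple zero; but the difference of the maxima takes both signs, since either
  component of the pair can be made to approach an element of \<open>M\<close> with the largest maximum.\<close>

lemma proximal:
  assumes p: "p1 \<in> M" "p2 \<in> M" "snd p1 = snd p2" and \<sigma>: "\<sigma> = 1 \<or> \<sigma> = - 1"
  shows "\<exists>\<tau> q1 q2 b. lim_pair \<sigma> p1 p2 \<tau> q1 q2 & fst q1 = shift b (fst q2)"
proof (rule ccontr)
  assume no: "\<not> ?thesis"
  have mx_ne: "mx (fst q1) ~= mx (fst q2)" if l: "lim_pair \<sigma> p1 p2 \<tau> q1 q2" for \<tau> q1 q2
  proof
    assume eq: "mx (fst q1) = mx (fst q2)"
    have q: "q1 \<in> M" "q2 \<in> M" "snd q1 = snd q2" using l by (auto simp: lim_pair_def)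
    obtain y z where y: "fst q1 y = mx (fst q1)" "deriv (fst q1) y = 0" and z: "fst q2 z = mx (fst q2)" "deriv (fst q2) z = 0"
      using mx(2)[OF M_memD(3)[OF q(1)]] mx(2)[OF M_memD(3)[OF q(2)]] by blast
    define b where "b = z - y"
    have ne: "fst q1 ~= shift b (fst q2)" using no l by blast
    then have "fst p1 ~= shift b (fst p2)" using lim_pair_shift_eq[OF l p] by blast
    then have P: "pair p1 p2 b" using p by (simp add: pair_def)
    have Q: "pair q1 q2 b" using q ne by (simp add: pair_def)
    obtain N where "!!s. zn q1 q2 b s = N" using lim_pair_zn[OF l \<sigma> P ne] by blast
    then have "simple q1 q2 b 0" by (rule simple_of_const[OF Q])
    moreover have "fst q1 y - shift b (fst q2) y = 0" using y z eq by (simp add: shift_simps b_def)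
    moreover have "deriv (fst q1) y - deriv (shift b (fst q2)) y = 0"
      using y z C1_circle_shift(2)[OF M_memD(3)[OF q(2)], of b] by (simp add: shift_simps b_def)
    ultimately show False using q by (simp add: simple_def Fl_zero)
  qed
  obtain m where m: "m \<in> M" "!!q. q \<in> M ==> mx (fst q) <= mx (fst m)" using mx_attained by blast
  define D where "D t = mx (fst (Fl t p1)) - mx (fst (Fl t p2))" for t
  have D_lim: "(%n. D (\<tau> n)) \<longlonglongrightarrow> mx (fst q1) - mx (fst q2)" if "lim_pair \<sigma> p1 p2 \<tau> q1 q2" for \<tau> q1 q2
    using that unfolding lim_pair_def D_def by (intro tendsto_diff conv_mx Fl_in_M p) auto
  \<comment> \<open>The times are chosen so that the orbit of p2 tends to m; along a subsequence
    that of p1 converges too, and its limit has a maximum different from that of m, hence below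
    it.\<close>
  have neg: "\<exists>t. \<sigma> * t >= real k & D t < 0" for k
  proof -
    obtain \<tau> where \<tau>: "!!n::nat. \<sigma> * \<tau> n >= real n" "conv (%n. Fl (\<tau> n) p2) m" using reach[OF p(2) m(1) \<sigma>] by blast
    obtain r q1 q2 where r: "strict_mono (r :: nat => nat)" "lim_pair \<sigma> p1 p2 (%n. \<tau> (r n)) q1 q2" using lim_pairI[OF p \<tau>(1)] by blast
    have "q2 = m" using r(2) conv_unique[OF _ conv_subseq[OF \<tau>(2) r(1)]] by (auto simp: lim_pair_def)
    moreover have "q1 \<in> M" using r(2) by (simp add: lim_pair_def)
    ultimately have "mx (fst q1) - mx (fst q2) < 0" using mx_ne[OF r(2)] m(2)[of q1] by simp
    from order_tendstoD(2)[OF D_lim[OF r(2)] this]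
    have "\<forall>\<^sub>F n in sequentially. D (\<tau> (r n)) < 0 & n >= k" using eventually_ge_at_top by (rule eventually_conj)
    then obtain n where n: "D (\<tau> (r n)) < 0" "n >= k" using eventually_happens' sequentially_bot by blast
    moreover have "\<sigma> * \<tau> (r n) >= real n" using r(2) by (simp add: lim_pair_def)
    ultimately show ?thesis by (intro exI[of _ "\<tau> (r n)"]) auto
  qed
  have pos: "\<exists>t. \<sigma> * t >= real k & D t > 0" for k
  proof -
    obtain \<tau> where \<tau>: "!!n::nat. \<sigma> * \<tau> n >= real n" "conv (%n. Fl (\<tau> n) p1) m" using reach[OF p(1) m(1) \<sigma>] by blast
    obtain r q1 q2 where r: "strict_mono (r :: nat => nat)" "lim_pair \<sigma> p1 p2 (%n. \<tau> (r n)) q1 q2" using lim_pairI[OF p \<tau>(1)] by blast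
    have "q1 = m" using r(2) conv_unique[OF _ conv_subseq[OF \<tau>(2) r(1)]] by (auto simp: lim_pair_def)
    moreover have "q2 \<in> M" using r(2) by (simp add: lim_pair_def)
    ultimately have "mx (fst q1) - mx (fst q2) > 0" using mx_ne[OF r(2)] m(2)[of q2] by simp
    from order_tendstoD(1)[OF D_lim[OF r(2)] this]
    have "\<forall>\<^sub>F n in sequentially. D (\<tau> (r n)) > 0 & n >= k" using eventually_ge_at_top by (rule eventually_conj)
    then obtain n where n: "D (\<tau> (r n)) > 0" "n >= k" using eventually_happens' sequentially_bot by blast
    moreover have "\<sigma> * \<tau> (r n) >= real n" using r(2) by (simp add: lim_pair_def)
    ultimately show ?thesis by (intro exI[of _ "\<tau> (r n)"]) auto
  qed
  \<comment> \<open>D changes sign beyond every k and is continuous, so it vanishes there. A limit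
    pair along such times has equal maxima, which \<open>mx_ne\<close> forbids.\<close>
  have "\<exists>t. \<sigma> * t >= real k & D t = 0" for k
  proof -
    obtain t1 t2 where t: "\<sigma> * t1 >= real k" "D t1 < 0" "\<sigma> * t2 >= real k" "D t2 > 0" using neg pos by blast
    have cD: "\<forall>x. isCont D x" unfolding D_def by (intro allI continuous_intros mx_continuous p)
    have "\<exists>t. min t1 t2 <= t & t <= max t1 t2 & D t = 0"
    proof (cases "t1 <= t2")
      case True
      then show ?thesis using IVT[of D t1 0 t2] t cD by (auto simp: min_def max_def)
    next
      case False
      then show ?thesis using IVT2[of D t1 0 t2] t cD by (auto simp: min_def max_def)
    qed
    then obtain t where "min t1 t2 <= t" "t <= max t1 t2" "D t = 0" by blast
    moreover from this have "\<sigma> * t >= real k" using \<sigma> t by auto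
    ultimately show ?thesis by blast
  qed
  then obtain \<tau> where \<tau>: "!!k. \<sigma> * \<tau> k >= real k" "!!k. D (\<tau> k) = 0" by metis
  obtain r q1 q2 where r: "strict_mono (r :: nat => nat)" "lim_pair \<sigma> p1 p2 (%n. \<tau> (r n)) q1 q2" using lim_pairI[OF p \<tau>(1)] by blast
  have "(%n. 0) \<longlonglongrightarrow> mx (fst q1) - mx (fst q2)" using D_lim[OF r(2)] \<tau>(2) by simp
  then have "mx (fst q1) - mx (fst q2) = 0" by (simp add: LIMSEQ_const_iff)
  then show False using mx_ne[OF r(2)] by simp
qed

end

lemma zero_number_translate:
  assumes L: "L > 0" and per: "!!x. u (x + L) = u x" and fin: "finite {x \<in> {0..<L}. u (x + b) = 0}"
  shows "zero_number L u = zero_number L (%x. u (x + b))"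
proof -
  have eq: "{x \<in> {b..<b + L}. u x = 0} = (%x. x + b) ` {x \<in> {0..<L}. u (x + b) = 0}"
  proof (intro equalityI subsetI)
    fix x assume "x \<in> {x \<in> {b..<b + L}. u x = 0}"
    then show "x \<in> (%x. x + b) ` {x \<in> {0..<L}. u (x + b) = 0}" by (intro image_eqI[of _ _ "x - b"]) auto
  qed auto
  have "zero_number L u = enat (card {x \<in> {b..<b + L}. u x = 0})"
    by (rule zero_number_window[where u = u and c = b, OF L per]) (unfold eq, rule finite_imageI[OF fin])
  also have "card {x \<in> {b..<b + L}. u x = 0} = card {x \<in> {0..<L}. u (x + b) = 0}"
    unfolding eq by (intro card_image inj_onI) simp
  also have "enat \<dots> = zero_number L (%x. u (x + b))" using fin by (simp add: zero_number_def)
  finally show ?thesis .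
qed

lemma periodic_uniformly_continuous:
  fixes u :: "real => real"
  assumes L: "L > 0" and c: "continuous_on UNIV u" and per: "!!x. u (x + L) = u x" and e: "e > 0"
  shows "\<exists>d>0. \<forall>x y. \<bar>x - y\<bar> < d --> \<bar>u x - u y\<bar> < e"
proof -
  have "uniformly_continuous_on {- 1..L + 1} u"
    by (rule compact_uniformly_continuous[OF continuous_on_subset[OF c]]) auto
  then obtain d where d: "d > 0" "!!x y. x \<in> {- 1..L + 1} ==> y \<in> {- 1..L + 1} ==> dist y x < d ==> dist (u y) (u x) < e"
    using e unfolding uniformly_continuous_on_def by meson
  show ?thesis
  proof (intro exI[of _ "min d 1"] conjI allI impI)
    fix x y assume xy: "\<bar>x - y\<bar> < min d 1"
    obtain k :: int where k: "y + of_int k * L \<in> {0..<0 + L}" using periodic_representative[OF L] .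
    have "dist (u (x + of_int k * L)) (u (y + of_int k * L)) < e"
      using k xy by (intro d(2)) (auto simp: dist_real_def abs_less_iff)
    then show "\<bar>u x - u y\<bar> < e" using periodic_add_int[of u L x k] periodic_add_int[of u L y k] per by (simp add: dist_real_def)
  qed (use d in auto)
qed

section \<open>Common periods, the count for shifts of one orbit, and the conclusion\<close>

context minimal_flow
begin

text \<open>By minimality a period of one element of M is a period of all of them
  (\<open>Gp_shift\<close>), so this existential definition yields a group. Outside it no element of
  M equals its own shift.\<close>

definition Gp where "Gp = {a. \<exists>p\<in>M. shift a (fst p) = fst p}"

lemma self_lim_pair:
  assumes "p \<in> M" "q \<in> M"
  obtains \<tau> where "lim_pair 1 p p \<tau> q q"
proof -
  obtain \<tau> where "!!n::nat. 1 * \<tau> n >= real n" "conv (%n. Fl (\<tau> n) p) q" using reach[OF assms, of 1] by auto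
  then have "lim_pair 1 p p \<tau> q q" using assms by (simp add: lim_pair_def)
  then show ?thesis by (rule that)
qed

lemma Gp_shift:
  assumes a: "a \<in> Gp" and q: "q \<in> M"
  shows "shift a (fst q) = fst q"
proof -
  obtain p where p: "p \<in> M" "fst p = shift a (fst p)" using a by (auto simp: Gp_def)
  obtain \<tau> where "lim_pair 1 p p \<tau> q q" by (rule self_lim_pair[OF p(1) q])
  from lim_pair_shift_eq[OF this p(1) p(1) refl p(2)] show ?thesis by simp
qed

lemma Gp_diff:
  assumes "a \<in> Gp" "b \<in> Gp"
  shows "a - b \<in> Gp"
proof -
  obtain p where p: "p \<in> M" using M_props(1) by blast
  have "shift (a - b) (fst p) = shift (a - b) (shift b (fst p))" using Gp_shift[OF assms(2) p] by simp
  also have "\<dots> = fst p" using Gp_shift[OF assms(1) p] by (simp add: shift_simps(2))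
  finally show ?thesis using p by (auto simp: Gp_def)
qed

lemma L_in_Gp: "L \<in> Gp"
proof -
  obtain p where p: "p \<in> M" using M_props(1) by blast
  then show ?thesis using C1_circle_D(1)[OF M_memD(3)[OF p]] by (auto simp: Gp_def shift_def fun_eq_iff intro!: bexI[of _ p])
qed

lemma pair_self:
  assumes p: "p \<in> M" and a: "a \<notin> Gp"
  shows "pair p p a"
proof -
  have "fst p ~= shift a (fst p)"
  proof
    assume "fst p = shift a (fst p)"
    then have "a \<in> Gp" unfolding Gp_def using p by (intro CollectI bexI[of _ p]) (rule sym)
    then show False using a by simp
  qed
  then show ?thesis using p by (simp add: pair_def)
qed

definition p0 where "p0 = (SOME p. p \<in> M)"

lemma p0: "p0 \<in> M" unfolding p0_def using M_props(1) some_in_eq by blast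

definition \<nu> where "\<nu> a = zn p0 p0 a 0"

text \<open>Every p in M is a forward limit of p0, so \<open>lim_pair_zn\<close> makes the count of
  (p, p) constant and equal to the eventual count of (p0, p0). Taking p = p0 identifies that
  eventual count with the value at time 0.\<close>

lemma zn_self:
  assumes p: "p \<in> M" and a: "a \<notin> Gp"
  shows "zn p p a s = \<nu> a"
proof -
  have one: "(1::real) = 1 \<or> (1::real) = - 1" by simp
  have ex: "\<exists>N t0. (\<forall>s. zn q q a s = N) & (\<forall>t. 1 * t >= t0 --> zn p0 p0 a t = N)" if q: "q \<in> M" for q
  proof -
    obtain \<tau> where l: "lim_pair 1 p0 p0 \<tau> q q" by (rule self_lim_pair[OF p0 q])
    show ?thesis by (rule lim_pair_zn[OF l one pair_self[OF p0 a]]) (use pair_self[OF q a] in \<open>simp add: pair_def\<close>)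
  qed
  obtain N t0 where N: "!!s. zn p p a s = N" "!!t. t >= t0 ==> zn p0 p0 a t = N" using ex[OF p] by auto
  obtain N' where N': "!!s. zn p0 p0 a s = N'" using ex[OF p0] by auto
  show ?thesis using N(1)[of s] N(2)[of t0] N'[of t0] N'[of 0] by (simp add: \<nu>_def)
qed

text \<open>A small change of the shift is a small C1 perturbation by uniform continuity, and at a
  simple time the count survives it.\<close>

lemma zn_near:
  assumes P: "pair p1 p2 a" and s: "simple p1 p2 a t"
  shows "\<exists>d>0. \<forall>b. \<bar>b - a\<bar> < d --> pair p1 p2 b --> zn p1 p2 b t = zn p1 p2 a t"
proof -
  have P12: "p1 \<in> M" "p2 \<in> M" using P by (auto simp: pair_def)
  define u where "u = fst (Fl t p2)"
  have C1: "fst (Fl t p1) \<in> C1_circle L" "u \<in> C1_circle L"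
    using M_memD(3)[OF Fl_in_M[OF P12(1)]] M_memD(3)[OF Fl_in_M[OF P12(2)]] by (auto simp: u_def)
  obtain \<epsilon> where e: "\<epsilon> > 0" "!!v. v \<in> C1_circle L ==> (\<forall>x. \<bar>v x - (fst (Fl t p1) x - shift a u x)\<bar> < \<epsilon> &
     \<bar>deriv v x - (deriv (fst (Fl t p1)) x - deriv (shift a u) x)\<bar> < \<epsilon>) ==> zero_number L v = enat (zn p1 p2 a t)"
    using simple_stable[OF P s] unfolding u_def by blast
  obtain d1 where d1: "d1 > 0" "!!x y. \<bar>x - y\<bar> < d1 ==> \<bar>u x - u y\<bar> < \<epsilon>"
    using periodic_uniformly_continuous[OF L C1_circle_D(4)[OF C1(2)] C1_circle_D(1)[OF C1(2)] e(1)] by blast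
  obtain d2 where d2: "d2 > 0" "!!x y. \<bar>x - y\<bar> < d2 ==> \<bar>deriv u x - deriv u y\<bar> < \<epsilon>"
    using periodic_uniformly_continuous[OF L C1_circle_D(3)[OF C1(2)] C1_circle_D(5)[OF C1(2)] e(1)] by blast
  show ?thesis
  proof (intro exI[of _ "min d1 d2"] conjI allI impI)
    fix b assume b: "\<bar>b - a\<bar> < min d1 d2" and Pb: "pair p1 p2 b"
    have S: "shift b u \<in> C1_circle L" "!!c x. deriv (shift c u) x = deriv u (x + c)"
      using C1_circle_shift[OF C1(2)] by (simp_all add: shift_simps(1))
    have "zero_number L (%x. fst (Fl t p1) x - shift b u x) = enat (zn p1 p2 a t)"
    proof (rule e(2)[OF C1_circle_combine(1)[OF C1(1) S(1)]], intro allI)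
      fix x
      have D: "deriv (%x. fst (Fl t p1) x - shift b u x) x = deriv (fst (Fl t p1)) x - deriv (shift b u) x"
        using fun_cong[OF C1_circle_combine(2)[OF C1(1) S(1)], of x] .
      have "\<bar>u (x + a) - u (x + b)\<bar> < \<epsilon>" "\<bar>deriv u (x + a) - deriv u (x + b)\<bar> < \<epsilon>"
        using b by (auto intro!: d1(2) d2(2))
      then show "\<bar>fst (Fl t p1) x - shift b u x - (fst (Fl t p1) x - shift a u x)\<bar> < \<epsilon> &
        \<bar>deriv (%x. fst (Fl t p1) x - shift b u x) x - (deriv (fst (Fl t p1)) x - deriv (shift a u) x)\<bar> < \<epsilon>"
        unfolding D S(2) shift_simps(1)[of _ _ x] by (intro conjI; linarith)
    qed
    then show "zn p1 p2 b t = zn p1 p2 a t" using zn_zero_number[OF Pb, of t] by (simp add: u_def)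
  qed (use d1 d2 in auto)
qed

text \<open>Arbitrarily small periods make the uniformly continuous first component of p0 constant,
  and then every real number is a period.\<close>

lemma Gp_discrete:
  assumes a0: "a0 \<notin> Gp"
  shows "\<exists>\<delta>>0. \<forall>c. 0 < c & c < \<delta> --> c \<notin> Gp"
proof (rule ccontr)
  assume "\<not> ?thesis"
  then have small: "!!\<delta>. \<delta> > 0 ==> \<exists>c. 0 < c & c < \<delta> & c \<in> Gp" by blast
  define u where "u = fst p0"
  note U = C1_circle_D[OF M_memD(3)[OF p0], folded u_def]
  have "u x = u y" for x y
  proof (rule ccontr)
    assume ne: "u x ~= u y"
    obtain d where d: "d > 0" "!!z z'. \<bar>z - z'\<bar> < d ==> \<bar>u z - u z'\<bar> < \<bar>u x - u y\<bar>"
      using periodic_uniformly_continuous[OF L U(4) U(1), of "\<bar>u x - u y\<bar>"] ne by auto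
    obtain c where c: "0 < c" "c < d" "c \<in> Gp" using small[OF d(1)] by blast
    have per: "u (z + c) = u z" for z using fun_cong[OF Gp_shift[OF c(3) p0], of z] by (simp add: shift_def u_def)
    obtain k :: int where k: "x + of_int k * c \<in> {y..<y + c}" using periodic_representative[OF c(1)] .
    have "u (x + of_int k * c) = u x" by (rule periodic_add_int[where u = u and L = c]) (rule per)
    moreover have "\<bar>(x + of_int k * c) - y\<bar> < d" using k c(2) by (auto simp: abs_less_iff)
    ultimately show False using d(2)[of "x + of_int k * c" y] by simp
  qed
  then have "shift a0 (fst p0) = fst p0" unfolding u_def shift_def by blast
  then show False using a0 p0 by (auto simp: Gp_def)
qed

text \<open>If the infimum of the positive periods were not attained, two periods just above it
  would differ by less than \<delta>.\<close>

lemma Gp_generator: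
  assumes a0: "a0 \<notin> Gp"
  shows "\<exists>T>0. T \<in> Gp & (\<forall>a. 0 < a & a < T --> a \<notin> Gp)"
proof -
  obtain \<delta> where \<delta>: "\<delta> > 0" "!!c. 0 < c ==> c < \<delta> ==> c \<notin> Gp" using Gp_discrete[OF a0] by blast
  define S where "S = Gp \<inter> {0<..}"
  have ne: "S ~= {}" using L_in_Gp L by (auto simp: S_def)
  have bd: "bdd_below S" by (rule bdd_belowI[of _ 0]) (auto simp: S_def)
  define T where "T = Inf S"
  have "c >= \<delta>" if "c \<in> S" for c using \<delta>(2)[of c] that by (auto simp: S_def not_less[symmetric])
  then have "T >= \<delta>" unfolding T_def by (rule cInf_greatest[OF ne])
  have lower: "T <= c" if "c \<in> S" for c unfolding T_def by (rule cInf_lower[OF that bd])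
  have "T \<in> Gp"
  proof (rule ccontr)
    assume T: "T \<notin> Gp"
    obtain c where c: "c \<in> S" "c < T + \<delta>" using cInf_lessD[OF ne, of "T + \<delta>"] \<delta>(1) unfolding T_def by auto
    have "c > T" using lower[OF c(1)] T c(1) by (cases "c = T") (auto simp: S_def)
    then obtain c' where c': "c' \<in> S" "c' < c" using cInf_lessD[OF ne, of c] unfolding T_def by auto
    have "c - c' \<in> Gp" using c(1) c'(1) by (intro Gp_diff) (auto simp: S_def)
    moreover have "0 < c - c'" "c - c' < \<delta>" using c c' lower[OF c'(1)] by auto
    ultimately show False using \<delta>(2) by blast
  qed
  moreover have "a \<notin> Gp" if "0 < a & a < T" for a using lower[of a] that by (auto simp: S_def)
  moreover have "T > 0" using \<open>T >= \<delta>\<close> \<delta>(1) by simp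
  ultimately show ?thesis by blast
qed

text \<open>Between 0 and the least positive period T the count is locally constant, because
  constancy in time makes every time simple; (0, T) is connected, and T-periodicity reduces the
  remaining shifts to this interval.\<close>

lemma \<nu>_const: "\<exists>N. \<forall>a. a \<notin> Gp --> \<nu> a = N"
proof (cases "Gp = UNIV")
  case False
  then obtain T where T: "T > 0" "T \<in> Gp" "!!a. 0 < a ==> a < T ==> a \<notin> Gp" using Gp_generator by blast
  have loc: "\<forall>\<^sub>F b in at a within {0<..<T}. \<nu> a = \<nu> b" if a: "a \<in> {0<..<T}" for a
  proof -
    have aG: "a \<notin> Gp" using T(3) a by auto
    have P: "pair p0 p0 a" by (rule pair_self[OF p0 aG])
    have "simple p0 p0 a 0" by (rule simple_of_const[OF P zn_self[OF p0 aG]])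
    then obtain d where d: "d > 0" "!!b. \<bar>b - a\<bar> < d ==> pair p0 p0 b ==> zn p0 p0 b 0 = zn p0 p0 a 0"
      using zn_near[OF P] by blast
    show ?thesis unfolding eventually_at
      by (intro exI[of _ d] conjI ballI impI d(1)) (use d(2) pair_self[OF p0] T(3) in \<open>auto simp: \<nu>_def dist_real_def\<close>)
  qed
  have const: "\<nu> a = \<nu> b" if "a \<in> {0<..<T}" "b \<in> {0<..<T}" for a b
    using connected_local_const[of "{0<..<T}" a b \<nu>] that loc by auto
  have per: "fst p0 (z + T) = fst p0 z" for z using fun_cong[OF Gp_shift[OF T(2) p0], of z] by (simp add: shift_def)
  have red: "\<exists>b\<in>{0<..<T}. \<nu> a = \<nu> b" if a: "a \<notin> Gp" for a
  proof -
    obtain k :: int where k: "a + of_int k * T \<in> {0..<0 + T}" using periodic_representative[OF T(1)] .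
    have sh: "shift (a + of_int k * T) (fst p0) = shift a (fst p0)"
    proof
      fix x show "shift (a + of_int k * T) (fst p0) x = shift a (fst p0) x"
        using periodic_add_int[of "fst p0" T "x + a" k] per by (simp add: shift_simps(1) add_ac)
    qed
    then have "\<nu> a = \<nu> (a + of_int k * T)" by (simp add: \<nu>_def zn_def Fl_zero[OF p0])
    moreover have "a + of_int k * T ~= 0"
    proof
      assume "a + of_int k * T = 0"
      then have "shift a (fst p0) = fst p0" using sh by (simp add: shift_simps(3))
      then show False using a p0 by (auto simp: Gp_def)
    qed
    ultimately show ?thesis using k by (intro bexI[of _ "a + of_int k * T"]) auto
  qed
  have "\<nu> a = \<nu> (T / 2)" if a: "a \<notin> Gp" for a
  proof -
    obtain b where b: "b \<in> {0<..<T}" "\<nu> a = \<nu> b" using red[OF a] by blast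
    have "T / 2 \<in> {0<..<T}" using T(1) by simp
    from const[OF b(1) this] b(2) show ?thesis by simp
  qed
  then show ?thesis by (intro exI[of _ "\<nu> (T / 2)"] allI impI)
qed auto

lemma near_good:
  assumes a0: "a0 \<notin> Gp" and d: "d > 0"
  shows "\<exists>b. \<bar>b - a\<bar> < d & b - c1 \<notin> Gp & b - c2 \<notin> Gp"
proof -
  obtain \<delta> where \<delta>: "\<delta> > 0" "!!c. 0 < c ==> c < \<delta> ==> c \<notin> Gp" using Gp_discrete[OF a0] by blast
  \<comment> \<open>The three candidates a + h, a + 2 * h, a + 3 * h differ by less than \<delta>,
    so each of the two cosets contains at most one of them and one candidate is left.\<close>
  define h where "h = min d \<delta> / 4"
  have h: "h > 0" "4 * h <= d" "4 * h <= \<delta>" using d \<delta>(1) by (auto simp: h_def)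
  have ex: "\<not> (y - c \<in> Gp & x - c \<in> Gp)" if "x < y" "y - x < \<delta>" for x y c
    using Gp_diff[of "y - c" "x - c"] \<delta>(2)[of "y - x"] that by auto
  have "\<exists>b\<in>{a + h, a + 2 * h, a + 3 * h}. b - c1 \<notin> Gp & b - c2 \<notin> Gp"
    using ex[of "a + h" "a + 2 * h" c1] ex[of "a + h" "a + 3 * h" c1] ex[of "a + 2 * h" "a + 3 * h" c1]
      ex[of "a + h" "a + 2 * h" c2] ex[of "a + h" "a + 3 * h" c2] ex[of "a + 2 * h" "a + 3 * h" c2] h by auto
  then obtain b where "b \<in> {a + h, a + 2 * h, a + 3 * h}" "b - c1 \<notin> Gp" "b - c2 \<notin> Gp" by blast
  moreover from this(1) have "\<bar>b - a\<bar> < d" using h by auto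
  ultimately show ?thesis by blast
qed

text \<open>A proximal limit pair reduces the count for \<open>(p1, p2)\<close> near one end of the orbit to the count for an
  element of \<open>M\<close> and its own shift.\<close>

lemma zn_near_end:
  assumes p: "p1 \<in> M" "p2 \<in> M" "snd p1 = snd p2" and \<sigma>: "\<sigma> = 1 \<or> \<sigma> = - 1"
    and N: "!!a. a \<notin> Gp ==> \<nu> a = N"
  shows "\<exists>b. \<forall>c. c - b \<notin> Gp --> pair p1 p2 c & (\<exists>t0. \<forall>t. \<sigma> * t >= t0 --> zn p1 p2 c t = N)"
proof -
  obtain \<tau> q1 q2 b where l: "lim_pair \<sigma> p1 p2 \<tau> q1 q2" and b: "fst q1 = shift b (fst q2)" using proximal[OF p \<sigma>] by blast
  have q: "q1 \<in> M" "q2 \<in> M" "snd q1 = snd q2" using l by (auto simp: lim_pair_def)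
  have "pair p1 p2 c & (\<exists>t0. \<forall>t. \<sigma> * t >= t0 --> zn p1 p2 c t = N)" if c: "c - b \<notin> Gp" for c
  proof -
    have ne: "fst q1 ~= shift c (fst q2)"
    proof
      assume "fst q1 = shift c (fst q2)"
      then have "shift (- b) (shift c (fst q2)) = shift (- b) (shift b (fst q2))" using b by simp
      then have "shift (c - b) (fst q2) = fst q2" by (simp add: shift_simps(2,3))
      then show False using c q(2) by (auto simp: Gp_def)
    qed
    have "fst p1 ~= shift c (fst p2)" using lim_pair_shift_eq[OF l p] ne by blast
    then have P: "pair p1 p2 c" using p by (simp add: pair_def)
    have Q: "pair q1 q2 c" using q ne by (simp add: pair_def)
    obtain N' t0 where N': "!!s. zn q1 q2 c s = N'" "!!t. \<sigma> * t >= t0 ==> zn p1 p2 c t = N'"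
      using lim_pair_zn[OF l \<sigma> P ne] by blast
    \<comment> \<open>Since q1 is q2 shifted by b, the difference for (q1, q2, c) is W translated by
      b, where W compares q2 with its own shift by c - b.\<close>
    define W where "W x = fst q2 x - shift (c - b) (fst q2) x" for x
    have Wb: "W (x + b) = fst q1 x - shift c (fst q2) x" for x unfolding b W_def by (simp add: shift_simps(1) add_ac)
    have zb: "zero_number L (%x. W (x + b)) = enat N'"
      using zn_zero_number[OF Q, of 0] N'(1)[of 0] q unfolding Wb by (simp add: Fl_zero)
    then have "finite {x \<in> {0..<L}. W (x + b) = 0}" unfolding zero_number_def by (simp split: if_splits)
    moreover have perq: "fst q2 (x + L) = fst q2 x" for x by (rule C1_circle_D(1)[OF M_memD(3)[OF q(2)]])
    have "W (x + L) = W x" for x using perq[of x] perq[of "x + (c - b)"] by (simp add: W_def shift_simps(1) algebra_simps)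
    ultimately have "zero_number L W = zero_number L (%x. W (x + b))" by (intro zero_number_translate[where u = W and b = b, OF L])
    moreover have "zero_number L W = enat N"
      using zn_zero_number[OF pair_self[OF q(2) c], of 0] zn_self[OF q(2) c, of 0] N[OF c] q unfolding W_def[abs_def] by (simp add: Fl_zero)
    ultimately have "N' = N" using zb by simp
    then show ?thesis using P N'(2) by blast
  qed
  then show ?thesis by blast
qed

text \<open>If every shift is a period, all elements of M are constants and two different ones never
  meet, so N = 0. Otherwise shifts c near a avoid the two cosets excluded by
  \<open>zn_near_end\<close>; for them the count is N at both ends, hence always, and at simple
  times the count for a agrees with that for such c.\<close>

lemma zn_constant: "\<exists>N. \<forall>p1 p2 a t. pair p1 p2 a --> zn p1 p2 a t = N"
proof (cases "Gp = UNIV")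
  case True
  have const: "fst p x = fst p 0" if "p \<in> M" for p x
    using fun_cong[OF Gp_shift[of x, OF _ that], of 0] True by (simp add: shift_simps(1))
  have "zn p1 p2 a t = 0" if P: "pair p1 p2 a" for p1 p2 a t
  proof -
    have F: "Fl t p1 \<in> M" "Fl t p2 \<in> M" "fst (Fl t p1) ~= shift a (fst (Fl t p2))" using pair_Fl[OF P, of t] by (auto simp: pair_def)
    obtain y where y: "fst (Fl t p1) y ~= fst (Fl t p2) (y + a)" using F(3) by (auto simp: shift_def fun_eq_iff)
    have "fst (Fl t p1) x - shift a (fst (Fl t p2)) x ~= 0" for x
      using y const[OF F(1), of x] const[OF F(1), of y] const[OF F(2), of "x + a"] const[OF F(2), of "y + a"] by (simp add: shift_simps(1))
    then show ?thesis by (simp add: zn_def)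
  qed
  then show ?thesis by blast
next
  case False
  then obtain a0 where a0: "a0 \<notin> Gp" by blast
  obtain N where N: "!!a. a \<notin> Gp ==> \<nu> a = N" using \<nu>_const by blast
  have "zn p1 p2 a t = N" if P: "pair p1 p2 a" for p1 p2 a t
  proof -
    have p: "p1 \<in> M" "p2 \<in> M" "snd p1 = snd p2" using P by (auto simp: pair_def)
    obtain b1 where b1: "!!c. c - b1 \<notin> Gp ==> pair p1 p2 c & (\<exists>t0. \<forall>t. 1 * t >= t0 --> zn p1 p2 c t = N)"
      using zn_near_end[OF p, of 1] N by blast
    obtain b2 where b2: "!!c. c - b2 \<notin> Gp ==> pair p1 p2 c & (\<exists>t0. \<forall>t. - 1 * t >= t0 --> zn p1 p2 c t = N)"
      using zn_near_end[OF p, of "- 1"] N by blast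
    have good: "zn p1 p2 c t = N" if c: "c - b1 \<notin> Gp" "c - b2 \<notin> Gp" for c t
    proof -
      have Pc: "pair p1 p2 c" using b1[OF c(1)] by simp
      obtain t1 where t1: "!!t. t >= t1 ==> zn p1 p2 c t = N" using b1[OF c(1)] by auto
      obtain t2 where t2: "!!t. - t >= t2 ==> zn p1 p2 c t = N" using b2[OF c(2)] by auto
      have "zn p1 p2 c t <= zn p1 p2 c (min t (- t2))" "zn p1 p2 c (max t t1) <= zn p1 p2 c t"
        using zn_antimono[OF Pc] by auto
      then show ?thesis using t1[of "max t t1"] t2[of "min t (- t2)"] by simp
    qed
    have "zn p1 p2 a s = N" if s: "simple p1 p2 a s" for s
    proof -
      obtain d where d: "d > 0" "!!b. \<bar>b - a\<bar> < d ==> pair p1 p2 b ==> zn p1 p2 b s = zn p1 p2 a s"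
        using zn_near[OF P s] by blast
      obtain c where c: "\<bar>c - a\<bar> < d" "c - b1 \<notin> Gp" "c - b2 \<notin> Gp" using near_good[OF a0 d(1)] by blast
      show ?thesis using d(2)[OF c(1)] b1[OF c(2)] good[OF c(2,3), of s] by simp
    qed
    then show ?thesis by (rule zn_const_of_simple[OF P])
  qed
  then show ?thesis by blast
qed

end

theorem lemma1p1:
  fixes L \<alpha> :: real
    and f :: "real \<times> real \<times> real \<Rightarrow> real"
    and M :: "((real \<Rightarrow> real) \<times> (real \<times> real \<times> real \<Rightarrow> real)) set"
  assumes "L > 0"
    and "0 < \<alpha>" and "\<alpha> < 1" and "compactly_embedded_C1 L \<alpha>"
    and "C1_function f"
    and "uniformly_almost_periodic UNIV f"
    and "\<And>b. b \<in> Basis \<Longrightarrow> uniformly_almost_periodic UNIV (partial b f)"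
    and "minimal_set L \<alpha> f M"
  shows "\<exists>N::nat. \<forall>t::real. \<forall>g\<in>translation_hull f. \<forall>u1 u2. \<forall>a::real.
    (u1, g) \<in> M \<longrightarrow> (u2, g) \<in> M \<longrightarrow> u1 \<noteq> shift a u2 \<longrightarrow>
    zero_number L (\<lambda>x. phi_flow L \<alpha> M t u1 g x - phi_shifted L \<alpha> M t a u2 g x) = enat N"
proof -
  interpret minimal_flow L \<alpha> f M
    by (unfold_locales; fact assms)
  obtain N where N: "\<And>p1 p2 a t. pair p1 p2 a \<Longrightarrow> zn p1 p2 a t = N" using zn_constant by blast
  show ?thesis
  proof (intro exI[of _ N] allI ballI impI)
    fix t a u1 u2 g assume g: "g \<in> translation_hull f" and M1: "(u1, g) \<in> M" and M2: "(u2, g) \<in> M" and ne: "u1 \<noteq> shift a u2"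
    have P: "pair (u1, g) (u2, g) a" using M1 M2 ne by (simp add: pair_def)
    have 1: "phi_flow L \<alpha> M t u1 g = fst (Fl t (u1, g))" by (simp add: Fl_def)
    \<comment> \<open>For t >= 0 the shift commutes with the solution by uniqueness; for t < 0 the
      shifted backward orbit is what \<open>phi_shifted\<close> means.\<close>
    have 2: "phi_shifted L \<alpha> M t a u2 g = shift a (fst (Fl t (u2, g)))"
      using phi_shift_M[OF M2, of t a] by (cases "t \<ge> 0") (simp_all add: phi_shifted_def Fl_nonneg, simp add: Fl_def)
    show "zero_number L (\<lambda>x. phi_flow L \<alpha> M t u1 g x - phi_shifted L \<alpha> M t a u2 g x) = enat N"
      unfolding 1 2 zn_zero_number[OF P] N[OF P] ..
  qed
qed

end
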